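(* Let $T\in(0,\infty)$, $K,L,p,\mathfrak B,\kappa\in[0,\infty)$, $\Theta=\bigcup_{n=1}^\infty\mathbb Z^n$, $(M_j)_{j\in\mathbb N}\subseteq\mathbb N$ satisfy $\liminf_{j\to\infty}M_j=\infty$, $\sup_{j\in\mathbb N}M_{j+1}/M_j\le\mathfrak B$, and $\sup_{j\in\mathbb N}M_j/j\le\kappa$. Let $\xi_d\in\mathbb R^d$, $d\in\mathbb N$, satisfy $\sup_{d\in\mathbb N}\lVert\xi_d\rVert_{\mathbb R^d}\le K$. For every $d\in\mathbb N$ let $f_d\in C([0,T]\times\mathbb R^d\times\mathbb R,\mathbb R)$, $g_d\in C(\mathbb R^d,\mathbb R)$ satisfy for all $t\in[0,T]$, $x\in\mathbb R^d$, $v,w\in\mathbb R$ that $\max\{|f_d(t,x,0)|,|g_d(x)|\}\le L\max\{1,\lVert x\rVert_{\mathbb R^d}^p\}$ and $|f_d(t,x,v)-f_d(t,x,w)|\le L|v-w|$. Let $(\Omega,\mathscr F,\mathbb P)$ be a probability space, let $U^\theta\colon\Omega\to[0,1]$, $\theta\in\Theta$, be independent on $[0,1]$ uniformly distributed random variables, for every $d\in\mathbb N$ let $W^{d,\theta}\colon[0,T]\times\Omega\to\mathbb R^d$, $\theta\in\Theta$, be independent standard Brownian motions, and assume for every $d\in\mathbb N$ that $(U^\theta)_{\theta\in\Theta}$ and $(W^{d,\theta})_{\theta\in\Theta}$ are independent. Let $Y^{d,\theta}_{n,j}\colon[0,T]\times\mathbb R^d\times\Omega\to\mathbb R$, $\theta\in\Theta$,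 $d,j\in\mathbb N$, $n\in\mathbb N_0\cup\{-1\}$, satisfy for all $n,j,d\in\mathbb N$, $\theta\in\Theta$, $t\in[0,T]$, $x\in\mathbb R^d$ that $Y^{d,\theta}_{-1,j}(t,x)=Y^{d,\theta}_{0,j}(t,x)=0$ and $$\begin{aligned}&Y^{d,\theta}_{n,j}(T-t,x)=\frac1{(M_j)^n}\Biggl[\sum_{i=1}^{(M_j)^n}g_d\bigl(x+W^{d,(\theta,0,i)}_t\bigr)\Biggr]+\sum_{l=0}^{n-1}\frac{t}{(M_j)^{n-l}}\Biggl[\sum_{i=1}^{(M_j)^{n-l}}\\&\quad\Bigl[f_d\Bigl(T-t+U^{(\theta,l,i)}t,\,x+W^{d,(\theta,l,i)}_{U^{(\theta,l,i)}t},\,Y^{d,(\theta,l,i)}_{l,j}\bigl(T-t+U^{(\theta,l,i)}t,\,x+W^{d,(\theta,l,i)}_{U^{(\theta,l,i)}t}\bigr)\Bigr)\\&\quad-\mathbb 1_{\mathbb N}(l)f_d\Bigl(T-t+U^{(\theta,l,i)}t,\,x+W^{d,(\theta,l,i)}_{U^{(\theta,l,i)}t},\,Y^{d,(\theta,-l,i)}_{l-1,j}\bigl(T-t+U^{(\theta,l,i)}t,\,x+W^{d,(\theta,l,i)}_{U^{(\theta,l,i)}t}\bigr)\Bigr)\Bigr]\Biggr].\end{aligned}$$ Let $(\mathrm{Cost}_{d,n,j})_{(d,n,j)\in\mathbb N\times(\mathbb N_0\cup\{-1\})\times\mathbb N}\subseteq\mathbb N_0$ satisfy for all $d,n,j\in\mathbb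 N$ that $\mathrm{Cost}_{d,-1,j}=\mathrm{Cost}_{d,0,j}=0$ and $$\mathrm{Cost}_{d,n,j}\le(M_j)^nd+\sum_{l=0}^{n-1}\bigl[(M_j)^{n-l}(\mathrm{Cost}_{d,l,j}+\mathrm{Cost}_{d,l-1,j}+d+1)\bigr].$$ Then (i) for every $d\in\mathbb N$ there exists a unique at most polynomially growing viscosity solution $y_d\in C([0,T]\times\mathbb R^d,\mathbb R)$ of $$\bigl(\tfrac{\partial y_d}{\partial t}\bigr)(t,x)+\tfrac12(\Delta_xy_d)(t,x)+f_d(t,x,y_d(t,x))=0$$ with $y_d(T,x)=g_d(x)$ for $(t,x)\in(0,T)\times\mathbb R^d$; and (ii) there exists $(N_{d,\varepsilon})_{(d,\varepsilon)\in\mathbb N\times(0,1]}\subseteq\mathbb N$ such that for all $d\in\mathbb N$, $\varepsilon\in(0,1]$, $\delta\in(0,\infty)$ it holds that $\sup_{n\in\{N_{d,\varepsilon},N_{d,\varepsilon}+1,\ldots\}}\bigl(\mathbb E[|Y^{d,0}_{n,n}(0,\xi_d)-y_d(0,\xi_d)|^2]\bigr)^{1/2}\le\varepsilon$ and $$\begin{aligned}\mathrm{Cost}_{d,N_{d,\varepsilon},N_{d,\varepsilon}}\le{}&\Bigl[\bigl[4^{p+2}\max\{L,1\}(1+T)^{p/2+1}e^{LT}(\max\{K,p,1\})^p\bigr]^{2(1+\delta)}e^\kappa\\&\cdot\Bigl(1+\sup_{n\in\mathbb N}\Bigl[\tfrac{[5\mathfrak Be^{2\kappa}(1+(2LT)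^2)]^{(1+\delta)}}{(M_n)^\delta}\Bigr]^n\Bigr)\Bigr]d^{1+p(1+\delta)}\varepsilon^{-2(1+\delta)}<\infty.\end{aligned}$$
   Context: $\mathbb N=\{1,2,3,\ldots\}$, $\mathbb N_0=\{0,1,2,\ldots\}$. $\lVert\cdot\rVert_{\mathbb R^d}$ is the Euclidean norm. For $\theta\in\mathbb Z^k\subseteq\Theta$ and $l,i\in\mathbb Z$, $(\theta,l,i)$ denotes the concatenated tuple in $\mathbb Z^{k+2}\subseteq\Theta$; the superscript $0$ in $Y^{d,0}_{n,n}$ denotes $0\in\mathbb Z^1\subseteq\Theta$. $\mathbb 1_{\mathbb N}(l)$ equals $1$ if $l\in\mathbb N$ and $0$ if $l=0$. A function $v\colon[0,T]\times\mathbb R^d\to\mathbb R$ is at most polynomially growing if there is $q\in[0,\infty)$ with $\sup_{(t,x)}|v(t,x)|/(1+\lVert x\rVert_{\mathbb R^d}^q)<\infty$. *)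

theory Defs
  imports "HOL-Probability.Probability" "HOL-Library.Function_Algebras"
begin

text \<open>
  The dimension \<open>d\<close> is quantified inside the statement and all constants have to be uniform in it,
  so \<open>d\<close>-dimensional space is the carrier of the library's \<^const>\<open>Euclidean_space\<close>: real
  sequences vanishing from index \<open>d\<close> on. On this carrier the topology of \<^typ>\<open>nat \<Rightarrow> real\<close> is the
  Euclidean one. Addition and subtraction of points are pointwise (Function_Algebras).
\<close>

abbreviation Rd :: "nat \<Rightarrow> (nat \<Rightarrow> real) set" where
  "Rd d \<equiv> topspace (Euclidean_space d)"

abbreviation norm_Rd :: "nat \<Rightarrow> (nat \<Rightarrow> real) \<Rightarrow> real" where
  "norm_Rd d x \<equiv> L2_set x {..<d}"

text \<open>The index set is the disjoint union of all \<open>\<int>\<^sup>n\<close> with \<open>n \<ge> 1\<close>; concatenation of tuples is \<open>@\<close>.\<close>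

definition Theta :: "int list set" where
  "Theta = {\<theta>. \<theta> \<noteq> []}"

text \<open>The root mean square of a random variable, with value \<open>\<infinity>\<close> where the Bochner integral would
  default to 0.\<close>

definition L2_norm_rv :: "'w measure \<Rightarrow> ('w \<Rightarrow> real) \<Rightarrow> ereal" where
  "L2_norm_rv P X =
     (if X \<in> borel_measurable P \<and> integrable P (\<lambda>\<omega>. \<bar>X \<omega>\<bar>\<^sup>2)
      then ereal (sqrt (\<integral>\<omega>. \<bar>X \<omega>\<bar>\<^sup>2 \<partial>P)) else \<infinity>)"

text \<open>Independence of two random variables with values in different types, which
  \<^const>\<open>prob_space.indep_var\<close> does not allow.\<close>

definition indep_pair ::
  "'w measure \<Rightarrow> 'a measure \<Rightarrow> ('w \<Rightarrow> 'a) \<Rightarrow> 'b measure \<Rightarrow> ('w \<Rightarrow> 'b) \<Rightarrow> bool" where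
  "indep_pair P R X S Z \<longleftrightarrow>
     X \<in> measurable P R \<and> Z \<in> measurable P S \<and>
     prob_space.indep_set P {X -` A \<inter> space P | A. A \<in> sets R} {Z -` A \<inter> space P | A. A \<in> sets S}"

text \<open>Standard Brownian motion on \<open>[0,T]\<close>: all paths are continuous, \<open>W\<^sub>0 = 0\<close> almost surely,
  \<open>W\<^sub>t - W\<^sub>s\<close> has law \<open>N(0, (t-s) I\<^sub>d)\<close> (a product of one-dimensional normal laws), and
  increments over successive intervals are independent.\<close>

definition standard_BM ::
  "'w measure \<Rightarrow> real \<Rightarrow> nat \<Rightarrow> (real \<Rightarrow> 'w \<Rightarrow> nat \<Rightarrow> real) \<Rightarrow> bool" where
  "standard_BM P T d W \<longleftrightarrow>
     (\<forall>t\<in>{0..T}. W t \<in> borel_measurable P \<and> (\<forall>\<omega>\<in>space P. W t \<omega> \<in> Rd d)) \<and>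
     (\<forall>\<omega>\<in>space P. continuous_on {0..T} (\<lambda>t. W t \<omega>)) \<and>
     (AE \<omega> in P. W 0 \<omega> = 0) \<and>
     (\<forall>s t. 0 \<le> s \<and> s < t \<and> t \<le> T \<longrightarrow>
        distr P (\<Pi>\<^sub>M k\<in>{..<d}. borel) (\<lambda>\<omega>. restrict (W t \<omega> - W s \<omega>) {..<d})
        = (\<Pi>\<^sub>M k\<in>{..<d}. density lborel (\<lambda>z. ennreal (normal_density 0 (sqrt (t - s)) z)))) \<and>
     (\<forall>(n::nat) (r :: nat \<Rightarrow> real). strict_mono_on {..n} r \<and> r ` {..n} \<subseteq> {0..T} \<longrightarrow>
        prob_space.indep_vars P (\<lambda>_. borel) (\<lambda>m \<omega>. W (r (Suc m)) \<omega> - W (r m) \<omega>) {..<n})"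

text \<open>\<open>\<phi> \<in> C\<^sup>1\<^sup>,\<^sup>2((0,T) \<times> \<real>\<^sup>d)\<close> with time derivative \<open>\<phi>t\<close>, gradient \<open>D\<close> and Hessian \<open>H\<close>,
  all given by continuous partial derivatives.\<close>

definition C12_with_derivs ::
  "real \<Rightarrow> nat \<Rightarrow> (real \<Rightarrow> (nat \<Rightarrow> real) \<Rightarrow> real) \<Rightarrow> (real \<Rightarrow> (nat \<Rightarrow> real) \<Rightarrow> real) \<Rightarrow>
   (real \<Rightarrow> (nat \<Rightarrow> real) \<Rightarrow> nat \<Rightarrow> real) \<Rightarrow> (real \<Rightarrow> (nat \<Rightarrow> real) \<Rightarrow> nat \<Rightarrow> nat \<Rightarrow> real) \<Rightarrow> bool" where
  "C12_with_derivs T d \<phi> \<phi>t D H \<longleftrightarrow>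
     continuous_on ({0<..<T} \<times> Rd d) (\<lambda>(t, x). \<phi> t x) \<and>
     continuous_on ({0<..<T} \<times> Rd d) (\<lambda>(t, x). \<phi>t t x) \<and>
     (\<forall>i<d. continuous_on ({0<..<T} \<times> Rd d) (\<lambda>(t, x). D t x i)) \<and>
     (\<forall>i<d. \<forall>k<d. continuous_on ({0<..<T} \<times> Rd d) (\<lambda>(t, x). H t x i k)) \<and>
     (\<forall>t\<in>{0<..<T}. \<forall>x\<in>Rd d.
        ((\<lambda>s. \<phi> s x) has_real_derivative \<phi>t t x) (at t) \<and>
        (\<forall>i<d. ((\<lambda>s. \<phi> t (x(i := s))) has_real_derivative D t x i) (at (x i))) \<and>
        (\<forall>i<d. \<forall>k<d. ((\<lambda>s. D t (x(k := s)) i) has_real_derivative H t x i k) (at (x k))))"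

text \<open>Viscosity solutions of \<open>\<partial>\<^sub>t u + G(t, x, u, \<nabla>\<^sub>x u, Hess\<^sub>x u) = 0\<close> on \<open>(0,T) \<times> \<real>\<^sup>d\<close>. The equation is
  posed backward in time, whence the signs: test functions touching from above give \<open>\<ge> 0\<close>.\<close>

definition viscosity_subsolution ::
  "real \<Rightarrow> nat \<Rightarrow> (real \<Rightarrow> (nat \<Rightarrow> real) \<Rightarrow> real \<Rightarrow> (nat \<Rightarrow> real) \<Rightarrow> (nat \<Rightarrow> nat \<Rightarrow> real) \<Rightarrow> real) \<Rightarrow>
   (real \<Rightarrow> (nat \<Rightarrow> real) \<Rightarrow> real) \<Rightarrow> bool" where
  "viscosity_subsolution T d G u \<longleftrightarrow>
     (\<forall>\<phi> \<phi>t D H. \<forall>t\<in>{0<..<T}. \<forall>x\<in>Rd d.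
        C12_with_derivs T d \<phi> \<phi>t D H \<and> \<phi> t x = u t x \<and>
        (\<forall>s\<in>{0<..<T}. \<forall>z\<in>Rd d. u s z \<le> \<phi> s z) \<longrightarrow>
        \<phi>t t x + G t x (\<phi> t x) (D t x) (H t x) \<ge> 0)"

definition viscosity_supersolution ::
  "real \<Rightarrow> nat \<Rightarrow> (real \<Rightarrow> (nat \<Rightarrow> real) \<Rightarrow> real \<Rightarrow> (nat \<Rightarrow> real) \<Rightarrow> (nat \<Rightarrow> nat \<Rightarrow> real) \<Rightarrow> real) \<Rightarrow>
   (real \<Rightarrow> (nat \<Rightarrow> real) \<Rightarrow> real) \<Rightarrow> bool" where
  "viscosity_supersolution T d G u \<longleftrightarrow>
     (\<forall>\<phi> \<phi>t D H. \<forall>t\<in>{0<..<T}. \<forall>x\<in>Rd d.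
        C12_with_derivs T d \<phi> \<phi>t D H \<and> \<phi> t x = u t x \<and>
        (\<forall>s\<in>{0<..<T}. \<forall>z\<in>Rd d. \<phi> s z \<le> u s z) \<longrightarrow>
        \<phi>t t x + G t x (\<phi> t x) (D t x) (H t x) \<le> 0)"

definition viscosity_solution ::
  "real \<Rightarrow> nat \<Rightarrow> (real \<Rightarrow> (nat \<Rightarrow> real) \<Rightarrow> real \<Rightarrow> (nat \<Rightarrow> real) \<Rightarrow> (nat \<Rightarrow> nat \<Rightarrow> real) \<Rightarrow> real) \<Rightarrow>
   (real \<Rightarrow> (nat \<Rightarrow> real) \<Rightarrow> real) \<Rightarrow> bool" where
  "viscosity_solution T d G u \<longleftrightarrow>
     continuous_on ({0<..<T} \<times> Rd d) (\<lambda>(t, x). u t x) \<and>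
     viscosity_subsolution T d G u \<and> viscosity_supersolution T d G u"

definition poly_growing :: "real \<Rightarrow> nat \<Rightarrow> (real \<Rightarrow> (nat \<Rightarrow> real) \<Rightarrow> real) \<Rightarrow> bool" where
  "poly_growing T d v \<longleftrightarrow>
     (\<exists>q\<ge>0. bdd_above ((\<lambda>(t, x). \<bar>v t x\<bar> / (1 + norm_Rd d x powr q)) ` ({0..T} \<times> Rd d)))"

text \<open>At most polynomially growing viscosity solutions \<open>u \<in> C([0,T] \<times> \<real>\<^sup>d)\<close> of
  \<open>\<partial>\<^sub>t u + \<Delta>\<^sub>x u / 2 + f(t, x, u) = 0\<close>, \<open>u(T, \<cdot>) = g\<close>.\<close>

definition semilinear_heat_solution ::
  "real \<Rightarrow> nat \<Rightarrow> (real \<Rightarrow> (nat \<Rightarrow> real) \<Rightarrow> real \<Rightarrow> real) \<Rightarrow> ((nat \<Rightarrow> real) \<Rightarrow> real) \<Rightarrow>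
   (real \<Rightarrow> (nat \<Rightarrow> real) \<Rightarrow> real) \<Rightarrow> bool" where
  "semilinear_heat_solution T d f g u \<longleftrightarrow>
     continuous_on ({0..T} \<times> Rd d) (\<lambda>(t, x). u t x) \<and>
     poly_growing T d u \<and>
     viscosity_solution T d (\<lambda>t x r b A. 1/2 * (\<Sum>k<d. A k k) + f t x r) u \<and>
     (\<forall>x\<in>Rd d. u T x = g x)"

end

theory Submission
  imports Defs
begin

text \<open>
  Viscosity solutions of polynomial growth are the fixed points of the Feynman--Kac operator
  \<open>u \<mapsto> E[g(x + W\<^sub>\<tau>) + \<tau> f(s, x + W\<^bsub>U\<tau>\<^esub>, u(s, x + W\<^bsub>U\<tau>\<^esub>))]\<close>, where \<open>\<tau> = T - t\<close> and \<open>s = t + U\<tau>\<close>. For trigonometric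
  polynomials as data, Feynman--Kac formulas are explicit classical solutions of the linear heat
  equation; density with polynomial weights, a maximum principle and stability extend the
  identification to all continuous data of polynomial growth.

  The multilevel Picard error satisfies a recursion in \<open>L\<^sup>2\<close>: independence within each level divides the
  variance by the sample number, and the expectations of the levels telescope. The recursion is closed
  pointwise in \<open>x\<close> by measuring errors against the square root of \<open>\<Phi>(\<tau>, x) = A E[exp (a \<parallel>x + W\<^sub>\<tau>\<parallel>\<^sup>2)]\<close>, which
  satisfies the semigroup identity \<open>\<Phi>(\<tau>, x) = E[\<Phi>(\<tau> - s, x + W\<^sub>s)]\<close>, with \<open>a\<close> of order \<open>p/(d (1 + T))\<close> so that \<open>\<surd>\<Phi>\<close>
  costs only a factor \<open>d\<^bsup>p/2\<^esup>\<close>, and by the time weight \<open>exp (M \<tau> / (2 T))\<close>, which makes the time integrals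
  gain another factor \<open>1/\<surd>M\<close>. The cost is at most \<open>d (5 M)\<^sup>n\<close>, and the index before \<open>N\<close> still has an error
  bound above \<open>\<epsilon>\<close>, which bounds the cost at \<open>N\<close> in terms of \<open>\<epsilon>\<close>.
\<close>

section \<open>Gaussian integrals\<close>

text \<open>Two families of weights share the work. Polynomial weights carry everything qualitative:
  the weight of degree \<open>m\<close> is negligible at infinity against that of degree
  \<open>Suc m\<close>, which makes maxima attained, while the constants may depend badly on the
  dimension. Gaussian weights carry everything quantitative; the Picard operator preserves a bound
  by a multiple of \<surd>\<Phi>, so the fixed point found in the polynomial class obeys it as well.
  Telescoping requires the approximations to have the same mean for every index tuple, hence that
  their laws agree. This is shown by splitting an approximation into independent blocks. The
  delicate block is level 0, where a terminal and a source sample share one Brownian path, so that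
  the joint law at a random time and at the final time enters. Data given on [0,T] and R^d are
  extended to all times and all real sequences by clamping the time and cutting off coordinates,
  which turns continuity on a subset into continuity everywhere.\<close>

definition proj :: "nat \<Rightarrow> (nat \<Rightarrow> real) \<Rightarrow> nat \<Rightarrow> real" where
  "proj d x = (\<lambda>i. if i < d then x i else 0)"

text \<open>For a standard normal \<open>z\<close> this is distributed like Brownian motion started
  in \<open>x\<close> and run for time \<open>s\<close>.\<close>

definition heat_shift :: "(nat \<Rightarrow> real) \<Rightarrow> real \<Rightarrow> (nat \<Rightarrow> real) \<Rightarrow> nat \<Rightarrow> real" where
  "heat_shift x s z = (\<lambda>i. x i + sqrt s * z i)"

text \<open>Pushing the product measure forward along \<open>proj d\<close> replaces the extensional
  functions of \<open>PiM\<close> by sequences that vanish from \<open>d\<close> on, so the law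
  lives on the Borel sets of the carrier used throughout.\<close>

definition gauss :: "nat \<Rightarrow> (nat \<Rightarrow> real) measure" where
  "gauss d = distr (\<Pi>\<^sub>M i\<in>{..<d}. std_normal_distribution) borel (proj d)"

abbreviation unif :: "real measure" where
  "unif \<equiv> uniform_measure lborel {0..1}"

lemma mem_Rd_iff: "x \<in> Rd d \<longleftrightarrow> (\<forall>i\<ge>d. x i = 0)"
  by (simp add: topspace_Euclidean_space)

lemma proj_in_Rd [simp]: "proj d x \<in> Rd d"
  by (simp add: mem_Rd_iff proj_def)

lemma proj_ident: "x \<in> Rd d \<Longrightarrow> proj d x = x"
  by (auto simp add: mem_Rd_iff proj_def)

lemma proj_proj [simp]: "proj d (proj d x) = proj d x"
  by (simp add: proj_ident)

lemma proj_nth: "i < d \<Longrightarrow> proj d x i = x i"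
  by (simp add: proj_def)

lemma measurable_proj_PiM [measurable]:
  "proj d \<in> borel_measurable (\<Pi>\<^sub>M i\<in>{..<d}. std_normal_distribution)"
proof (rule measurable_coordinatewise_then_product)
  fix i show "(\<lambda>x. proj d x i) \<in> borel_measurable (\<Pi>\<^sub>M i\<in>{..<d}. std_normal_distribution)"
    by (cases "i < d") (simp_all add: proj_def)
qed

lemma continuous_on_nth':
  fixes F :: "'a::topological_space \<Rightarrow> nat \<Rightarrow> real"
  shows "continuous_on S F \<Longrightarrow> continuous_on S (\<lambda>x. F x i)"
  by (rule continuous_on_product_then_coordinatewise)

lemma continuous_on_proj [continuous_intros]:
  fixes F :: "'a::topological_space \<Rightarrow> nat \<Rightarrow> real"
  assumes "continuous_on S F" shows "continuous_on S (\<lambda>x. proj d (F x))"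
proof (rule continuous_on_coordinatewise_then_product)
  fix i show "continuous_on S (\<lambda>x. proj d (F x) i)"
    using assms by (cases "i < d") (simp_all add: proj_def continuous_on_nth')
qed

lemma continuous_on_heat_shift [continuous_intros]:
  fixes F G :: "'a::topological_space \<Rightarrow> nat \<Rightarrow> real"
  assumes "continuous_on S F" "continuous_on S s" "continuous_on S G"
  shows "continuous_on S (\<lambda>x. heat_shift (F x) (s x) (G x))"
  unfolding heat_shift_def
  by (intro continuous_on_coordinatewise_then_product continuous_intros continuous_on_nth'[OF assms(1)]
    continuous_on_nth'[OF assms(3)] assms(2))

lemma measurable_nth:
  fixes F :: "'a \<Rightarrow> nat \<Rightarrow> real"
  assumes "F \<in> borel_measurable M"
  shows "(\<lambda>x. F x i) \<in> borel_measurable M"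
  by (rule measurable_compose[OF assms borel_measurable_continuous_onI[OF continuous_on_product_coordinates]])

lemma measurable_heat_shift [measurable (raw)]:
  assumes "F \<in> borel_measurable M" "s \<in> borel_measurable M" "G \<in> borel_measurable M"
  shows "(\<lambda>x. heat_shift (F x) (s x) (G x)) \<in> borel_measurable M"
proof -
  note [measurable] = assms measurable_nth[OF assms(1)] measurable_nth[OF assms(3)]
  show ?thesis
    unfolding heat_shift_def by (rule measurable_coordinatewise_then_product) measurable
qed


interpretation std_normal: prob_space std_normal_distribution
  by (rule prob_space_normal_density) simp

interpretation unif: prob_space unif
  by (rule prob_space_uniform_measure) auto

interpretation gauss_PiM: product_prob_space "\<lambda>i. std_normal_distribution" I for I
  by unfold_locales

lemma sets_gauss [simp, measurable_cong]: "sets (gauss d) = sets borel"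
  and space_gauss [simp]: "space (gauss d) = UNIV"
  by (simp_all add: gauss_def)

lemma prob_space_gauss: "prob_space (gauss d)"
  unfolding gauss_def
  by (rule prob_space.prob_space_distr[OF prob_space_PiM]) (auto intro: std_normal.prob_space_axioms)

interpretation gauss: prob_space "gauss d" for d
  by (rule prob_space_gauss)

lemma AE_gauss_Rd: "AE z in gauss d. z \<in> Rd d"
proof -
  have "Measurable.pred borel (\<lambda>z::nat\<Rightarrow>real. z \<in> Rd d)"
    unfolding mem_Rd_iff by measurable
  then show ?thesis
    unfolding gauss_def by (subst AE_distr_iff) (auto simp: pred_def)
qed

lemma nn_integral_gauss_prod:
  assumes [measurable]: "\<And>i. i < d \<Longrightarrow> F i \<in> borel_measurable borel"
  shows "(\<integral>\<^sup>+z. (\<Prod>i<d. F i (z i)) \<partial>gauss d) = (\<Prod>i<d. \<integral>\<^sup>+z. F i z \<partial>std_normal_distribution)"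
proof -
  have "(\<integral>\<^sup>+z. (\<Prod>i<d. F i (z i)) \<partial>gauss d) =
        (\<integral>\<^sup>+z. (\<Prod>i<d. F i (proj d z i)) \<partial>(\<Pi>\<^sub>M i\<in>{..<d}. std_normal_distribution))"
  proof -
    have "(\<lambda>z. F i (z i)) \<in> borel_measurable borel" if "i < d" for i
      by (rule measurable_compose[OF _ assms[OF that]]) measurable
    then have "(\<lambda>z. \<Prod>i<d. F i (z i)) \<in> borel_measurable borel" by auto
    then show ?thesis
      unfolding gauss_def by (intro nn_integral_distr) auto
  qed
  also have "\<dots> = (\<integral>\<^sup>+z. (\<Prod>i<d. F i (z i)) \<partial>(\<Pi>\<^sub>M i\<in>{..<d}. std_normal_distribution))"
    by (intro nn_integral_cong prod.cong) (auto simp: proj_def)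
  also have "\<dots> = (\<Prod>i<d. \<integral>\<^sup>+z. F i z \<partial>std_normal_distribution)"
    by (subst gauss_PiM.product_nn_integral_prod) auto
  finally show ?thesis .
qed

lemma
  fixes F :: "nat \<Rightarrow> real \<Rightarrow> complex"
  assumes int: "\<And>i. i < d \<Longrightarrow> integrable std_normal_distribution (F i)"
  shows integral_gauss_prod:
      "(\<integral>z. (\<Prod>i<d. F i (z i)) \<partial>gauss d) = (\<Prod>i<d. \<integral>z. F i z \<partial>std_normal_distribution)"
    and integrable_gauss_prod: "integrable (gauss d) (\<lambda>z. \<Prod>i<d. F i (z i))"
proof -
  have [measurable]: "F i \<in> borel_measurable borel" if "i < d" for i
    using int[OF that] by auto
  have meas: "(\<lambda>z. \<Prod>i<d. F i (z i)) \<in> borel_measurable borel"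
  proof -
    have "(\<lambda>z. F i (z i)) \<in> borel_measurable borel" if "i < d" for i
      by (rule measurable_compose[where N = borel]) (use that in \<open>measurable\<close>)
    then show ?thesis by auto
  qed
  have eq: "(\<Prod>i<d. F i (proj d z i)) = (\<Prod>i<d. F i (z i))" for z
    by (intro prod.cong) (auto simp: proj_def)
  show "(\<integral>z. (\<Prod>i<d. F i (z i)) \<partial>gauss d) = (\<Prod>i<d. \<integral>z. F i z \<partial>std_normal_distribution)"
    unfolding gauss_def
    by (subst integral_distr)
      (use meas int in \<open>auto simp: eq intro!: gauss_PiM.product_integral_prod[OF finite_lessThan]\<close>)
  show "integrable (gauss d) (\<lambda>z. \<Prod>i<d. F i (z i))"
    unfolding gauss_def
    by (subst integrable_distr_eq) (use meas int in \<open>auto simp: eq intro!: gauss_PiM.product_integrable_prod\<close>)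
qed

lemma distr_gauss_nth: "i < d \<Longrightarrow> distr (gauss d) borel (\<lambda>z. z i) = std_normal_distribution"
proof -
  assume i: "i < d"
  have "distr (gauss d) borel (\<lambda>z. z i) =
        distr (\<Pi>\<^sub>M i\<in>{..<d}. std_normal_distribution) borel (\<lambda>z. proj d z i)"
    unfolding gauss_def by (subst distr_distr) (auto simp: comp_def)
  also have "\<dots> = distr (\<Pi>\<^sub>M i\<in>{..<d}. std_normal_distribution) std_normal_distribution (\<lambda>z. z i)"
    using i by (intro distr_cong) (auto simp: proj_def)
  also have "\<dots> = std_normal_distribution"
    using i by (intro distr_PiM_component) (auto intro: std_normal.prob_space_axioms)
  finally show ?thesis .
qed

lemma integrable_gauss_even_power:
  "i < d \<Longrightarrow> integrable (gauss d) (\<lambda>z. z i ^ (2 * m))"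
proof -
  assume i: "i < d"
  have "integrable std_normal_distribution (\<lambda>z::real. z ^ (2 * m))"
    using std_normal_moment_even[of m]
    by (subst integrable_density) (auto simp: has_bochner_integral_iff)
  then show ?thesis
    unfolding distr_gauss_nth[OF i, symmetric]
    by (subst (asm) integrable_distr_eq) auto
qed

text \<open>Completing the square: the exponent is that of a normal density with variance
  \<open>1/(1 - 2c\<sigma>\<^sup>2)\<close>.\<close>

lemma nn_integral_std_normal_exp_square:
  assumes "2 * c * \<sigma>\<^sup>2 < 1"
  shows "(\<integral>\<^sup>+z. ennreal (exp (c * (x + \<sigma> * z)\<^sup>2)) \<partial>std_normal_distribution) =
    ennreal (1 / sqrt (1 - 2 * c * \<sigma>\<^sup>2) * exp (c * x\<^sup>2 / (1 - 2 * c * \<sigma>\<^sup>2)))"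
proof -
  define r where "r = 1 - 2 * c * \<sigma>\<^sup>2"
  define \<mu> where "\<mu> = 2 * c * x * \<sigma> / r"
  define K where "K = 1 / sqrt r * exp (c * x\<^sup>2 / r)"
  have r: "r > 0" using assms by (simp add: r_def)
  have c\<sigma>: "c * \<sigma>\<^sup>2 = (1 - r) / 2" by (simp add: r_def field_simps)
  have expo: "c * (x + \<sigma> * z)\<^sup>2 - z\<^sup>2 / 2 = c * x\<^sup>2 / r - r * (z - \<mu>)\<^sup>2 / 2" for z
  proof -
    have "c * (x + \<sigma> * z)\<^sup>2 - z\<^sup>2 / 2 = c * x\<^sup>2 + 2 * c * x * \<sigma> * z + (c * \<sigma>\<^sup>2) * z\<^sup>2 - z\<^sup>2 / 2"
      by (simp add: power2_eq_square algebra_simps)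
    also have "\<dots> = c * x\<^sup>2 + r * \<mu> * z - r * z\<^sup>2 / 2"
      unfolding c\<sigma> \<mu>_def using r by (simp add: field_simps)
    also have "\<dots> = c * x\<^sup>2 + r * \<mu>\<^sup>2 / 2 - r * (z - \<mu>)\<^sup>2 / 2"
      by (simp add: power2_eq_square field_simps)
    also have "r * \<mu>\<^sup>2 / 2 = 2 * c * x\<^sup>2 * (c * \<sigma>\<^sup>2) / r"
      unfolding \<mu>_def using r by (simp add: power2_eq_square field_simps)
    also have "\<dots> = c * x\<^sup>2 / r - c * x\<^sup>2"
      unfolding c\<sigma> using r by (simp add: field_simps)
    finally show ?thesis by simp
  qed
  have dens: "std_normal_density z * exp (c * (x + \<sigma> * z)\<^sup>2) = K * normal_density \<mu> (1 / sqrt r) z" for z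
  proof -
    have "std_normal_density z * exp (c * (x + \<sigma> * z)\<^sup>2)
        = 1 / sqrt (2 * pi) * exp (c * (x + \<sigma> * z)\<^sup>2 - z\<^sup>2 / 2)"
      by (simp add: std_normal_density_def exp_add[symmetric])
    also have "\<dots> = K * (sqrt r / sqrt (2 * pi) * exp (- (r * (z - \<mu>)\<^sup>2 / 2)))"
    proof -
      have "exp (A - B) = exp A * exp (- B)" for A B :: real
        by (simp add: exp_diff exp_minus divide_inverse)
      then show ?thesis unfolding expo K_def using r by simp
    qed
    also have "sqrt r / sqrt (2 * pi) * exp (- (r * (z - \<mu>)\<^sup>2 / 2)) = normal_density \<mu> (1 / sqrt r) z"
      using r by (simp add: normal_density_def power_divide real_sqrt_divide real_sqrt_mult field_simps)
    finally show ?thesis .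
  qed
  have K: "K \<ge> 0" using r by (simp add: K_def)
  have "(\<integral>\<^sup>+z. ennreal (exp (c * (x + \<sigma> * z)\<^sup>2)) \<partial>std_normal_distribution)
      = (\<integral>\<^sup>+z. ennreal (std_normal_density z) * ennreal (exp (c * (x + \<sigma> * z)\<^sup>2)) \<partial>lborel)"
    by (subst nn_integral_density) auto
  also have "\<dots> = (\<integral>\<^sup>+z. ennreal K * ennreal (normal_density \<mu> (1 / sqrt r) z) \<partial>lborel)"
    using K by (intro nn_integral_cong) (simp add: ennreal_mult[symmetric] dens)
  also have "\<dots> = ennreal K * (\<integral>\<^sup>+z. ennreal (normal_density \<mu> (1 / sqrt r) z) \<partial>lborel)"
    by (rule nn_integral_cmult) auto
  also have "(\<integral>\<^sup>+z. ennreal (normal_density \<mu> (1 / sqrt r) z) \<partial>lborel) = 1"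
  proof -
    interpret prob_space "density lborel (normal_density \<mu> (1 / sqrt r))"
      by (rule prob_space_normal_density) (use r in auto)
    show ?thesis using emeasure_space_1 by (simp add: emeasure_density)
  qed
  finally show ?thesis by (simp add: K_def r_def)
qed

text \<open>This is the closed form of E[exp (a |x + W_t|^2)] for \<open>d\<close>-dimensional
  Brownian motion, valid while 2 a t < 1; the power collects the normalisations of the
  one-dimensional integrals.\<close>

definition gauss_weight :: "nat \<Rightarrow> real \<Rightarrow> real \<Rightarrow> (nat \<Rightarrow> real) \<Rightarrow> real" where
  "gauss_weight d a t x = (1 / sqrt (1 - 2 * a * t)) ^ d * exp (a * (\<Sum>i<d. (x i)\<^sup>2) / (1 - 2 * a * t))"

lemma gauss_weight_prod:
  "gauss_weight d a t x = (\<Prod>i<d. 1 / sqrt (1 - 2 * a * t) * exp (a / (1 - 2 * a * t) * (x i)\<^sup>2))"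
  by (simp only: gauss_weight_def prod.distrib prod_constant card_lessThan exp_sum[symmetric] finite_lessThan)
     (simp add: sum_distrib_left sum_divide_distrib)

lemma gauss_weight_nonneg: "2 * a * t < 1 \<Longrightarrow> 0 \<le> gauss_weight d a t x"
  by (simp add: gauss_weight_def)

lemma measurable_gauss_weight [measurable (raw)]:
  assumes [measurable]: "s \<in> borel_measurable M" and F: "F \<in> borel_measurable M"
  shows "(\<lambda>x. gauss_weight d a (s x) (F x)) \<in> borel_measurable M"
proof -
  note [measurable] = measurable_nth[OF F]
  show ?thesis unfolding gauss_weight_def by measurable
qed

text \<open>Semigroup property: averaging over a Gaussian step of variance \<open>s\<close> only
  moves the time parameter. The integral factorises over the coordinates, and in each of them the
  exponent a/(1 - 2 a t) is sent to a/(1 - 2 a (t + s)).\<close>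

lemma nn_integral_gauss_weight:
  assumes "0 \<le> a" "0 \<le> t" "0 \<le> s" "2 * a * (t + s) < 1"
  shows "(\<integral>\<^sup>+z. ennreal (gauss_weight d a t (heat_shift x s z)) \<partial>gauss d)
    = ennreal (gauss_weight d a (t + s) x)"
proof -
  define c where "c = a / (1 - 2 * a * t)"
  have at: "2 * a * t \<le> 2 * a * (t + s)"
    using assms by (intro mult_left_mono) auto
  then have r: "1 - 2 * a * t > 0" using assms by linarith
  \<comment> \<open>The factor left by completing the square is a quotient of two normalisations, so
    the product of the prefactors collapses to the one at time \<open>t + s\<close>.\<close>
  have r2: "1 - 2 * c * (sqrt s)\<^sup>2 = (1 - 2 * a * (t + s)) / (1 - 2 * a * t)"
    unfolding c_def using assms r by (simp add: field_simps)
  have lt: "2 * c * (sqrt s)\<^sup>2 < 1"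
    using r2 assms r divide_pos_pos[of "1 - 2 * a * (t + s)" "1 - 2 * a * t"] by linarith
  have "(\<integral>\<^sup>+z. ennreal (gauss_weight d a t (heat_shift x s z)) \<partial>gauss d) =
    (\<integral>\<^sup>+z. (\<Prod>i<d. ennreal (1 / sqrt (1 - 2 * a * t)) *
        ennreal (exp (c * (x i + sqrt s * z i)\<^sup>2))) \<partial>gauss d)"
    using r by (intro nn_integral_cong)
      (simp add: gauss_weight_prod prod_ennreal[symmetric] ennreal_mult c_def heat_shift_def
        flip: ennreal_mult)
  also have "\<dots> = (\<Prod>i<d. \<integral>\<^sup>+z. ennreal (1 / sqrt (1 - 2 * a * t)) *
        ennreal (exp (c * (x i + sqrt s * z)\<^sup>2)) \<partial>std_normal_distribution)"
    by (rule nn_integral_gauss_prod) measurable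
  also have "\<dots> = (\<Prod>i<d. ennreal (1 / sqrt (1 - 2 * a * t)) *
        ennreal (1 / sqrt (1 - 2 * c * (sqrt s)\<^sup>2) * exp (c * (x i)\<^sup>2 / (1 - 2 * c * (sqrt s)\<^sup>2))))"
    using lt by (intro prod.cong refl, subst nn_integral_cmult)
      (auto simp: nn_integral_std_normal_exp_square)
  also have "\<dots> = (\<Prod>i<d. ennreal (1 / sqrt (1 - 2 * a * (t + s)) * exp (a / (1 - 2 * a * (t + s)) * (x i)\<^sup>2)))"
  proof (intro prod.cong refl)
    fix i
    have rescale: "1 / sqrt r * (1 / sqrt (R / r) * exp (a / r * y / (R / r))) = 1 / sqrt R * exp (a / R * y)"
      if "r > 0" "R > 0" for r R y :: real
      using that by (simp add: real_sqrt_divide)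
    have "1 / sqrt (1 - 2 * a * t) * (1 / sqrt (1 - 2 * c * (sqrt s)\<^sup>2) * exp (c * (x i)\<^sup>2 / (1 - 2 * c * (sqrt s)\<^sup>2)))
      = 1 / sqrt (1 - 2 * a * (t + s)) * exp (a / (1 - 2 * a * (t + s)) * (x i)\<^sup>2)"
      unfolding r2 unfolding c_def by (rule rescale) (use r assms(4) in auto)
    then show "ennreal (1 / sqrt (1 - 2 * a * t)) *
        ennreal (1 / sqrt (1 - 2 * c * (sqrt s)\<^sup>2) * exp (c * (x i)\<^sup>2 / (1 - 2 * c * (sqrt s)\<^sup>2))) =
        ennreal (1 / sqrt (1 - 2 * a * (t + s)) * exp (a / (1 - 2 * a * (t + s)) * (x i)\<^sup>2))"
      using r lt by (simp flip: ennreal_mult)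
  qed
  also have "\<dots> = ennreal (gauss_weight d a (t + s) x)"
    using assms by (simp add: gauss_weight_prod prod_ennreal)
  finally show ?thesis .
qed

lemma gauss_weight_mono:
  assumes "0 \<le> a" "0 \<le> t" "t \<le> t'" "2 * a * t' < 1"
  shows "gauss_weight d a t x \<le> gauss_weight d a t' x"
proof -
  have le: "2 * a * t \<le> 2 * a * t'" using assms by (intro mult_left_mono) auto
  have pos: "0 < 1 - 2 * a * t'" using assms by simp
  have "a * (\<Sum>i<d. (x i)\<^sup>2) / (1 - 2 * a * t) \<le> a * (\<Sum>i<d. (x i)\<^sup>2) / (1 - 2 * a * t')"
    by (rule divide_left_mono) (use le pos assms in \<open>auto intro!: mult_nonneg_nonneg sum_nonneg mult_pos_pos\<close>)
  moreover have "1 / sqrt (1 - 2 * a * t) \<le> 1 / sqrt (1 - 2 * a * t')"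
    by (rule divide_left_mono) (use le pos in \<open>auto intro!: mult_pos_pos\<close>)
  ultimately show ?thesis
    unfolding gauss_weight_def using le pos
    by (intro mult_mono power_mono) auto
qed

text \<open>Plane waves are eigenfunctions of the heat semigroup. The part of the phase that does
  not depend on \<open>z\<close> is split off as a factor \<open>cis\<close>, and the rest is a
  product of normal characteristic functions, of which the real part is taken.\<close>

lemma integral_gauss_cos:
  assumes "0 \<le> s"
  shows "(\<integral>z. cos ((\<Sum>i<d. k i * heat_shift x s z i) + b) \<partial>gauss d)
    = exp (- (s * (\<Sum>i<d. (k i)\<^sup>2) / 2)) * cos ((\<Sum>i<d. k i * x i) + b)"
proof -
  define E where "E z = (\<Prod>i<d. iexp (k i * sqrt s * z i))" for z :: "nat \<Rightarrow> real"
  have E_eq: "E z = iexp (\<Sum>i<d. k i * sqrt s * z i)" for z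
    by (simp add: E_def exp_sum[symmetric] sum_distrib_left)
  have int1: "integrable std_normal_distribution (\<lambda>z. iexp (k i * sqrt s * z))" for i
    by (rule std_normal.integrable_const_bound[where B = 1]) auto
  have intE: "integrable (gauss d) E"
    unfolding E_def by (rule integrable_gauss_prod[of d "\<lambda>i z. iexp (k i * sqrt s * z)"]) (rule int1)
  have charf: "(\<integral>z. iexp (k i * sqrt s * z) \<partial>std_normal_distribution) = of_real (exp (- (s * (k i)\<^sup>2) / 2))" for i
    using fun_cong[OF char_std_normal_distribution, of "k i * sqrt s"] assms
    by (simp add: power_mult_distrib mult_ac char_def)
  have "integral\<^sup>L (gauss d) E = (\<Prod>i<d. of_real (exp (- (s * (k i)\<^sup>2) / 2)))"
    unfolding E_def integral_gauss_prod[of d "\<lambda>i z. iexp (k i * sqrt s * z)", OF int1] charf ..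
  also have "\<dots> = of_real (exp (- (s * (\<Sum>i<d. (k i)\<^sup>2) / 2)))"
    by (simp add: exp_sum[symmetric] sum_divide_distrib sum_distrib_left sum_negf flip: of_real_prod)
  finally have IE: "integral\<^sup>L (gauss d) E = of_real (exp (- (s * (\<Sum>i<d. (k i)\<^sup>2) / 2)))" .
  let ?A = "(\<Sum>i<d. k i * x i) + b"
  have eq: "cos ((\<Sum>i<d. k i * heat_shift x s z i) + b) = Re (cis ?A * E z)" for z
  proof -
    have "(\<Sum>i<d. k i * heat_shift x s z i) + b = ?A + (\<Sum>i<d. k i * sqrt s * z i)"
      by (simp add: heat_shift_def algebra_simps sum.distrib)
    moreover have "E z = cis (\<Sum>i<d. k i * sqrt s * z i)"
      by (simp add: E_eq cis_conv_exp)
    ultimately show ?thesis by (simp only: cis_mult cis.sel)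
  qed
  have "(\<integral>z. cos ((\<Sum>i<d. k i * heat_shift x s z i) + b) \<partial>gauss d)
      = Re (\<integral>z. cis ?A * E z \<partial>gauss d)"
    unfolding eq using intE by (intro integral_Re) auto
  also have "(\<integral>z. cis ?A * E z \<partial>gauss d) = cis ?A * integral\<^sup>L (gauss d) E"
    using intE by simp
  finally show ?thesis unfolding IE by simp
qed

text \<open>Bridges the law prescribed for Brownian increments in \<open>standard_BM\<close>, a
  product of normal densities on extensional functions, and a rescaled \<open>gauss\<close>.\<close>

lemma distr_PiM_normal:
  assumes "0 < \<sigma>"
  shows "distr (\<Pi>\<^sub>M i\<in>{..<d}. density lborel (\<lambda>z. ennreal (normal_density 0 \<sigma> z))) borel (proj d)
    = distr (gauss d) borel (\<lambda>z i. \<sigma> * z i)"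
proof -
  let ?N = "density lborel (\<lambda>z. ennreal (normal_density 0 \<sigma> z))"
  have "distributed std_normal_distribution lborel (\<lambda>x. x) std_normal_density"
    by (auto simp: distributed_def distr_id2)
  from std_normal.normal_density_affine[OF this, of \<sigma> 0]
  have N: "distr std_normal_distribution lborel (\<lambda>x. \<sigma> * x) = ?N"
    using assms by (simp add: distributed_def)
  interpret N: prob_space ?N using assms by (rule prob_space_normal_density)
  have N'': "distr std_normal_distribution ?N (\<lambda>x. \<sigma> * x) = ?N"
    using N by (metis distr_cong sets_density)
  have "(\<Pi>\<^sub>M i\<in>{..<d}. ?N) =
      distr (\<Pi>\<^sub>M i\<in>{..<d}. std_normal_distribution) (\<Pi>\<^sub>M i\<in>{..<d}. ?N) (compose {..<d} (\<lambda>x. \<sigma> * x))"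
    by (subst distr_PiM_finite_prob_space')
       (auto intro: std_normal.prob_space_axioms N.prob_space_axioms simp: N'')
  then have "distr (\<Pi>\<^sub>M i\<in>{..<d}. ?N) borel (proj d) =
     distr (distr (\<Pi>\<^sub>M i\<in>{..<d}. std_normal_distribution) (\<Pi>\<^sub>M i\<in>{..<d}. ?N) (compose {..<d} (\<lambda>x. \<sigma> * x))) borel (proj d)"
    by simp
  also have "\<dots> = distr (\<Pi>\<^sub>M i\<in>{..<d}. std_normal_distribution) borel (proj d \<circ> compose {..<d} (\<lambda>x. \<sigma> * x))"
  proof (rule distr_distr)
    show "proj d \<in> borel_measurable (\<Pi>\<^sub>M i\<in>{..<d}. ?N)"
    proof (rule measurable_coordinatewise_then_product)
      fix i show "(\<lambda>x. proj d x i) \<in> borel_measurable (\<Pi>\<^sub>M i\<in>{..<d}. ?N)"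
      proof (cases "i < d")
        case True
        then have "(\<lambda>x. x i) \<in> borel_measurable (\<Pi>\<^sub>M i\<in>{..<d}. ?N)"
          by (intro measurable_compose[OF measurable_component_singleton[of i "{..<d}" "\<lambda>_. ?N"]]) auto
        then show ?thesis using True by (simp add: proj_def)
      qed (simp add: proj_def)
    qed
      show "compose {..<d} (\<lambda>x. \<sigma> * x) \<in> measurable (\<Pi>\<^sub>M i\<in>{..<d}. std_normal_distribution) (\<Pi>\<^sub>M i\<in>{..<d}. ?N)"
      unfolding compose_def[abs_def]
    proof (rule measurable_restrict)
      fix i assume "i \<in> {..<d}"
      then have "(\<lambda>x. x i) \<in> borel_measurable (\<Pi>\<^sub>M i\<in>{..<d}. std_normal_distribution)"
        by (intro measurable_compose[OF measurable_component_singleton[of i "{..<d}" "\<lambda>_. std_normal_distribution"]]) auto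
      then show "(\<lambda>x. \<sigma> * x i) \<in> measurable (\<Pi>\<^sub>M i\<in>{..<d}. std_normal_distribution) ?N"
        by simp
    qed
  qed
  also have "\<dots> = distr (\<Pi>\<^sub>M i\<in>{..<d}. std_normal_distribution) borel ((\<lambda>z i. \<sigma> * z i) \<circ> proj d)"
    by (intro distr_cong) (auto simp: proj_def compose_def)
  also have "\<dots> = distr (gauss d) borel (\<lambda>z i. \<sigma> * z i)"
    unfolding gauss_def
    by (rule distr_distr[symmetric]) (auto intro!: measurable_coordinatewise_then_product)
  finally show ?thesis .
qed

section \<open>The Feynman--Kac operator\<close>

text \<open>Equivalent to 1 + |x|^(2m) up to factors depending on \<open>d\<close> and
  \<open>m\<close>, but a sum over coordinates: its derivatives are monomials and its Gaussian
  integral reduces to one-dimensional moments.\<close>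

definition poly_weight :: "nat \<Rightarrow> nat \<Rightarrow> (nat \<Rightarrow> real) \<Rightarrow> real" where
  "poly_weight d m x = 1 + (\<Sum>i<d. x i ^ (2 * m))"

lemma poly_weight_ge_1: "1 \<le> poly_weight d m x"
  by (simp add: poly_weight_def sum_nonneg)

lemma poly_weight_pos: "0 < poly_weight d m x"
  using poly_weight_ge_1[of d m x] by linarith

lemma continuous_on_poly_weight [continuous_intros]:
  fixes F :: "'a::topological_space \<Rightarrow> nat \<Rightarrow> real"
  assumes "continuous_on S F" shows "continuous_on S (\<lambda>x. poly_weight d m (F x))"
  unfolding poly_weight_def by (intro continuous_intros continuous_on_nth'[OF assms])

lemma measurable_poly_weight [measurable]: "poly_weight d m \<in> borel_measurable borel"
  by (intro borel_measurable_continuous_onI continuous_intros)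

lemma poly_weight_proj: "poly_weight d m (proj d x) = poly_weight d m x"
  by (simp add: poly_weight_def proj_def)

lemma add_power_even_le:
  fixes a b :: real
  shows "(a + b) ^ (2 * m) \<le> 4 ^ m * (a ^ (2 * m) + b ^ (2 * m))"
proof -
  have "(a + b)\<^sup>2 \<le> 4 * max (a\<^sup>2) (b\<^sup>2)"
    using sum_squares_bound[of a b] by (simp add: power2_sum)
  then have "((a + b)\<^sup>2) ^ m \<le> (4 * max (a\<^sup>2) (b\<^sup>2)) ^ m"
    by (intro power_mono) auto
  also have "\<dots> \<le> 4 ^ m * ((a\<^sup>2) ^ m + (b\<^sup>2) ^ m)"
    by (auto simp: power_mult_distrib max_def)
  finally show ?thesis by (simp add: power_mult)
qed

text \<open>The bound is a product because this separates the starting point from the noise: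
  integrating out \<open>z\<close> leaves a constant times the weight of \<open>x\<close>.\<close>

lemma poly_weight_heat_shift:
  assumes "0 \<le> s" "s \<le> T"
  shows "poly_weight d m (heat_shift x s z)
    \<le> 4 ^ m * (1 + T) ^ m * (poly_weight d m x * poly_weight d m z)"
proof -
  define c where "c = 4 ^ m * (1 + T) ^ m"
  have T: "1 \<le> (1 + T) ^ m" "1 \<le> (4::real) ^ m" using assms by (auto intro: one_le_power)
  then have c: "1 \<le> c" unfolding c_def using mult_mono[of 1 "4^m" 1 "(1 + T)^m"] by simp
  have "(x i + sqrt s * z i) ^ (2 * m) \<le> c * (x i ^ (2 * m) + z i ^ (2 * m))" for i
  proof -
    have "(sqrt s * z i) ^ (2 * m) = s ^ m * z i ^ (2 * m)"
      using assms by (simp add: power_mult_distrib power_mult)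
    also have "\<dots> \<le> (1 + T) ^ m * z i ^ (2 * m)"
      using assms by (intro mult_right_mono power_mono) auto
    finally have "x i ^ (2 * m) + (sqrt s * z i) ^ (2 * m) \<le> (1 + T) ^ m * (x i ^ (2 * m) + z i ^ (2 * m))"
      using mult_right_mono[OF T(1) zero_le_even_power[of "2 * m" "x i"]] by (simp add: algebra_simps)
    then have "4 ^ m * (x i ^ (2 * m) + (sqrt s * z i) ^ (2 * m)) \<le> c * (x i ^ (2 * m) + z i ^ (2 * m))"
      by (simp add: c_def mult.assoc)
    then show ?thesis
      using add_power_even_le[of "x i" "sqrt s * z i" m] by linarith
  qed
  then have "(\<Sum>i<d. heat_shift x s z i ^ (2 * m)) \<le> c * ((\<Sum>i<d. x i ^ (2 * m)) + (\<Sum>i<d. z i ^ (2 * m)))"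
    by (simp add: heat_shift_def sum_distrib_left sum.distrib[symmetric] sum_mono)
  then have "poly_weight d m (heat_shift x s z) \<le> c * (1 + (\<Sum>i<d. x i ^ (2 * m)) + (\<Sum>i<d. z i ^ (2 * m)))"
    using c by (simp add: poly_weight_def algebra_simps)
  also have "\<dots> \<le> c * (poly_weight d m x * poly_weight d m z)"
    using c by (intro mult_left_mono)
      (auto simp: poly_weight_def algebra_simps zero_le_even_power intro!: mult_nonneg_nonneg sum_nonneg)
  finally show ?thesis by (simp add: c_def)
qed

lemma integrable_poly_weight: "integrable (gauss d) (poly_weight d m)"
  unfolding poly_weight_def[abs_def] by (auto intro!: integrable_gauss_even_power)

section \<open>Joint law of a random time fraction and a Gaussian vector, and samples built from
  it\<close>

definition noise :: "nat \<Rightarrow> (real \<times> (nat \<Rightarrow> real)) measure" where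
  "noise d = unif \<Otimes>\<^sub>M gauss d"

interpretation unif_gauss: pair_prob_space unif "gauss d" for d ..

lemma prob_space_noise: "prob_space (noise d)"
  unfolding noise_def by (rule unif_gauss.prob_space_axioms)

interpretation noise: prob_space "noise d" for d
  by (rule prob_space_noise)

lemma sets_noise [simp, measurable_cong]: "sets (noise d) = sets (borel \<Otimes>\<^sub>M borel)"
  unfolding noise_def by (rule sets_pair_measure_cong) auto

lemma space_noise [simp]: "space (noise d) = UNIV"
  by (simp add: noise_def space_pair_measure)

lemma AE_noise: "AE p in noise d. fst p \<in> {0..1} \<and> snd p \<in> Rd d"
proof -
  have [measurable]: "Measurable.pred borel (\<lambda>z::nat\<Rightarrow>real. z \<in> Rd d)"
    unfolding mem_Rd_iff by measurable
  have 1: "AE u in unif. u \<in> {0..1}"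
    by (rule AE_uniform_measureI) auto
  have "AE u in unif. AE z in gauss d. u \<in> {0..1} \<and> z \<in> Rd d"
    using 1 by eventually_elim (use AE_gauss_Rd[of d] in auto)
  moreover have "Measurable.pred (unif \<Otimes>\<^sub>M gauss d) (\<lambda>p. fst p \<in> {0..1} \<and> snd p \<in> Rd d)"
    by measurable
  ultimately have "AE p in noise d. case p of (u, z) \<Rightarrow> u \<in> {0..1} \<and> z \<in> Rd d"
    unfolding noise_def by (intro unif_gauss.AE_pair_measure) (auto simp: pred_def case_prod_beta)
  then show ?thesis by (auto simp: case_prod_beta)
qed

lemma unif_eq_density: "unif = density lborel (\<lambda>x. ennreal (indicator {0..1} x))"
  unfolding uniform_measure_def
  by (intro density_cong) (auto simp: divide_ennreal[of 1 1, simplified] split: split_indicator)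

lemma unif_FTC:
  fixes f F :: "real \<Rightarrow> real"
  assumes "\<And>u. 0 \<le> u \<Longrightarrow> u \<le> 1 \<Longrightarrow> (F has_real_derivative f u) (at u)"
    and cont: "continuous_on UNIV f"
  shows "integrable unif f" "integral\<^sup>L unif f = F 1 - F 0"
proof -
  have [measurable]: "f \<in> borel_measurable borel"
    by (rule borel_measurable_continuous_onI[OF cont])
  have "isCont f u" for u
    using cont by (simp add: continuous_on_eq_continuous_at)
  then have *: "has_bochner_integral lborel (\<lambda>x. f x * indicator {0..1} x) (F 1 - F 0)"
    using assms by (intro has_bochner_integral_FTC_Icc_real) auto
  then show "integrable unif f" "integral\<^sup>L unif f = F 1 - F 0"
    unfolding unif_eq_density
    by (auto simp: has_bochner_integral_iff integrable_density integral_density mult.commute)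
qed

lemma
  fixes f :: "real \<Rightarrow> real" and G :: "(nat \<Rightarrow> real) \<Rightarrow> real"
  assumes f: "integrable unif f" and G: "integrable (gauss d) G"
  shows integrable_noise_mult: "integrable (noise d) (\<lambda>p. f (fst p) * G (snd p))"
    and integral_noise_mult: "(\<integral>p. f (fst p) * G (snd p) \<partial>noise d) = integral\<^sup>L unif f * integral\<^sup>L (gauss d) G"
proof -
  have [measurable]: "f \<in> borel_measurable borel" "G \<in> borel_measurable borel"
    using f G by auto
  show *: "integrable (noise d) (\<lambda>p. f (fst p) * G (snd p))"
    unfolding noise_def
    by (rule unif_gauss.Fubini_integrable) (use f G in \<open>auto simp: abs_mult\<close>)
  show "(\<integral>p. f (fst p) * G (snd p) \<partial>noise d) = integral\<^sup>L unif f * integral\<^sup>L (gauss d) G"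
    using unif_gauss.integral_fst'[OF *[unfolded noise_def]] by (simp add: noise_def)
qed

text \<open>Both terms are driven by the one normal vector \<open>snd p\<close>, which is not the
  coupling given by a Brownian path. Only the expectation of the sum is used, so any coupling with
  the right marginals will do.\<close>

definition fk_sample :: "real \<Rightarrow> (real \<Rightarrow> (nat \<Rightarrow> real) \<Rightarrow> real) \<Rightarrow> ((nat \<Rightarrow> real) \<Rightarrow> real) \<Rightarrow>
    real \<Rightarrow> (nat \<Rightarrow> real) \<Rightarrow> real \<times> (nat \<Rightarrow> real) \<Rightarrow> real" where
  "fk_sample T h g t x p = g (heat_shift x (T - t) (snd p))
     + (T - t) * h (t + fst p * (T - t)) (heat_shift x (fst p * (T - t)) (snd p))"

definition feynman_kac :: "nat \<Rightarrow> real \<Rightarrow> (real \<Rightarrow> (nat \<Rightarrow> real) \<Rightarrow> real) \<Rightarrow> ((nat \<Rightarrow> real) \<Rightarrow> real) \<Rightarrow>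
    real \<Rightarrow> (nat \<Rightarrow> real) \<Rightarrow> real" where
  "feynman_kac d T h g t x = (\<integral>p. fk_sample T h g t x p \<partial>noise d)"

text \<open>Continuity is global because data are extended beyond [0,T] and R^d, whereas the bound
  is confined to \<open>{0..T}\<close>: the time coefficient of a trigonometric polynomial may be
  unbounded elsewhere.\<close>

definition growth :: "nat \<Rightarrow> real \<Rightarrow> nat \<Rightarrow> (real \<Rightarrow> (nat \<Rightarrow> real) \<Rightarrow> real) \<Rightarrow> bool" where
  "growth d T m h \<longleftrightarrow> continuous_on UNIV (\<lambda>(t, x). h t x) \<and>
     (\<exists>C. \<forall>t\<in>{0..T}. \<forall>x. \<bar>h t x\<bar> \<le> C * poly_weight d m x)"

lemma growth_cont: "growth d T m h \<Longrightarrow> continuous_on UNIV (\<lambda>(t, x). h t x)"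
  by (simp add: growth_def)

lemma continuous_on_pair_comp:
  fixes h :: "real \<Rightarrow> (nat \<Rightarrow> real) \<Rightarrow> real"
  assumes "continuous_on UNIV (\<lambda>(t, x). h t x)" "continuous_on S s" "continuous_on S F"
  shows "continuous_on S (\<lambda>y. h (s y) (F y))"
proof -
  have "continuous_on S ((\<lambda>(t, x). h t x) \<circ> (\<lambda>y. (s y, F y)))"
    by (rule continuous_on_compose)
      (auto intro!: continuous_intros assms continuous_on_subset[OF assms(1)])
  then show ?thesis by (simp add: comp_def)
qed

lemma measurable_pair_comp:
  fixes h :: "real \<Rightarrow> (nat \<Rightarrow> real) \<Rightarrow> real"
  assumes "continuous_on UNIV (\<lambda>(t, x). h t x)"
    and [measurable]: "s \<in> borel_measurable M" "F \<in> borel_measurable M"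
  shows "(\<lambda>y. h (s y) (F y)) \<in> borel_measurable M"
proof -
  have "(\<lambda>(t, x). h t x) \<in> borel_measurable (borel \<Otimes>\<^sub>M borel)"
    using borel_measurable_continuous_onI[OF assms(1)] by (simp add: borel_prod)
  from measurable_compose[OF _ this, of "\<lambda>y. (s y, F y)" M] show ?thesis by simp
qed

lemma growthE:
  assumes "growth d T m h"
  obtains C where "C \<ge> 0" "\<forall>t\<in>{0..T}. \<forall>x. \<bar>h t x\<bar> \<le> C * poly_weight d m x"
proof -
  from assms obtain C where "\<forall>t\<in>{0..T}. \<forall>x. \<bar>h t x\<bar> \<le> C * poly_weight d m x"
    unfolding growth_def by auto
  then have C: "\<bar>h t x\<bar> \<le> C * poly_weight d m x" if "0 \<le> t" "t \<le> T" for t x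
    using that by auto
  have "\<bar>h t x\<bar> \<le> \<bar>C\<bar> * poly_weight d m x" if "0 \<le> t" "t \<le> T" for t x
    using C[OF that, of x] mult_right_mono[OF abs_ge_self[of C], of "poly_weight d m x"] poly_weight_pos[of d m x]
    by linarith
  then show thesis by (intro that[of "\<bar>C\<bar>"]) auto
qed

lemma growth_add: "growth d T m h \<Longrightarrow> growth d T m h' \<Longrightarrow> growth d T m (\<lambda>t x. h t x + h' t x)"
proof -
  assume h: "growth d T m h" "growth d T m h'"
  obtain C where "C \<ge> 0" and C: "\<forall>t\<in>{0..T}. \<forall>x. \<bar>h t x\<bar> \<le> C * poly_weight d m x"
    by (rule growthE[OF h(1)])
  obtain C' where "C' \<ge> 0" and C': "\<forall>t\<in>{0..T}. \<forall>x. \<bar>h' t x\<bar> \<le> C' * poly_weight d m x"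
    by (rule growthE[OF h(2)])
  have "\<bar>h t x + h' t x\<bar> \<le> (C + C') * poly_weight d m x" if "0 \<le> t" "t \<le> T" for t x
  proof -
    have "\<bar>h t x\<bar> \<le> C * poly_weight d m x" "\<bar>h' t x\<bar> \<le> C' * poly_weight d m x"
      using C C' that by auto
    then show ?thesis by (simp add: algebra_simps)
  qed
  then show ?thesis
    using h unfolding growth_def
    by (auto simp: case_prod_beta intro!: continuous_intros exI[of _ "C + C'"])
qed

lemma growth_uminus: "growth d T m h \<Longrightarrow> growth d T m (\<lambda>t x. - h t x)"
  unfolding growth_def by (auto simp: case_prod_beta intro!: continuous_intros)

lemma growth_diff: "growth d T m h \<Longrightarrow> growth d T m h' \<Longrightarrow> growth d T m (\<lambda>t x. h t x - h' t x)"
  using growth_add[of d T m h "\<lambda>t x. - h' t x"] growth_uminus[of d T m h'] by simp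

lemma growth_bounded:
  assumes "continuous_on UNIV (\<lambda>(t, x). h t x)" "\<And>t x. 0 \<le> t \<Longrightarrow> t \<le> T \<Longrightarrow> \<bar>h t x\<bar> \<le> B"
  shows "growth d T m h"
proof -
  have "\<bar>h t x\<bar> \<le> \<bar>B\<bar> * poly_weight d m x" if "0 \<le> t" "t \<le> T" for t x
    using assms(2)[OF that, of x] mult_left_mono[OF poly_weight_ge_1[of d m x] abs_ge_zero[of B]] by linarith
  then have "\<forall>t\<in>{0..T}. \<forall>x. \<bar>h t x\<bar> \<le> \<bar>B\<bar> * poly_weight d m x" by auto
  then show ?thesis using assms(1) unfolding growth_def by blast
qed

lemma growth_zero: "growth d T m (\<lambda>_ _. 0)"
  by (rule growth_bounded[where B = 0]) auto

lemma measurable_fk_sample: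
  assumes "continuous_on UNIV (\<lambda>(t, x). h t x)" "continuous_on UNIV g"
  shows "fk_sample T h g t x \<in> borel_measurable (noise d)"
proof -
  have [measurable]: "g \<in> borel_measurable borel"
    by (rule borel_measurable_continuous_onI[OF assms(2)])
  have [measurable]: "(\<lambda>p. h (t + fst p * (T - t)) (heat_shift x (fst p * (T - t)) (snd p))) \<in> borel_measurable (noise d)"
    by (rule measurable_pair_comp[OF assms(1)]) measurable
  show ?thesis unfolding fk_sample_def[abs_def] by measurable
qed

text \<open>The price of moving a polynomial weight through one Gaussian step. It depends on
  \<open>d\<close>, which is harmless because the quantitative estimates rest on Gaussian weights
  instead.\<close>

definition fk_const :: "nat \<Rightarrow> real \<Rightarrow> nat \<Rightarrow> real" where
  "fk_const d T m = 4 ^ m * (1 + T) ^ m * integral\<^sup>L (gauss d) (poly_weight d m)"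

lemma fk_const_ge_1: "0 \<le> T \<Longrightarrow> 1 \<le> fk_const d T m"
proof -
  assume T: "0 \<le> T"
  have "1 \<le> 4 ^ m * (1 + T) ^ m"
    using mult_mono[of 1 "4^m" 1 "(1 + T)^m"] T by (simp add: one_le_power)
  moreover have "1 \<le> integral\<^sup>L (gauss d) (poly_weight d m)"
    using integral_mono[OF _ integrable_poly_weight, of d "\<lambda>_. 1" m] poly_weight_ge_1[of d m]
      gauss.prob_space[of d] by simp
  ultimately show ?thesis
    unfolding fk_const_def using mult_mono[of 1 "4 ^ m * (1 + T) ^ m" 1 "integral\<^sup>L (gauss d) (poly_weight d m)"]
    by simp
qed

text \<open>The source may grow backward in time like exp (\<nu> (T - s)). Its time integral gains a
  factor 1/\<nu>, and a large \<nu> later makes the Picard operator a contraction without any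
  restriction on \<open>T\<close>.\<close>

lemma
  assumes t: "0 \<le> t" "t \<le> T" and lam: "0 < \<nu>" and c: "0 \<le> c" "0 \<le> b"
    and cont: "continuous_on UNIV (\<lambda>(t, x). h t x)" "continuous_on UNIV g"
    and g: "\<And>x. \<bar>g x\<bar> \<le> b * poly_weight d m x"
    and h: "\<And>s x. 0 \<le> s \<Longrightarrow> s \<le> T \<Longrightarrow> \<bar>h s x\<bar> \<le> c * exp (\<nu> * (T - s)) * poly_weight d m x"
  shows integrable_fk_sample_exp: "integrable (noise d) (fk_sample T h g t x)"
    and fk_bound_exp: "\<bar>feynman_kac d T h g t x\<bar>
      \<le> fk_const d T m * (b + c * exp (\<nu> * (T - t)) / \<nu>) * poly_weight d m x"
proof -
  define \<tau> where "\<tau> = T - t"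
  \<comment> \<open>Bounds the two terms of a sample with the weights of \<open>x\<close> and
    \<open>z\<close> divided out; the exponent comes from T - (t + u \<tau>) = \<tau> (1 -
    u).\<close>
  define e where "e u = b + c * (\<tau> * exp (\<nu> * \<tau> * (1 - u)))" for u :: real
  define K where "K = 4 ^ m * (1 + T) ^ m * poly_weight d m x"
  have \<tau>: "0 \<le> \<tau>" using t by (simp add: \<tau>_def)
  have K: "0 \<le> K" unfolding K_def using t poly_weight_pos[of d m x] by simp
  have e_int: "integrable unif e" "integral\<^sup>L unif e = b + c * ((exp (\<nu> * \<tau>) - 1) / \<nu>)"
  proof -
    define F where "F u = b * u + c * (- exp (\<nu> * \<tau> * (1 - u)) / \<nu>)" for u
    have "(F has_real_derivative e u) (at u)" for u
      unfolding F_def e_def using lam by (auto intro!: derivative_eq_intros)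
    moreover have "continuous_on UNIV e" unfolding e_def by (intro continuous_intros)
    ultimately show "integrable unif e" "integral\<^sup>L unif e = b + c * ((exp (\<nu> * \<tau>) - 1) / \<nu>)"
      using unif_FTC[of F e] by (auto simp: F_def algebra_simps diff_divide_distrib)
  qed
  have dom: "AE p in noise d. norm (fk_sample T h g t x p) \<le> K * (e (fst p) * poly_weight d m (snd p))"
    using AE_noise
  proof eventually_elim
    case (elim p)
    obtain u z where p: "p = (u, z)" by (cases p)
    have u: "0 \<le> u" "u \<le> 1" using elim by (auto simp: p)
    have u\<tau>: "0 \<le> u * \<tau>" "u * \<tau> \<le> \<tau>" "t + u * \<tau> \<le> T" "0 \<le> t + u * \<tau>"
      using u \<tau> t mult_right_mono[of u 1 \<tau>] by (auto simp: \<tau>_def)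
    have w: "poly_weight d m (heat_shift x s z) \<le> K * poly_weight d m z" if "0 \<le> s" "s \<le> \<tau>" for s
      using poly_weight_heat_shift[of s T d m x z] that t by (simp add: K_def \<tau>_def mult_ac)
    have "\<bar>g (heat_shift x \<tau> z)\<bar> \<le> b * (K * poly_weight d m z)"
      using g[of "heat_shift x \<tau> z"] mult_left_mono[OF w[OF \<tau> order_refl] c(2)] by linarith
    moreover have "\<bar>h (t + u * \<tau>) (heat_shift x (u * \<tau>) z)\<bar>
       \<le> c * exp (\<nu> * (T - (t + u * \<tau>))) * (K * poly_weight d m z)"
      using h[OF u\<tau>(4,3), of "heat_shift x (u * \<tau>) z"] c
        mult_left_mono[OF w[OF u\<tau>(1,2)], of "c * exp (\<nu> * (T - (t + u * \<tau>)))"]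
      by simp
    then have "\<tau> * \<bar>h (t + u * \<tau>) (heat_shift x (u * \<tau>) z)\<bar>
       \<le> \<tau> * (c * exp (\<nu> * \<tau> * (1 - u)) * (K * poly_weight d m z))"
      using \<tau> by (intro mult_left_mono) (auto simp: \<tau>_def algebra_simps)
    ultimately have "\<bar>g (heat_shift x \<tau> z)\<bar> + \<tau> * \<bar>h (t + u * \<tau>) (heat_shift x (u * \<tau>) z)\<bar>
      \<le> b * (K * poly_weight d m z) + \<tau> * (c * exp (\<nu> * \<tau> * (1 - u)) * (K * poly_weight d m z))"
      by (rule add_mono)
    moreover have "norm (fk_sample T h g t x p) \<le> \<bar>g (heat_shift x \<tau> z)\<bar> + \<tau> * \<bar>h (t + u * \<tau>) (heat_shift x (u * \<tau>) z)\<bar>"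
      unfolding fk_sample_def p \<tau>_def[symmetric] using \<tau> by (auto simp: abs_mult intro: order_trans[OF abs_triangle_ineq])
    ultimately show ?case
      by (simp add: e_def p algebra_simps)
  qed
  have int: "integrable (noise d) (\<lambda>p. K * (e (fst p) * poly_weight d m (snd p)))"
    using integrable_noise_mult[OF e_int(1) integrable_poly_weight] by simp
  show *: "integrable (noise d) (fk_sample T h g t x)"
    by (rule Bochner_Integration.integrable_bound[OF int measurable_fk_sample[OF cont]]) (use dom in auto)
  have "\<bar>feynman_kac d T h g t x\<bar> \<le> (\<integral>p. norm (fk_sample T h g t x p) \<partial>noise d)"
    unfolding feynman_kac_def using integral_norm_bound[of "noise d" "fk_sample T h g t x"] by simp
  also have "\<dots> \<le> (\<integral>p. K * (e (fst p) * poly_weight d m (snd p)) \<partial>noise d)"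
    using * int dom by (intro integral_mono_AE) auto
  also have "\<dots> = K * (integral\<^sup>L unif e * integral\<^sup>L (gauss d) (poly_weight d m))"
    using integral_noise_mult[OF e_int(1) integrable_poly_weight, of d m] by simp
  also have "\<dots> = fk_const d T m * integral\<^sup>L unif e * poly_weight d m x"
    by (simp add: K_def fk_const_def mult_ac)
  also have "\<dots> \<le> fk_const d T m * (b + c * exp (\<nu> * (T - t)) / \<nu>) * poly_weight d m x"
  proof (intro mult_right_mono mult_left_mono)
    show "integral\<^sup>L unif e \<le> b + c * exp (\<nu> * (T - t)) / \<nu>"
      unfolding e_int(2) using c lam by (simp add: \<tau>_def divide_right_mono right_diff_distrib)
  qed (use fk_const_ge_1[of T d m] t poly_weight_pos[of d m x] in auto)
  finally show "\<bar>feynman_kac d T h g t x\<bar>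
      \<le> fk_const d T m * (b + c * exp (\<nu> * (T - t)) / \<nu>) * poly_weight d m x" .
qed

text \<open>The case \<nu> = 1 of the preceding bound, for sources without an exponential
  factor.\<close>

lemma fk_bound:
  assumes t: "0 \<le> t" "t \<le> T" and c: "0 \<le> c" "0 \<le> b"
    and cont: "continuous_on UNIV (\<lambda>(t, x). h t x)" "continuous_on UNIV g"
    and g: "\<And>x. \<bar>g x\<bar> \<le> b * poly_weight d m x"
    and h: "\<And>s x. 0 \<le> s \<Longrightarrow> s \<le> T \<Longrightarrow> \<bar>h s x\<bar> \<le> c * poly_weight d m x"
  shows "\<bar>feynman_kac d T h g t x\<bar> \<le> fk_const d T m * (b + c * exp T) * poly_weight d m x"
proof -
  have "\<bar>h s x\<bar> \<le> c * exp (1 * (T - s)) * poly_weight d m x" if "0 \<le> s" "s \<le> T" for s x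
  proof -
    have "c * 1 * poly_weight d m x \<le> c * exp (1 * (T - s)) * poly_weight d m x"
      using that c poly_weight_pos[of d m x] by (intro mult_right_mono mult_left_mono) auto
    then show ?thesis using h[OF that, of x] by simp
  qed
  from fk_bound_exp[OF t zero_less_one c cont g this, of x]
  have "\<bar>feynman_kac d T h g t x\<bar> \<le> fk_const d T m * (b + c * exp (T - t)) * poly_weight d m x"
    by simp
  also have "\<dots> \<le> fk_const d T m * (b + c * exp T) * poly_weight d m x"
    using fk_const_ge_1[of T d m] t c poly_weight_pos[of d m x]
    by (intro mult_right_mono mult_left_mono add_left_mono) auto
  finally show ?thesis .
qed

lemma integrable_fk_sample:
  assumes h: "growth d T m h" "growth d T m (\<lambda>_. g)" and t: "0 \<le> t" "t \<le> T"
  shows "integrable (noise d) (fk_sample T h g t x)"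
proof -
  obtain C where C: "C \<ge> 0" "\<forall>t\<in>{0..T}. \<forall>x. \<bar>h t x\<bar> \<le> C * poly_weight d m x"
    by (rule growthE[OF h(1)])
  obtain B where B: "B \<ge> 0" "\<forall>t\<in>{0..T}. \<forall>x. \<bar>g x\<bar> \<le> B * poly_weight d m x"
    by (rule growthE[OF h(2)])
  have "\<bar>h s x\<bar> \<le> C * exp (1 * (T - s)) * poly_weight d m x" if "0 \<le> s" "s \<le> T" for s x
  proof -
    have "C * 1 * poly_weight d m x \<le> C * exp (1 * (T - s)) * poly_weight d m x"
      using that C(1) poly_weight_pos[of d m x] by (intro mult_right_mono mult_left_mono) auto
    moreover have "\<bar>h s x\<bar> \<le> C * poly_weight d m x" using C(2) that by auto
    ultimately show ?thesis by simp
  qed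
  moreover have "continuous_on UNIV g"
    using continuous_on_pair_comp[OF growth_cont[OF h(2)], of UNIV "\<lambda>_. 0" "\<lambda>x. x"] by simp
  ultimately show ?thesis
    using integrable_fk_sample_exp[of t T 1 C B h g d m x] t C(1) B growth_cont[OF h(1)] by auto
qed

lemma fk_add:
  assumes "growth d T m h" "growth d T m (\<lambda>_. g)" "growth d T m h'" "growth d T m (\<lambda>_. g')" "0 \<le> t" "t \<le> T"
  shows "feynman_kac d T (\<lambda>t x. h t x + h' t x) (\<lambda>x. g x + g' x) t x
    = feynman_kac d T h g t x + feynman_kac d T h' g' t x"
proof -
  have "fk_sample T (\<lambda>t x. h t x + h' t x) (\<lambda>x. g x + g' x) t x
      = (\<lambda>p. fk_sample T h g t x p + fk_sample T h' g' t x p)"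
    by (simp add: fk_sample_def[abs_def] algebra_simps)
  then show ?thesis
    unfolding feynman_kac_def using assms
    by (simp add: Bochner_Integration.integral_add[OF integrable_fk_sample[of d T m h g t x] integrable_fk_sample[of d T m h' g' t x]])
qed

lemma fk_uminus: "feynman_kac d T (\<lambda>t x. - h t x) (\<lambda>x. - g x) t x = - feynman_kac d T h g t x"
proof -
  have "fk_sample T (\<lambda>t x. - h t x) (\<lambda>x. - g x) t x = (\<lambda>p. - fk_sample T h g t x p)"
    by (simp add: fk_sample_def[abs_def] algebra_simps)
  then show ?thesis unfolding feynman_kac_def by simp
qed

lemma fk_diff:
  assumes "growth d T m h" "growth d T m (\<lambda>_. g)" "growth d T m h'" "growth d T m (\<lambda>_. g')" "0 \<le> t" "t \<le> T"
  shows "feynman_kac d T (\<lambda>t x. h t x - h' t x) (\<lambda>x. g x - g' x) t x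
    = feynman_kac d T h g t x - feynman_kac d T h' g' t x"
  using fk_add[of d T m h g "\<lambda>t x. - h' t x" "\<lambda>x. - g' x" t x] assms
    growth_uminus[of d T m h'] growth_uminus[of d T m "\<lambda>_. g'"]
  by (simp add: fk_uminus)

lemma fk_terminal: "continuous_on UNIV g \<Longrightarrow> feynman_kac d T h g T x = g x"
  using noise.prob_space[of d] by (simp add: feynman_kac_def fk_sample_def[abs_def] heat_shift_def)

text \<open>Cutting off coordinates commutes with the Gaussian shift below \<open>d\<close>. This
  lets identities proved on R^d be transferred to all sequences.\<close>

lemma fk_proj:
  assumes "\<And>t x. h t (proj d x) = h t x" "\<And>x. g (proj d x) = g x"
  shows "feynman_kac d T h g t (proj d x) = feynman_kac d T h g t x"
proof -
  have "proj d (heat_shift (proj d x) s z) = proj d (heat_shift x s z)" for s z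
    by (auto simp: proj_def heat_shift_def)
  then have "h t (heat_shift (proj d x) s z) = h t (heat_shift x s z)"
    "g (heat_shift (proj d x) s z) = g (heat_shift x s z)" for t s z
    by (metis assms(1), metis assms(2))
  then show ?thesis by (simp add: feynman_kac_def fk_sample_def)
qed

section \<open>Trigonometric data\<close>

lemma continuous_on_nth_snd [continuous_intros]:
  "continuous_on S (\<lambda>p::'a::topological_space \<times> (nat \<Rightarrow> real). snd p i)"
  by (intro continuous_on_nth' continuous_intros)

text \<open>Coefficients vary continuously in time so that sources can be approximated too, and the
  phase \<open>b\<close> yields sines along with cosines. The inductive form stands for finite sums
  with varying wave vectors.\<close>

inductive trig :: "nat \<Rightarrow> (real \<Rightarrow> (nat \<Rightarrow> real) \<Rightarrow> real) \<Rightarrow> bool" for d where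
  trig_base: "continuous_on UNIV a \<Longrightarrow> trig d (\<lambda>t x. a t * cos ((\<Sum>i<d. k i * x i) + b))"
| trig_add: "trig d q \<Longrightarrow> trig d r \<Longrightarrow> trig d (\<lambda>t x. q t x + r t x)"

text \<open>The product formula for cosines keeps the class closed under multiplication: wave
  vectors and phases are added and subtracted.\<close>

lemma trig_base_mult:
  assumes "trig d q" and a: "continuous_on UNIV a"
  shows "trig d (\<lambda>t x. a t * cos ((\<Sum>i<d. k i * x i) + b) * q t x)"
  using assms(1)
proof induction
  case (trig_base a' k' b')
  have "cos A * cos B = 1/2 * cos (A + B) + 1/2 * cos (A - B)" for A B :: real
    by (simp add: cos_add cos_diff field_simps)
  then have cc: "a t * cos A * (a' t * cos B) = (a t * a' t / 2) * cos (A + B) + (a t * a' t / 2) * cos (A - B)"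
    for t and A B :: real
  proof -
    have "a t * cos A * (a' t * cos B) = a t * a' t * (cos A * cos B)" by simp
    also have "\<dots> = a t * a' t * (1/2 * cos (A + B) + 1/2 * cos (A - B))"
      by (simp only: \<open>\<And>A B. cos A * cos B = 1/2 * cos (A + B) + 1/2 * cos (A - B)\<close>)
    finally show ?thesis by (simp add: algebra_simps)
  qed
  have "trig d (\<lambda>t x. (a t * a' t / 2) * cos ((\<Sum>i<d. (k i + k' i) * x i) + (b + b'))
      + (a t * a' t / 2) * cos ((\<Sum>i<d. (k i - k' i) * x i) + (b - b')))"
    by (intro trig.intros continuous_intros a trig_base) auto
  moreover have "(\<Sum>i<d. (k i + k' i) * x i) + (b + b') = ((\<Sum>i<d. k i * x i) + b) + ((\<Sum>i<d. k' i * x i) + b')"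
    "(\<Sum>i<d. (k i - k' i) * x i) + (b - b') = ((\<Sum>i<d. k i * x i) + b) - ((\<Sum>i<d. k' i * x i) + b')" for x
    by (simp_all add: algebra_simps sum.distrib sum_subtractf)
  ultimately show ?case by (simp only: cc)
next
  case (trig_add q r)
  then show ?case using trig.trig_add[OF trig_add.IH] by (simp add: distrib_left)
qed

lemma trig_mult:
  assumes "trig d q" "trig d r"
  shows "trig d (\<lambda>t x. q t x * r t x)"
  using assms(1)
proof induction
  case (trig_base a k b)
  then show ?case by (rule trig_base_mult[OF assms(2)])
next
  case (trig_add q r)
  then show ?case using trig.trig_add[OF trig_add.IH] by (simp add: distrib_right)
qed

lemma trig_fun_of_time: "continuous_on UNIV a \<Longrightarrow> trig d (\<lambda>t x. a t)"
  using trig_base[of a d "\<lambda>_. 0" 0] by simp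

lemma trig_sin:
  assumes "i < d" shows "trig d (\<lambda>t x. sin (\<rho> * x i))"
proof -
  have "trig d (\<lambda>t x. 1 * cos ((\<Sum>j<d. (if j = i then \<rho> else 0) * x j) + (- pi / 2)))"
    by (rule trig_base) simp
  moreover have "(\<Sum>j<d. (if j = i then \<rho> else 0) * x j) = \<rho> * x i" for x :: "nat \<Rightarrow> real"
    using assms by (simp add: if_distrib[of "\<lambda>c. c * _"] cong: if_cong)
  ultimately show ?thesis by (simp add: cos_diff)
qed

lemma trig_continuous: "trig d q \<Longrightarrow> continuous_on UNIV (\<lambda>(t, x). q t x)"
proof (induction rule: trig.induct)
  case (trig_base a k b)
  have "continuous_on UNIV (\<lambda>p::real \<times> (nat \<Rightarrow> real). a (fst p))"
    using continuous_on_compose2[OF trig_base, of UNIV fst] by (simp add: continuous_on_fst)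
  then show ?case by (auto simp: case_prod_beta intro!: continuous_intros)
qed (auto simp: case_prod_beta intro!: continuous_intros)

lemma trig_bounded: "trig d q \<Longrightarrow> \<exists>B. \<forall>t\<in>{0..T}. \<forall>x. \<bar>q t x\<bar> \<le> B"
proof (induction rule: trig.induct)
  case (trig_base a k b)
  have "compact (a ` {0..T})"
    by (intro compact_continuous_image continuous_on_subset[OF trig_base]) auto
  then obtain B where B: "\<forall>t\<in>{0..T}. \<bar>a t\<bar> \<le> B"
    unfolding bounded_iff[of "a ` _"] using compact_imp_bounded[of "a ` {0..T}"] by (auto simp: bounded_iff)
  have "\<bar>a t * cos ((\<Sum>i<d. k i * x i) + b)\<bar> \<le> B" if "t \<in> {0..T}" for t x
  proof -
    have "\<bar>a t\<bar> \<le> B" using B that by auto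
    then show ?thesis
      using mult_mono[of "\<bar>a t\<bar>" B "\<bar>cos ((\<Sum>i<d. k i * x i) + b)\<bar>" 1]
      by (simp add: abs_mult order_trans[OF abs_ge_zero])
  qed
  then show ?case by blast
next
  case (trig_add q r)
  then obtain B C where "\<forall>t\<in>{0..T}. \<forall>x. \<bar>q t x\<bar> \<le> B" "\<forall>t\<in>{0..T}. \<forall>x. \<bar>r t x\<bar> \<le> C" by auto
  then show ?case by (intro exI[of _ "B + C"]) (auto intro!: order_trans[OF abs_triangle_ineq] add_mono)
qed

lemma trig_growth: "trig d q \<Longrightarrow> growth d T m q"
  using trig_bounded[of d q T] trig_continuous[of d q] growth_bounded[of q T _ d m] by (auto simp: Ball_def)

lemma trig_proj: "trig d q \<Longrightarrow> q t (proj d x) = q t x"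
  by (induction rule: trig.induct) (auto simp: proj_def)

lemma linear_form_upd:
  fixes x :: "nat \<Rightarrow> real"
  assumes "i < d"
  shows "(\<Sum>j<d. k j * (x(i := s)) j) = (\<Sum>j<d. k j * x j) + k i * (s - x i)"
proof -
  have "(\<Sum>j<d. k j * (x(i := s)) j) = (\<Sum>j<d. k j * x j + (if j = i then k i * (s - x i) else 0))"
    by (intro sum.cong) (auto simp: algebra_simps)
  then show ?thesis using assms by (simp add: sum.distrib)
qed

lemma C12_trig:
  assumes \<alpha>: "\<And>t. 0 < t \<Longrightarrow> t < T \<Longrightarrow> (\<alpha> has_real_derivative \<alpha>' t) (at t)"
    and \<alpha>': "continuous_on {0<..<T} \<alpha>'"
  shows "C12_with_derivs T d
    (\<lambda>t x. \<alpha> t * cos ((\<Sum>i<d. k i * x i) + b))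
    (\<lambda>t x. \<alpha>' t * cos ((\<Sum>i<d. k i * x i) + b))
    (\<lambda>t x i. - (\<alpha> t * k i) * sin ((\<Sum>i<d. k i * x i) + b))
    (\<lambda>t x i j. - (\<alpha> t * k i * k j) * cos ((\<Sum>i<d. k i * x i) + b))"
proof -
  let ?S = "{0<..<T} \<times> Rd d"
  have "continuous_on {0<..<T} \<alpha>"
    by (intro continuous_at_imp_continuous_on ballI DERIV_isCont[OF \<alpha>]) auto
  then have c: "continuous_on ?S (\<lambda>p. \<alpha> (fst p))" "continuous_on ?S (\<lambda>p. \<alpha>' (fst p))"
    using continuous_on_compose2[of "{0<..<T}" \<alpha> ?S fst] continuous_on_compose2[OF \<alpha>', of ?S fst]
    by (auto simp: continuous_on_fst)
  have 1: "((\<lambda>s. \<alpha> t * cos ((\<Sum>j<d. k j * (x(i := s)) j) + b)) has_real_derivative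
      - (\<alpha> t * k i) * sin ((\<Sum>i<d. k i * x i) + b)) (at (x i))" if "i < d" for i t x
    unfolding linear_form_upd[OF that] by (auto intro!: derivative_eq_intros)
  have 2: "((\<lambda>s. - (\<alpha> t * k i) * sin ((\<Sum>j<d. k j * (x(l := s)) j) + b)) has_real_derivative
      - (\<alpha> t * k i * k l) * cos ((\<Sum>i<d. k i * x i) + b)) (at (x l))" if "l < d" for i l t x
    unfolding linear_form_upd[OF that] by (auto intro!: derivative_eq_intros)
  have 3: "((\<lambda>s. \<alpha> s * cos ((\<Sum>i<d. k i * x i) + b)) has_real_derivative
      \<alpha>' t * cos ((\<Sum>i<d. k i * x i) + b)) (at t)" if "0 < t" "t < T" for t x
    using \<alpha>[OF that] by (auto intro!: derivative_eq_intros)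
  show ?thesis
    unfolding C12_with_derivs_def using 1 2 3 c
    by (auto simp: case_prod_beta simp del: fun_upd_apply intro!: continuous_intros)
qed

lemma C12_add:
  assumes "C12_with_derivs T d \<phi> \<phi>t D H" "C12_with_derivs T d \<psi> \<psi>t E J"
  shows "C12_with_derivs T d (\<lambda>t x. \<phi> t x + \<psi> t x) (\<lambda>t x. \<phi>t t x + \<psi>t t x)
    (\<lambda>t x i. D t x i + E t x i) (\<lambda>t x i j. H t x i j + J t x i j)"
  using assms unfolding C12_with_derivs_def case_prod_beta
  by (auto intro!: continuous_intros derivative_intros)

lemma C12_uminus:
  assumes "C12_with_derivs T d \<phi> \<phi>t D H"
  shows "C12_with_derivs T d (\<lambda>t x. - \<phi> t x) (\<lambda>t x. - \<phi>t t x) (\<lambda>t x i. - D t x i) (\<lambda>t x i j. - H t x i j)"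
  using assms unfolding C12_with_derivs_def case_prod_beta
  by (auto intro!: continuous_intros derivative_intros)

section \<open>Classical solutions of the linear equation with trigonometric data\<close>

definition classical :: "nat \<Rightarrow> real \<Rightarrow> (real \<Rightarrow> (nat \<Rightarrow> real) \<Rightarrow> real) \<Rightarrow> ((nat \<Rightarrow> real) \<Rightarrow> real) \<Rightarrow> bool" where
  "classical d T h g \<longleftrightarrow> (\<exists>w wt D H. C12_with_derivs T d w wt D H \<and>
     (\<forall>t\<in>{0<..<T}. \<forall>x. wt t x + 1/2 * (\<Sum>i<d. H t x i i) + h t x = 0) \<and>
     (\<forall>t\<in>{0..T}. \<forall>x. w t x = feynman_kac d T h g t x) \<and>
     continuous_on ({0..T} \<times> UNIV) (\<lambda>(t, x). w t x))"

text \<open>Growth of degree 0 is available in the applications because trigonometric polynomials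
  are bounded on [0,T].\<close>

lemma classical_add:
  assumes "classical d T h g" "classical d T h' g'"
    and gr: "growth d T 0 h" "growth d T 0 (\<lambda>_. g)" "growth d T 0 h'" "growth d T 0 (\<lambda>_. g')"
  shows "classical d T (\<lambda>t x. h t x + h' t x) (\<lambda>x. g x + g' x)"
proof -
  obtain w wt D H where w: "C12_with_derivs T d w wt D H"
     "\<forall>t\<in>{0<..<T}. \<forall>x. wt t x + 1/2 * (\<Sum>i<d. H t x i i) + h t x = 0"
     "\<forall>t\<in>{0..T}. \<forall>x. w t x = feynman_kac d T h g t x"
     "continuous_on ({0..T} \<times> UNIV) (\<lambda>(t, x). w t x)"
    using assms(1) unfolding classical_def by blast
  obtain w' wt' D' H' where w': "C12_with_derivs T d w' wt' D' H'"
     "\<forall>t\<in>{0<..<T}. \<forall>x. wt' t x + 1/2 * (\<Sum>i<d. H' t x i i) + h' t x = 0"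
     "\<forall>t\<in>{0..T}. \<forall>x. w' t x = feynman_kac d T h' g' t x"
     "continuous_on ({0..T} \<times> UNIV) (\<lambda>(t, x). w' t x)"
    using assms(2) unfolding classical_def by blast
  have "(wt t x + wt' t x) + 1/2 * (\<Sum>i<d. H t x i i + H' t x i i) + (h t x + h' t x) = 0"
    if "t \<in> {0<..<T}" for t x
  proof -
    have "wt t x + 1/2 * (\<Sum>i<d. H t x i i) + h t x = 0" "wt' t x + 1/2 * (\<Sum>i<d. H' t x i i) + h' t x = 0"
      using w(2) w'(2) that by auto
    then show ?thesis by (simp add: sum.distrib algebra_simps)
  qed
  moreover have "\<forall>t\<in>{0..T}. \<forall>x. w t x + w' t x = feynman_kac d T (\<lambda>t x. h t x + h' t x) (\<lambda>x. g x + g' x) t x"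
    using w(3) w'(3) gr by (auto simp: fk_add)
  moreover have "continuous_on ({0..T} \<times> UNIV) (\<lambda>(t, x). w t x + w' t x)"
    using w(4) w'(4) by (auto simp: case_prod_beta intro!: continuous_intros)
  ultimately show ?thesis
    unfolding classical_def
    by (intro exI[of _ "\<lambda>t x. w t x + w' t x"] exI[of _ "\<lambda>t x. wt t x + wt' t x"]
      exI[of _ "\<lambda>t x i. D t x i + D' t x i"] exI[of _ "\<lambda>t x i j. H t x i j + H' t x i j"])
      (simp add: C12_add[OF w(1) w'(1)])
qed

lemma integral_noise_iterated:
  fixes F :: "real \<times> (nat \<Rightarrow> real) \<Rightarrow> real"
  assumes "integrable (noise d) F"
  shows "(\<integral>p. F p \<partial>noise d) = (\<integral>u. (\<integral>z. F (u, z) \<partial>gauss d) \<partial>unif)"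
  using unif_gauss.integral_fst'[of d F] assms by (simp add: noise_def)

lemma sum_trig_hessian:
  "(\<Sum>i<d. - (\<alpha> * k i * k i) * c) = - (\<alpha> * (\<Sum>i<d. (k i)\<^sup>2) * c)" for \<alpha> c :: real
  by (simp add: sum_distrib_left sum_distrib_right sum_negf power2_eq_square mult_ac)

text \<open>Separation of variables: for a single wave the equation becomes \<alpha>' = \<nu>
  \<alpha> - a with \<alpha>(T) = 0, solved by variation of constants, and the Feynman--Kac formula
  evaluates to the same integral.\<close>

lemma classical_trig_source:
  assumes T: "0 < T" and a: "continuous_on UNIV a"
  shows "classical d T (\<lambda>t x. a t * cos ((\<Sum>i<d. k i * x i) + b)) (\<lambda>_. 0)"
proof -
  define \<nu> where "\<nu> = (\<Sum>i<d. (k i)\<^sup>2) / 2"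
  let ?h = "\<lambda>t x. a t * cos ((\<Sum>i<d. k i * x i) + b)"
  \<comment> \<open>The interval exceeds [0,T] so that the antiderivative is two-sided
    differentiable at 0 and at \<open>T\<close>.\<close>
  have "continuous_on {-1..T + 1} (\<lambda>s. exp (- \<nu> * s) * a s)"
    by (intro continuous_intros continuous_on_subset[OF a]) auto
  then obtain A where A: "\<And>s. s \<in> {-1..T + 1} \<Longrightarrow> (A has_vector_derivative exp (- \<nu> * s) * a s) (at s within {-1..T + 1})"
    by (rule antiderivative_continuous) blast
  have dA: "(A has_real_derivative exp (- \<nu> * s) * a s) (at s)" if "0 \<le> s" "s \<le> T" for s
  proof -
    have "at s within {-1..T + 1} = at s"
      by (rule at_within_interior) (use that in auto)
    then show ?thesis
      using A[of s] that by (simp add: has_real_derivative_iff_has_vector_derivative)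
  qed
  define \<alpha> where "\<alpha> t = exp (\<nu> * t) * (A T - A t)" for t
  define \<alpha>' where "\<alpha>' t = \<nu> * \<alpha> t - a t" for t
  have d\<alpha>: "(\<alpha> has_real_derivative \<alpha>' t) (at t)" if "0 \<le> t" "t \<le> T" for t
  proof -
    have "(\<alpha> has_real_derivative (exp (\<nu> * t) * \<nu>) * (A T - A t) + exp (\<nu> * t) * (0 - exp (- \<nu> * t) * a t)) (at t)"
      unfolding \<alpha>_def by (auto intro!: derivative_eq_intros dA that)
    moreover have "exp (\<nu> * t) * (exp (- \<nu> * t) * a t) = a t"
      by (simp add: exp_minus field_simps)
    then have "(exp (\<nu> * t) * \<nu>) * (A T - A t) + exp (\<nu> * t) * (0 - exp (- \<nu> * t) * a t) = \<alpha>' t"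
      unfolding \<alpha>'_def \<alpha>_def diff_0 mult_minus_right by simp
    ultimately show ?thesis by simp
  qed
  have cont\<alpha>: "continuous_on {0..T} \<alpha>"
    by (intro continuous_at_imp_continuous_on ballI DERIV_isCont[OF d\<alpha>]) auto
  have C: "C12_with_derivs T d
    (\<lambda>t x. \<alpha> t * cos ((\<Sum>i<d. k i * x i) + b))
    (\<lambda>t x. \<alpha>' t * cos ((\<Sum>i<d. k i * x i) + b))
    (\<lambda>t x i. - (\<alpha> t * k i) * sin ((\<Sum>i<d. k i * x i) + b))
    (\<lambda>t x i j. - (\<alpha> t * k i * k j) * cos ((\<Sum>i<d. k i * x i) + b))"
  proof (rule C12_trig)
    show "continuous_on {0<..<T} \<alpha>'"
      unfolding \<alpha>'_def by (intro continuous_intros continuous_on_subset[OF a] continuous_on_subset[OF cont\<alpha>]) auto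
  qed (use d\<alpha> in auto)
  have fk: "feynman_kac d T ?h (\<lambda>_. 0) t x = \<alpha> t * cos ((\<Sum>i<d. k i * x i) + b)" if t: "0 \<le> t" "t \<le> T" for t x
  proof -
    let ?c = "cos ((\<Sum>i<d. k i * x i) + b)"
    define \<tau> where "\<tau> = T - t"
    have "trig d ?h" using a by (rule trig_base)
    then have int: "integrable (noise d) (fk_sample T ?h (\<lambda>_. 0) t x)"
      by (intro integrable_fk_sample[of d T 0] trig_growth growth_zero t)
    have "feynman_kac d T ?h (\<lambda>_. 0) t x = (\<integral>u. (\<integral>z. \<tau> * (a (t + u * \<tau>) *
        cos ((\<Sum>i<d. k i * heat_shift x (u * \<tau>) z i) + b)) \<partial>gauss d) \<partial>unif)"
      unfolding feynman_kac_def integral_noise_iterated[OF int]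
      by (simp add: fk_sample_def \<tau>_def)
    also have "\<dots> = (\<integral>u. \<tau> * (a (t + u * \<tau>) * exp (- (u * \<tau> * \<nu>))) * ?c \<partial>unif)"
    proof (rule integral_cong_AE)
      have [measurable]: "a \<in> borel_measurable borel"
        by (rule borel_measurable_continuous_onI[OF a])
      show "(\<lambda>u. \<tau> * (a (t + u * \<tau>) * exp (- (u * \<tau> * \<nu>))) * ?c) \<in> borel_measurable unif"
        by measurable
      have "(\<lambda>p. fk_sample T ?h (\<lambda>_. 0) t x p) \<in> borel_measurable (unif \<Otimes>\<^sub>M gauss d)"
        using int unfolding noise_def by auto
      then have "(\<lambda>u. \<integral>z. fk_sample T ?h (\<lambda>_. 0) t x (u, z) \<partial>gauss d) \<in> borel_measurable unif"
        by measurable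
      then show "(\<lambda>u. \<integral>z. \<tau> * (a (t + u * \<tau>) * cos ((\<Sum>i<d. k i * heat_shift x (u * \<tau>) z i) + b)) \<partial>gauss d)
          \<in> borel_measurable unif"
        by (simp add: fk_sample_def \<tau>_def)
      have "AE u in unif. u \<in> {0..1}" by (rule AE_uniform_measureI) auto
      then show "AE u in unif. (\<integral>z. \<tau> * (a (t + u * \<tau>) * cos ((\<Sum>i<d. k i * heat_shift x (u * \<tau>) z i) + b)) \<partial>gauss d) =
          \<tau> * (a (t + u * \<tau>) * exp (- (u * \<tau> * \<nu>))) * ?c"
      proof eventually_elim
        case (elim u)
        then have "0 \<le> u * \<tau>" using t by (simp add: \<tau>_def)
        from integral_gauss_cos[OF this, of d k x b] show ?case
          by (simp add: \<nu>_def)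
      qed
    qed
    also have "\<dots> = (\<integral>u. \<tau> * (a (t + u * \<tau>) * exp (- (u * \<tau> * \<nu>))) \<partial>unif) * ?c"
      by simp
    also have "(\<integral>u. \<tau> * (a (t + u * \<tau>) * exp (- (u * \<tau> * \<nu>))) \<partial>unif) = \<alpha> t"
    proof -
      \<comment> \<open>The integrand in \<open>u\<close> is the derivative of the antiderivative
        \<open>A\<close> read along \<open>t + u * \<tau>\<close>, up to a constant factor, so the
        time average reduces to end values.\<close>
      define F where "F u = exp (\<nu> * t) * A (t + u * \<tau>)" for u
      have "(F has_real_derivative \<tau> * (a (t + u * \<tau>) * exp (- (u * \<tau> * \<nu>)))) (at u)"
        if u: "0 \<le> u" "u \<le> 1" for u
      proof -
        have "0 \<le> u * \<tau>" "u * \<tau> \<le> \<tau>" using u t mult_right_mono[of u 1 \<tau>] by (auto simp: \<tau>_def)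
        then have s: "0 \<le> t + u * \<tau>" "t + u * \<tau> \<le> T" using t by (auto simp: \<tau>_def)
        have "((\<lambda>u. A (t + u * \<tau>)) has_real_derivative (exp (- \<nu> * (t + u * \<tau>)) * a (t + u * \<tau>)) * \<tau>) (at u)"
          by (rule DERIV_chain2[where f = A and g = "\<lambda>u. t + u * \<tau>", OF dA[OF s]]) (auto intro!: derivative_eq_intros)
        then have "(F has_real_derivative exp (\<nu> * t) * ((exp (- \<nu> * (t + u * \<tau>)) * a (t + u * \<tau>)) * \<tau>)) (at u)"
          unfolding F_def by (rule DERIV_cmult)
        moreover have "exp (\<nu> * t) * exp (- \<nu> * (t + u * \<tau>)) = exp (- (u * \<tau> * \<nu>))"
          by (simp add: exp_add[symmetric] algebra_simps)
        moreover have "exp (\<nu> * t) * ((exp (- \<nu> * (t + u * \<tau>)) * a (t + u * \<tau>)) * \<tau>)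
            = \<tau> * (a (t + u * \<tau>) * (exp (\<nu> * t) * exp (- \<nu> * (t + u * \<tau>))))"
          by (simp only: mult_ac)
        ultimately show ?thesis by (simp only:)
      qed
      moreover have "continuous_on UNIV (\<lambda>u. \<tau> * (a (t + u * \<tau>) * exp (- (u * \<tau> * \<nu>))))"
        by (intro continuous_intros continuous_on_compose2[OF a]) auto
      ultimately have "(\<integral>u. \<tau> * (a (t + u * \<tau>) * exp (- (u * \<tau> * \<nu>))) \<partial>unif) = F 1 - F 0"
        by (intro unif_FTC)
      then show ?thesis by (simp add: F_def \<alpha>_def \<tau>_def algebra_simps)
    qed
    finally show ?thesis .
  qed
  have "\<alpha>' t * c + 1/2 * (\<Sum>i<d. - (\<alpha> t * k i * k i) * c) + a t * c = 0" for t c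
    unfolding sum_trig_hessian by (simp add: \<alpha>'_def \<nu>_def algebra_simps)
  moreover have "continuous_on ({0..T} \<times> UNIV) (\<lambda>(t, x). \<alpha> t * cos ((\<Sum>i<d. k i * x i) + b))"
    unfolding case_prod_beta
    by (intro continuous_intros continuous_on_compose2[OF cont\<alpha>]) auto
  ultimately show ?thesis
    unfolding classical_def using C fk
    by (intro exI[of _ "\<lambda>t x. \<alpha> t * cos ((\<Sum>i<d. k i * x i) + b)"] exI conjI ballI allI) auto
qed

text \<open>A single wave decays at a rate of half the squared length of its wave vector, backward
  from the terminal time.\<close>

lemma classical_trig_terminal:
  assumes T: "0 < T"
  shows "classical d T (\<lambda>_ _. 0) (\<lambda>x. a * cos ((\<Sum>i<d. k i * x i) + b))"
proof -
  define \<nu> where "\<nu> = (\<Sum>i<d. (k i)\<^sup>2) / 2"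
  define \<alpha> where "\<alpha> t = a * exp (- (\<nu> * (T - t)))" for t
  have C: "C12_with_derivs T d
    (\<lambda>t x. \<alpha> t * cos ((\<Sum>i<d. k i * x i) + b))
    (\<lambda>t x. (\<nu> * \<alpha> t) * cos ((\<Sum>i<d. k i * x i) + b))
    (\<lambda>t x i. - (\<alpha> t * k i) * sin ((\<Sum>i<d. k i * x i) + b))
    (\<lambda>t x i j. - (\<alpha> t * k i * k j) * cos ((\<Sum>i<d. k i * x i) + b))"
    by (rule C12_trig) (auto simp: \<alpha>_def intro!: derivative_eq_intros continuous_intros)
  have fk: "feynman_kac d T (\<lambda>_ _. 0) (\<lambda>x. a * cos ((\<Sum>i<d. k i * x i) + b)) t x
     = \<alpha> t * cos ((\<Sum>i<d. k i * x i) + b)" if t: "0 \<le> t" "t \<le> T" for t x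
  proof -
    have "trig d (\<lambda>t x. a * cos ((\<Sum>i<d. k i * x i) + b))" by (rule trig_base) simp
    then have int: "integrable (noise d) (fk_sample T (\<lambda>_ _. 0) (\<lambda>x. a * cos ((\<Sum>i<d. k i * x i) + b)) t x)"
      by (intro integrable_fk_sample[of d T 0] trig_growth growth_zero t)
    show ?thesis
      unfolding feynman_kac_def integral_noise_iterated[OF int]
      using t integral_gauss_cos[of "T - t" d k x b] unif.prob_space
      by (simp add: fk_sample_def \<alpha>_def \<nu>_def mult_ac)
  qed
  have "(\<nu> * \<alpha> t) * c + 1/2 * (\<Sum>i<d. - (\<alpha> t * k i * k i) * c) + 0 = 0" for t c
    unfolding sum_trig_hessian by (simp add: \<nu>_def algebra_simps)
  moreover have "continuous_on ({0..T} \<times> UNIV) (\<lambda>(t, x). \<alpha> t * cos ((\<Sum>i<d. k i * x i) + b))"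
    unfolding case_prod_beta \<alpha>_def by (intro continuous_intros)
  ultimately show ?thesis
    unfolding classical_def using C fk
    by (intro exI[of _ "\<lambda>t x. \<alpha> t * cos ((\<Sum>i<d. k i * x i) + b)"] exI conjI ballI allI) auto
qed

lemma growth_time_slice:
  assumes "trig d q" shows "growth d T m (\<lambda>_. q s)"
proof -
  have "trig d (\<lambda>_. q s)"
    using assms
  proof induction
    case (trig_base a k b)
    show ?case by (rule trig.trig_base) simp
  qed (rule trig.trig_add)
  then show ?thesis by (rule trig_growth)
qed

text \<open>Members of \<open>trig\<close> carry a time argument; the slice at time 0 serves as the
  terminal value. By linearity, source and terminal value are treated separately.\<close>

lemma classical_trig:
  assumes T: "0 < T" and q: "trig d q" and r: "trig d r"
  shows "classical d T q (r 0)"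
proof -
  have "classical d T q (\<lambda>_. 0)"
    using q
  proof induction
    case (trig_base a k b)
    then show ?case by (rule classical_trig_source[OF T])
  next
    case (trig_add q r)
    then show ?case
      using classical_add[OF trig_add.IH] by (simp add: trig_growth growth_zero)
  qed
  moreover have "classical d T (\<lambda>_ _. 0) (r 0)"
    using r
  proof induction
    case (trig_base a k b)
    show ?case by (rule classical_trig_terminal[OF T])
  next
    case (trig_add q r)
    then show ?case
      using classical_add[OF trig_add.IH] by (simp add: growth_time_slice growth_zero)
  qed
  ultimately show ?thesis
    using classical_add[of d T q "\<lambda>_. 0" "\<lambda>_ _. 0" "r 0"] q r
    by (simp add: growth_time_slice growth_zero trig_growth)
qed

section \<open>Weighted density of trigonometric polynomials\<close>

text \<open>Tychonoff's theorem. With {0} as the factor from \<open>d\<close> on, this yields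
  compact boxes in R^d.\<close>

lemma compact_box: "compact {x::nat \<Rightarrow> real. \<forall>i. x i \<in> K i}" if "\<And>i. compact (K i)"
proof -
  have "compactin (product_topology (\<lambda>i. euclidean) UNIV) (PiE UNIV K)"
    unfolding compactin_PiE using that by simp
  moreover have "PiE UNIV K = {x. \<forall>i. x i \<in> K i}" by auto
  ultimately show ?thesis by (simp add: euclidean_product_topology)
qed

lemma poly_weight_box: "(\<And>i. i < d \<Longrightarrow> \<bar>x i\<bar> \<le> R) \<Longrightarrow> poly_weight d m x \<le> 1 + real d * R ^ (2 * m)"
proof -
  assume x: "\<And>i. i < d \<Longrightarrow> \<bar>x i\<bar> \<le> R"
  have "(\<Sum>i<d. x i ^ (2 * m)) \<le> (\<Sum>i<d. R ^ (2 * m))"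
  proof (rule sum_mono)
    fix i assume "i \<in> {..<d}"
    then have "\<bar>x i\<bar> ^ (2 * m) \<le> R ^ (2 * m)" using x[of i] by (intro power_mono) auto
    then show "x i ^ (2 * m) \<le> R ^ (2 * m)" by (simp add: power_even_abs)
  qed
  then show ?thesis by (simp add: poly_weight_def)
qed

text \<open>Leaving the box in one coordinate makes the weight of degree \<open>Suc m\<close> exceed
  the one of degree \<open>m\<close> by the order R^2. The bound of the weight over the box is
  dominated as well, which is what functions repeating their box values outside require.\<close>

lemma poly_weight_tail:
  assumes "0 \<le> C" "0 < \<delta>"
  obtains R where "1 \<le> R" "\<And>x i. i < d \<Longrightarrow> R < \<bar>x i\<bar> \<Longrightarrow>
    C * (poly_weight d m x + (1 + real d * R ^ (2 * m))) \<le> \<delta> * poly_weight d (Suc m) x"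
proof -
  \<comment> \<open>With D the weight of degree \<open>Suc m\<close>, the bracket times R^2 will be
    at most (3 + 2 d) D; this R makes C (3 + 2 d) \<le> \<delta> R^2.\<close>
  define R where "R = max 1 (C * (3 + 2 * real d) / \<delta>)"
  have R: "1 \<le> R" "C * (3 + 2 * real d) / \<delta> \<le> R" by (auto simp: R_def)
  have R2: "C * (3 + 2 * real d) \<le> \<delta> * R\<^sup>2"
  proof -
    have "C * (3 + 2 * real d) \<le> \<delta> * R" using R assms by (simp add: field_simps)
    also have "\<dots> \<le> \<delta> * R\<^sup>2" using R(1) assms self_le_power[of R 2] by simp
    finally show ?thesis .
  qed
  have "C * (poly_weight d m x + (1 + real d * R ^ (2 * m))) \<le> \<delta> * poly_weight d (Suc m) x"
    if i: "i < d" "R < \<bar>x i\<bar>" for x i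
  proof -
    let ?D = "poly_weight d (Suc m) x"
    have D0: "0 \<le> ?D" using poly_weight_pos[of d "Suc m" x] by simp
    have "R ^ (2 * m) * R\<^sup>2 = R ^ (2 * Suc m)" by (simp add: power2_eq_square)
    also have "\<dots> \<le> \<bar>x i\<bar> ^ (2 * Suc m)" using R i by (intro power_mono) auto
    also have "\<dots> = x i ^ (2 * Suc m)" by (rule power_even_abs) simp
    also have "\<dots> \<le> (\<Sum>i<d. x i ^ (2 * Suc m))"
      using i by (intro member_le_sum) (auto intro!: zero_le_even_power simp del: power_Suc mult_Suc_right)
    also have "\<dots> \<le> ?D" by (simp add: poly_weight_def)
    finally have RD: "R ^ (2 * m) * R\<^sup>2 \<le> ?D" .
    have R1: "1 \<le> R ^ (2 * m)" using R by simp
    have "x j ^ (2 * m) * R\<^sup>2 \<le> R ^ (2 * m) * R\<^sup>2 + x j ^ (2 * Suc m)" for j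
    proof (cases "\<bar>x j\<bar> \<le> R")
      case True
      then have "\<bar>x j\<bar> ^ (2 * m) \<le> R ^ (2 * m)" by (intro power_mono) auto
      then have "x j ^ (2 * m) * R\<^sup>2 \<le> R ^ (2 * m) * R\<^sup>2"
        by (simp add: power_even_abs mult_right_mono)
      moreover have "0 \<le> x j ^ (2 * Suc m)" by (rule zero_le_even_power) simp
      ultimately show ?thesis by linarith
    next
      case False
      then have "R\<^sup>2 \<le> \<bar>x j\<bar>\<^sup>2" using R by (intro power_mono) auto
      then have "x j ^ (2 * m) * R\<^sup>2 \<le> x j ^ (2 * m) * (x j)\<^sup>2"
        by (intro mult_left_mono) (auto intro: zero_le_even_power)
      also have "\<dots> = x j ^ (2 * Suc m)" by (simp add: power2_eq_square)
      finally show ?thesis using R by (simp add: add_increasing)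
    qed
    then have "(\<Sum>j<d. x j ^ (2 * m) * R\<^sup>2) \<le> (\<Sum>j<d. R ^ (2 * m) * R\<^sup>2 + x j ^ (2 * Suc m))"
      by (intro sum_mono) auto
    also have "\<dots> \<le> real d * ?D + ?D"
      using mult_left_mono[OF RD, of "real d"] by (simp add: sum.distrib poly_weight_def)
    finally have "poly_weight d m x * R\<^sup>2 \<le> R\<^sup>2 + (real d * ?D + ?D)"
      by (simp add: poly_weight_def sum_distrib_right distrib_right)
    moreover have "R\<^sup>2 \<le> ?D" using RD R1 mult_right_mono[OF R1, of "R\<^sup>2"] by simp
    moreover have "(1 + real d * R ^ (2 * m)) * R\<^sup>2 \<le> ?D + real d * ?D"
      using mult_left_mono[OF RD, of "real d"] \<open>R\<^sup>2 \<le> ?D\<close> by (simp add: algebra_simps)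
    ultimately have "(poly_weight d m x + (1 + real d * R ^ (2 * m))) * R\<^sup>2 \<le> (3 + 2 * real d) * ?D"
      by (simp add: algebra_simps)
    then have "C * ((poly_weight d m x + (1 + real d * R ^ (2 * m))) * R\<^sup>2) \<le> C * ((3 + 2 * real d) * ?D)"
      using assms by (intro mult_left_mono) auto
    also have "\<dots> \<le> \<delta> * R\<^sup>2 * ?D"
      using mult_right_mono[OF R2 D0] by (simp add: mult_ac)
    finally have "(C * (poly_weight d m x + (1 + real d * R ^ (2 * m)))) * R\<^sup>2 \<le> (\<delta> * ?D) * R\<^sup>2"
      by (simp add: mult_ac)
    then show ?thesis
      by (rule mult_right_le_imp_le) (use R in auto)
  qed
  then show thesis by (rule that[OF R(1)])
qed

text \<open>A subalgebra with one common frequency: its members see \<open>x\<close> only through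
  the numbers \<open>sin (\<rho> * x i)\<close>, a property that general members of
  \<open>trig\<close> lack.\<close>

inductive sin_poly :: "nat \<Rightarrow> real \<Rightarrow> (real \<Rightarrow> (nat \<Rightarrow> real) \<Rightarrow> real) \<Rightarrow> bool" for d \<rho> where
  const: "sin_poly d \<rho> (\<lambda>t x. c)"
| time: "sin_poly d \<rho> (\<lambda>t x. t)"
| sin: "i < d \<Longrightarrow> sin_poly d \<rho> (\<lambda>t x. sin (\<rho> * x i))"
| add: "sin_poly d \<rho> q \<Longrightarrow> sin_poly d \<rho> r \<Longrightarrow> sin_poly d \<rho> (\<lambda>t x. q t x + r t x)"
| mult: "sin_poly d \<rho> q \<Longrightarrow> sin_poly d \<rho> r \<Longrightarrow> sin_poly d \<rho> (\<lambda>t x. q t x * r t x)"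

lemma sin_poly_trig: "sin_poly d \<rho> q \<Longrightarrow> trig d q"
  by (induction rule: sin_poly.induct)
    (auto intro: trig_fun_of_time trig_sin trig_add trig_mult continuous_on_id continuous_on_const)

lemma sin_poly_cong:
  "sin_poly d \<rho> q \<Longrightarrow> (\<And>i. i < d \<Longrightarrow> sin (\<rho> * x i) = sin (\<rho> * y i)) \<Longrightarrow> q t x = q t y"
  by (induction rule: sin_poly.induct) auto

text \<open>Polynomials in \<open>sin (\<rho> x\<^sub>i)\<close> with \<open>\<rho> = \<pi>/(2R)\<close> separate the points of the box of radius
  \<open>R\<close> and already attain all their values there, so a uniform approximation on the box is
  globally bounded.\<close>

lemma trig_dense:
  assumes h: "growth d T m h" and proj: "\<And>t x. h t (proj d x) = h t x" and \<delta>: "0 < \<delta>"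
  obtains q where "trig d q" "\<forall>t\<in>{0..T}. \<forall>x. \<bar>h t x - q t x\<bar> \<le> \<delta> * poly_weight d (Suc m) x"
proof -
  obtain C where C0: "0 \<le> C" and C: "\<forall>t\<in>{0..T}. \<forall>x. \<bar>h t x\<bar> \<le> C * poly_weight d m x"
    by (rule growthE[OF h])
  \<comment> \<open>The approximant may exceed \<open>h\<close> by 1 on the box, hence
    \<open>C + 1\<close> instead of \<open>C\<close>.\<close>
  have "0 \<le> C + 1" using C0 by simp
  then obtain R where R: "1 \<le> R" and tail: "\<And>x i. i < d \<Longrightarrow> R < \<bar>x i\<bar> \<Longrightarrow>
    (C + 1) * (poly_weight d m x + (1 + real d * R ^ (2 * m))) \<le> \<delta> * poly_weight d (Suc m) x"
    using poly_weight_tail[of "C + 1" \<delta> d m] \<delta> by metis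
  define \<rho> where "\<rho> = pi / (2 * R)"
  have \<rho>: "0 < \<rho>" "\<rho> * R = pi / 2" using R by (auto simp: \<rho>_def)
  define Box where "Box = {x::nat \<Rightarrow> real. \<forall>i. x i \<in> (if i < d then {-R..R} else {0})}"
  define S where "S = {0..T} \<times> Box"
  define A where "A = {F. sin_poly d \<rho> (\<lambda>t x. F (t, x))}"
  have angle: "- (pi / 2) \<le> \<rho> * v \<and> \<rho> * v \<le> pi / 2" if "v \<in> {-R..R}" for v
    using mult_left_mono[of v R \<rho>] mult_left_mono[of "-R" v \<rho>] that \<rho> by auto
  interpret function_ring_on A S
  proof
    show "compact S" unfolding S_def Box_def
      by (intro compact_Times compact_box) auto
    show "continuous_on S F" if "F \<in> A" for F
      using trig_continuous[OF sin_poly_trig, of d \<rho> "\<lambda>t x. F (t, x)"] that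
      by (auto simp: A_def intro: continuous_on_subset)
    show "\<exists>F\<in>A. F p \<noteq> F p'" if "p \<in> S" "p' \<in> S" "p \<noteq> p'" for p p'
    proof (cases "fst p = fst p'")
      case False
      have "fst \<in> A" using sin_poly.time[of d \<rho>] by (simp add: A_def)
      then show ?thesis using False by (intro bexI[of _ fst])
    next
      case True
      then have "snd p \<noteq> snd p'" using that by (auto simp: prod_eq_iff)
      then obtain i where i: "snd p i \<noteq> snd p' i" by auto
      have box: "snd p \<in> Box" "snd p' \<in> Box" using that by (auto simp: S_def)
      have "x i = 0" if "x \<in> Box" "\<not> i < d" for x
        using that unfolding Box_def by (metis (mono_tags, lifting) mem_Collect_eq singletonD)
      then have id: "i < d" using i box by metis
      have vals: "snd p i \<in> {-R..R}" "snd p' i \<in> {-R..R}"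
        using box id unfolding Box_def by (metis (mono_tags, lifting) mem_Collect_eq)+
      have "sin (\<rho> * snd p i) \<noteq> sin (\<rho> * snd p' i)"
        using sin_inj_pi[of "\<rho> * snd p i" "\<rho> * snd p' i"] angle[OF vals(1)] angle[OF vals(2)] i \<rho> by auto
      moreover have "(\<lambda>p. sin (\<rho> * snd p i)) \<in> A"
        using sin_poly.sin[OF id] by (simp add: A_def)
      ultimately show ?thesis by (intro bexI[of _ "\<lambda>p. sin (\<rho> * snd p i)"])
    qed
    show "(\<lambda>p. F p + G p) \<in> A" "(\<lambda>p. F p * G p) \<in> A" if "F \<in> A" "G \<in> A" for F G
      using that sin_poly.add[of d \<rho> "\<lambda>t x. F (t, x)" "\<lambda>t x. G (t, x)"]
        sin_poly.mult[of d \<rho> "\<lambda>t x. F (t, x)" "\<lambda>t x. G (t, x)"] by (simp_all add: A_def)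
    show "(\<lambda>_. c) \<in> A" for c
      using sin_poly.const[of d \<rho> c] by (simp add: A_def)
  qed
  have "continuous_on S (\<lambda>(t, x). h t x)"
    by (rule continuous_on_subset[OF growth_cont[OF h]]) simp
  \<comment> \<open>Accuracy \<delta> serves the box, accuracy 1 the global bound of the
    approximant.\<close>
  then obtain F where F: "F \<in> A" "\<forall>p\<in>S. \<bar>(\<lambda>(t, x). h t x) p - F p\<bar> < min \<delta> 1"
    using Stone_Weierstrass_basic[of "\<lambda>(t, x). h t x" "min \<delta> 1"] \<delta> by auto
  define q where "q t x = F (t, x)" for t x
  have q: "sin_poly d \<rho> q" using F(1) by (simp add: A_def q_def[abs_def])
  have near: "\<bar>h t x - q t x\<bar> < min \<delta> 1" if "t \<in> {0..T}" "x \<in> Box" for t x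
    using F(2) that by (auto simp: S_def q_def)
  have main: "\<bar>h t x - q t x\<bar> \<le> \<delta> * poly_weight d (Suc m) x"
    if t: "0 \<le> t" "t \<le> T" and x: "x \<in> Rd d" for t x
  proof (cases "x \<in> Box")
    case True
    then show ?thesis
      using near[of t x] t mult_left_mono[OF poly_weight_ge_1[of d "Suc m" x] less_imp_le[OF \<delta>]] by auto
  next
    case False
    then obtain i where "x i \<notin> (if i < d then {-R..R} else {0})" by (auto simp: Box_def)
    then have i: "i < d" "R < \<bar>x i\<bar>"
      using x by (auto simp: mem_Rd_iff abs_if split: if_splits)
    \<comment> \<open>The point of the box with the same sines as \<open>x\<close>, so that
      \<open>q\<close> takes the same value at both.\<close>
    define y where "y i = (if i < d then arcsin (sin (\<rho> * x i)) / \<rho> else 0)" for i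
    have yR: "\<bar>y i\<bar> \<le> R" for i
    proof (cases "i < d")
      case True
      have "- (pi / 2) \<le> arcsin (sin (\<rho> * x i))" "arcsin (sin (\<rho> * x i)) \<le> pi / 2"
        using arcsin_bounded[OF sin_ge_minus_one sin_le_one, of "\<rho> * x i"] by auto
      then have "\<bar>arcsin (sin (\<rho> * x i))\<bar> \<le> R * \<rho>" using \<rho> by (simp add: mult.commute abs_if)
      then show ?thesis using \<rho> True by (simp add: y_def pos_divide_le_eq)
    qed (use R in \<open>simp add: y_def\<close>)
    have yB: "y \<in> Box"
    proof -
      have "y i \<in> (if i < d then {-R..R} else {0})" for i
        using yR[of i] by (cases "i < d") (auto simp: abs_le_iff, simp add: y_def)
      then show ?thesis unfolding Box_def by blast
    qed
    have "q t x = q t y"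
      using q by (rule sin_poly_cong) (use \<rho> in \<open>simp add: y_def\<close>)
    then have "\<bar>q t x\<bar> \<le> \<bar>h t y\<bar> + 1"
      using near[of t y] yB t by auto
    also have "\<dots> \<le> C * (1 + real d * R ^ (2 * m)) + 1"
    proof -
      have "\<bar>h t y\<bar> \<le> C * poly_weight d m y" using C t by auto
      also have "\<dots> \<le> C * (1 + real d * R ^ (2 * m))"
        using yR C0 by (intro mult_left_mono poly_weight_box) auto
      finally show ?thesis by simp
    qed
    finally have "\<bar>q t x\<bar> \<le> C * (1 + real d * R ^ (2 * m)) + 1" .
    moreover have "\<bar>h t x\<bar> \<le> C * poly_weight d m x" using C t by auto
    moreover have "C * poly_weight d m x + (C * (1 + real d * R ^ (2 * m)) + 1)
      \<le> (C + 1) * (poly_weight d m x + (1 + real d * R ^ (2 * m)))"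
      using poly_weight_pos[of d m x] R by (simp add: algebra_simps)
    ultimately show ?thesis using tail[of i x] i by linarith
  qed
  have tq: "trig d q" by (rule sin_poly_trig[OF q])
  show thesis
  proof (rule that[OF tq], intro ballI allI)
    fix t x assume "t \<in> {0..T}"
    then show "\<bar>h t x - q t x\<bar> \<le> \<delta> * poly_weight d (Suc m) x"
      using main[of t "proj d x"] by (simp add: proj trig_proj[OF tq] poly_weight_proj)
  qed
qed

section \<open>Approximation of Feynman--Kac formulas by classical solutions\<close>

definition classical_witness where
  "classical_witness d T q w wt D H \<longleftrightarrow> C12_with_derivs T d w wt D H \<and>
     (\<forall>t\<in>{0<..<T}. \<forall>x. wt t x + 1/2 * (\<Sum>i<d. H t x i i) + q t x = 0) \<and>
     continuous_on ({0..T} \<times> UNIV) (\<lambda>(t, x). w t x)"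

text \<open>The approximation error is measured in degree \<open>Suc m\<close>, while
  \<open>w\<close> itself is bounded in degree \<open>m\<close>, with a constant \<open>B\<close>
  that may depend on \<delta>. This gap lets the \<delta>-terms dominate at infinity in the
  comparison argument.\<close>

lemma approx_classical:
  assumes T: "0 < T" and h: "growth d T m h" "growth d T m (\<lambda>_. g)"
    and proj: "\<And>t x. h t (proj d x) = h t x" "\<And>x. g (proj d x) = g x" and \<delta>: "0 < \<delta>"
  obtains q w wt D H B where "classical_witness d T q w wt D H"
    "\<forall>t\<in>{0..T}. \<forall>x. \<bar>h t x - q t x\<bar> \<le> \<delta> * poly_weight d (Suc m) x"
    "\<forall>t\<in>{0..T}. \<forall>x. \<bar>w t x - feynman_kac d T h g t x\<bar> \<le> \<delta> * poly_weight d (Suc m) x"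
    "0 \<le> B" "\<forall>t\<in>{0..T}. \<forall>x. \<bar>w t x\<bar> \<le> B * poly_weight d m x"
proof -
  \<comment> \<open>Dividing by the constant of \<open>fk_bound\<close> makes the error of the
    solution, and not just that of the data, at most \<delta>.\<close>
  define \<delta>' where "\<delta>' = \<delta> / (fk_const d T (Suc m) * (1 + exp T))"
  have k: "1 \<le> fk_const d T (Suc m) * (1 + exp T)"
    using mult_mono[of 1 "fk_const d T (Suc m)" 1 "1 + exp T"] fk_const_ge_1[of T d "Suc m"] T by simp
  have \<delta>': "0 < \<delta>'" "\<delta>' \<le> \<delta>" "fk_const d T (Suc m) * (\<delta>' + \<delta>' * exp T) = \<delta>"
  proof -
    show "0 < \<delta>'" unfolding \<delta>'_def using \<delta> k by simp
    have "\<delta> * 1 \<le> \<delta> * (fk_const d T (Suc m) * (1 + exp T))" using k \<delta> by (intro mult_left_mono) auto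
    then show "\<delta>' \<le> \<delta>" unfolding \<delta>'_def using k by (simp add: pos_divide_le_eq)
    have "fk_const d T (Suc m) * (\<delta>' + \<delta>' * exp T) = \<delta>' * (fk_const d T (Suc m) * (1 + exp T))"
      by (simp add: algebra_simps)
    also have "\<dots> = \<delta>"
      using nonzero_eq_divide_eq[of "fk_const d T (Suc m) * (1 + exp T)" \<delta>' \<delta>] k \<delta>'_def by linarith
    finally show "fk_const d T (Suc m) * (\<delta>' + \<delta>' * exp T) = \<delta>" .
  qed
  obtain q where q: "trig d q" "\<forall>t\<in>{0..T}. \<forall>x. \<bar>h t x - q t x\<bar> \<le> \<delta>' * poly_weight d (Suc m) x"
    by (rule trig_dense[OF h(1) proj(1) \<delta>'(1)])
  obtain r where r: "trig d r" "\<forall>t\<in>{0..T}. \<forall>x. \<bar>g x - r t x\<bar> \<le> \<delta>' * poly_weight d (Suc m) x"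
    by (rule trig_dense[OF h(2) proj(2) \<delta>'(1)])
  obtain w wt D H where w: "C12_with_derivs T d w wt D H"
     "\<forall>t\<in>{0<..<T}. \<forall>x. wt t x + 1/2 * (\<Sum>i<d. H t x i i) + q t x = 0"
     "\<forall>t\<in>{0..T}. \<forall>x. w t x = feynman_kac d T q (r 0) t x"
     "continuous_on ({0..T} \<times> UNIV) (\<lambda>(t, x). w t x)"
    using classical_trig[OF T q(1) r(1)] unfolding classical_def by blast
  have cg: "continuous_on UNIV g"
    using continuous_on_pair_comp[OF growth_cont[OF h(2)], of UNIV "\<lambda>_. 0" "\<lambda>x. x"] by simp
  have cr: "continuous_on UNIV (r 0)"
    using continuous_on_pair_comp[OF trig_continuous[OF r(1)], of UNIV "\<lambda>_. 0" "\<lambda>x. x"] by simp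
  have close: "\<bar>w t x - feynman_kac d T h g t x\<bar> \<le> \<delta> * poly_weight d (Suc m) x" if t: "0 \<le> t" "t \<le> T" for t x
  proof -
    have "feynman_kac d T (\<lambda>t x. q t x - h t x) (\<lambda>x. r 0 x - g x) t x
       = feynman_kac d T q (r 0) t x - feynman_kac d T h g t x"
      by (rule fk_diff[of d T m]) (auto intro: trig_growth growth_time_slice q(1) r(1) h t)
    then have "w t x - feynman_kac d T h g t x = feynman_kac d T (\<lambda>t x. q t x - h t x) (\<lambda>x. r 0 x - g x) t x"
      using w(3) t by auto
    also have "\<bar>\<dots>\<bar> \<le> fk_const d T (Suc m) * (\<delta>' + \<delta>' * exp T) * poly_weight d (Suc m) x"
    proof (rule fk_bound[OF t])
      show "continuous_on UNIV (\<lambda>(t, x). q t x - h t x)"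
        using trig_continuous[OF q(1)] growth_cont[OF h(1)] by (auto simp: case_prod_beta intro!: continuous_intros)
      show "continuous_on UNIV (\<lambda>x. r 0 x - g x)" by (intro continuous_intros cr cg)
    qed (use \<delta>' q(2) r(2) T in \<open>auto simp: abs_minus_commute\<close>)
    finally show ?thesis by (simp add: \<delta>'(3))
  qed
  have qd: "\<bar>h t x - q t x\<bar> \<le> \<delta> * poly_weight d (Suc m) x" if "0 \<le> t" "t \<le> T" for t x
  proof -
    have "\<bar>h t x - q t x\<bar> \<le> \<delta>' * poly_weight d (Suc m) x" using q(2) that by auto
    then show ?thesis
      using mult_right_mono[OF \<delta>'(2), of "poly_weight d (Suc m) x"] poly_weight_pos[of d "Suc m" x] by linarith
  qed
  obtain C1 where C1: "0 \<le> C1" "\<forall>t\<in>{0..T}. \<forall>x. \<bar>q t x\<bar> \<le> C1 * poly_weight d m x"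
    by (rule growthE[OF trig_growth[OF q(1)]])
  obtain C2 where C2: "0 \<le> C2" "\<forall>t\<in>{0..T}. \<forall>x. \<bar>r 0 x\<bar> \<le> C2 * poly_weight d m x"
    by (rule growthE[OF growth_time_slice[OF r(1)]])
  have "\<bar>w t x\<bar> \<le> (fk_const d T m * (C2 + C1 * exp T)) * poly_weight d m x" if t: "0 \<le> t" "t \<le> T" for t x
  proof -
    have "w t x = feynman_kac d T q (r 0) t x" using w(3) t by auto
    then show ?thesis
      using fk_bound[OF t C1(1) C2(1) trig_continuous[OF q(1)] cr, of d m x] C1(2) C2(2) T by auto
  qed
  moreover have "0 \<le> fk_const d T m * (C2 + C1 * exp T)"
    using fk_const_ge_1[of T d m] T C1(1) C2(1) by simp
  ultimately show thesis
    using that[of q w wt D H "fk_const d T m * (C2 + C1 * exp T)"] w(1,2,4) close qd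
    unfolding classical_witness_def by auto
qed

text \<open>Divided by the weight of degree \<open>Suc m\<close>, the formula is a uniform limit of
  classical solutions divided by the same weight, and these are continuous up to the
  boundary.\<close>

lemma continuous_on_fk:
  assumes T: "0 < T" and h: "growth d T m h" "growth d T m (\<lambda>_. g)"
    and proj: "\<And>t x. h t (proj d x) = h t x" "\<And>x. g (proj d x) = g x"
  shows "continuous_on ({0..T} \<times> UNIV) (\<lambda>(t, x). feynman_kac d T h g t x)"
proof -
  let ?D = "poly_weight d (Suc m)"
  have "\<exists>w. continuous_on ({0..T} \<times> UNIV) (\<lambda>(t, x). w t x) \<and>
     (\<forall>t\<in>{0..T}. \<forall>x. \<bar>w t x - feynman_kac d T h g t x\<bar> \<le> (1 / (1 + real n)) * ?D x)" for n
  proof -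
    have "0 < 1 / (1 + real n)" by simp
    then obtain q w wt D H B where "classical_witness d T q w wt D H"
      "\<forall>t\<in>{0..T}. \<forall>x. \<bar>h t x - q t x\<bar> \<le> (1 / (1 + real n)) * ?D x"
      "\<forall>t\<in>{0..T}. \<forall>x. \<bar>w t x - feynman_kac d T h g t x\<bar> \<le> (1 / (1 + real n)) * ?D x"
      "0 \<le> B" "\<forall>t\<in>{0..T}. \<forall>x. \<bar>w t x\<bar> \<le> B * poly_weight d m x"
      by (rule approx_classical[OF T h proj])
    then show ?thesis
      unfolding classical_witness_def by (intro exI[of _ w] conjI) auto
  qed
  then obtain w where w: "\<And>n. continuous_on ({0..T} \<times> UNIV) (\<lambda>(t, x). w n t x)"
     "\<And>n. \<forall>t\<in>{0..T}. \<forall>x. \<bar>w n t x - feynman_kac d T h g t x\<bar> \<le> (1 / (1 + real n)) * ?D x"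
    by metis
  let ?Y = "\<lambda>p. feynman_kac d T h g (fst p) (snd p) / ?D (snd p)"
  have "continuous_on ({0..T} \<times> UNIV) ?Y"
  proof (rule uniform_limit_theorem[where F = sequentially and f = "\<lambda>n p. w n (fst p) (snd p) / ?D (snd p)"])
    show "\<forall>\<^sub>F n in sequentially. continuous_on ({0..T} \<times> UNIV) (\<lambda>p. w n (fst p) (snd p) / ?D (snd p))"
    proof (rule always_eventually, rule allI, rule continuous_on_divide)
      fix n
      show "continuous_on ({0..T} \<times> UNIV) (\<lambda>p. w n (fst p) (snd p))"
        using w(1)[of n] by (simp add: case_prod_beta)
      show "continuous_on ({0..T} \<times> UNIV) (\<lambda>p. ?D (snd p))"
        by (intro continuous_on_poly_weight continuous_on_snd continuous_on_id)
      show "\<forall>p\<in>{0..T} \<times> UNIV. ?D (snd p) \<noteq> 0"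
        by (metis poly_weight_pos less_irrefl)
    qed
    show "uniform_limit ({0..T} \<times> UNIV) (\<lambda>n p. w n (fst p) (snd p) / ?D (snd p)) ?Y sequentially"
    proof (rule uniform_limitI)
      fix e :: real assume "e > 0"
      then obtain N where N: "1 / (1 + real N) < e"
        using reals_Archimedean[of e] by (auto simp: inverse_eq_divide)
      have "dist (w n (fst p) (snd p) / ?D (snd p)) (?Y p) < e" if "n \<ge> N" "p \<in> {0..T} \<times> UNIV" for n p
      proof -
        have "\<bar>w n (fst p) (snd p) - feynman_kac d T h g (fst p) (snd p)\<bar> \<le> (1 / (1 + real n)) * ?D (snd p)"
          using w(2)[of n] that by auto
        then have "dist (w n (fst p) (snd p) / ?D (snd p)) (?Y p) \<le> 1 / (1 + real n)"
          using poly_weight_pos[of d "Suc m" "snd p"]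
          by (simp add: dist_real_def diff_divide_distrib[symmetric] abs_div_pos[symmetric] pos_divide_le_eq)
        also have "\<dots> \<le> 1 / (1 + real N)" using that by (simp add: frac_le)
        finally show ?thesis using N by simp
      qed
      then show "\<forall>\<^sub>F n in sequentially. \<forall>p\<in>{0..T} \<times> UNIV. dist (w n (fst p) (snd p) / ?D (snd p)) (?Y p) < e"
        unfolding eventually_sequentially by blast
    qed
  qed simp
  then have "continuous_on ({0..T} \<times> UNIV) (\<lambda>p. ?Y p * ?D (snd p))"
    by (rule continuous_on_mult) (intro continuous_on_poly_weight continuous_on_snd continuous_on_id)
  then show ?thesis
    using poly_weight_pos[of d "Suc m"] by (simp add: case_prod_beta less_imp_neq[THEN not_sym])
qed

section \<open>Viscosity solutions of linear heat equations\<close>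

text \<open>If the second derivative were positive, \<open>F'\<close>, which vanishes at the
  maximum, would be positive just to the right of it, and the mean value theorem would give a larger
  value.\<close>

lemma max_second_derivative:
  fixes F F' :: "real \<Rightarrow> real"
  assumes F: "\<And>s. (F has_real_derivative F' s) (at s)" and F': "(F' has_real_derivative H) (at a)"
    and \<rho>: "0 < \<rho>" and max: "\<And>s. \<bar>s - a\<bar> < \<rho> \<Longrightarrow> F s \<le> F a"
  shows "H \<le> 0"
proof (rule ccontr)
  assume "\<not> H \<le> 0"
  have 0: "F' a = 0"
    by (rule DERIV_local_max[OF F \<rho>]) (use max in \<open>auto simp: abs_minus_commute\<close>)
  from DERIV_pos_inc_right[OF F'] \<open>\<not> H \<le> 0\<close> obtain e where e: "e > 0" "\<And>h. 0 < h \<Longrightarrow> h < e \<Longrightarrow> 0 < F' (a + h)"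
    unfolding 0 by auto
  define k where "k = min e \<rho> / 2"
  have k: "0 < k" "k < e" "k < \<rho>" using e \<rho> by (auto simp: k_def)
  have "\<exists>z. a < z \<and> z < a + k \<and> F (a + k) - F a = (a + k - a) * F' z"
    by (rule MVT2) (use k F in auto)
  then obtain z where z: "a < z" "z < a + k" "F (a + k) - F a = k * F' z" by auto
  have "0 < F' z" using e(2)[of "z - a"] z k by auto
  then have "F (a + k) > F a" using z k by (smt (verit) mult_pos_pos)
  then show False using max[of "a + k"] k by simp
qed

text \<open>Maxima along the time axis and along each coordinate axis are enough because the heat
  operator contains only the time derivative and pure second derivatives.\<close>

lemma C12_max_test:
  assumes \<zeta>: "C12_with_derivs T d \<zeta> \<zeta>t D H" and t: "0 < t" "t < T" and x: "x \<in> Rd d"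
    and maxt: "\<exists>\<rho>>0. \<forall>s. \<bar>s - t\<bar> < \<rho> \<longrightarrow> \<zeta> s x \<le> \<zeta> t x"
    and maxx: "\<And>i. i < d \<Longrightarrow> \<exists>\<rho>>0. \<forall>s. \<bar>s - x i\<bar> < \<rho> \<longrightarrow> \<zeta> t (x(i := s)) \<le> \<zeta> t x"
  shows "\<zeta>t t x = 0" "(\<Sum>i<d. H t x i i) \<le> 0"
proof -
  have d: "((\<lambda>s. \<zeta> s z) has_real_derivative \<zeta>t t z) (at t)"
    "i < d \<Longrightarrow> ((\<lambda>s. \<zeta> t (z(i := s))) has_real_derivative D t z i) (at (z i))"
    "i < d \<Longrightarrow> k < d \<Longrightarrow> ((\<lambda>s. D t (z(k := s)) i) has_real_derivative H t z i k) (at (z k))"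
    if "z \<in> Rd d" for z i k
    using \<zeta> t that unfolding C12_with_derivs_def by auto
  obtain \<rho> where "\<rho> > 0" "\<forall>s. \<bar>s - t\<bar> < \<rho> \<longrightarrow> \<zeta> s x \<le> \<zeta> t x" using maxt by blast
  then show "\<zeta>t t x = 0"
    using DERIV_local_max[OF d(1)[OF x], of \<rho>] by (auto simp: abs_minus_commute)
  have "H t x i i \<le> 0" if i: "i < d" for i
  proof -
    obtain \<rho> where \<rho>: "\<rho> > 0" "\<forall>s. \<bar>s - x i\<bar> < \<rho> \<longrightarrow> \<zeta> t (x(i := s)) \<le> \<zeta> t x" using maxx[OF i] by blast
    show ?thesis
    proof (rule max_second_derivative[where F = "\<lambda>s. \<zeta> t (x(i := s))" and F' = "\<lambda>s. D t (x(i := s)) i" and a = "x i"])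
      fix s
      have "x(i := s) \<in> Rd d" using x i by (auto simp: mem_Rd_iff)
      from d(2)[OF this i] show "((\<lambda>s. \<zeta> t (x(i := s))) has_real_derivative D t (x(i := s)) i) (at s)"
        by (simp del: fun_upd_apply) (simp add: fun_upd_same)
    qed (use \<rho> d(3)[OF x i i] in auto)
  qed
  then show "(\<Sum>i<d. H t x i i) \<le> 0" by (intro sum_nonpos) auto
qed

text \<open>The metric on sequences is a series with weights (1/2)^n, whose total is 2; this
  connects metric balls with coordinate boxes.\<close>

lemma dist_coordinates_le:
  fixes x y :: "nat \<Rightarrow> real"
  assumes "\<And>i. \<bar>x i - y i\<bar> \<le> \<rho>"
  shows "dist x y \<le> 2 * \<rho>"
proof -
  let ?m = "\<lambda>n. min (dist (x (from_nat n)) (y (from_nat n))) 1"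
  have le: "(1/2)^n * ?m n \<le> (1/2)^n * \<rho>" for n :: nat
    using assms[of "from_nat n"] by (intro mult_left_mono) (auto simp: dist_real_def min_def)
  have s: "summable (\<lambda>n. (1/2::real)^n)" by (simp add: summable_geometric_iff)
  then have "summable (\<lambda>n. (1/2)^n * ?m n)"
    by (rule summable_comparison_test'[where N = 0]) auto
  then have "dist x y \<le> (\<Sum>n. (1/2)^n * \<rho>)"
    unfolding dist_fun_def by (intro suminf_le le summable_mult2 s)
  also have "\<dots> = 2 * \<rho>"
    using suminf_mult2[OF s, of \<rho>] suminf_geometric[of "1/2::real"] by simp
  finally show ?thesis .
qed

text \<open>The linear equation, whose source does not see the solution: the form in which
  approximation and comparison are available.\<close>

definition heat_subsolution :: "real \<Rightarrow> nat \<Rightarrow> (real \<Rightarrow> (nat \<Rightarrow> real) \<Rightarrow> real) \<Rightarrow> (real \<Rightarrow> (nat \<Rightarrow> real) \<Rightarrow> real) \<Rightarrow> bool" where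
  "heat_subsolution T d h u \<longleftrightarrow> (\<forall>\<phi> \<phi>t D H. \<forall>t\<in>{0<..<T}. \<forall>x\<in>Rd d.
        C12_with_derivs T d \<phi> \<phi>t D H \<and> \<phi> t x = u t x \<and>
        (\<forall>s\<in>{0<..<T}. \<forall>z\<in>Rd d. u s z \<le> \<phi> s z) \<longrightarrow>
        \<phi>t t x + 1/2 * (\<Sum>i<d. H t x i i) + h t x \<ge> 0)"

text \<open>At a touching point the test function has the value of \<open>u\<close>, so the
  nonlinear term can be frozen along \<open>u\<close>.\<close>

lemma viscosity_subsolution_iff:
  "viscosity_subsolution T d (\<lambda>t x r b A. 1/2 * (\<Sum>k<d. A k k) + f t x r) u
    \<longleftrightarrow> heat_subsolution T d (\<lambda>t x. f t x (u t x)) u"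
  unfolding viscosity_subsolution_def heat_subsolution_def
  by (intro iff_allI ball_cong refl) (auto simp: add.assoc)

text \<open>Negation turns touching from below into touching from above, so both halves of a
  viscosity solution become subsolution statements.\<close>

lemma viscosity_supersolution_iff:
  "viscosity_supersolution T d (\<lambda>t x r b A. 1/2 * (\<Sum>k<d. A k k) + f t x r) u
    \<longleftrightarrow> heat_subsolution T d (\<lambda>t x. - f t x (u t x)) (\<lambda>t x. - u t x)"
  (is "?L \<longleftrightarrow> ?R")
proof
  assume L: ?L
  show ?R
    unfolding heat_subsolution_def
  proof (intro allI ballI impI, elim conjE)
    fix \<phi> \<phi>t D H t x
    assume a: "t \<in> {0<..<T}" "x \<in> Rd d" "C12_with_derivs T d \<phi> \<phi>t D H" "\<phi> t x = - u t x"
      "\<forall>s\<in>{0<..<T}. \<forall>z\<in>Rd d. - u s z \<le> \<phi> s z"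
    have "C12_with_derivs T d (\<lambda>t x. - \<phi> t x) (\<lambda>t x. - \<phi>t t x) (\<lambda>t x i. - D t x i) (\<lambda>t x i j. - H t x i j)"
      by (rule C12_uminus[OF a(3)])
    moreover have "- \<phi> t x = u t x" "\<forall>s\<in>{0<..<T}. \<forall>z\<in>Rd d. - \<phi> s z \<le> u s z"
      using a(4,5) by (auto simp: minus_le_iff)
    ultimately have "- \<phi>t t x + (1/2 * (\<Sum>k<d. - H t x k k) + f t x (- \<phi> t x)) \<le> 0"
      using L a(1,2) unfolding viscosity_supersolution_def by blast
    then show "0 \<le> \<phi>t t x + 1/2 * (\<Sum>i<d. H t x i i) + - f t x (u t x)"
      using a(4) by (simp add: sum_negf)
  qed
next
  assume R: ?R
  show ?L
    unfolding viscosity_supersolution_def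
  proof (intro allI ballI impI, elim conjE)
    fix \<phi> \<phi>t D H t x
    assume a: "t \<in> {0<..<T}" "x \<in> Rd d" "C12_with_derivs T d \<phi> \<phi>t D H" "\<phi> t x = u t x"
      "\<forall>s\<in>{0<..<T}. \<forall>z\<in>Rd d. \<phi> s z \<le> u s z"
    have "C12_with_derivs T d (\<lambda>t x. - \<phi> t x) (\<lambda>t x. - \<phi>t t x) (\<lambda>t x i. - D t x i) (\<lambda>t x i j. - H t x i j)"
      by (rule C12_uminus[OF a(3)])
    moreover have "- \<phi> t x = - u t x" "\<forall>s\<in>{0<..<T}. \<forall>z\<in>Rd d. - u s z \<le> - \<phi> s z"
      using a(4,5) by auto
    ultimately have "0 \<le> - \<phi>t t x + 1/2 * (\<Sum>i<d. - H t x i i) + - f t x (u t x)"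
      using R a(1,2) unfolding heat_subsolution_def by blast
    then show "\<phi>t t x + (1/2 * (\<Sum>k<d. H t x k k) + f t x (\<phi> t x)) \<le> 0"
      using a(4) by (simp add: sum_negf)
  qed
qed

lemma sum_upd_square:
  fixes x x0 :: "nat \<Rightarrow> real"
  assumes "i < d"
  shows "(\<Sum>j<d. ((x(i := s)) j - x0 j)\<^sup>2) = (\<Sum>j<d. (x j - x0 j)\<^sup>2) + ((s - x0 i)\<^sup>2 - (x i - x0 i)\<^sup>2)"
proof -
  have "(\<Sum>j<d. ((x(i := s)) j - x0 j)\<^sup>2)
     = (\<Sum>j<d. (x j - x0 j)\<^sup>2 + (if j = i then (s - x0 i)\<^sup>2 - (x i - x0 i)\<^sup>2 else 0))"
    by (intro sum.cong) auto
  then show ?thesis using assms by (simp add: sum.distrib)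
qed

lemma C12_quadratic:
  "C12_with_derivs T d
    (\<lambda>t x. c * ((t - t0)\<^sup>2 + (\<Sum>j<d. (x j - x0 j)\<^sup>2))) (\<lambda>t x. c * (2 * (t - t0)))
    (\<lambda>t x i. c * (2 * (x i - x0 i))) (\<lambda>t x i j. if i = j then 2 * c else 0)"
proof -
  have 1: "((\<lambda>s. c * ((t - t0)\<^sup>2 + (\<Sum>j<d. ((x(i := s)) j - x0 j)\<^sup>2))) has_real_derivative
      c * (2 * (x i - x0 i))) (at (x i))" if "i < d" for i t x
    unfolding sum_upd_square[OF that] by (auto intro!: derivative_eq_intros)
  have 2: "((\<lambda>s. c * (2 * ((x(k := s)) i - x0 i))) has_real_derivative (if i = k then 2 * c else 0)) (at (x k))"
    for i k and x :: "nat \<Rightarrow> real"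
    by (auto intro!: derivative_eq_intros)
  show ?thesis
    unfolding C12_with_derivs_def using 1 2
    by (auto simp: case_prod_beta simp del: fun_upd_apply intro!: continuous_intros derivative_eq_intros)
qed

lemma C12_diff:
  assumes "C12_with_derivs T d \<phi> \<phi>t D H" "C12_with_derivs T d \<psi> \<psi>t E J"
  shows "C12_with_derivs T d (\<lambda>t x. \<phi> t x - \<psi> t x) (\<lambda>t x. \<phi>t t x - \<psi>t t x)
    (\<lambda>t x i. D t x i - E t x i) (\<lambda>t x i j. H t x i j - J t x i j)"
  using C12_add[OF assms(1) C12_uminus[OF assms(2)]] by simp

text \<open>Stability: near a touching point the source is almost that of a classical solution \<open>w\<close>
  uniformly close to \<open>u\<close>; subtracting a small paraboloid forces the maximum of \<open>w - \<phi>\<close> into the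
  interior of a small cylinder.\<close>

lemma heat_subsolution_fk:
  assumes T: "0 < T" and h: "growth d T m h" "growth d T m (\<lambda>_. g)"
    and proj: "\<And>t x. h t (proj d x) = h t x" "\<And>x. g (proj d x) = g x"
  shows "heat_subsolution T d h (feynman_kac d T h g)"
  unfolding heat_subsolution_def
proof (intro allI ballI impI, elim conjE)
  fix \<phi> \<phi>t D H t0 x0
  assume t0: "t0 \<in> {0<..<T}" and x0: "x0 \<in> Rd d" and C: "C12_with_derivs T d \<phi> \<phi>t D H"
    and touch: "\<phi> t0 x0 = feynman_kac d T h g t0 x0"
    and above: "\<forall>s\<in>{0<..<T}. \<forall>z\<in>Rd d. feynman_kac d T h g s z \<le> \<phi> s z"
  let ?y = "feynman_kac d T h g"
  define E where "E p = \<phi>t (fst p) (snd p) + 1/2 * (\<Sum>i<d. H (fst p) (snd p) i i) + h (fst p) (snd p)" for p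
  let ?Dom = "{0<..<T} \<times> Rd d"
  have contE: "continuous_on ?Dom E"
    using C continuous_on_subset[OF growth_cont[OF h(1)], of ?Dom] unfolding C12_with_derivs_def E_def
    by (auto simp: case_prod_beta intro!: continuous_intros)
  show "0 \<le> \<phi>t t0 x0 + 1/2 * (\<Sum>i<d. H t0 x0 i i) + h t0 x0"
  proof (rule ccontr)
    assume neg: "\<not> 0 \<le> \<phi>t t0 x0 + 1/2 * (\<Sum>i<d. H t0 x0 i i) + h t0 x0"
    define \<eta> where "\<eta> = - E (t0, x0) / 2"
    have \<eta>: "0 < \<eta>" "E (t0, x0) = - 2 * \<eta>" using neg by (auto simp: \<eta>_def E_def)
    have "(t0, x0) \<in> ?Dom" using t0 x0 by auto
    then obtain e where e: "e > 0" "\<And>p. p \<in> ?Dom \<Longrightarrow> dist p (t0, x0) < e \<Longrightarrow> dist (E p) (E (t0, x0)) < \<eta>"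
      using contE \<eta>(1) unfolding continuous_on_iff by metis
    \<comment> \<open>A point of the cylinder is at distance at most 3 \<rho> from (t0, x0): \<rho>
      from the time and 2 \<rho> from the sequence metric. A quarter of \<open>e\<close> keeps this
      below \<open>e\<close>.\<close>
    define \<rho> where "\<rho> = min (e / 4) (min (t0 / 2) ((T - t0) / 2))"
    have \<rho>: "0 < \<rho>" "\<rho> \<le> e / 4" "0 < t0 - \<rho>" "t0 + \<rho> < T"
    proof -
      have le: "\<rho> \<le> e / 4" "\<rho> \<le> t0 / 2" "\<rho> \<le> (T - t0) / 2"
        unfolding \<rho>_def by (meson min.cobounded1 min.cobounded2 order_trans)+
      have tt: "0 < t0" "t0 < T" using t0 by auto
      show "\<rho> \<le> e / 4" by (rule le)
      show "0 < t0 - \<rho>" using le(2) tt by linarith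
      show "t0 + \<rho> < T" using le(3) tt by (simp add: field_simps)
      show "0 < \<rho>" unfolding \<rho>_def using e(1) tt by simp
    qed
    define Box where "Box = {x::nat\<Rightarrow>real. \<forall>i. x i \<in> (if i < d then {x0 i - \<rho>..x0 i + \<rho>} else {0})}"
    define Q where "Q = {t0 - \<rho>..t0 + \<rho>} \<times> Box"
    have Box_iff: "x \<in> Box \<longleftrightarrow> x \<in> Rd d \<and> (\<forall>i<d. \<bar>x i - x0 i\<bar> \<le> \<rho>)" for x
    proof -
      have "(v \<in> {x0 i - \<rho>..x0 i + \<rho>}) = (\<bar>v - x0 i\<bar> \<le> \<rho>)" for v i by auto
      then show ?thesis unfolding Box_def mem_Rd_iff
        by (auto simp del: atLeastAtMost_iff)
    qed
    have QD: "Q \<subseteq> ?Dom" using \<rho> by (auto simp: Q_def Box_iff)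
    have Qcompact: "compact Q" unfolding Q_def Box_def by (intro compact_Times compact_box) auto
    have Ele: "E p < - \<eta>" if "p \<in> Q" for p
    proof -
      have "dist (snd p) x0 \<le> 2 * \<rho>"
      proof (rule dist_coordinates_le)
        fix i show "\<bar>snd p i - x0 i\<bar> \<le> \<rho>"
          using that x0 \<rho> by (cases "i < d") (auto simp: Q_def Box_iff mem_Rd_iff)
      qed
      moreover have "dist (fst p) t0 \<le> \<rho>" using that by (auto simp: Q_def dist_real_def)
      ultimately have "dist p (t0, x0) \<le> \<rho> + 2 * \<rho>"
        using dist_Pair_Pair[of "fst p" "snd p" t0 x0] sqrt_sum_squares_le_sum_abs[of "dist (fst p) t0" "dist (snd p) x0"]
        by simp
      then have "dist p (t0, x0) < e" using \<rho> e by linarith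
      then show ?thesis using e(2)[of p] that QD \<eta> by (auto simp: dist_real_def)
    qed
    \<comment> \<open>The paraboloid contributes at most c (2 \<rho> + d) to the heat operator; this
      may use up only a third of the defect \<eta>.\<close>
    define c where "c = \<eta> / (3 * (2 * \<rho> + d + 1))"
    have c: "0 < c" "c * (2 * \<rho> + d) \<le> \<eta> / 3"
    proof -
      show "0 < c" using \<eta> \<rho> by (simp add: c_def)
      have "c * (2 * \<rho> + d) \<le> c * (2 * \<rho> + d + 1)" using \<open>0 < c\<close> by (intro mult_left_mono) auto
      also have "\<dots> = \<eta> / 3" unfolding c_def using \<rho> by (simp add: field_simps)
      finally show "c * (2 * \<rho> + d) \<le> \<eta> / 3" .
    qed
    let ?W = "poly_weight d (Suc m)"
    have p0Q: "(t0, x0) \<in> Q" using x0 \<rho> by (auto simp: Q_def Box_iff)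
    then have Qne: "Q \<noteq> {}" by auto
    obtain B where B: "0 < B" "\<And>p. p \<in> Q \<Longrightarrow> ?W (snd p) \<le> B"
    proof -
      have "continuous_on Q (\<lambda>p. ?W (snd p))" by (intro continuous_intros)
      then obtain p where "p \<in> Q" "\<forall>p'\<in>Q. ?W (snd p') \<le> ?W (snd p)"
        using continuous_attains_sup[OF Qcompact Qne, of "\<lambda>p. ?W (snd p)"] by auto
      then show thesis using that[of "?W (snd p)"] poly_weight_pos[of d "Suc m"] by auto
    qed
    \<comment> \<open>Twice the approximation error must stay below the height c \<rho>^2 of the
      paraboloid at the boundary, to confine the maximum, and the error itself below a third of
      \<eta>, to preserve the contradiction.\<close>
    define \<omega> where "\<omega> = min (c * \<rho>\<^sup>2) \<eta> / 4"
    have \<omega>: "0 < \<omega>" "2 * \<omega> < c * \<rho>\<^sup>2" "3 * \<omega> < \<eta>" using c \<rho> \<eta> by (auto simp: \<omega>_def min_def)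
    have "0 < \<omega> / B" using \<omega> B by simp
    then obtain q w wt DD J B' where
      w: "classical_witness d T q w wt DD J"
      and qh: "\<forall>t\<in>{0..T}. \<forall>x. \<bar>h t x - q t x\<bar> \<le> \<omega> / B * ?W x"
      and wy: "\<forall>t\<in>{0..T}. \<forall>x. \<bar>w t x - ?y t x\<bar> \<le> \<omega> / B * ?W x"
      and "0 \<le> B'" "\<forall>t\<in>{0..T}. \<forall>x. \<bar>w t x\<bar> \<le> B' * poly_weight d m x"
      by (rule approx_classical[OF T h proj])
    have bnd: "\<bar>h t x - q t x\<bar> \<le> \<omega>" "\<bar>w t x - ?y t x\<bar> \<le> \<omega>" if "(t, x) \<in> Q" for t x
    proof -
      have "t \<in> {0..T}" using that QD by auto
      moreover have "\<omega> / B * ?W x \<le> \<omega>" using B(2)[OF that] B(1) \<omega>(1) by (simp add: field_simps)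
      ultimately show "\<bar>h t x - q t x\<bar> \<le> \<omega>" "\<bar>w t x - ?y t x\<bar> \<le> \<omega>"
        using qh wy by (meson order_trans)+
    qed
    define N where "N t x = c * ((t - t0)\<^sup>2 + (\<Sum>j<d. (x j - x0 j)\<^sup>2))" for t and x :: "nat \<Rightarrow> real"
    define \<zeta> where "\<zeta> t x = w t x - \<phi> t x - N t x" for t x
    have C\<zeta>: "C12_with_derivs T d \<zeta> (\<lambda>t x. wt t x - \<phi>t t x - c * (2 * (t - t0)))
      (\<lambda>t x i. DD t x i - D t x i - c * (2 * (x i - x0 i)))
      (\<lambda>t x i j. J t x i j - H t x i j - (if i = j then 2 * c else 0))"
      unfolding \<zeta>_def N_def using w C C12_quadratic[of T d c t0 x0] unfolding classical_witness_def
      by (intro C12_diff) auto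
    have "continuous_on Q (\<lambda>p. \<zeta> (fst p) (snd p))"
      using C\<zeta> continuous_on_subset[OF _ QD] unfolding C12_with_derivs_def by (auto simp: case_prod_beta)
    then obtain p where p: "p \<in> Q" "\<forall>p'\<in>Q. \<zeta> (fst p') (snd p') \<le> \<zeta> (fst p) (snd p)"
      using continuous_attains_sup[OF Qcompact Qne, of "\<lambda>p. \<zeta> (fst p) (snd p)"] by auto
    obtain t x where tx: "p = (t, x)" by (cases p)
    have txQ: "(t, x) \<in> Q" and maxQ: "\<And>s z. (s, z) \<in> Q \<Longrightarrow> \<zeta> s z \<le> \<zeta> t x"
      using p by (auto simp: tx)
    have x: "x \<in> Rd d" and t: "0 < t" "t < T" using txQ QD by auto
    \<comment> \<open>At the centre \<zeta> is at least -\<omega>, elsewhere on the cylinder at most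
      \<omega> - N. A maximum therefore has N \<le> 2 \<omega>, which excludes the boundary.\<close>
    have "\<zeta> t0 x0 \<ge> - \<omega>" using bnd(2)[OF p0Q] touch by (simp add: \<zeta>_def N_def)
    then have "\<zeta> t x \<ge> - \<omega>" using maxQ[OF p0Q] by linarith
    moreover have "\<zeta> t x \<le> \<omega> - N t x"
    proof -
      have "?y t x \<le> \<phi> t x" using above t x by auto
      then show ?thesis using bnd(2)[OF txQ] by (simp add: \<zeta>_def)
    qed
    ultimately have "N t x \<le> 2 * \<omega>" by linarith
    then have Nlt: "c * ((t - t0)\<^sup>2 + (\<Sum>j<d. (x j - x0 j)\<^sup>2)) < c * \<rho>\<^sup>2" using \<omega> by (simp add: N_def)
    then have Nlt': "(t - t0)\<^sup>2 + (\<Sum>j<d. (x j - x0 j)\<^sup>2) < \<rho>\<^sup>2" using c by simp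
    have tin: "\<bar>t - t0\<bar> < \<rho>"
    proof -
      have "(t - t0)\<^sup>2 < \<rho>\<^sup>2" using Nlt' sum_nonneg[of "{..<d}" "\<lambda>j. (x j - x0 j)\<^sup>2"] by simp
      then show ?thesis using \<rho> abs_le_square_iff[of \<rho> "t - t0"] by auto
    qed
    have xin: "\<bar>x i - x0 i\<bar> < \<rho>" if "i < d" for i
    proof -
      have "(x i - x0 i)\<^sup>2 \<le> (\<Sum>j<d. (x j - x0 j)\<^sup>2)" using that by (intro member_le_sum) auto
      then have "(x i - x0 i)\<^sup>2 < \<rho>\<^sup>2" using Nlt' zero_le_power2[of "t - t0"] by linarith
      then show ?thesis using \<rho> abs_le_square_iff[of \<rho> "x i - x0 i"] by auto
    qed
    have "\<exists>r>0. \<forall>s. \<bar>s - t\<bar> < r \<longrightarrow> \<zeta> s x \<le> \<zeta> t x"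
    proof (intro exI[of _ "\<rho> - \<bar>t - t0\<bar>"] conjI allI impI)
      fix s assume "\<bar>s - t\<bar> < \<rho> - \<bar>t - t0\<bar>"
      then have "(s, x) \<in> Q" using txQ by (auto simp: Q_def abs_if split: if_splits)
      then show "\<zeta> s x \<le> \<zeta> t x" by (rule maxQ)
    qed (use tin in auto)
    moreover have "\<exists>r>0. \<forall>s. \<bar>s - x i\<bar> < r \<longrightarrow> \<zeta> t (x(i := s)) \<le> \<zeta> t x" if i: "i < d" for i
    proof (intro exI[of _ "\<rho> - \<bar>x i - x0 i\<bar>"] conjI allI impI)
      fix s assume "\<bar>s - x i\<bar> < \<rho> - \<bar>x i - x0 i\<bar>"
      then have "\<bar>s - x0 i\<bar> \<le> \<rho>" by linarith
      then have "(t, x(i := s)) \<in> Q" using txQ i by (auto simp: Q_def Box_iff mem_Rd_iff)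
      then show "\<zeta> t (x(i := s)) \<le> \<zeta> t x" by (rule maxQ)
    qed (use xin[OF i] in auto)
    ultimately have "wt t x - \<phi>t t x - c * (2 * (t - t0)) = 0"
      and "(\<Sum>i<d. J t x i i - H t x i i - (if i = i then 2 * c else 0)) \<le> 0"
      using C12_max_test[OF C\<zeta> t x] by auto
    moreover from this(2) have "(\<Sum>i<d. J t x i i) \<le> (\<Sum>i<d. H t x i i) + 2 * c * d"
      by (simp add: sum_subtractf sum.distrib algebra_simps)
    moreover have "wt t x + 1/2 * (\<Sum>i<d. J t x i i) + q t x = 0"
      using w t unfolding classical_witness_def by auto
    moreover have "E (t, x) = \<phi>t t x + 1/2 * (\<Sum>i<d. H t x i i) + h t x" by (simp add: E_def)
    ultimately have "0 \<le> E (t, x) + (q t x - h t x) + (c * (2 * (t - t0)) + c * d)"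
      by (simp add: algebra_simps)
    moreover have "c * (2 * (t - t0)) + c * d \<le> c * (2 * \<rho> + d)"
      using tin c(1) mult_left_mono[of "2 * (t - t0)" "2 * \<rho>" c] by (simp add: algebra_simps)
    moreover have "q t x - h t x \<le> \<omega>" using bnd(1)[OF txQ] by linarith
    ultimately show False using Ele[OF txQ] c(2) \<omega> \<eta> by linarith
  qed
qed

section \<open>Comparison with classical solutions\<close>

lemma poly_weight_upd:
  assumes "i < d"
  shows "poly_weight d m (x(i := s)) = poly_weight d m x + (s ^ (2 * m) - x i ^ (2 * m))"
proof -
  have "(\<Sum>j<d. (x(i := s)) j ^ (2 * m)) = (\<Sum>j<d. x j ^ (2 * m) + (if j = i then s ^ (2 * m) - x i ^ (2 * m) else 0))"
    by (intro sum.cong) auto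
  then show ?thesis using assms by (simp add: poly_weight_def sum.distrib)
qed

lemma C12_poly_weight:
  "C12_with_derivs T d
    (\<lambda>t x. c * exp (\<nu> * (T - t)) * poly_weight d (Suc m) x)
    (\<lambda>t x. - \<nu> * (c * exp (\<nu> * (T - t)) * poly_weight d (Suc m) x))
    (\<lambda>t x i. c * exp (\<nu> * (T - t)) * (real (2 * Suc m) * x i ^ (2 * m + 1)))
    (\<lambda>t x i j. if i = j then c * exp (\<nu> * (T - t)) * (real (2 * Suc m) * (real (2 * m + 1) * x i ^ (2 * m))) else 0)"
proof -
  have 1: "((\<lambda>s. c * exp (\<nu> * (T - t)) * poly_weight d (Suc m) (x(i := s))) has_real_derivative
      c * exp (\<nu> * (T - t)) * (real (2 * Suc m) * x i ^ (2 * m + 1))) (at (x i))" if "i < d" for i t x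
    unfolding poly_weight_upd[OF that] by (rule derivative_eq_intros refl | simp)+
  have 2: "((\<lambda>s. c * exp (\<nu> * (T - t)) * (real (2 * Suc m) * (x(k := s)) i ^ (2 * m + 1))) has_real_derivative
      (if i = k then c * exp (\<nu> * (T - t)) * (real (2 * Suc m) * (real (2 * m + 1) * x i ^ (2 * m))) else 0)) (at (x k))"
    for i k t and x :: "nat \<Rightarrow> real"
  proof (cases "i = k")
    case True
    have "((\<lambda>s. c * exp (\<nu> * (T - t)) * (real (2 * Suc m) * s ^ (2 * m + 1))) has_real_derivative
      c * exp (\<nu> * (T - t)) * (real (2 * Suc m) * (real (2 * m + 1) * x k ^ (2 * m)))) (at (x k))"
      by (rule derivative_eq_intros refl | simp)+
    then show ?thesis using True by simp
  qed simp
  have 3: "((\<lambda>t. c * exp (\<nu> * (T - t)) * poly_weight d (Suc m) x) has_real_derivative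
      - \<nu> * (c * exp (\<nu> * (T - t)) * poly_weight d (Suc m) x)) (at t)" for t x
    by (rule derivative_eq_intros refl | simp)+
  have 4: "continuous_on S (\<lambda>p. if i = k then c * exp (\<nu> * (T - fst p)) * (real (2 * Suc m) * (real (2 * m + 1) * snd p i ^ (2 * m))) else 0)"
    for S :: "(real \<times> (nat \<Rightarrow> real)) set" and i k by (cases "i = k") (auto intro!: continuous_intros)
  show ?thesis
    unfolding C12_with_derivs_def case_prod_beta
    by (intro conjI allI impI ballI 1 2 3 4 continuous_intros)
qed

text \<open>The barrier \<eta>/t keeps maxima away from time 0, where the equation gives no
  information; the constant lifts the test function to the touching height.\<close>

lemma C12_inverse_time:
  "C12_with_derivs T d (\<lambda>t x. \<eta> / t + c) (\<lambda>t x. - \<eta> / t\<^sup>2) (\<lambda>t x i. 0) (\<lambda>t x i j. 0)"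
  unfolding C12_with_derivs_def
  by (auto simp: case_prod_beta power2_eq_square intro!: continuous_intros derivative_eq_intros)

text \<open>The Feynman--Kac side is replaced by a smooth approximation \<open>w\<close>, so
  variables need not be doubled: \<open>w\<close> plus a growing weight, a barrier in time and a
  constant is itself a test function for \<open>u\<close>. The barrier restricts the conclusion to
  positive times.\<close>

lemma heat_comparison:
  assumes T: "0 < T" and gr: "growth d T m h" "growth d T m (\<lambda>_. g)" "growth d T m u"
    and proj: "\<And>t x. h t (proj d x) = h t x" "\<And>x. g (proj d x) = g x"
    and sub: "heat_subsolution T d h u" and uT: "\<And>x. u T x \<le> g x"
    and t: "0 < t" "t \<le> T" and x: "x \<in> Rd d"
  shows "u t x \<le> feynman_kac d T h g t x"
proof -
  let ?W = "poly_weight d (Suc m)"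
  \<comment> \<open>Half the Laplacian of the weight is at most (\<nu> - 1) times the weight, so the
    factor exp (\<nu> (T - t)) leaves one full unit of strictness in \<psi>.\<close>
  define \<nu> where "\<nu> = real (Suc m) * real (2 * m + 1) * (real d + 1) + 1"
  define \<psi> where "\<psi> t x = exp (\<nu> * (T - t)) * ?W x" for t x
  have \<nu>: "1 \<le> \<nu>" by (simp add: \<nu>_def)
  have \<psi>ge: "?W x \<le> \<psi> t x" if "t \<le> T" for t x
    unfolding \<psi>_def using mult_right_mono[of 1 "exp (\<nu> * (T - t))" "?W x"] \<nu> that poly_weight_pos[of d "Suc m" x]
    by simp
  have hess: "1/2 * (\<Sum>i<d. real (2 * Suc m) * (real (2 * m + 1) * x i ^ (2 * m))) \<le> (\<nu> - 1) * ?W x" for x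
  proof -
    have "x i ^ (2 * m) \<le> 1 + x i ^ (2 * Suc m)" for i
    proof (cases "\<bar>x i\<bar> \<le> 1")
      case True
      then have "\<bar>x i\<bar> ^ (2 * m) \<le> 1" by (intro power_le_one) auto
      moreover have "0 \<le> x i ^ (2 * Suc m)" by (rule zero_le_even_power) simp
      moreover have "\<bar>x i\<bar> ^ (2 * m) = x i ^ (2 * m)" by (rule power_even_abs) simp
      ultimately show ?thesis by linarith
    next
      case False
      then have "\<bar>x i\<bar> ^ (2 * m) \<le> \<bar>x i\<bar> ^ (2 * Suc m)" by (intro power_increasing) auto
      moreover have "\<bar>x i\<bar> ^ (2 * m) = x i ^ (2 * m)" "\<bar>x i\<bar> ^ (2 * Suc m) = x i ^ (2 * Suc m)"
        by (rule power_even_abs, simp)+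
      ultimately show ?thesis by linarith
    qed
    then have "(\<Sum>i<d. x i ^ (2 * m)) \<le> (\<Sum>i<d. 1 + x i ^ (2 * Suc m))" by (intro sum_mono)
    also have "\<dots> \<le> (real d + 1) * ?W x"
    proof -
      have "0 \<le> (\<Sum>i<d. x i ^ (2 * Suc m))" by (intro sum_nonneg zero_le_even_power) auto
      then show ?thesis by (simp add: sum.distrib poly_weight_def algebra_simps)
    qed
    finally have *: "(\<Sum>i<d. x i ^ (2 * m)) \<le> (real d + 1) * ?W x" .
    have "1/2 * (\<Sum>i<d. real (2 * Suc m) * (real (2 * m + 1) * x i ^ (2 * m)))
      = (real (Suc m) * real (2 * m + 1)) * (\<Sum>i<d. x i ^ (2 * m))"
      unfolding sum_distrib_left by (intro sum.cong) (auto simp: field_simps)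
    also have "\<dots> \<le> (real (Suc m) * real (2 * m + 1)) * ((real d + 1) * ?W x)"
      using * by (intro mult_left_mono) auto
    finally show ?thesis by (simp add: \<nu>_def mult_ac)
  qed
  have step: "u t x \<le> feynman_kac d T h g t x + \<delta> * ?W x + \<delta> * \<psi> t x + \<eta> / t" if \<delta>: "0 < \<delta>" and \<eta>: "0 < \<eta>" for \<delta> \<eta>
  proof -
    obtain q w wt D H B where w: "classical_witness d T q w wt D H"
      and qh: "\<forall>t\<in>{0..T}. \<forall>x. \<bar>h t x - q t x\<bar> \<le> \<delta> * ?W x"
      and wy: "\<forall>t\<in>{0..T}. \<forall>x. \<bar>w t x - feynman_kac d T h g t x\<bar> \<le> \<delta> * ?W x"
      and B0: "0 \<le> B" and B: "\<forall>t\<in>{0..T}. \<forall>x. \<bar>w t x\<bar> \<le> B * poly_weight d m x"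
      by (rule approx_classical[OF T gr(1,2) proj \<delta>])
    obtain Cu where Cu0: "0 \<le> Cu" and Cu: "\<forall>t\<in>{0..T}. \<forall>x. \<bar>u t x\<bar> \<le> Cu * poly_weight d m x"
      by (rule growthE[OF gr(3)])
    \<comment> \<open>The excess of \<open>u\<close> over the perturbed \<open>w\<close>; a positive
      value is to be refuted at a maximum.\<close>
    define G where "G t x = u t x - w t x - \<delta> * \<psi> t x - \<eta> / t" for t x
    have C: "0 \<le> B + Cu" using B0 Cu0 by simp
    have uw: "u t x - w t x \<le> (B + Cu) * poly_weight d m x" if "0 \<le> t" "t \<le> T" for t x
    proof -
      have "\<bar>w t x\<bar> \<le> B * poly_weight d m x" "\<bar>u t x\<bar> \<le> Cu * poly_weight d m x" using B Cu that by auto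
      then show ?thesis by (simp add: algebra_simps)
    qed
    have "G t x \<le> 0"
    proof (rule ccontr)
      assume pos: "\<not> G t x \<le> 0"
      \<comment> \<open>Outside this box the growth of \<open>u - w\<close>, of degree
        \<open>m\<close>, is absorbed by \<delta> \<psi>.\<close>
      obtain R0 where R0: "1 \<le> R0" and tail: "\<And>x i. i < d \<Longrightarrow> R0 < \<bar>x i\<bar> \<Longrightarrow>
          (B + Cu) * (poly_weight d m x + (1 + real d * R0 ^ (2 * m))) \<le> \<delta> * ?W x"
        using poly_weight_tail[OF C \<delta>, of d m] by metis
      define B1 where "B1 = (B + Cu) * (1 + real d * R0 ^ (2 * m))"
      have B1: "0 \<le> B1" unfolding B1_def using R0 by (intro mult_nonneg_nonneg[OF C] add_nonneg_nonneg) auto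
      define Box where "Box = {x::nat\<Rightarrow>real. \<forall>i. x i \<in> (if i < d then {-R0..R0} else {0})}"
      \<comment> \<open>Before this time the barrier exceeds the bound \<open>B1\<close> of
        \<open>u - w\<close> on the box.\<close>
      define \<tau> where "\<tau> = min t (\<eta> / (B1 + 1))"
      have \<tau>: "0 < \<tau>" "\<tau> \<le> t" "\<tau> * (B1 + 1) \<le> \<eta>"
      proof -
        show "0 < \<tau>" "\<tau> \<le> t" unfolding \<tau>_def using t \<eta> B1 by auto
        have "\<tau> \<le> \<eta> / (B1 + 1)" by (simp add: \<tau>_def)
        then show "\<tau> * (B1 + 1) \<le> \<eta>" using B1 by (simp add: pos_le_divide_eq)
      qed
      define Q where "Q = {\<tau>..T} \<times> Box"
      have outside: "G s z < 0" if s: "0 < s" "s \<le> T" and z: "z \<in> Rd d" and nQ: "(s, z) \<notin> Q" for s z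
      proof (cases "z \<in> Box")
        case False
        then obtain i where "z i \<notin> (if i < d then {-R0..R0} else {0})" by (auto simp: Box_def)
        then have i: "i < d" "R0 < \<bar>z i\<bar>" using z by (auto simp: mem_Rd_iff abs_if split: if_splits)
        have "u s z - w s z \<le> (B + Cu) * poly_weight d m z" using uw s by simp
        also have "\<dots> \<le> (B + Cu) * (poly_weight d m z + (1 + real d * R0 ^ (2 * m)))"
          using C R0 by (intro mult_left_mono) auto
        also have "\<dots> \<le> \<delta> * ?W z" by (rule tail[of i z, OF i])
        also have "\<dots> \<le> \<delta> * \<psi> s z" using \<psi>ge[OF s(2)] \<delta> by (intro mult_left_mono) auto
        finally have "u s z - w s z \<le> \<delta> * \<psi> s z" .
        moreover have "0 < \<eta> / s" using \<eta> s by simp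
        ultimately show ?thesis by (simp add: G_def)
      next
        case True
        then have "s < \<tau>" using nQ s by (auto simp: Q_def)
        have zR: "\<bar>z i\<bar> \<le> R0" if "i < d" for i
        proof -
          have "z i \<in> (if i < d then {-R0..R0} else {0})" using True unfolding Box_def by blast
          then show ?thesis using that by (auto simp: abs_le_iff minus_le_iff)
        qed
        have "u s z - w s z \<le> (B + Cu) * poly_weight d m z" using uw s by simp
        also have "\<dots> \<le> B1" unfolding B1_def using C zR by (intro mult_left_mono poly_weight_box) auto
        also have "\<dots> < \<eta> / s"
        proof -
          have "B1 * s \<le> B1 * \<tau>" using B1 \<open>s < \<tau>\<close> by (intro mult_left_mono) auto
          also have "\<dots> < \<eta>" using \<tau> by (simp add: algebra_simps)
          finally show ?thesis using s by (simp add: pos_less_divide_eq)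
        qed
        finally have "u s z - w s z < \<eta> / s" .
        moreover have "0 \<le> \<delta> * \<psi> s z" using \<psi>ge[OF s(2), of z] \<delta> poly_weight_pos[of d "Suc m" z] by simp
        ultimately show ?thesis by (simp add: G_def)
      qed
      have QD: "Q \<subseteq> {0<..T} \<times> Rd d"
      proof -
        have "z \<in> Rd d" if "z \<in> Box" for z
          unfolding mem_Rd_iff
        proof (intro allI impI)
          fix i assume "d \<le> i"
          moreover have "z i \<in> (if i < d then {-R0..R0} else {0})" using that unfolding Box_def by blast
          ultimately show "z i = 0" by simp
        qed
        then show ?thesis using \<tau> by (auto simp: Q_def)
      qed
      have txQ: "(t, x) \<in> Q" using outside[OF t x] pos by auto
      then have Qne: "Q \<noteq> {}" by auto
      have compQ: "compact Q" unfolding Q_def Box_def by (intro compact_Times compact_box) auto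
      have "continuous_on Q (\<lambda>p. u (fst p) (snd p))" "continuous_on Q (\<lambda>p. w (fst p) (snd p))"
      proof -
        have "Q \<subseteq> {0..T} \<times> UNIV" using QD by auto
        then show "continuous_on Q (\<lambda>p. u (fst p) (snd p))" "continuous_on Q (\<lambda>p. w (fst p) (snd p))"
          using continuous_on_subset[OF growth_cont[OF gr(3)], of Q] w
            continuous_on_subset[of "{0..T} \<times> UNIV" "\<lambda>(t, x). w t x" Q]
          unfolding classical_witness_def by (simp_all add: case_prod_beta)
      qed
      then have "continuous_on Q (\<lambda>p. G (fst p) (snd p))"
        unfolding G_def \<psi>_def using QD
        by (intro continuous_on_diff continuous_on_mult continuous_on_divide continuous_on_exp
          continuous_on_const continuous_on_fst continuous_on_snd continuous_on_id continuous_on_poly_weight) auto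
      then obtain p where p: "p \<in> Q" "\<forall>p'\<in>Q. G (fst p') (snd p') \<le> G (fst p) (snd p)"
        using continuous_attains_sup[OF compQ Qne, of "\<lambda>p. G (fst p) (snd p)"] by auto
      obtain s z where sz: "p = (s, z)" by (cases p)
      have szQ: "(s, z) \<in> Q" and Gs: "0 < G s z"
      proof -
        show "(s, z) \<in> Q" using p(1) by (simp add: sz)
        have "G t x \<le> G s z" using p(2) txQ by (auto simp: sz)
        then show "0 < G s z" using pos by simp
      qed
      have s: "0 < s" "s \<le> T" and z: "z \<in> Rd d" using szQ QD by auto
      have glob: "G r v \<le> G s z" if "0 < r" "r \<le> T" "v \<in> Rd d" for r v
      proof (cases "(r, v) \<in> Q")
        case True then show ?thesis using p(2) by (auto simp: sz)
      next
        case False then show ?thesis using outside[OF that] Gs by simp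
      qed
      \<comment> \<open>At the terminal time \<open>u\<close> is at most \<open>g\<close>, and
        \<open>w\<close> differs from \<open>g\<close> by at most \<delta> times the weight, for
        which \<delta> \<psi> compensates.\<close>
      have "s \<noteq> T"
      proof
        assume "s = T"
        have "g z = feynman_kac d T h g T z"
          using continuous_on_pair_comp[OF growth_cont[OF gr(2)], of UNIV "\<lambda>_. 0" "\<lambda>x. x"]
          by (simp add: fk_terminal)
        then have "g z - w T z \<le> \<delta> * ?W z" using wy[rule_format, of T z] T by (auto simp: abs_le_iff)
        then have "u T z - w T z \<le> \<delta> * \<psi> T z" using uT[of z] mult_left_mono[OF \<psi>ge[OF order_refl, of z] less_imp_le[OF \<delta>]] by linarith
        then have "G T z \<le> - \<eta> / T" by (simp add: G_def)
        moreover have "0 < \<eta> / T" using \<eta> T by simp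
        ultimately show False using Gs \<open>s = T\<close> by simp
      qed
      then have s': "s \<in> {0<..<T}" using s by auto
      \<comment> \<open>Adding the maximal value \<open>G s z\<close> lifts the function so that it
        touches \<open>u\<close> from above at (s, z).\<close>
      define \<phi> where "\<phi> t x = w t x + (\<delta> * exp (\<nu> * (T - t)) * ?W x + (\<eta> / t + G s z))" for t x
      have "C12_with_derivs T d w wt D H" using w unfolding classical_witness_def by blast
      from C12_add[OF this C12_add[OF C12_poly_weight[of T d \<delta> \<nu> m] C12_inverse_time[of T d \<eta> "G s z"]]]
      have "C12_with_derivs T d \<phi>
         (\<lambda>t x. wt t x + (- \<nu> * (\<delta> * exp (\<nu> * (T - t)) * ?W x) + - \<eta> / t\<^sup>2))
         (\<lambda>t x i. D t x i + (\<delta> * exp (\<nu> * (T - t)) * (real (2 * Suc m) * x i ^ (2 * m + 1)) + 0))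
         (\<lambda>t x i j. H t x i j + ((if i = j then \<delta> * exp (\<nu> * (T - t)) * (real (2 * Suc m) * (real (2 * m + 1) * x i ^ (2 * m))) else 0) + 0))"
        unfolding \<phi>_def .
      moreover have "\<phi> s z = u s z" by (simp add: \<phi>_def G_def \<psi>_def)
      moreover have "\<forall>r\<in>{0<..<T}. \<forall>v\<in>Rd d. u r v \<le> \<phi> r v"
      proof (intro ballI)
        fix r v assume "r \<in> {0<..<T}" "v \<in> Rd d"
        then have "G r v \<le> G s z" using glob by auto
        then show "u r v \<le> \<phi> r v" by (simp add: \<phi>_def G_def[of r v] \<psi>_def)
      qed
      ultimately have "0 \<le> (wt s z + (- \<nu> * (\<delta> * exp (\<nu> * (T - s)) * ?W z) + - \<eta> / s\<^sup>2))
         + 1/2 * (\<Sum>i<d. H s z i i + ((if i = i then \<delta> * exp (\<nu> * (T - s)) * (real (2 * Suc m) * (real (2 * m + 1) * z i ^ (2 * m))) else 0) + 0)) + h s z"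
        using sub s' z unfolding heat_subsolution_def by blast
      also have "(\<Sum>i<d. H s z i i + ((if i = i then \<delta> * exp (\<nu> * (T - s)) * (real (2 * Suc m) * (real (2 * m + 1) * z i ^ (2 * m))) else 0) + 0))
         = (\<Sum>i<d. H s z i i) + \<delta> * exp (\<nu> * (T - s)) * (\<Sum>i<d. real (2 * Suc m) * (real (2 * m + 1) * z i ^ (2 * m)))"
        unfolding sum_distrib_left by (simp add: sum.distrib)
      also have "(wt s z + (- \<nu> * (\<delta> * exp (\<nu> * (T - s)) * ?W z) + - \<eta> / s\<^sup>2))
         + 1/2 * ((\<Sum>i<d. H s z i i) + \<delta> * exp (\<nu> * (T - s)) * (\<Sum>i<d. real (2 * Suc m) * (real (2 * m + 1) * z i ^ (2 * m)))) + h s z = (wt s z + 1/2 * (\<Sum>i<d. H s z i i) + q s z) + (h s z - q s z) - \<nu> * (\<delta> * \<psi> s z) - \<eta> / s\<^sup>2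
         + \<delta> * exp (\<nu> * (T - s)) * (1/2 * (\<Sum>i<d. real (2 * Suc m) * (real (2 * m + 1) * z i ^ (2 * m))))"
        unfolding \<psi>_def by (simp only: distrib_left minus_mult_left[symmetric] mult_ac)
      \<comment> \<open>The unit reserved in \<nu> pays for the source error \<open>h - q\<close>;
        only the strictly negative derivative of the barrier remains.\<close>
      also have "\<dots> \<le> 0 + \<delta> * \<psi> s z - \<nu> * (\<delta> * \<psi> s z) - \<eta> / s\<^sup>2 + (\<nu> - 1) * (\<delta> * \<psi> s z)"
      proof -
        have "wt s z + 1/2 * (\<Sum>i<d. H s z i i) + q s z = 0"
          using w s' unfolding classical_witness_def by auto
        moreover have "h s z - q s z \<le> \<delta> * \<psi> s z"
        proof -
          have "\<bar>h s z - q s z\<bar> \<le> \<delta> * ?W z" using qh s by auto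
          then show ?thesis using mult_left_mono[OF \<psi>ge[OF s(2), of z], of \<delta>] \<delta> by linarith
        qed
        moreover have "\<delta> * exp (\<nu> * (T - s)) * (1/2 * (\<Sum>i<d. real (2 * Suc m) * (real (2 * m + 1) * z i ^ (2 * m))))
            \<le> \<delta> * exp (\<nu> * (T - s)) * ((\<nu> - 1) * ?W z)"
          using \<delta> by (intro mult_left_mono hess) auto
        then have "\<delta> * exp (\<nu> * (T - s)) * (1/2 * (\<Sum>i<d. real (2 * Suc m) * (real (2 * m + 1) * z i ^ (2 * m))))
            \<le> (\<nu> - 1) * (\<delta> * \<psi> s z)"
          by (simp only: \<psi>_def mult_ac)
        ultimately show ?thesis by linarith
      qed
      also have "\<dots> = - (\<eta> / s\<^sup>2)" by (simp add: algebra_simps)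
      also have "\<dots> < 0" using \<eta> s by simp
      finally show False by simp
    qed
    moreover have "w t x \<le> feynman_kac d T h g t x + \<delta> * ?W x"
      using wy[rule_format, of t x] t by (auto simp: abs_le_iff)
    ultimately show ?thesis by (simp add: G_def)
  qed
  \<comment> \<open>With \<eta> = \<delta> all error terms together are \<delta> times this fixed
    \<open>K\<close>, and \<delta> is arbitrary.\<close>
  define K where "K = ?W x + \<psi> t x + 1 / t"
  have K: "0 < K" using poly_weight_pos[of d "Suc m" x] \<psi>ge[OF t(2), of x] t by (simp add: K_def add_pos_pos)
  show ?thesis
  proof (rule field_le_epsilon)
    fix e :: real assume "0 < e"
    then have "0 < e / K" using K by simp
    moreover define \<delta> where "\<delta> = e / K"
    ultimately have "0 < \<delta>" by simp
    from step[OF this this] have "u t x \<le> feynman_kac d T h g t x + \<delta> * K"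
      by (simp add: K_def algebra_simps)
    then show "u t x \<le> feynman_kac d T h g t x + e" using K by (simp add: \<delta>_def)
  qed
qed

section \<open>The semilinear equation\<close>

text \<open>The counterpart of \<open>proj\<close> for the time: composition with both extends a
  function from [0,T] and R^d to a total one.\<close>

definition clip :: "real \<Rightarrow> real \<Rightarrow> real" where
  "clip T t = max 0 (min T t)"

lemma clip_range: "0 \<le> T \<Longrightarrow> 0 \<le> clip T t" "0 \<le> T \<Longrightarrow> clip T t \<le> T"
  by (auto simp: clip_def)

lemma clip_id [simp]: "0 \<le> t \<Longrightarrow> t \<le> T \<Longrightarrow> clip T t = t"
  by (auto simp: clip_def)

lemma continuous_on_clip [continuous_intros]: "continuous_on S F \<Longrightarrow> continuous_on S (\<lambda>x. clip T (F x))"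
  unfolding clip_def by (intro continuous_intros)

lemma measurable_clip [measurable]: "clip T \<in> borel_measurable borel"
  by (intro borel_measurable_continuous_onI continuous_intros)

lemma poly_weight_mono:
  assumes "m \<le> m'" shows "poly_weight d m x \<le> (1 + real d) * poly_weight d m' x"
proof -
  have "x i ^ (2 * m) \<le> 1 + x i ^ (2 * m')" for i
  proof (cases "\<bar>x i\<bar> \<le> 1")
    case True
    then have "\<bar>x i\<bar> ^ (2 * m) \<le> 1" by (intro power_le_one) auto
    moreover have "\<bar>x i\<bar> ^ (2 * m) = x i ^ (2 * m)" by (rule power_even_abs) simp
    moreover have "0 \<le> x i ^ (2 * m')" by (rule zero_le_even_power) simp
    ultimately show ?thesis by linarith
  next
    case False
    then have "\<bar>x i\<bar> ^ (2 * m) \<le> \<bar>x i\<bar> ^ (2 * m')" using assms by (intro power_increasing) auto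
    then show ?thesis by (simp add: power_even_abs)
  qed
  then have "(\<Sum>i<d. x i ^ (2 * m)) \<le> (\<Sum>i<d. 1 + x i ^ (2 * m'))" by (intro sum_mono)
  moreover have "0 \<le> (\<Sum>i<d. x i ^ (2 * m'))" by (intro sum_nonneg zero_le_even_power) auto
  then have "0 \<le> real d * (\<Sum>i<d. x i ^ (2 * m'))" by simp
  ultimately show ?thesis by (simp add: sum.distrib poly_weight_def algebra_simps)
qed

lemma growth_mono:
  assumes "growth d T m h" "m \<le> m'" shows "growth d T m' h"
proof -
  obtain C where C0: "0 \<le> C" and C: "\<forall>t\<in>{0..T}. \<forall>x. \<bar>h t x\<bar> \<le> C * poly_weight d m x"
    by (rule growthE[OF assms(1)])
  have "\<forall>t\<in>{0..T}. \<forall>x. \<bar>h t x\<bar> \<le> (C * (1 + real d)) * poly_weight d m' x"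
  proof (intro ballI allI)
    fix t x assume "t \<in> {0..T}"
    then have "\<bar>h t x\<bar> \<le> C * poly_weight d m x" using C by auto
    also have "\<dots> \<le> C * ((1 + real d) * poly_weight d m' x)"
      using C0 by (intro mult_left_mono poly_weight_mono assms)
    finally show "\<bar>h t x\<bar> \<le> (C * (1 + real d)) * poly_weight d m' x" by (simp add: mult.assoc)
  qed
  then show ?thesis using assms(1) unfolding growth_def by blast
qed

text \<open>Together with \<open>poly_weight_le_norm_powr\<close> this translates growth in the
  Euclidean norm, in which data and solutions are described, into polynomial weights and
  back.\<close>

lemma norm_powr_le_poly_weight:
  assumes q: "0 \<le> q" "q \<le> real (2 * m)"
  shows "norm_Rd d x powr q \<le> (1 + real d ^ m) * poly_weight d m x"
proof (cases "norm_Rd d x \<le> 1")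
  case True
  have "norm_Rd d x powr q \<le> 1" using True q by (intro powr_le1) (auto simp: L2_set_nonneg)
  also have "1 \<le> (1 + real d ^ m) * poly_weight d m x"
    using mult_mono[of 1 "1 + real d ^ m" 1 "poly_weight d m x"] poly_weight_ge_1[of d m x] by simp
  finally show ?thesis .
next
  case False
  then have d: "0 < d" by (cases d) (auto simp: L2_set_def)
  have "norm_Rd d x powr q \<le> norm_Rd d x powr real (2 * m)"
    using False q by (intro powr_mono) auto
  also have "\<dots> = norm_Rd d x ^ (2 * m)" using False by (subst powr_realpow) auto
  also have "\<dots> = (\<Sum>i<d. (x i)\<^sup>2) ^ m"
    by (simp add: L2_set_def power_mult sum_nonneg)
  also have "\<dots> \<le> real d ^ m * poly_weight d m x"
  proof -
    let ?A = "(\<lambda>i. (x i)\<^sup>2) ` {..<d}"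
    have "Max ?A \<in> ?A" using d by (intro Max_in) auto
    then obtain j where j: "j < d" "Max ?A = (x j)\<^sup>2" by auto
    have "(\<Sum>i<d. (x i)\<^sup>2) \<le> real d * (x j)\<^sup>2"
      using sum_bounded_above[of "{..<d}" "\<lambda>i. (x i)\<^sup>2" "(x j)\<^sup>2"] j(2)[symmetric] by simp
    then have "(\<Sum>i<d. (x i)\<^sup>2) ^ m \<le> (real d * (x j)\<^sup>2) ^ m"
      by (intro power_mono) (auto simp: sum_nonneg)
    also have "\<dots> = real d ^ m * x j ^ (2 * m)" by (simp add: power_mult_distrib power_mult)
    also have "\<dots> \<le> real d ^ m * poly_weight d m x"
      unfolding poly_weight_def using j(1)
      by (intro mult_left_mono) (auto intro!: add_increasing member_le_sum zero_le_even_power)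
    finally show ?thesis .
  qed
  also have "\<dots> \<le> (1 + real d ^ m) * poly_weight d m x"
    using poly_weight_pos[of d m x] by (intro mult_right_mono) auto
  finally show ?thesis .
qed

lemma poly_weight_le_norm_powr:
  assumes "1 \<le> m"
  shows "poly_weight d m x \<le> (1 + real d) * (1 + norm_Rd d x powr real (2 * m))"
proof -
  have "x i ^ (2 * m) \<le> norm_Rd d x powr real (2 * m)" if "i < d" for i
  proof (cases "norm_Rd d x = 0")
    case True
    then have "x i = 0" using that by (simp add: L2_set_eq_0_iff)
    then show ?thesis using assms by (simp add: zero_power)
  next
    case False
    then have pos: "0 < norm_Rd d x" using L2_set_nonneg[of x "{..<d}"] by linarith
    have "(x i)\<^sup>2 \<le> (\<Sum>i<d. (x i)\<^sup>2)" using that by (intro member_le_sum) auto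
    then have "((x i)\<^sup>2) ^ m \<le> (\<Sum>i<d. (x i)\<^sup>2) ^ m" by (intro power_mono) auto
    also have "\<dots> = norm_Rd d x ^ (2 * m)" by (simp add: L2_set_def power_mult sum_nonneg)
    also have "\<dots> = norm_Rd d x powr real (2 * m)" using pos by (subst powr_realpow) auto
    finally show ?thesis by (simp add: power_mult)
  qed
  then have "(\<Sum>i<d. x i ^ (2 * m)) \<le> (\<Sum>i<d. norm_Rd d x powr real (2 * m))" by (intro sum_mono) auto
  then have "poly_weight d m x \<le> 1 + real d * norm_Rd d x powr real (2 * m)" by (simp add: poly_weight_def)
  also have "\<dots> \<le> (1 + real d) * (1 + norm_Rd d x powr real (2 * m))" by (simp add: algebra_simps)
  finally show ?thesis .
qed

text \<open>Concavity of the square root turns the semigroup identity into an inequality: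
  \<surd>\<Phi> is a supermartingale along Brownian motion. This serves the first-moment bound on
  the exact solution, while the mean square errors use \<Phi> itself.\<close>

lemma nn_integral_sqrt_gauss_weight:
  assumes "0 \<le> a" "0 \<le> t" "0 \<le> s" "2 * a * (t + s) < 1" and A: "0 < A"
  shows "(\<integral>\<^sup>+z. ennreal (sqrt (A * gauss_weight d a t (heat_shift x s z))) \<partial>gauss d)
    \<le> ennreal (sqrt (A * gauss_weight d a (t + s) x))"
proof -
  define S where "S = sqrt (A * gauss_weight d a (t + s) x)"
  have gpos: "0 < A * gauss_weight d a (t + s) x"
    using assms by (simp add: gauss_weight_def)
  then have S: "0 < S" "S * S = A * gauss_weight d a (t + s) x" by (auto simp: S_def)
  have "2 * a * t \<le> 2 * a * (t + s)" using assms by (intro mult_left_mono) auto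
  then have t1: "2 * a * t < 1" using assms by linarith
  \<comment> \<open>Jensen's inequality through \<open>\<surd>w \<le> (w/S + S)/2\<close>\<close>
  have sqrt_le: "sqrt w \<le> w / (2 * S) + S / 2" if "0 \<le> w" for w
  proof -
    have "0 \<le> (sqrt w - S)\<^sup>2" by simp
    then have "2 * S * sqrt w \<le> w + S * S" using that by (simp add: power2_diff algebra_simps power2_eq_square)
    then have "sqrt w \<le> (w + S * S) / (2 * S)" using S by (simp add: pos_le_divide_eq mult_ac)
    then show ?thesis using S(1) by (simp add: add_divide_distrib)
  qed
  have "(\<integral>\<^sup>+z. ennreal (sqrt (A * gauss_weight d a t (heat_shift x s z))) \<partial>gauss d)
    \<le> (\<integral>\<^sup>+z. ennreal (A / (2 * S)) * ennreal (gauss_weight d a t (heat_shift x s z)) + ennreal (S / 2) \<partial>gauss d)"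
  proof (rule nn_integral_mono)
    fix z
    have g0: "0 \<le> gauss_weight d a t (heat_shift x s z)" by (rule gauss_weight_nonneg[OF t1])
    then have "sqrt (A * gauss_weight d a t (heat_shift x s z)) \<le> A / (2 * S) * gauss_weight d a t (heat_shift x s z) + S / 2"
      using sqrt_le[of "A * gauss_weight d a t (heat_shift x s z)"] A by simp
    then show "ennreal (sqrt (A * gauss_weight d a t (heat_shift x s z)))
      \<le> ennreal (A / (2 * S)) * ennreal (gauss_weight d a t (heat_shift x s z)) + ennreal (S / 2)"
      using A S g0 by (simp flip: ennreal_mult ennreal_plus)
  qed
  also have "\<dots> = ennreal (A / (2 * S)) * ennreal (gauss_weight d a (t + s) x) + ennreal (S / 2)"
    using nn_integral_gauss_weight[OF assms(1-4)] gauss.emeasure_space_1[of d]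
    by (subst nn_integral_add) (auto simp: nn_integral_cmult)
  also have "\<dots> = ennreal (A / (2 * S) * gauss_weight d a (t + s) x + S / 2)"
    using A S gauss_weight_nonneg[OF assms(4)] by (simp flip: ennreal_mult ennreal_plus)
  also have "A / (2 * S) * gauss_weight d a (t + s) x + S / 2 = S"
    using S by (simp add: field_simps)
  finally show ?thesis by (simp add: S_def)
qed

lemma unif_exp_integral:
  assumes "0 \<le> L" "0 \<le> \<tau>"
  shows "(\<integral>\<^sup>+u. ennreal (\<tau> * L * exp (L * ((1 - u) * \<tau>))) \<partial>unif) = ennreal (exp (L * \<tau>) - 1)"
proof -
  define F where "F u = - exp (L * ((1 - u) * \<tau>))" for u
  have "(F has_real_derivative \<tau> * L * exp (L * ((1 - u) * \<tau>))) (at u)" for u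
    unfolding F_def by (auto intro!: derivative_eq_intros)
  moreover have "continuous_on UNIV (\<lambda>u. \<tau> * L * exp (L * ((1 - u) * \<tau>)))" by (intro continuous_intros)
  ultimately have "integrable unif (\<lambda>u. \<tau> * L * exp (L * ((1 - u) * \<tau>)))"
    "(\<integral>u. \<tau> * L * exp (L * ((1 - u) * \<tau>)) \<partial>unif) = F 1 - F 0"
    by (intro unif_FTC[of F]; blast)+
  then show ?thesis
    using assms by (subst nn_integral_eq_integral) (auto simp: F_def)
qed

lemma nn_integral_noise_iterated:
  assumes [measurable]: "F \<in> borel_measurable (borel \<Otimes>\<^sub>M borel)"
  shows "(\<integral>\<^sup>+p. F p \<partial>noise d) = (\<integral>\<^sup>+u. (\<integral>\<^sup>+z. F (u, z) \<partial>gauss d) \<partial>unif)"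
  unfolding noise_def by (subst gauss.nn_integral_fst[symmetric]) auto

lemma AE_unif: "AE u in unif. 0 \<le> u \<and> u \<le> 1"
proof -
  have "AE u in unif. u \<in> {0..1}" by (rule AE_uniform_measureI) auto
  then show ?thesis by simp
qed

section \<open>Fixed points of the Picard operator\<close>

locale semilinear =
  fixes d m :: nat and T L :: real
    and f :: "real \<Rightarrow> (nat \<Rightarrow> real) \<Rightarrow> real \<Rightarrow> real" and g :: "(nat \<Rightarrow> real) \<Rightarrow> real"
  assumes T: "0 < T" and L: "0 \<le> L"
    and f_cont: "continuous_on UNIV (\<lambda>(t, x, v). f t x v)"
    and f_lip: "\<And>t x v w. 0 \<le> t \<Longrightarrow> t \<le> T \<Longrightarrow> \<bar>f t x v - f t x w\<bar> \<le> L * \<bar>v - w\<bar>"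
    and f_proj: "\<And>t x v. f t (proj d x) v = f t x v" and g_proj: "\<And>x. g (proj d x) = g x"
    and f_growth: "growth d T m (\<lambda>t x. f t x 0)" and g_growth: "growth d T m (\<lambda>_. g)"
begin

definition picard :: "(real \<Rightarrow> (nat \<Rightarrow> real) \<Rightarrow> real) \<Rightarrow> real \<Rightarrow> (nat \<Rightarrow> real) \<Rightarrow> real" where
  "picard u = feynman_kac d T (\<lambda>t x. f t x (u t x)) g"

lemma g_cont: "continuous_on UNIV g"
  using continuous_on_pair_comp[OF growth_cont[OF g_growth], of UNIV "\<lambda>_. 0" "\<lambda>x. x"] by simp

lemma growth_comp:
  assumes u: "growth d T n u" and "m \<le> n"
  shows "growth d T n (\<lambda>t x. f t x (u t x))"
proof -
  have f0: "growth d T n (\<lambda>t x. f t x 0)" by (rule growth_mono[OF f_growth assms(2)])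
  obtain C where C: "0 \<le> C" "\<forall>t\<in>{0..T}. \<forall>x. \<bar>u t x\<bar> \<le> C * poly_weight d n x"
    by (rule growthE[OF u])
  obtain B where B: "0 \<le> B" "\<forall>t\<in>{0..T}. \<forall>x. \<bar>f t x 0\<bar> \<le> B * poly_weight d n x"
    by (rule growthE[OF f0])
  have "\<forall>t\<in>{0..T}. \<forall>x. \<bar>f t x (u t x)\<bar> \<le> (B + L * C) * poly_weight d n x"
  proof (intro ballI allI)
    fix t x assume t: "t \<in> {0..T}"
    have "\<bar>f t x (u t x)\<bar> \<le> \<bar>f t x 0\<bar> + L * \<bar>u t x\<bar>" using f_lip[of t x "u t x" 0] t by auto
    also have "\<dots> \<le> B * poly_weight d n x + L * (C * poly_weight d n x)"
      using B C L t by (intro add_mono mult_left_mono) auto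
    finally show "\<bar>f t x (u t x)\<bar> \<le> (B + L * C) * poly_weight d n x" by (simp add: algebra_simps)
  qed
  moreover have "continuous_on UNIV (\<lambda>p. (\<lambda>(t, x, v). f t x v) (fst p, snd p, u (fst p) (snd p)))"
    using growth_cont[OF u]
    by (intro continuous_on_compose2[OF f_cont] continuous_intros) (auto simp: case_prod_beta)
  ultimately show ?thesis unfolding growth_def by (auto simp: case_prod_beta)
qed

text \<open>The Lipschitz bound passes the exponential weight on to the difference of the sources,
  so the gain 1/\<nu> of \<open>fk_bound_exp\<close> appears in front.\<close>

lemma picard_contraction:
  assumes u: "growth d T n u" "growth d T n v" "m \<le> n" and c: "0 \<le> c" and \<nu>: "0 < \<nu>"
    and diff: "\<And>t x. 0 \<le> t \<Longrightarrow> t \<le> T \<Longrightarrow> \<bar>u t x - v t x\<bar> \<le> c * exp (\<nu> * (T - t)) * poly_weight d n x"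
    and t: "0 \<le> t" "t \<le> T"
  shows "\<bar>picard u t x - picard v t x\<bar> \<le> (fk_const d T n * L / \<nu>) * c * exp (\<nu> * (T - t)) * poly_weight d n x"
proof -
  have gr: "growth d T n (\<lambda>t x. f t x (u t x))" "growth d T n (\<lambda>t x. f t x (v t x))" "growth d T n (\<lambda>_. g)"
    using growth_comp[OF u(1,3)] growth_comp[OF u(2,3)] growth_mono[OF g_growth u(3)] by auto
  have "picard u t x - picard v t x = feynman_kac d T (\<lambda>t x. f t x (u t x) - f t x (v t x)) (\<lambda>x. g x - g x) t x"
    unfolding picard_def by (rule fk_diff[symmetric, OF gr(1,3,2,3) t])
  also have "\<bar>\<dots>\<bar> \<le> fk_const d T n * (0 + (L * c) * exp (\<nu> * (T - t)) / \<nu>) * poly_weight d n x"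
  proof (rule fk_bound_exp[OF t \<nu>])
    show "continuous_on UNIV (\<lambda>(t, x). f t x (u t x) - f t x (v t x))"
      by (rule growth_cont[OF growth_diff[OF gr(1,2)]])
    fix s x assume s: "0 \<le> s" "s \<le> T"
    have "\<bar>f s x (u s x) - f s x (v s x)\<bar> \<le> L * \<bar>u s x - v s x\<bar>" by (rule f_lip[OF s])
    also have "\<dots> \<le> L * (c * exp (\<nu> * (T - s)) * poly_weight d n x)" using diff[OF s] L by (intro mult_left_mono)
    finally show "\<bar>f s x (u s x) - f s x (v s x)\<bar> \<le> L * c * exp (\<nu> * (T - s)) * poly_weight d n x"
      by (simp add: mult.assoc)
  qed (use L c in auto)
  finally show ?thesis by (simp add: mult_ac)
qed

text \<open>Uniqueness is stated in every degree \<open>n\<close> from \<open>m\<close> on, because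
  a viscosity solution is only known to grow polynomially, possibly faster than the data.\<close>

lemma fixpoint_unique:
  assumes u: "growth d T n u" "growth d T n v" "m \<le> n"
    and fp: "\<And>t x. 0 \<le> t \<Longrightarrow> t \<le> T \<Longrightarrow> u t x = picard u t x" "\<And>t x. 0 \<le> t \<Longrightarrow> t \<le> T \<Longrightarrow> v t x = picard v t x"
    and t: "0 \<le> t" "t \<le> T"
  shows "u t x = v t x"
proof -
  define \<nu> where "\<nu> = 2 * fk_const d T n * L + 1"
  have k: "1 \<le> fk_const d T n" using fk_const_ge_1 T by simp
  have \<nu>: "0 < \<nu>" "fk_const d T n * L / \<nu> \<le> 1/2"
    using k L by (auto simp: \<nu>_def add_nonneg_pos pos_divide_le_eq add_pos_nonneg)
  obtain C where C: "0 \<le> C" "\<forall>t\<in>{0..T}. \<forall>x. \<bar>u t x - v t x\<bar> \<le> C * poly_weight d n x"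
    by (rule growthE[OF growth_diff[OF u(1,2)]])
  have "\<forall>t x. 0 \<le> t \<longrightarrow> t \<le> T \<longrightarrow> \<bar>u t x - v t x\<bar> \<le> (C * (1/2) ^ j) * exp (\<nu> * (T - t)) * poly_weight d n x" for j
  proof (induction j)
    case 0
    show ?case
    proof (intro allI impI)
      fix t x assume t: "0 \<le> t" "t \<le> T"
      have "\<bar>u t x - v t x\<bar> \<le> C * 1 * poly_weight d n x" using C t by auto
      also have "\<dots> \<le> C * exp (\<nu> * (T - t)) * poly_weight d n x"
        using C(1) \<nu> t poly_weight_pos[of d n x] by (intro mult_right_mono mult_left_mono) auto
      finally show "\<bar>u t x - v t x\<bar> \<le> C * (1/2) ^ 0 * exp (\<nu> * (T - t)) * poly_weight d n x" by simp
    qed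
  next
    case (Suc j)
    show ?case
    proof (intro allI impI)
      fix t x assume t: "0 \<le> t" "t \<le> T"
      have "\<bar>u t x - v t x\<bar> \<le> (fk_const d T n * L / \<nu>) * (C * (1/2) ^ j) * exp (\<nu> * (T - t)) * poly_weight d n x"
        using picard_contraction[OF u _ \<nu>(1), of "C * (1/2) ^ j" t x] Suc C(1) t by (simp add: fp[OF t])
      also have "\<dots> \<le> (1/2) * (C * (1/2) ^ j) * exp (\<nu> * (T - t)) * poly_weight d n x"
        using \<nu>(2) C(1) poly_weight_pos[of d n x] by (intro mult_right_mono) auto
      finally show "\<bar>u t x - v t x\<bar> \<le> C * (1/2) ^ Suc j * exp (\<nu> * (T - t)) * poly_weight d n x" by simp
    qed
  qed
  then have "\<bar>u t x - v t x\<bar> \<le> (1/2) ^ j * (C * exp (\<nu> * (T - t)) * poly_weight d n x)" for j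
    using t by (simp add: mult_ac)
  moreover have "(\<lambda>j. (1/2) ^ j * (C * exp (\<nu> * (T - t)) * poly_weight d n x)) \<longlonglongrightarrow> 0 * (C * exp (\<nu> * (T - t)) * poly_weight d n x)"
    by (intro tendsto_mult tendsto_const LIMSEQ_power_zero) auto
  ultimately have "\<bar>u t x - v t x\<bar> \<le> 0"
    by (intro LIMSEQ_le_const[of _ 0]) auto
  then show ?thesis by simp
qed

text \<open>Banach's theorem on bounded continuous functions, restricted to the closed set cut out
  by a bound \<open>V\<close> that the Picard operator preserves; in this way the fixed point
  inherits the bound.\<close>

lemma fixpoint_exists:
  assumes V0: "\<And>t x. 0 \<le> V t x"
    and V: "\<And>u t x. growth d T m u \<Longrightarrow> (\<And>t x. 0 \<le> t \<Longrightarrow> t \<le> T \<Longrightarrow> \<bar>u t x\<bar> \<le> V t x) \<Longrightarrow>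
        0 \<le> t \<Longrightarrow> t \<le> T \<Longrightarrow> \<bar>picard u t x\<bar> \<le> V t x"
  obtains y where "growth d T m y" "\<forall>t x. y t (proj d x) = y t x" "\<forall>t\<in>{0..T}. \<forall>x. y t x = picard y t x"
    "\<forall>t\<in>{0..T}. \<forall>x. \<bar>y t x\<bar> \<le> V t x"
proof -
  let ?D = "poly_weight d m"
  define \<nu> where "\<nu> = 2 * fk_const d T m * L + 1"
  have k: "1 \<le> fk_const d T m" using fk_const_ge_1 T by simp
  have \<nu>: "0 < \<nu>" "fk_const d T m * L / \<nu> \<le> 1/2"
    using k L by (auto simp: \<nu>_def add_nonneg_pos pos_divide_le_eq add_pos_nonneg)
  define \<omega> where "\<omega> t x = exp (\<nu> * (T - clip T t)) * ?D x" for t x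
  have \<omega>: "0 < \<omega> t x" for t x using poly_weight_pos[of d m x] by (simp add: \<omega>_def)
  have \<omega>_proj: "\<omega> t (proj d x) = \<omega> t x" for t x by (simp add: \<omega>_def poly_weight_proj)
  have \<omega>_le: "\<omega> t x \<le> exp (\<nu> * T) * ?D x" for t x
    unfolding \<omega>_def using \<nu> clip_range[of T t] T poly_weight_pos[of d m x]
    by (intro mult_right_mono) auto
  have \<omega>_cont: "continuous_on S (\<lambda>p. \<omega> (fst p) (snd p))" for S :: "(real \<times> (nat \<Rightarrow> real)) set"
    unfolding \<omega>_def by (intro continuous_intros)
  \<comment> \<open>A bounded function stands for the quotient of a candidate by the weight
    \<omega>. Clamping its arguments makes the candidate invariant under \<open>proj\<close> and
    determined by its values on [0,T].\<close>
  define of_b where "of_b b t x = apply_bcontfun b (clip T t, proj d x) * \<omega> t x"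
    for b :: "(real \<times> (nat \<Rightarrow> real)) \<Rightarrow>\<^sub>C real" and t x
  have of_b_growth: "growth d T m (of_b b)" for b
  proof -
    have "\<forall>t\<in>{0..T}. \<forall>x. \<bar>of_b b t x\<bar> \<le> (norm b * exp (\<nu> * T)) * ?D x"
    proof (intro ballI allI)
      fix t x
      have "\<bar>of_b b t x\<bar> \<le> norm b * (exp (\<nu> * T) * ?D x)"
        unfolding of_b_def abs_mult using norm_bounded[of b "(clip T t, proj d x)"] \<omega>_le[of t x] \<omega>[of t x]
        by (intro mult_mono) auto
      then show "\<bar>of_b b t x\<bar> \<le> (norm b * exp (\<nu> * T)) * ?D x" by (simp add: mult.assoc)
    qed
    moreover have "continuous_on UNIV (\<lambda>p. of_b b (fst p) (snd p))"
      unfolding of_b_def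
      by (intro continuous_on_mult \<omega>_cont continuous_on_compose2[OF continuous_on_apply_bcontfun[of UNIV b]] continuous_intros) auto
    ultimately show ?thesis unfolding growth_def by (auto simp: case_prod_beta)
  qed
  have of_b_proj: "of_b b t (proj d x) = of_b b t x" for b t x by (simp add: of_b_def \<omega>_proj)
  have of_b_proj': "f t (proj d x) (of_b b t (proj d x)) = f t x (of_b b t x)" for b t x
    by (simp add: of_b_proj f_proj)
  define Gf where "Gf b p = picard (of_b b) (clip T (fst p)) (snd p) / \<omega> (fst p) (snd p)" for b p
  have Gf_bcont: "Gf b \<in> bcontfun" for b
  proof -
    obtain C1 where C1: "0 \<le> C1" "\<forall>t\<in>{0..T}. \<forall>x. \<bar>f t x (of_b b t x)\<bar> \<le> C1 * ?D x"
      by (rule growthE[OF growth_comp[OF of_b_growth order_refl]])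
    obtain C2 where C2: "0 \<le> C2" "\<forall>t\<in>{0..T}. \<forall>x. \<bar>g x\<bar> \<le> C2 * ?D x"
      by (rule growthE[OF g_growth])
    have "continuous_on ({0..T} \<times> UNIV) (\<lambda>(t, x). picard (of_b b) t x)"
      unfolding picard_def
      by (rule continuous_on_fk[OF T growth_comp[OF of_b_growth order_refl] g_growth of_b_proj' g_proj])
    then have "continuous_on UNIV (\<lambda>p. (\<lambda>(t, x). picard (of_b b) t x) (clip T (fst p), snd p))"
      by (rule continuous_on_compose2) (use clip_range[of T] T in \<open>auto intro!: continuous_intros\<close>)
    then have "continuous_on UNIV (Gf b)"
      unfolding Gf_def[abs_def] using \<omega> \<omega>_cont[of UNIV]
      by (intro continuous_on_divide) (auto simp: less_imp_neq[THEN not_sym])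
    moreover have "norm (Gf b p) \<le> fk_const d T m * (C2 + C1 * exp T)" for p
    proof -
      obtain t x where p: "p = (t, x)" by (cases p)
      have "0 \<le> clip T t" "clip T t \<le> T" using clip_range[of T t] T by auto
      then have "\<bar>picard (of_b b) (clip T t) x\<bar> \<le> fk_const d T m * (C2 + C1 * exp T) * ?D x"
        unfolding picard_def using C1 C2 T
        by (intro fk_bound growth_cont[OF growth_comp[OF of_b_growth order_refl]] g_cont) auto
      also have "\<dots> \<le> fk_const d T m * (C2 + C1 * exp T) * \<omega> t x"
      proof (rule mult_left_mono)
        have "0 \<le> \<nu> * (T - clip T t)" using \<nu>(1) clip_range[of T t] T by simp
        then have "1 \<le> exp (\<nu> * (T - clip T t))" by simp
        from mult_right_mono[OF this less_imp_le[OF poly_weight_pos[of d m x]]]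
        show "?D x \<le> \<omega> t x" by (simp add: \<omega>_def)
        show "0 \<le> fk_const d T m * (C2 + C1 * exp T)" using k C1(1) C2(1) by simp
      qed
      finally show ?thesis using \<omega>[of t x] by (simp add: Gf_def p abs_of_pos pos_divide_le_eq)
    qed
    ultimately show ?thesis by (rule bcontfun_normI)
  qed
  define G where "G b = Bcontfun (Gf b)" for b
  have G_apply: "apply_bcontfun (G b) p = Gf b p" for b p
    unfolding G_def by (simp add: Bcontfun_inverse Gf_bcont)
  define S where "S = {b. \<forall>t\<in>{0..T}. \<forall>x. \<bar>of_b b t x\<bar> \<le> V t x}"
  have of_b_G: "of_b (G b) t x = picard (of_b b) t x" if "0 \<le> t" "t \<le> T" for b t x
  proof -
    have "picard (of_b b) t (proj d x) = picard (of_b b) t x"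
      unfolding picard_def by (rule fk_proj) (auto simp: of_b_proj f_proj g_proj)
    then show ?thesis
      using that \<omega>[of t x] by (simp add: of_b_def[of "G b"] G_apply Gf_def \<omega>_proj)
  qed
  have "\<exists>!b\<in>S. G b = b"
  proof (rule Banach_fix[where c = "1/2", OF complete_eq_closed[THEN iffD2]])
    \<comment> \<open>Evaluation at a point is 1-Lipschitz for the supremum distance, so each single
      constraint is closed.\<close>
    have "closed {b. \<bar>of_b b t x\<bar> \<le> V t x}" for t x
    proof (rule closed_Collect_le)
      have "continuous_on UNIV (\<lambda>b::(real \<times> (nat \<Rightarrow> real)) \<Rightarrow>\<^sub>C real. apply_bcontfun b p)" for p
        unfolding continuous_on_iff by (metis dist_bounded le_less_trans)
      then show "continuous_on UNIV (\<lambda>b. \<bar>of_b b t x\<bar>)"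
        unfolding of_b_def by (intro continuous_intros) auto
    qed simp
    moreover have "S = (\<Inter>t\<in>{0..T}. \<Inter>x. {b. \<bar>of_b b t x\<bar> \<le> V t x})" by (auto simp: S_def)
    ultimately show "closed S" by (simp add: closed_INT)
    have "0 \<in> S" using V0 by (simp add: S_def of_b_def)
    then show "S \<noteq> {}" by auto
    show "G ` S \<subseteq> S"
    proof (intro subsetI, elim imageE)
      fix b' b assume b: "b' = G b" "b \<in> S"
      have "\<bar>picard (of_b b) t x\<bar> \<le> V t x" if "0 \<le> t" "t \<le> T" for t x
        by (rule V[OF of_b_growth _ that]) (use b(2) in \<open>auto simp: S_def\<close>)
      then show "b' \<in> S" unfolding b(1) S_def by (auto simp: of_b_G)
    qed
    show "dist (G b) (G b') \<le> 1/2 * dist b b'" for b b'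
    proof (rule dist_bound)
      fix p :: "real \<times> (nat \<Rightarrow> real)"
      obtain t x where p: "p = (t, x)" by (cases p)
      let ?t = "clip T t"
      have t: "0 \<le> ?t" "?t \<le> T" using clip_range[of T t] T by auto
      have "\<bar>of_b b s z - of_b b' s z\<bar> \<le> dist b b' * exp (\<nu> * (T - s)) * ?D z" if "0 \<le> s" "s \<le> T" for s z
      proof -
        have "\<bar>of_b b s z - of_b b' s z\<bar> = dist (apply_bcontfun b (clip T s, proj d z)) (apply_bcontfun b' (clip T s, proj d z)) * \<omega> s z"
          unfolding of_b_def left_diff_distrib[symmetric] abs_mult dist_real_def using \<omega>[of s z] by simp
        also have "\<dots> \<le> dist b b' * \<omega> s z" using \<omega>[of s z] by (intro mult_right_mono dist_bounded) auto
        finally show ?thesis using that by (simp add: \<omega>_def mult.assoc)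
      qed
      from picard_contraction[OF of_b_growth of_b_growth order_refl zero_le_dist \<nu>(1) this t, of x]
      have "\<bar>picard (of_b b) ?t x - picard (of_b b') ?t x\<bar> \<le> (fk_const d T m * L / \<nu>) * (dist b b' * \<omega> t x)"
        by (simp add: \<omega>_def mult_ac)
      also have "\<dots> \<le> (1/2) * (dist b b' * \<omega> t x)"
        using \<nu>(2) \<omega>[of t x] by (intro mult_right_mono) auto
      finally show "dist (apply_bcontfun (G b) p) (apply_bcontfun (G b') p) \<le> 1/2 * dist b b'"
        using \<omega>[of t x]
        by (simp add: G_apply Gf_def p dist_real_def diff_divide_distrib[symmetric] abs_of_pos pos_divide_le_eq)
    qed
  qed auto
  then obtain b where b: "b \<in> S" "G b = b" by auto
  have "of_b b t x = picard (of_b b) t x" if "0 \<le> t" "t \<le> T" for t x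
    using of_b_G[OF that, of b x] b(2) by simp
  then show thesis
    using that[of "of_b b"] of_b_growth[of b] of_b_proj b(1) by (auto simp: S_def)
qed

text \<open>The bound reproduces itself. With \<tau> = T - t, the terminal value and
  \<open>f t x 0\<close> contribute 1 + \<tau> times \<open>S0\<close>, the Lipschitz part
  contributes (1 + \<tau>) (exp (L \<tau>) - 1) times \<open>S0\<close>, and these add up to (1 +
  \<tau>) exp (L \<tau>) times \<open>S0\<close>.\<close>

lemma picard_gauss_bound:
  assumes a: "0 \<le> a" "2 * a * T < 1" and A: "0 < A"
    and gA: "\<And>x. \<bar>g x\<bar> \<le> sqrt (A * gauss_weight d a 0 x)"
    and fA: "\<And>t x. 0 \<le> t \<Longrightarrow> t \<le> T \<Longrightarrow> \<bar>f t x 0\<bar> \<le> sqrt (A * gauss_weight d a 0 x)"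
    and u: "growth d T m u"
    and uV: "\<And>t x. 0 \<le> t \<Longrightarrow> t \<le> T \<Longrightarrow>
       \<bar>u t x\<bar> \<le> (1 + (T - t)) * exp (L * (T - t)) * sqrt (A * gauss_weight d a (T - t) x)"
    and t: "0 \<le> t" "t \<le> T"
  shows "\<bar>picard u t x\<bar> \<le> (1 + (T - t)) * exp (L * (T - t)) * sqrt (A * gauss_weight d a (T - t) x)"
proof -
  define \<tau> where "\<tau> = T - t"
  have \<tau>: "0 \<le> \<tau>" "\<tau> \<le> T" using t by (auto simp: \<tau>_def)
  have aT: "2 * a * s < 1" if "s \<le> T" for s
    using mult_left_mono[OF that, of "2 * a"] a by simp
  define S0 where "S0 = sqrt (A * gauss_weight d a \<tau> x)"
  have S0: "0 \<le> S0" using A gauss_weight_nonneg[OF aT[OF \<tau>(2)], of d x] by (simp add: S0_def)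
  define S where "S u z = sqrt (A * gauss_weight d a ((1 - u) * \<tau>) (heat_shift x (u * \<tau>) z))" for u z
  \<comment> \<open>The factor of the assumed bound at the intermediate time, 1 + (1 - u) \<tau>, is
    enlarged to 1 + \<tau>, so that the remaining exponential integrates exactly.\<close>
  define c where "c u = \<tau> + (1 + \<tau>) * (\<tau> * L * exp (L * ((1 - u) * \<tau>)))" for u
  define G0 where "G0 z = sqrt (A * gauss_weight d a 0 (heat_shift x \<tau> z))" for z
  have c0: "0 \<le> c u" for u using \<tau> L by (simp add: c_def)
  have [measurable]: "(\<lambda>p. S (fst p) (snd p)) \<in> borel_measurable (borel \<Otimes>\<^sub>M borel)"
    unfolding S_def by measurable
  have [measurable]: "c \<in> borel_measurable borel" unfolding c_def by measurable
  have [measurable]: "G0 \<in> borel_measurable borel" unfolding G0_def by measurable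
  have dom: "AE p in noise d. norm (fk_sample T (\<lambda>t x. f t x (u t x)) g t x p) \<le> G0 (snd p) + c (fst p) * S (fst p) (snd p)"
    using AE_noise
  proof eventually_elim
    case (elim p)
    obtain v z where p: "p = (v, z)" by (cases p)
    have v: "0 \<le> v" "v \<le> 1" using elim by (auto simp: p)
    have v\<tau>: "0 \<le> v * \<tau>" "v * \<tau> \<le> \<tau>" using v \<tau> mult_right_mono[of v 1 \<tau>] by auto
    define s where "s = t + v * \<tau>"
    have s: "0 \<le> s" "s \<le> T" "T - s = (1 - v) * \<tau>" using v\<tau> t by (auto simp: s_def \<tau>_def algebra_simps)
    let ?X = "heat_shift x (v * \<tau>) z"
    have "gauss_weight d a 0 ?X \<le> gauss_weight d a ((1 - v) * \<tau>) ?X"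
      using a aT[of "(1 - v) * \<tau>"] s v \<tau> by (intro gauss_weight_mono) auto
    then have "sqrt (A * gauss_weight d a 0 ?X) \<le> S v z"
      unfolding S_def using A by (intro real_sqrt_le_mono mult_left_mono) auto
    then have f0: "\<bar>f s ?X 0\<bar> \<le> S v z" using fA[OF s(1,2), of ?X] by linarith
    have Sv: "0 \<le> S v z" using f0 by linarith
    have "\<bar>u s ?X\<bar> \<le> (1 + (1 - v) * \<tau>) * exp (L * ((1 - v) * \<tau>)) * S v z"
      using uV[OF s(1,2), of ?X] unfolding s(3) S_def .
    also have "\<dots> \<le> (1 + \<tau>) * exp (L * ((1 - v) * \<tau>)) * S v z"
      using Sv v\<tau> by (intro mult_right_mono) (auto simp: algebra_simps)
    finally have "\<bar>f s ?X (u s ?X)\<bar> \<le> S v z + L * ((1 + \<tau>) * exp (L * ((1 - v) * \<tau>)) * S v z)"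
      using f_lip[OF s(1,2), of ?X "u s ?X" 0] f0 mult_left_mono[OF _ L, of "\<bar>u s ?X\<bar>"] by fastforce
    then have "\<tau> * \<bar>f s ?X (u s ?X)\<bar> \<le> \<tau> * (S v z + L * ((1 + \<tau>) * exp (L * ((1 - v) * \<tau>)) * S v z))"
      using \<tau> by (intro mult_left_mono) auto
    also have "\<dots> = c v * S v z" by (simp add: c_def algebra_simps)
    finally have "\<tau> * \<bar>f s ?X (u s ?X)\<bar> \<le> c v * S v z" .
    moreover have "\<bar>g (heat_shift x \<tau> z)\<bar> \<le> G0 z" unfolding G0_def by (rule gA)
    moreover have "norm (fk_sample T (\<lambda>t x. f t x (u t x)) g t x p) \<le> \<bar>g (heat_shift x \<tau> z)\<bar> + \<tau> * \<bar>f s ?X (u s ?X)\<bar>"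
      unfolding fk_sample_def p \<tau>_def[symmetric] s_def using \<tau>
      by (auto simp: abs_mult intro: order_trans[OF abs_triangle_ineq])
    ultimately show ?case by (simp add: p)
  qed
  have "ennreal \<bar>picard u t x\<bar> \<le> (\<integral>\<^sup>+p. ennreal (norm (fk_sample T (\<lambda>t x. f t x (u t x)) g t x p)) \<partial>noise d)"
    unfolding picard_def feynman_kac_def
    using integral_norm_bound_ennreal[OF integrable_fk_sample[OF growth_comp[OF u order_refl] g_growth t, of x]] by simp
  also have "\<dots> \<le> (\<integral>\<^sup>+p. ennreal (G0 (snd p)) + ennreal (c (fst p)) * ennreal (S (fst p) (snd p)) \<partial>noise d)"
  proof (rule nn_integral_mono_AE)
    have G0: "0 \<le> G0 z" for z using A gauss_weight_nonneg[of a 0 d] by (simp add: G0_def)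
    show "AE p in noise d. ennreal (norm (fk_sample T (\<lambda>t x. f t x (u t x)) g t x p))
       \<le> ennreal (G0 (snd p)) + ennreal (c (fst p)) * ennreal (S (fst p) (snd p))"
      using dom AE_noise
    proof eventually_elim
      case (elim p)
      have "2 * a * ((1 - fst p) * \<tau>) < 1"
        using elim(2) \<tau> mult_right_mono[of "1 - fst p" 1 \<tau>] by (intro aT) auto
      then have "0 \<le> S (fst p) (snd p)" using A by (simp add: S_def gauss_weight_nonneg)
      then show ?case using elim(1) G0[of "snd p"] c0[of "fst p"] by (simp flip: ennreal_mult ennreal_plus)
    qed
  qed
  also have "\<dots> = (\<integral>\<^sup>+v. (\<integral>\<^sup>+z. ennreal (G0 z) + ennreal (c v) * ennreal (S v z) \<partial>gauss d) \<partial>unif)"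
    by (subst nn_integral_noise_iterated) auto
  also have "\<dots> \<le> (\<integral>\<^sup>+v. ennreal S0 + ennreal (c v) * ennreal S0 \<partial>unif)"
  proof (rule nn_integral_mono_AE)
    show "AE v in unif. (\<integral>\<^sup>+z. ennreal (G0 z) + ennreal (c v) * ennreal (S v z) \<partial>gauss d)
        \<le> ennreal S0 + ennreal (c v) * ennreal S0"
      using AE_unif
    proof eventually_elim
      case (elim v)
      have Sm: "S v \<in> borel_measurable borel" unfolding S_def by measurable
      have "(\<integral>\<^sup>+z. ennreal (G0 z) + ennreal (c v) * ennreal (S v z) \<partial>gauss d)
          = (\<integral>\<^sup>+z. ennreal (G0 z) \<partial>gauss d) + ennreal (c v) * (\<integral>\<^sup>+z. ennreal (S v z) \<partial>gauss d)"
        using Sm by (subst nn_integral_add) (auto simp: nn_integral_cmult)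
      also have "(\<integral>\<^sup>+z. ennreal (G0 z) \<partial>gauss d) \<le> ennreal S0"
        using nn_integral_sqrt_gauss_weight[of a 0 \<tau> A d x] a A \<tau> aT[OF \<tau>(2)] by (simp add: G0_def S0_def)
      also have "(\<integral>\<^sup>+z. ennreal (S v z) \<partial>gauss d) \<le> ennreal S0"
      proof -
        have "(1 - v) * \<tau> + v * \<tau> = \<tau>" by (simp add: algebra_simps)
        then show ?thesis
          using nn_integral_sqrt_gauss_weight[of a "(1 - v) * \<tau>" "v * \<tau>" A d x] a A \<tau> aT[OF \<tau>(2)] elim
          by (simp add: S_def S0_def)
      qed
      finally show ?case by (simp add: add_mono mult_left_mono)
    qed
  qed
  also have "\<dots> = ennreal S0 + ennreal S0 * (ennreal \<tau> + ennreal (1 + \<tau>) * (\<integral>\<^sup>+v. ennreal (\<tau> * L * exp (L * ((1 - v) * \<tau>))) \<partial>unif))"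
  proof -
    have "ennreal (c v) * ennreal S0 = ennreal S0 * (ennreal \<tau> + ennreal (1 + \<tau>) * ennreal (\<tau> * L * exp (L * ((1 - v) * \<tau>))))" for v
      using \<tau> L S0 unfolding c_def by (simp flip: ennreal_mult ennreal_plus add: mult.commute)
    then show ?thesis
      using unif.emeasure_space_1
      by (subst nn_integral_add) (auto simp: nn_integral_cmult nn_integral_add)
  qed
  also have "\<dots> = ennreal ((1 + \<tau>) * exp (L * \<tau>) * S0)"
  proof -
    have "ennreal S0 + ennreal S0 * (ennreal \<tau> + ennreal (1 + \<tau>) * ennreal E) = ennreal ((1 + \<tau>) * (E + 1) * S0)"
      if "0 \<le> E" for E
    proof -
      have "ennreal S0 + ennreal S0 * (ennreal \<tau> + ennreal (1 + \<tau>) * ennreal E) = ennreal (S0 + S0 * (\<tau> + (1 + \<tau>) * E))"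
        using that \<tau> S0 by (simp flip: ennreal_mult ennreal_plus)
      then show ?thesis by (simp add: algebra_simps)
    qed
    from this[of "exp (L * \<tau>) - 1"] show ?thesis
      unfolding unif_exp_integral[OF L \<tau>(1)] using \<tau> L by simp
  qed
  finally show ?thesis
    using S0 \<tau> by (simp add: S0_def \<tau>_def)
qed

end

section \<open>Independent noise sources\<close>

lemma (in prob_space) distr_pair_indep:
  assumes [measurable]: "X \<in> measurable M A" "Z \<in> measurable M B"
    and indep: "\<And>a b. a \<in> sets A \<Longrightarrow> b \<in> sets B \<Longrightarrow>
      prob ((X -` a \<inter> space M) \<inter> (Z -` b \<inter> space M)) = prob (X -` a \<inter> space M) * prob (Z -` b \<inter> space M)"
  shows "distr M (A \<Otimes>\<^sub>M B) (\<lambda>\<omega>. (X \<omega>, Z \<omega>)) = distr M A X \<Otimes>\<^sub>M distr M B Z"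
proof (rule pair_measure_eqI[symmetric])
  show "sigma_finite_measure (distr M A X)" "sigma_finite_measure (distr M B Z)"
    by (auto intro!: prob_space_imp_sigma_finite prob_space_distr)
  show "sets (distr M A X \<Otimes>\<^sub>M distr M B Z) = sets (distr M (A \<Otimes>\<^sub>M B) (\<lambda>\<omega>. (X \<omega>, Z \<omega>)))"
    by (simp cong: sets_pair_measure_cong)
  fix a b assume "a \<in> sets (distr M A X)" "b \<in> sets (distr M B Z)"
  then have [measurable]: "a \<in> sets A" "b \<in> sets B" by auto
  have "(\<lambda>\<omega>. (X \<omega>, Z \<omega>)) -` (a \<times> b) \<inter> space M = (X -` a \<inter> space M) \<inter> (Z -` b \<inter> space M)" by auto
  then show "emeasure (distr M A X) a * emeasure (distr M B Z) b = emeasure (distr M (A \<Otimes>\<^sub>M B) (\<lambda>\<omega>. (X \<omega>, Z \<omega>))) (a \<times> b)"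
    by (simp add: emeasure_distr emeasure_eq_measure indep ennreal_mult)
qed

lemma measurable_fun_plus [measurable (raw)]:
  fixes F G :: "'a \<Rightarrow> nat \<Rightarrow> real"
  assumes "F \<in> borel_measurable M" "G \<in> borel_measurable M"
  shows "(\<lambda>x. F x + G x) \<in> borel_measurable M"
  by (rule measurable_coordinatewise_then_product)
    (use measurable_nth[OF assms(1)] measurable_nth[OF assms(2)] in \<open>simp add: plus_fun_def\<close>)

lemma measurable_fun_minus [measurable (raw)]:
  fixes F G :: "'a \<Rightarrow> nat \<Rightarrow> real"
  assumes "F \<in> borel_measurable M" "G \<in> borel_measurable M"
  shows "(\<lambda>x. F x - G x) \<in> borel_measurable M"
  by (rule measurable_coordinatewise_then_product)
    (use measurable_nth[OF assms(1)] measurable_nth[OF assms(2)] in \<open>simp add: fun_diff_def\<close>)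

text \<open>Supplies grid times converging to a given time, for the joint measurability of a path in
  time and noise.\<close>

lemma floor_scaled_tendsto: "(\<lambda>n. of_int \<lfloor>t * real (Suc n)\<rfloor> / real (Suc n)) \<longlonglongrightarrow> (t::real)"
proof (rule LIMSEQ_I)
  fix r :: real assume "0 < r"
  then obtain N where N: "inverse (real (Suc N)) < r" using reals_Archimedean by blast
  have "norm (of_int \<lfloor>t * real (Suc n)\<rfloor> / real (Suc n) - t) < r" if "n \<ge> N" for n
  proof -
    have "\<bar>of_int \<lfloor>t * real (Suc n)\<rfloor> - t * real (Suc n)\<bar> \<le> 1" by linarith
    then have "\<bar>(of_int \<lfloor>t * real (Suc n)\<rfloor> - t * real (Suc n)) / real (Suc n)\<bar> \<le> inverse (real (Suc n))"
      by (simp add: abs_divide divide_right_mono inverse_eq_divide)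
    moreover have "(of_int \<lfloor>t * real (Suc n)\<rfloor> - t * real (Suc n)) / real (Suc n) = of_int \<lfloor>t * real (Suc n)\<rfloor> / real (Suc n) - t"
      by (simp add: diff_divide_distrib)
    moreover have "inverse (real (Suc n)) \<le> inverse (real (Suc N))" using that by simp
    ultimately show ?thesis using N unfolding real_norm_def by linarith
  qed
  then show "\<exists>no. \<forall>n\<ge>no. norm (of_int \<lfloor>t * real (Suc n)\<rfloor> / real (Suc n) - t) < r" by blast
qed

locale bm_noise = prob_space P for P :: "'w measure" +
  fixes d :: nat and T :: real and U :: "int list \<Rightarrow> 'w \<Rightarrow> real"
    and W :: "int list \<Rightarrow> real \<Rightarrow> 'w \<Rightarrow> nat \<Rightarrow> real"
  assumes T: "0 < T"
    and U_range: "\<And>\<theta> \<omega>. \<theta> \<in> Theta \<Longrightarrow> \<omega> \<in> space P \<Longrightarrow> U \<theta> \<omega> \<in> {0..1}"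
    and U_indep: "indep_vars (\<lambda>_. borel) U Theta"
    and U_uniform: "\<And>\<theta>. \<theta> \<in> Theta \<Longrightarrow> distr P lborel (U \<theta>) = unif"
    and W_BM: "\<And>\<theta>. \<theta> \<in> Theta \<Longrightarrow> standard_BM P T d (W \<theta>)"
    and W_indep: "indep_vars (\<lambda>_. \<Pi>\<^sub>M t\<in>{0..T}. borel) (\<lambda>\<theta> \<omega>. \<lambda>t\<in>{0..T}. W \<theta> t \<omega>) Theta"
    and UW_indep: "indep_pair P
            (\<Pi>\<^sub>M \<theta>\<in>Theta. borel) (\<lambda>\<omega>. \<lambda>\<theta>\<in>Theta. U \<theta> \<omega>)
            (\<Pi>\<^sub>M \<theta>\<in>Theta. \<Pi>\<^sub>M t\<in>{0..T}. borel) (\<lambda>\<omega>. \<lambda>\<theta>\<in>Theta. \<lambda>t\<in>{0..T}. W \<theta> t \<omega>)"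
begin

abbreviation paths :: "(real \<Rightarrow> nat \<Rightarrow> real) measure" where
  "paths \<equiv> \<Pi>\<^sub>M t\<in>{0..T}. borel"

text \<open>\<open>Inl \<theta>\<close> stands for the source \<open>U\<^sup>\<theta>\<close>, \<open>Inr \<theta>\<close> for \<open>W\<^sup>\<theta>\<close>; the uniform variables are turned into
  constant paths so that all sources take values in the same space.\<close>

definition const_path :: "real \<Rightarrow> real \<Rightarrow> nat \<Rightarrow> real" where
  "const_path u = (\<lambda>t\<in>{0..T}. \<lambda>i. u)"

definition source :: "int list + int list \<Rightarrow> 'w \<Rightarrow> real \<Rightarrow> nat \<Rightarrow> real" where
  "source k \<omega> = (case k of Inl \<theta> \<Rightarrow> const_path (U \<theta> \<omega>) | Inr \<theta> \<Rightarrow> (\<lambda>t\<in>{0..T}. W \<theta> t \<omega>))"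

definition sources :: "(int list + int list) set" where
  "sources = Inl ` Theta \<union> Inr ` Theta"

lemma measurable_const_path [measurable]: "const_path \<in> measurable borel paths"
  unfolding const_path_def[abs_def]
  by (intro measurable_restrict measurable_coordinatewise_then_product) auto

lemma measurable_U [measurable]: "\<theta> \<in> Theta \<Longrightarrow> U \<theta> \<in> borel_measurable P"
  using U_indep unfolding indep_vars_def2 by auto

lemma measurable_source: "k \<in> sources \<Longrightarrow> source k \<in> measurable P paths"
  using W_indep unfolding indep_vars_def2 sources_def source_def[abs_def]
  by (auto intro: measurable_compose[OF measurable_U measurable_const_path])

text \<open>A finite set of sources splits into uniform and Brownian ones. Independence within each
  kind and between the two families together give the product formula.\<close>

lemma indep_sources: "indep_vars (\<lambda>_. paths) source sources"
  unfolding indep_vars_def2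
proof (intro conjI ballI measurable_source indep_setsI)
  fix k assume "k \<in> sources"
  then show "{source k -` A \<inter> space P |A. A \<in> sets paths} \<subseteq> events"
    using measurable_sets[OF measurable_source] by auto
next
  fix A J
  assume J: "J \<noteq> {}" "J \<subseteq> sources" "finite J" and A: "\<forall>j\<in>J. A j \<in> {source j -` A \<inter> space P |A. A \<in> sets paths}"
  then obtain B where B: "\<And>j. j \<in> J \<Longrightarrow> B j \<in> sets paths" "\<And>j. j \<in> J \<Longrightarrow> A j = source j -` B j \<inter> space P"
    by (simp add: bchoice_iff) metis
  define J1 where "J1 = {\<theta>. Inl \<theta> \<in> J}"
  define J2 where "J2 = {\<theta>. Inr \<theta> \<in> J}"
  have JJ: "J = Inl ` J1 \<union> Inr ` J2"
  proof -
    have "k \<in> J \<longleftrightarrow> k \<in> Inl ` J1 \<union> Inr ` J2" for k by (cases k) (auto simp: J1_def J2_def)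
    then show ?thesis by blast
  qed
  have fin: "finite J1" "finite J2"
    using J(3) by (auto simp: JJ finite_image_iff)
  have sub: "J1 \<subseteq> Theta" "J2 \<subseteq> Theta" using J(2) by (auto simp: J1_def J2_def sources_def)
  define E1 where "E1 = {\<omega>\<in>space P. \<forall>\<theta>\<in>J1. const_path (U \<theta> \<omega>) \<in> B (Inl \<theta>)}"
  define E2 where "E2 = {\<omega>\<in>space P. \<forall>\<theta>\<in>J2. (\<lambda>t\<in>{0..T}. W \<theta> t \<omega>) \<in> B (Inr \<theta>)}"
  let ?R = "\<Pi>\<^sub>M \<theta>\<in>Theta. (borel :: real measure)" and ?S = "\<Pi>\<^sub>M \<theta>\<in>Theta. paths"
  have A1: "{x\<in>space ?R. \<forall>\<theta>\<in>J1. const_path (x \<theta>) \<in> B (Inl \<theta>)} \<in> sets ?R"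
  proof (rule sets.sets_Collect_finite_All[OF _ fin(1)])
    fix \<theta> assume \<theta>: "\<theta> \<in> J1"
    then have [measurable]: "B (Inl \<theta>) \<in> sets paths" "\<theta> \<in> Theta" using B(1) sub by (auto simp: J1_def)
    show "{x\<in>space ?R. const_path (x \<theta>) \<in> B (Inl \<theta>)} \<in> sets ?R" by measurable
  qed
  have A2: "{x\<in>space ?S. \<forall>\<theta>\<in>J2. x \<theta> \<in> B (Inr \<theta>)} \<in> sets ?S"
  proof (rule sets.sets_Collect_finite_All[OF _ fin(2)])
    fix \<theta> assume \<theta>: "\<theta> \<in> J2"
    then have [measurable]: "B (Inr \<theta>) \<in> sets paths" "\<theta> \<in> Theta" using B(1) sub by (auto simp: J2_def)
    show "{x\<in>space ?S. x \<theta> \<in> B (Inr \<theta>)} \<in> sets ?S" by measurable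
  qed
  have E1: "E1 = (\<lambda>\<omega>. \<lambda>\<theta>\<in>Theta. U \<theta> \<omega>) -` {x\<in>space ?R. \<forall>\<theta>\<in>J1. const_path (x \<theta>) \<in> B (Inl \<theta>)} \<inter> space P"
    using sub by (auto simp: E1_def space_PiM PiE_def)
  have E2: "E2 = (\<lambda>\<omega>. \<lambda>\<theta>\<in>Theta. \<lambda>t\<in>{0..T}. W \<theta> t \<omega>) -` {x\<in>space ?S. \<forall>\<theta>\<in>J2. x \<theta> \<in> B (Inr \<theta>)} \<inter> space P"
    using sub by (auto simp: E2_def space_PiM PiE_def)
  have ind: "indep_set {(\<lambda>\<omega>. \<lambda>\<theta>\<in>Theta. U \<theta> \<omega>) -` A \<inter> space P |A. A \<in> sets ?R}
      {(\<lambda>\<omega>. \<lambda>\<theta>\<in>Theta. \<lambda>t\<in>{0..T}. W \<theta> t \<omega>) -` A \<inter> space P |A. A \<in> sets ?S}"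
    using UW_indep unfolding indep_pair_def by blast
  have "prob (E1 \<inter> E2) = prob E1 * prob E2"
  proof (rule indep_setD[OF ind])
    show "E1 \<in> {(\<lambda>\<omega>. \<lambda>\<theta>\<in>Theta. U \<theta> \<omega>) -` A \<inter> space P |A. A \<in> sets ?R}"
      unfolding E1 using A1 by blast
    show "E2 \<in> {(\<lambda>\<omega>. \<lambda>\<theta>\<in>Theta. \<lambda>t\<in>{0..T}. W \<theta> t \<omega>) -` A \<inter> space P |A. A \<in> sets ?S}"
      unfolding E2 using A2 by blast
  qed
  moreover have "prob E1 = (\<Prod>\<theta>\<in>J1. prob (A (Inl \<theta>)))"
  proof (cases "J1 = {}")
    case True then show ?thesis by (simp add: E1_def prob_space)
  next
    case False
    have "prob (\<Inter>\<theta>\<in>J1. U \<theta> -` (const_path -` B (Inl \<theta>)) \<inter> space P) = (\<Prod>\<theta>\<in>J1. prob (U \<theta> -` (const_path -` B (Inl \<theta>)) \<inter> space P))"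
    proof (rule indep_varsD[OF U_indep False fin(1) sub(1)])
      fix \<theta> assume "\<theta> \<in> J1"
      then show "const_path -` B (Inl \<theta>) \<in> sets borel"
        using measurable_sets[OF measurable_const_path, of "B (Inl \<theta>)"] B(1) by (simp add: J1_def)
    qed
    moreover have "(\<Inter>\<theta>\<in>J1. U \<theta> -` (const_path -` B (Inl \<theta>)) \<inter> space P) = E1" using False by (auto simp: E1_def)
    moreover have "U \<theta> -` (const_path -` B (Inl \<theta>)) \<inter> space P = A (Inl \<theta>)" if "\<theta> \<in> J1" for \<theta>
      using B(2)[of "Inl \<theta>"] that by (auto simp: J1_def source_def)
    ultimately show ?thesis by simp
  qed
  moreover have "prob E2 = (\<Prod>\<theta>\<in>J2. prob (A (Inr \<theta>)))"
  proof (cases "J2 = {}")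
    case True then show ?thesis by (simp add: E2_def prob_space)
  next
    case False
    have "prob (\<Inter>\<theta>\<in>J2. (\<lambda>\<omega>. \<lambda>t\<in>{0..T}. W \<theta> t \<omega>) -` B (Inr \<theta>) \<inter> space P) = (\<Prod>\<theta>\<in>J2. prob ((\<lambda>\<omega>. \<lambda>t\<in>{0..T}. W \<theta> t \<omega>) -` B (Inr \<theta>) \<inter> space P))"
      by (rule indep_varsD[OF W_indep False fin(2) sub(2)]) (use B(1) in \<open>simp add: J2_def\<close>)
    moreover have "(\<Inter>\<theta>\<in>J2. (\<lambda>\<omega>. \<lambda>t\<in>{0..T}. W \<theta> t \<omega>) -` B (Inr \<theta>) \<inter> space P) = E2" using False by (auto simp: E2_def)
    moreover have "(\<lambda>\<omega>. \<lambda>t\<in>{0..T}. W \<theta> t \<omega>) -` B (Inr \<theta>) \<inter> space P = A (Inr \<theta>)" if "\<theta> \<in> J2" for \<theta>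
      using B(2)[of "Inr \<theta>"] that by (auto simp: J2_def source_def)
    ultimately show ?thesis by simp
  qed
  moreover have "(\<Inter>j\<in>J. A j) = E1 \<inter> E2"
  proof -
    have "\<omega> \<in> (\<Inter>j\<in>J. A j) \<longleftrightarrow> \<omega> \<in> E1 \<inter> E2" for \<omega>
    proof -
      have "\<omega> \<in> (\<Inter>j\<in>J. A j) \<longleftrightarrow> (\<omega> \<in> space P \<and> (\<forall>j\<in>J. source j \<omega> \<in> B j))" using J(1) B(2) by auto
      also have "\<dots> \<longleftrightarrow> \<omega> \<in> E1 \<inter> E2" unfolding JJ ball_Un by (auto simp: E1_def E2_def source_def)
      finally show ?thesis .
    qed
    then show ?thesis by blast
  qed
  moreover have "(\<Prod>j\<in>J. prob (A j)) = (\<Prod>\<theta>\<in>J1. prob (A (Inl \<theta>))) * (\<Prod>\<theta>\<in>J2. prob (A (Inr \<theta>)))"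
    unfolding JJ using fin by (subst prod.union_disjoint) (auto simp: prod.reindex)
  ultimately show "prob (\<Inter>j\<in>J. A j) = (\<Prod>j\<in>J. prob (A j))" by simp
qed

text \<open>Measurability with respect to \<open>alg S\<close> records which noise a random variable
  depends on, so that independence reduces to disjointness of index sets.\<close>

definition alg :: "(int list + int list) set \<Rightarrow> 'w measure" where
  "alg S = vimage_algebra (space P) (\<lambda>\<omega>. \<lambda>k\<in>S. source k \<omega>) (PiM S (\<lambda>_. paths))"

lemma space_alg [simp]: "space (alg S) = space P"
  by (simp add: alg_def)

lemma source_in_paths: "source k \<omega> \<in> space paths"
  by (auto simp: space_PiM source_def const_path_def split: sum.split)

lemma restrict_source_space: "(\<lambda>\<omega>. \<lambda>k\<in>S. source k \<omega>) \<in> space P \<rightarrow> space (PiM S (\<lambda>_. paths))"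
  using source_in_paths by (auto simp: space_PiM)

lemma measurable_alg_source: "k \<in> S \<Longrightarrow> source k \<in> measurable (alg S) paths"
proof -
  assume k: "k \<in> S"
  have "(\<lambda>\<omega>. (\<lambda>k\<in>S. source k \<omega>) k) \<in> measurable (alg S) paths"
    unfolding alg_def
    by (rule measurable_compose[OF measurable_vimage_algebra1[OF restrict_source_space] measurable_component_singleton[OF k]])
  then show ?thesis using k by simp
qed

lemma measurable_id_alg:
  assumes "S \<subseteq> S'" shows "(\<lambda>\<omega>. \<omega>) \<in> measurable (alg S') (alg S)"
  unfolding alg_def[of S]
  by (rule measurable_vimage_algebra2)
    (use assms measurable_alg_source in \<open>auto intro!: measurable_restrict\<close>)

lemma measurable_id_P:
  assumes "S \<subseteq> sources" shows "(\<lambda>\<omega>. \<omega>) \<in> measurable P (alg S)"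
  unfolding alg_def[of S]
  by (rule measurable_vimage_algebra2)
    (use assms measurable_source in \<open>auto intro!: measurable_restrict\<close>)

lemma measurable_alg_P: "S \<subseteq> sources \<Longrightarrow> F \<in> measurable (alg S) N \<Longrightarrow> F \<in> measurable P N"
  using measurable_compose[OF measurable_id_P] by blast

lemma measurable_alg_U:
  assumes "Inl \<theta> \<in> S" shows "U \<theta> \<in> borel_measurable (alg S)"
proof -
  have "(\<lambda>\<omega>. source (Inl \<theta>) \<omega> 0) \<in> borel_measurable (alg S)"
    by (rule measurable_compose[OF measurable_alg_source[OF assms] measurable_component_singleton]) (use T in auto)
  from measurable_nth[OF this, of 0] show ?thesis using T by (simp add: source_def const_path_def)
qed

lemma measurable_alg_W:
  assumes "Inr \<theta> \<in> S" "0 \<le> t" "t \<le> T" shows "W \<theta> t \<in> borel_measurable (alg S)"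
proof -
  have "(\<lambda>\<omega>. source (Inr \<theta>) \<omega> t) \<in> borel_measurable (alg S)"
    by (rule measurable_compose[OF measurable_alg_source[OF assms(1)] measurable_component_singleton]) (use assms in auto)
  then show ?thesis using assms by (simp add: source_def)
qed

text \<open>By continuity of the paths the process is a limit of processes that read the path on a
  time grid, and on each grid only countably many times occur. This permits the insertion of a
  random time.\<close>

lemma measurable_alg_W_joint:
  assumes S: "Inr \<theta> \<in> S" and \<theta>: "\<theta> \<in> Theta"
  shows "(\<lambda>p. W \<theta> (clip T (fst p)) (snd p)) \<in> borel_measurable (borel \<Otimes>\<^sub>M alg S)"
proof (rule borel_measurable_LIMSEQ_metric)
  fix n
  show "(\<lambda>p. W \<theta> (clip T (of_int \<lfloor>fst p * real (Suc n)\<rfloor> / real (Suc n))) (snd p)) \<in> borel_measurable (borel \<Otimes>\<^sub>M alg S)"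
  proof (rule measurable_compose_countable[where f = "\<lambda>i p. W \<theta> (clip T (of_int i / real (Suc n))) (snd p)"
        and g = "\<lambda>p. \<lfloor>fst p * real (Suc n)\<rfloor>"])
    fix i :: int
    show "(\<lambda>p. W \<theta> (clip T (of_int i / real (Suc n))) (snd p)) \<in> borel_measurable (borel \<Otimes>\<^sub>M alg S)"
      by (rule measurable_compose[OF measurable_snd measurable_alg_W[OF S]]) (use T clip_range in auto)
  qed measurable
next
  fix p :: "real \<times> 'w" assume "p \<in> space (borel \<Otimes>\<^sub>M alg S)"
  then have "snd p \<in> space P" by (auto simp: space_pair_measure)
  then have "continuous_on {0..T} (\<lambda>t. W \<theta> t (snd p))"
    using W_BM[OF \<theta>] unfolding standard_BM_def by blast
  then have "continuous_on UNIV (\<lambda>t. W \<theta> (clip T t) (snd p))"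
    by (rule continuous_on_compose2) (use T clip_range in \<open>auto intro!: continuous_intros\<close>)
  then have "isCont (\<lambda>t. W \<theta> (clip T t) (snd p)) (fst p)"
    by (simp add: continuous_on_eq_continuous_at)
  then show "(\<lambda>n. W \<theta> (clip T (of_int \<lfloor>fst p * real (Suc n)\<rfloor> / real (Suc n))) (snd p)) \<longlonglongrightarrow> W \<theta> (clip T (fst p)) (snd p)"
    by (rule isCont_tendsto_compose[OF _ floor_scaled_tendsto])
qed

lemma sets_alg: "sets (alg S) = {(\<lambda>\<omega>. \<lambda>k\<in>S. source k \<omega>) -` A \<inter> space P |A. A \<in> sets (PiM S (\<lambda>_. paths))}"
  unfolding alg_def by (rule sets_vimage_algebra2[OF restrict_source_space])

lemma indep_alg:
  assumes "\<And>j. j \<in> J \<Longrightarrow> S j \<subseteq> sources" "disjoint_family_on S J"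
  shows "indep_sets (\<lambda>j. sets (alg (S j))) J"
  using indep_vars_restrict[OF indep_sources assms] unfolding indep_vars_def2 sets_alg by auto

text \<open>The form in which independence is used later: it suffices to name, for each variable, a
  set of sources that determines it, disjoint from the others.\<close>

lemma indep_vars_alg:
  assumes "\<And>j. j \<in> J \<Longrightarrow> S j \<subseteq> sources" "disjoint_family_on S J"
    and X: "\<And>j. j \<in> J \<Longrightarrow> X j \<in> measurable (alg (S j)) (N j)"
  shows "indep_vars N X J"
  unfolding indep_vars_def2
proof (intro conjI ballI)
  show "indep_sets (\<lambda>i. {X i -` A \<inter> space P |A. A \<in> sets (N i)}) J"
  proof (rule indep_sets_mono_sets[OF indep_alg[OF assms(1,2)]])
    fix j assume "j \<in> J"
    then show "{X j -` A \<inter> space P |A. A \<in> sets (N j)} \<subseteq> sets (alg (S j))"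
      using measurable_sets[OF X] by auto
  qed
qed (use assms measurable_alg_P in blast)

lemma distr_freeze:
  assumes S: "S \<subseteq> sources" "S' \<subseteq> sources" "S \<inter> S' = {}"
    and X: "X \<in> measurable (alg S) A" and Z: "Z \<in> measurable (alg S') B"
  shows "distr P (A \<Otimes>\<^sub>M B) (\<lambda>\<omega>. (X \<omega>, Z \<omega>)) = distr P A X \<Otimes>\<^sub>M distr P B Z"
proof (rule distr_pair_indep)
  show "X \<in> measurable P A" "Z \<in> measurable P B" using S X Z measurable_alg_P by blast+
  fix a b assume ab: "a \<in> sets A" "b \<in> sets B"
  define F where "F j = (if j then S else S')" for j
  have dj: "disjoint_family_on F UNIV" using S(3) by (auto simp: disjoint_family_on_def F_def)
  have ind: "indep_sets (\<lambda>j. sets (alg (F j))) UNIV"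
    by (rule indep_alg[OF _ dj]) (use S in \<open>simp add: F_def\<close>)
  define E where "E j = (if j then X -` a \<inter> space P else Z -` b \<inter> space P)" for j
  have "E j \<in> sets (alg (F j))" for j
    using measurable_sets[OF X ab(1)] measurable_sets[OF Z ab(2)] by (auto simp: E_def F_def)
  then have "prob (\<Inter>j\<in>UNIV. E j) = (\<Prod>j\<in>UNIV. prob (E j))"
    using indep_setsD[OF ind, of UNIV E] by simp
  then show "prob ((X -` a \<inter> space P) \<inter> (Z -` b \<inter> space P)) = prob (X -` a \<inter> space P) * prob (Z -` b \<inter> space P)"
    by (simp add: UNIV_bool E_def Int_commute mult.commute)
qed

text \<open>Takes the place of conditioning: a random argument is frozen and the remaining noise is
  integrated first, which is legitimate because the two depend on disjoint sources.\<close>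

lemma nn_integral_freeze:
  assumes S: "S \<subseteq> sources" "S' \<subseteq> sources" "S \<inter> S' = {}"
    and X: "X \<in> measurable (alg S) A" and H: "H \<in> borel_measurable (A \<Otimes>\<^sub>M alg S')"
  shows "(\<integral>\<^sup>+\<omega>. H (X \<omega>, \<omega>) \<partial>P) = (\<integral>\<^sup>+a. (\<integral>\<^sup>+\<omega>. H (a, \<omega>) \<partial>P) \<partial>distr P A X)"
proof -
  \<comment> \<open>The measure \<open>P\<close> seen only through the sources in \<open>S'\<close>;
    jointly with \<open>X\<close> it has a product law.\<close>
  let ?Q = "distr P (alg S') (\<lambda>\<omega>. \<omega>)"
  have XP: "X \<in> measurable P A" and idP: "(\<lambda>\<omega>. \<omega>) \<in> measurable P (alg S')"
    using S X measurable_alg_P measurable_id_P by blast+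
  interpret Q: prob_space ?Q by (rule prob_space_distr[OF idP])
  have pair: "(\<lambda>\<omega>. (X \<omega>, \<omega>)) \<in> measurable P (A \<Otimes>\<^sub>M alg S')" using XP idP by simp
  have "(\<integral>\<^sup>+\<omega>. H (X \<omega>, \<omega>) \<partial>P) = (\<integral>\<^sup>+p. H p \<partial>distr P (A \<Otimes>\<^sub>M alg S') (\<lambda>\<omega>. (X \<omega>, \<omega>)))"
    using H pair by (subst nn_integral_distr) auto
  also have "\<dots> = (\<integral>\<^sup>+p. H p \<partial>(distr P A X \<Otimes>\<^sub>M ?Q))"
    using distr_freeze[OF S X measurable_id_alg[OF order_refl]] by simp
  also have "\<dots> = (\<integral>\<^sup>+a. (\<integral>\<^sup>+\<omega>. H (a, \<omega>) \<partial>?Q) \<partial>distr P A X)"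
    using H by (intro Q.nn_integral_fst[symmetric]) (simp cong: measurable_cong_sets sets_pair_measure_cong)
  also have "\<dots> = (\<integral>\<^sup>+a. (\<integral>\<^sup>+\<omega>. H (a, \<omega>) \<partial>P) \<partial>distr P A X)"
    using idP H by (intro nn_integral_cong nn_integral_distr) (auto intro: measurable_Pair2)
  finally show ?thesis .
qed

lemma integral_freeze:
  fixes H :: "'a \<times> 'w \<Rightarrow> real"
  assumes S: "S \<subseteq> sources" "S' \<subseteq> sources" "S \<inter> S' = {}"
    and X: "X \<in> measurable (alg S) A" and H: "H \<in> borel_measurable (A \<Otimes>\<^sub>M alg S')"
    and int: "integrable P (\<lambda>\<omega>. H (X \<omega>, \<omega>))"
  shows "integrable (distr P A X) (\<lambda>a. \<integral>\<omega>. H (a, \<omega>) \<partial>P)"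
    and "(\<integral>\<omega>. H (X \<omega>, \<omega>) \<partial>P) = (\<integral>a. (\<integral>\<omega>. H (a, \<omega>) \<partial>P) \<partial>distr P A X)"
proof -
  let ?Q = "distr P (alg S') (\<lambda>\<omega>. \<omega>)"
  have XP: "X \<in> measurable P A" and idP: "(\<lambda>\<omega>. \<omega>) \<in> measurable P (alg S')"
    using S X measurable_alg_P measurable_id_P by blast+
  interpret Q: prob_space ?Q by (rule prob_space_distr[OF idP])
  interpret X: prob_space "distr P A X" by (rule prob_space_distr[OF XP])
  interpret XQ: pair_prob_space "distr P A X" ?Q ..
  have pair: "(\<lambda>\<omega>. (X \<omega>, \<omega>)) \<in> measurable P (A \<Otimes>\<^sub>M alg S')" using XP idP by simp
  have D: "distr P (A \<Otimes>\<^sub>M alg S') (\<lambda>\<omega>. (X \<omega>, \<omega>)) = distr P A X \<Otimes>\<^sub>M ?Q"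
    using distr_freeze[OF S X measurable_id_alg[OF order_refl]] by simp
  have "integrable (distr P (A \<Otimes>\<^sub>M alg S') (\<lambda>\<omega>. (X \<omega>, \<omega>))) H"
    using int H pair by (subst integrable_distr_eq) auto
  then have intXQ: "integrable (distr P A X \<Otimes>\<^sub>M ?Q) H" unfolding D .
  have inner: "(\<integral>\<omega>. H (a, \<omega>) \<partial>?Q) = (\<integral>\<omega>. H (a, \<omega>) \<partial>P)" if "a \<in> space A" for a
    using idP H that by (intro integral_distr) (auto intro: measurable_Pair2)
  show "integrable (distr P A X) (\<lambda>a. \<integral>\<omega>. H (a, \<omega>) \<partial>P)"
    using XQ.integrable_fst'[OF intXQ] inner by (subst (asm) Bochner_Integration.integrable_cong[OF refl]) auto
  have "(\<integral>\<omega>. H (X \<omega>, \<omega>) \<partial>P) = (\<integral>p. H p \<partial>(distr P A X \<Otimes>\<^sub>M ?Q))"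
    using H pair unfolding D[symmetric] by (subst integral_distr) auto
  also have "\<dots> = (\<integral>a. (\<integral>\<omega>. H (a, \<omega>) \<partial>?Q) \<partial>distr P A X)"
    using XQ.integral_fst'[OF intXQ] by simp
  also have "\<dots> = (\<integral>a. (\<integral>\<omega>. H (a, \<omega>) \<partial>P) \<partial>distr P A X)"
    by (rule Bochner_Integration.integral_cong[OF refl]) (simp add: inner)
  finally show "(\<integral>\<omega>. H (X \<omega>, \<omega>) \<partial>P) = (\<integral>a. (\<integral>\<omega>. H (a, \<omega>) \<partial>P) \<partial>distr P A X)" .
qed

section \<open>Laws of the Brownian motions at fixed and at random times\<close>

lemma W_props:
  assumes "\<theta> \<in> Theta"
  shows measurable_W: "0 \<le> t \<Longrightarrow> t \<le> T \<Longrightarrow> W \<theta> t \<in> borel_measurable P"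
    and W_Rd: "0 \<le> t \<Longrightarrow> t \<le> T \<Longrightarrow> \<omega> \<in> space P \<Longrightarrow> W \<theta> t \<omega> \<in> Rd d"
    and W_zero: "AE \<omega> in P. W \<theta> 0 \<omega> = 0"
  using W_BM[OF assms] unfolding standard_BM_def by auto

lemma distr_increment:
  assumes \<theta>: "\<theta> \<in> Theta" and st: "0 \<le> s" "s < t" "t \<le> T"
  shows "distr P borel (\<lambda>\<omega>. W \<theta> t \<omega> - W \<theta> s \<omega>) = distr (gauss d) borel (\<lambda>z i. sqrt (t - s) * z i)"
proof -
  let ?N = "\<lambda>_::nat. density lborel (\<lambda>z. ennreal (normal_density 0 (sqrt (t - s)) z))"
  let ?inc = "\<lambda>\<omega>. W \<theta> t \<omega> - W \<theta> s \<omega>"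
  have [measurable]: "W \<theta> t \<in> borel_measurable P" "W \<theta> s \<in> borel_measurable P"
    using measurable_W[OF \<theta>] st by auto
  have inc [measurable]: "?inc \<in> borel_measurable P" by measurable
  have D: "distr P (\<Pi>\<^sub>M k\<in>{..<d}. borel) (\<lambda>\<omega>. restrict (?inc \<omega>) {..<d}) = PiM {..<d} ?N"
    using W_BM[OF \<theta>] st unfolding standard_BM_def by blast
  have pm: "proj d \<in> borel_measurable (\<Pi>\<^sub>M k\<in>{..<d}. borel)"
  proof (rule measurable_coordinatewise_then_product)
    fix i show "(\<lambda>x. proj d x i) \<in> borel_measurable (\<Pi>\<^sub>M k\<in>{..<d}. borel)"
      by (cases "i < d") (simp_all add: proj_def)
  qed
  have rm: "(\<lambda>\<omega>. restrict (?inc \<omega>) {..<d}) \<in> measurable P (\<Pi>\<^sub>M k\<in>{..<d}. borel)"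
    by (intro measurable_restrict measurable_nth inc)
  have "distr P borel ?inc = distr P borel (proj d \<circ> (\<lambda>\<omega>. restrict (?inc \<omega>) {..<d}))"
  proof (rule distr_cong)
    fix \<omega> assume "\<omega> \<in> space P"
    then have "W \<theta> t \<omega> \<in> Rd d" "W \<theta> s \<omega> \<in> Rd d" using W_Rd[OF \<theta>] st by auto
    then show "?inc \<omega> = (proj d \<circ> (\<lambda>\<omega>. restrict (?inc \<omega>) {..<d})) \<omega>"
      by (auto simp: proj_def mem_Rd_iff fun_diff_def)
  qed auto
  also have "\<dots> = distr (PiM {..<d} ?N) borel (proj d)"
    unfolding D[symmetric] by (rule distr_distr[symmetric, OF pm rm])
  also have "\<dots> = distr (gauss d) borel (\<lambda>z i. sqrt (t - s) * z i)"
    by (rule distr_PiM_normal) (use st in simp)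
  finally show ?thesis .
qed

lemma measurable_scale [measurable]: "(\<lambda>z i. c * z i) \<in> borel_measurable (borel :: (nat \<Rightarrow> real) measure)"
  by (rule measurable_coordinatewise_then_product) measurable

lemma nn_integral_W:
  assumes \<theta>: "\<theta> \<in> Theta" and s: "0 \<le> s" "s \<le> T" and H [measurable]: "H \<in> borel_measurable borel"
  shows "(\<integral>\<^sup>+\<omega>. H (x + W \<theta> s \<omega>) \<partial>P) = (\<integral>\<^sup>+z. H (heat_shift x s z) \<partial>gauss d)"
\<comment> \<open>The law of an increment is only prescribed for distinct times; at time 0 the path
  vanishes almost surely.\<close>
proof (cases "s = 0")
  case True
  have "(\<integral>\<^sup>+\<omega>. H (x + W \<theta> s \<omega>) \<partial>P) = (\<integral>\<^sup>+\<omega>. H x \<partial>P)"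
    using W_zero[OF \<theta>] True by (intro nn_integral_cong_AE) (auto elim!: eventually_mono)
  then show ?thesis using emeasure_space_1 gauss.emeasure_space_1[of d] True by (simp add: heat_shift_def)
next
  case False
  have [measurable]: "W \<theta> s \<in> borel_measurable P" "W \<theta> 0 \<in> borel_measurable P"
    using measurable_W[OF \<theta>] s by auto
  have "(\<integral>\<^sup>+\<omega>. H (x + W \<theta> s \<omega>) \<partial>P) = (\<integral>\<^sup>+\<omega>. H (x + (W \<theta> s \<omega> - W \<theta> 0 \<omega>)) \<partial>P)"
    using W_zero[OF \<theta>] by (intro nn_integral_cong_AE) (auto elim!: eventually_mono)
  also have "\<dots> = (\<integral>\<^sup>+y. H (x + y) \<partial>distr P borel (\<lambda>\<omega>. W \<theta> s \<omega> - W \<theta> 0 \<omega>))"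
    by (subst nn_integral_distr) auto
  also have "\<dots> = (\<integral>\<^sup>+y. H (x + y) \<partial>distr (gauss d) borel (\<lambda>z i. sqrt s * z i))"
    using distr_increment[OF \<theta>, of 0 s] s False by simp
  also have "\<dots> = (\<integral>\<^sup>+z. H (x + (\<lambda>i. sqrt s * z i)) \<partial>gauss d)"
    by (rule nn_integral_distr) measurable
  finally show ?thesis by (simp add: heat_shift_def plus_fun_def)
qed

text \<open>The joint law at two times, obtained from the independent increments over [0, s] and
  [s, t].\<close>

lemma nn_integral_W2:
  assumes \<theta>: "\<theta> \<in> Theta" and st: "0 < s" "s < t" "t \<le> T" and H [measurable]: "H \<in> borel_measurable (borel \<Otimes>\<^sub>M borel)"
  shows "(\<integral>\<^sup>+\<omega>. H (x + W \<theta> s \<omega>, x + W \<theta> t \<omega>) \<partial>P)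
    = (\<integral>\<^sup>+z. (\<integral>\<^sup>+z'. H (heat_shift x s z, heat_shift (heat_shift x s z) (t - s) z') \<partial>gauss d) \<partial>gauss d)"
proof -
  define r where "r k = (if k = 0 then 0 else if k = 1 then s else t)" for k :: nat
  let ?I1 = "\<lambda>\<omega>. W \<theta> s \<omega> - W \<theta> 0 \<omega>" and ?I2 = "\<lambda>\<omega>. W \<theta> t \<omega> - W \<theta> s \<omega>"
  have [measurable]: "W \<theta> s \<in> borel_measurable P" "W \<theta> 0 \<in> borel_measurable P" "W \<theta> t \<in> borel_measurable P"
    using measurable_W[OF \<theta>] st by auto
  have "strict_mono_on {..2} r" using st by (auto simp: strict_mono_on_def r_def)
  moreover have "r ` {..2} \<subseteq> {0..T}" using st by (auto simp: r_def)
  ultimately have ind: "indep_vars (\<lambda>_. borel) (\<lambda>m \<omega>. W \<theta> (r (Suc m)) \<omega> - W \<theta> (r m) \<omega>) {..<2}"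
    using W_BM[OF \<theta>] unfolding standard_BM_def by blast
  have pair: "distr P (borel \<Otimes>\<^sub>M borel) (\<lambda>\<omega>. (?I1 \<omega>, ?I2 \<omega>)) = distr P borel ?I1 \<Otimes>\<^sub>M distr P borel ?I2"
  proof (rule distr_pair_indep)
    fix a b :: "(nat \<Rightarrow> real) set" assume "a \<in> sets borel" "b \<in> sets borel"
    then have "prob (\<Inter>m\<in>{..<2}. (\<lambda>\<omega>. W \<theta> (r (Suc m)) \<omega> - W \<theta> (r m) \<omega>) -` (if m = 0 then a else b) \<inter> space P)
      = (\<Prod>m\<in>{..<2}. prob ((\<lambda>\<omega>. W \<theta> (r (Suc m)) \<omega> - W \<theta> (r m) \<omega>) -` (if m = 0 then a else b) \<inter> space P))"
      by (intro indep_varsD[OF ind]) (auto simp: lessThan_empty_iff)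
    moreover have "{..<2} = {0, 1::nat}" by auto
    ultimately show "prob ((?I1 -` a \<inter> space P) \<inter> (?I2 -` b \<inter> space P)) = prob (?I1 -` a \<inter> space P) * prob (?I2 -` b \<inter> space P)"
      by (simp add: r_def)
  qed measurable
  have D1: "distr P borel ?I1 = distr (gauss d) borel (\<lambda>z i. sqrt s * z i)"
    using distr_increment[OF \<theta>, of 0 s] st by simp
  have D2: "distr P borel ?I2 = distr (gauss d) borel (\<lambda>z i. sqrt (t - s) * z i)"
    using distr_increment[OF \<theta>, of s t] st by simp
  interpret D2: prob_space "distr P borel ?I2" by (rule prob_space_distr) measurable
  have "(\<integral>\<^sup>+\<omega>. H (x + W \<theta> s \<omega>, x + W \<theta> t \<omega>) \<partial>P) = (\<integral>\<^sup>+\<omega>. (\<lambda>(y, y'). H (x + y, (x + y) + y')) (?I1 \<omega>, ?I2 \<omega>) \<partial>P)"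
    using W_zero[OF \<theta>] by (intro nn_integral_cong_AE) (auto elim!: eventually_mono simp: algebra_simps)
  also have "\<dots> = (\<integral>\<^sup>+p. (\<lambda>(y, y'). H (x + y, (x + y) + y')) p \<partial>(distr P borel ?I1 \<Otimes>\<^sub>M distr P borel ?I2))"
    unfolding pair[symmetric] by (rule nn_integral_distr[symmetric]) measurable
  also have "\<dots> = (\<integral>\<^sup>+y. (\<integral>\<^sup>+y'. H (x + y, (x + y) + y') \<partial>distr P borel ?I2) \<partial>distr P borel ?I1)"
    by (subst D2.nn_integral_fst[symmetric]) auto
  also have "\<dots> = (\<integral>\<^sup>+y. (\<integral>\<^sup>+z'. H (x + y, heat_shift (x + y) (t - s) z') \<partial>gauss d) \<partial>distr P borel ?I1)"
  proof (rule nn_integral_cong)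
    fix y
    have "(\<integral>\<^sup>+y'. H (x + y, (x + y) + y') \<partial>distr P borel ?I2) = (\<integral>\<^sup>+z'. H (x + y, (x + y) + (\<lambda>i. sqrt (t - s) * z' i)) \<partial>gauss d)"
      unfolding D2 by (rule nn_integral_distr) measurable
    moreover have "(x + y) + (\<lambda>i. sqrt (t - s) * z' i) = heat_shift (x + y) (t - s) z'" for z'
      by (simp add: heat_shift_def plus_fun_def)
    ultimately show "(\<integral>\<^sup>+y'. H (x + y, (x + y) + y') \<partial>distr P borel ?I2) = (\<integral>\<^sup>+z'. H (x + y, heat_shift (x + y) (t - s) z') \<partial>gauss d)"
      by simp
  qed
  also have "\<dots> = (\<integral>\<^sup>+z. (\<integral>\<^sup>+z'. H (x + (\<lambda>i. sqrt s * z i), heat_shift (x + (\<lambda>i. sqrt s * z i)) (t - s) z') \<partial>gauss d) \<partial>gauss d)"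
    unfolding D1 by (rule nn_integral_distr) measurable
  finally show ?thesis
    by (simp add: heat_shift_def[of x] plus_fun_def)
qed

lemma nn_integral_U:
  assumes "\<theta> \<in> Theta" and [measurable]: "H \<in> borel_measurable borel"
  shows "(\<integral>\<^sup>+u. H u \<partial>distr P borel (U \<theta>)) = (\<integral>\<^sup>+u. H u \<partial>unif)"
proof -
  have "distr P borel (U \<theta>) = distr P lborel (U \<theta>)" by (rule distr_cong) auto
  then show ?thesis using U_uniform[OF assms(1)] by simp
qed

lemma sources_pair: "\<theta> \<in> Theta \<Longrightarrow> {Inl \<theta>} \<subseteq> sources" "\<theta> \<in> Theta \<Longrightarrow> {Inr \<theta>} \<subseteq> sources"
  by (auto simp: sources_def)

text \<open>The time at which the path is read depends on \<open>U\<close>, which is independent of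
  the path and can be frozen. The time is clamped because joint measurability is available in that
  form.\<close>

lemma nn_integral_UW:
  assumes \<theta>: "\<theta> \<in> Theta" and \<tau>: "0 \<le> \<tau>" "\<tau> \<le> T" and H [measurable]: "H \<in> borel_measurable (borel \<Otimes>\<^sub>M borel)"
  shows "(\<integral>\<^sup>+\<omega>. H (U \<theta> \<omega>, x + W \<theta> (U \<theta> \<omega> * \<tau>) \<omega>) \<partial>P)
    = (\<integral>\<^sup>+p. H (fst p, heat_shift x (fst p * \<tau>) (snd p)) \<partial>noise d)"
proof -
  have [measurable]: "(\<lambda>p. W \<theta> (clip T (fst p)) (snd p)) \<in> borel_measurable (borel \<Otimes>\<^sub>M alg {Inr \<theta>})"
    by (rule measurable_alg_W_joint[OF _ \<theta>]) simp
  have m1: "(\<lambda>p. W \<theta> (clip T (fst p * \<tau>)) (snd p)) \<in> borel_measurable (borel \<Otimes>\<^sub>M alg {Inr \<theta>})"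
    by (rule measurable_compose[of "\<lambda>p. (fst p * \<tau>, snd p)" _ "borel \<Otimes>\<^sub>M alg {Inr \<theta>}", OF _ measurable_alg_W_joint[OF _ \<theta>, of "{Inr \<theta>}"], simplified]) measurable
  have m2: "(\<lambda>p. H (fst p, x + W \<theta> (clip T (fst p * \<tau>)) (snd p))) \<in> borel_measurable (borel \<Otimes>\<^sub>M alg {Inr \<theta>})"
    using m1 by measurable
  have rng: "0 \<le> u * \<tau>" "u * \<tau> \<le> T" if "0 \<le> u" "u \<le> 1" for u
    using that \<tau> mult_right_mono[of u 1 \<tau>] by auto
  have "(\<integral>\<^sup>+\<omega>. H (U \<theta> \<omega>, x + W \<theta> (U \<theta> \<omega> * \<tau>) \<omega>) \<partial>P) = (\<integral>\<^sup>+\<omega>. (\<lambda>p. H (fst p, x + W \<theta> (clip T (fst p * \<tau>)) (snd p))) (U \<theta> \<omega>, \<omega>) \<partial>P)"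
    using rng U_range[OF \<theta>] by (intro nn_integral_cong) auto
  also have "\<dots> = (\<integral>\<^sup>+u. (\<integral>\<^sup>+\<omega>. (\<lambda>p. H (fst p, x + W \<theta> (clip T (fst p * \<tau>)) (snd p))) (u, \<omega>) \<partial>P) \<partial>distr P borel (U \<theta>))"
    by (rule nn_integral_freeze[OF sources_pair[OF \<theta>] _ measurable_alg_U m2]) auto
  also have "\<dots> = (\<integral>\<^sup>+u. (\<integral>\<^sup>+z. H (u, heat_shift x (clip T (u * \<tau>)) z) \<partial>gauss d) \<partial>distr P borel (U \<theta>))"
    using clip_range T by (intro nn_integral_cong) (auto intro!: nn_integral_W[OF \<theta>, of _ "\<lambda>y. H (_, y)"])
  also have "\<dots> = (\<integral>\<^sup>+u. (\<integral>\<^sup>+z. H (u, heat_shift x (clip T (u * \<tau>)) z) \<partial>gauss d) \<partial>unif)"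
    by (rule nn_integral_U[OF \<theta>]) measurable
  also have "\<dots> = (\<integral>\<^sup>+u. (\<integral>\<^sup>+z. H (u, heat_shift x (u * \<tau>) z) \<partial>gauss d) \<partial>unif)"
  proof (rule nn_integral_cong_AE)
    show "AE u in unif. (\<integral>\<^sup>+z. H (u, heat_shift x (clip T (u * \<tau>)) z) \<partial>gauss d) = (\<integral>\<^sup>+z. H (u, heat_shift x (u * \<tau>) z) \<partial>gauss d)"
      using AE_unif by eventually_elim (simp add: rng)
  qed
  also have "\<dots> = (\<integral>\<^sup>+p. H (fst p, heat_shift x (fst p * \<tau>) (snd p)) \<partial>noise d)"
    by (subst nn_integral_noise_iterated) auto
  finally show ?thesis .
qed

end

section \<open>Root mean square bounds\<close>

context prob_space
begin

text \<open>Bundles measurability with a finite bound. The nonnegative integral makes square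
  integrability part of the bound and rules out the default value of the Bochner integral.\<close>

definition L2le :: "('a \<Rightarrow> real) \<Rightarrow> real \<Rightarrow> bool" where
  "L2le X c \<longleftrightarrow> X \<in> borel_measurable M \<and> 0 \<le> c \<and> (\<integral>\<^sup>+\<omega>. ennreal ((X \<omega>)\<^sup>2) \<partial>M) \<le> ennreal (c\<^sup>2)"

lemma L2leD:
  assumes "L2le X c"
  shows "X \<in> borel_measurable M" "0 \<le> c" "integrable M (\<lambda>\<omega>. (X \<omega>)\<^sup>2)" "expectation (\<lambda>\<omega>. (X \<omega>)\<^sup>2) \<le> c\<^sup>2"
    "integrable M X"
proof -
  show [measurable]: "X \<in> borel_measurable M" and c: "0 \<le> c" using assms by (auto simp: L2le_def)
  have le: "(\<integral>\<^sup>+\<omega>. ennreal ((X \<omega>)\<^sup>2) \<partial>M) \<le> ennreal (c\<^sup>2)" using assms by (simp add: L2le_def)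
  show int: "integrable M (\<lambda>\<omega>. (X \<omega>)\<^sup>2)"
    by (rule integrableI_nonneg) (use le in \<open>auto intro: le_less_trans simp: top.not_eq_extremum\<close>)
  then have "ennreal (expectation (\<lambda>\<omega>. (X \<omega>)\<^sup>2)) \<le> ennreal (c\<^sup>2)"
    using le by (subst nn_integral_eq_integral[symmetric]) auto
  then show "expectation (\<lambda>\<omega>. (X \<omega>)\<^sup>2) \<le> c\<^sup>2" by simp
  have nle: "norm (X \<omega>) \<le> 1 + (X \<omega>)\<^sup>2" for \<omega>
  proof (cases "\<bar>X \<omega>\<bar> \<le> 1")
    case False
    then have "\<bar>X \<omega>\<bar> ^ 1 \<le> \<bar>X \<omega>\<bar> ^ 2" by (intro power_increasing) auto
    then show ?thesis by simp
  qed (simp add: add_increasing2)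
  show "integrable M X"
  proof (rule Bochner_Integration.integrable_bound[of M "\<lambda>\<omega>. 1 + (X \<omega>)\<^sup>2"])
    show "integrable M (\<lambda>\<omega>. 1 + (X \<omega>)\<^sup>2)" using int by simp
    show "AE \<omega> in M. norm (X \<omega>) \<le> norm (1 + (X \<omega>)\<^sup>2)"
    proof (rule AE_I2)
      fix \<omega> show "norm (X \<omega>) \<le> norm (1 + (X \<omega>)\<^sup>2)"
        using nle[of \<omega>] abs_ge_self[of "1 + (X \<omega>)\<^sup>2"] unfolding real_norm_def by linarith
    qed
  qed measurable
qed

lemma L2leI:
  assumes "X \<in> borel_measurable M" "0 \<le> c" "integrable M (\<lambda>\<omega>. (X \<omega>)\<^sup>2)" "expectation (\<lambda>\<omega>. (X \<omega>)\<^sup>2) \<le> c\<^sup>2"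
  shows "L2le X c"
  unfolding L2le_def using assms by (subst nn_integral_eq_integral) auto

lemma L2le_mono: "L2le X a \<Longrightarrow> a \<le> b \<Longrightarrow> L2le X b"
  unfolding L2le_def by (auto intro: order_trans ennreal_leI power_mono)

lemma L2le_dominated:
  assumes "L2le X c" "Z \<in> borel_measurable M" "\<And>\<omega>. \<omega> \<in> space M \<Longrightarrow> \<bar>Z \<omega>\<bar> \<le> \<bar>X \<omega>\<bar>"
  shows "L2le Z c"
proof -
  have "(\<integral>\<^sup>+\<omega>. ennreal ((Z \<omega>)\<^sup>2) \<partial>M) \<le> (\<integral>\<^sup>+\<omega>. ennreal ((X \<omega>)\<^sup>2) \<partial>M)"
    using assms(3) by (intro nn_integral_mono ennreal_leI) (simp add: abs_le_square_iff)
  then show ?thesis using assms unfolding L2le_def by auto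
qed

lemma L2le_cong: "(\<And>\<omega>. \<omega> \<in> space M \<Longrightarrow> X \<omega> = Z \<omega>) \<Longrightarrow> L2le X c \<longleftrightarrow> L2le Z c"
  unfolding L2le_def by (auto cong: nn_integral_cong measurable_cong)

lemma L2le_const: "L2le (\<lambda>_. k) \<bar>k\<bar>"
  by (rule L2leI) (auto simp: prob_space)

lemma L2le_cmult: "L2le X c \<Longrightarrow> L2le (\<lambda>\<omega>. k * X \<omega>) (\<bar>k\<bar> * c)"
  using L2leD[of X c]
  by (intro L2leI) (auto simp: power_mult_distrib mult_left_mono)

lemma L2le_zero_AE:
  assumes "L2le X 0" shows "AE \<omega> in M. X \<omega> = 0"
proof -
  have "(\<integral>\<^sup>+\<omega>. ennreal ((X \<omega>)\<^sup>2) \<partial>M) = 0" using assms by (simp add: L2le_def)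
  then have "AE \<omega> in M. ennreal ((X \<omega>)\<^sup>2) = 0"
    using L2leD(1)[OF assms] by (subst (asm) nn_integral_0_iff_AE) auto
  then show ?thesis by eventually_elim (simp add: ennreal_eq_0_iff)
qed

text \<open>Minkowski's inequality, from Young's inequality with the optimal weight b/a. The
  division forces the cases a = 0 and b = 0 apart.\<close>

lemma L2le_add:
  assumes X: "L2le X a" and Z: "L2le Z b"
  shows "L2le (\<lambda>\<omega>. X \<omega> + Z \<omega>) (a + b)"
proof -
  note D = L2leD[OF X] L2leD[OF Z]
  note [measurable] = D(1,6)
  consider "a = 0" | "b = 0" | "0 < a" "0 < b" using D(2,7) by linarith
  then show ?thesis
  proof cases
    case 1
    then have "AE \<omega> in M. X \<omega> = 0" using L2le_zero_AE X by simp
    then have "(\<integral>\<^sup>+\<omega>. ennreal ((X \<omega> + Z \<omega>)\<^sup>2) \<partial>M) = (\<integral>\<^sup>+\<omega>. ennreal ((Z \<omega>)\<^sup>2) \<partial>M)"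
      by (intro nn_integral_cong_AE) (auto elim!: eventually_mono)
    then show ?thesis using Z 1 unfolding L2le_def by auto
  next
    case 2
    then have "AE \<omega> in M. Z \<omega> = 0" using L2le_zero_AE Z by simp
    then have "(\<integral>\<^sup>+\<omega>. ennreal ((X \<omega> + Z \<omega>)\<^sup>2) \<partial>M) = (\<integral>\<^sup>+\<omega>. ennreal ((X \<omega>)\<^sup>2) \<partial>M)"
      by (intro nn_integral_cong_AE) (auto elim!: eventually_mono)
    then show ?thesis using X 2 unfolding L2le_def by auto
  next
    case 3
    have young: "(x + z)\<^sup>2 \<le> (1 + b / a) * x\<^sup>2 + (1 + a / b) * z\<^sup>2" for x z :: real
    proof -
      have "0 \<le> (b * x - a * z)\<^sup>2 / (a * b)" using 3 by simp
      also have "\<dots> = (b / a) * x\<^sup>2 + (a / b) * z\<^sup>2 - 2 * x * z"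
        using 3 by (simp add: power2_eq_square field_simps)
      finally show ?thesis by (simp add: power2_sum algebra_simps)
    qed
    have le: "expectation (\<lambda>\<omega>. (X \<omega> + Z \<omega>)\<^sup>2) \<le> expectation (\<lambda>\<omega>. (1 + b / a) * (X \<omega>)\<^sup>2 + (1 + a / b) * (Z \<omega>)\<^sup>2)"
      and int: "integrable M (\<lambda>\<omega>. (X \<omega> + Z \<omega>)\<^sup>2)"
    proof -
      have i: "integrable M (\<lambda>\<omega>. (1 + b / a) * (X \<omega>)\<^sup>2 + (1 + a / b) * (Z \<omega>)\<^sup>2)"
        using D by auto
      show int: "integrable M (\<lambda>\<omega>. (X \<omega> + Z \<omega>)\<^sup>2)"
        by (rule Bochner_Integration.integrable_bound[OF i]) (use young 3 in \<open>auto intro!: AE_I2 order_trans[OF young abs_ge_self]\<close>)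
      show "expectation (\<lambda>\<omega>. (X \<omega> + Z \<omega>)\<^sup>2) \<le> expectation (\<lambda>\<omega>. (1 + b / a) * (X \<omega>)\<^sup>2 + (1 + a / b) * (Z \<omega>)\<^sup>2)"
        by (rule integral_mono[OF int i young])
    qed
    note le
    also have "expectation (\<lambda>\<omega>. (1 + b / a) * (X \<omega>)\<^sup>2 + (1 + a / b) * (Z \<omega>)\<^sup>2)
        = (1 + b / a) * expectation (\<lambda>\<omega>. (X \<omega>)\<^sup>2) + (1 + a / b) * expectation (\<lambda>\<omega>. (Z \<omega>)\<^sup>2)"
      using D by simp
    also have "\<dots> \<le> (1 + b / a) * a\<^sup>2 + (1 + a / b) * b\<^sup>2"
      using D 3 by (intro add_mono mult_left_mono) auto
    also have "\<dots> = (a + b)\<^sup>2" using 3 by (simp add: power2_eq_square field_simps)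
    finally show ?thesis using int 3 by (intro L2leI) auto
  qed
qed

lemma L2le_sum:
  assumes "finite I" "\<And>i. i \<in> I \<Longrightarrow> L2le (X i) (c i)"
  shows "L2le (\<lambda>\<omega>. \<Sum>i\<in>I. X i \<omega>) (\<Sum>i\<in>I. c i)"
  using assms
proof (induction I)
  case empty then show ?case using L2le_const[of 0] by simp
next
  case (insert i I)
  then show ?case using L2le_add[of "X i" "c i"] by simp
qed

lemma abs_expectation_le_L2:
  assumes "L2le X c" shows "\<bar>expectation X\<bar> \<le> c"
proof -
  note D = L2leD[OF assms]
  have "0 \<le> variance X" by (rule integral_nonneg_AE) auto
  then have "(expectation X)\<^sup>2 \<le> c\<^sup>2" using variance_eq[OF D(5,3)] D(4) by linarith
  then show ?thesis using D(2) abs_le_square_iff[of "expectation X" c] by simp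
qed

lemma L2le_center:
  assumes "L2le X c" shows "L2le (\<lambda>\<omega>. X \<omega> - expectation X) c"
proof -
  note D = L2leD[OF assms]
  have "integrable M (\<lambda>\<omega>. (X \<omega> - expectation X)\<^sup>2)"
    using D by (simp add: power2_diff)
  moreover have "expectation (\<lambda>\<omega>. (X \<omega> - expectation X)\<^sup>2) \<le> c\<^sup>2"
    using variance_eq[OF D(5,3)] D(4) zero_le_power2[of "expectation X"] by linarith
  ultimately show ?thesis using D by (intro L2leI) auto
qed

text \<open>Independence kills the mixed moments of the centred variables, so the sum of
  \<open>N\<close> of them has norm at most c \<surd>N; centring does not increase the norm.\<close>

lemma L2le_indep_mean:
  assumes I: "finite I" "card I = N" "1 \<le> N" and ind: "indep_vars (\<lambda>_. borel) X I"
    and X: "\<And>i. i \<in> I \<Longrightarrow> L2le (X i) c"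
  shows "L2le (\<lambda>\<omega>. 1 / real N * (\<Sum>i\<in>I. X i \<omega> - expectation (X i))) (c / sqrt (real N))"
proof -
  define Z where "Z i \<omega> = X i \<omega> - expectation (X i)" for i \<omega>
  have Z: "L2le (Z i) c" if "i \<in> I" for i unfolding Z_def by (rule L2le_center[OF X[OF that]])
  have Z0: "expectation (Z i) = 0" if "i \<in> I" for i
    unfolding Z_def using L2leD(5)[OF X[OF that]] by (simp add: prob_space)
  have indZ: "indep_vars (\<lambda>_. borel) Z I"
    using indep_vars_compose2[OF ind, of "\<lambda>i x. x - expectation (X i)" "\<lambda>_. borel"] by (simp add: Z_def[abs_def])
  have c: "0 \<le> c" using I X L2leD(2) by (metis card.empty ex_in_conv not_one_le_zero)
  have ij: "integrable M (\<lambda>\<omega>. Z i \<omega> * Z j \<omega>)" "i \<noteq> j \<Longrightarrow> expectation (\<lambda>\<omega>. Z i \<omega> * Z j \<omega>) = 0"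
    if "i \<in> I" "j \<in> I" for i j
  proof -
    have sub: "indep_vars (\<lambda>_. borel) Z {i, j}" by (rule indep_vars_subset[OF indZ]) (use that in auto)
    have ints: "\<And>k. k \<in> {i, j} \<Longrightarrow> integrable M (Z k)" using Z L2leD(5) that by blast
    show "integrable M (\<lambda>\<omega>. Z i \<omega> * Z j \<omega>)"
    proof (cases "i = j")
      case True then show ?thesis using L2leD(3)[OF Z[OF that(1)]] by (simp add: power2_eq_square)
    next
      case False then show ?thesis using indep_vars_integrable[OF _ sub ints] by simp
    qed
    show "expectation (\<lambda>\<omega>. Z i \<omega> * Z j \<omega>) = 0" if "i \<noteq> j"
      using indep_vars_lebesgue_integral[OF _ sub ints] that Z0[OF \<open>i \<in> I\<close>] by simp
  qed
  have sq: "(\<Sum>i\<in>I. Z i \<omega>)\<^sup>2 = (\<Sum>i\<in>I. \<Sum>j\<in>I. Z i \<omega> * Z j \<omega>)" for \<omega>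
    by (simp add: power2_eq_square sum_product)
  have "expectation (\<lambda>\<omega>. (\<Sum>i\<in>I. Z i \<omega>)\<^sup>2) = (\<Sum>i\<in>I. \<Sum>j\<in>I. expectation (\<lambda>\<omega>. Z i \<omega> * Z j \<omega>))"
    unfolding sq using ij by (simp add: Bochner_Integration.integral_sum)
  also have "\<dots> = (\<Sum>i\<in>I. \<Sum>j\<in>I. if j = i then expectation (\<lambda>\<omega>. Z i \<omega> * Z i \<omega>) else 0)"
    using ij(2) by (intro sum.cong refl) (auto dest: not_sym)
  also have "\<dots> = (\<Sum>i\<in>I. expectation (\<lambda>\<omega>. (Z i \<omega>)\<^sup>2))"
    using I(1) by (simp add: power2_eq_square)
  also have "\<dots> \<le> real N * c\<^sup>2"
    using sum_bounded_above[of I "\<lambda>i. expectation (\<lambda>\<omega>. (Z i \<omega>)\<^sup>2)" "c\<^sup>2"] L2leD(4)[OF Z] I(2) by simp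
  finally have "expectation (\<lambda>\<omega>. (\<Sum>i\<in>I. Z i \<omega>)\<^sup>2) \<le> (sqrt (real N) * c)\<^sup>2"
    by (simp add: power_mult_distrib)
  moreover have "integrable M (\<lambda>\<omega>. (\<Sum>i\<in>I. Z i \<omega>)\<^sup>2)" unfolding sq using ij by auto
  moreover have "(\<lambda>\<omega>. \<Sum>i\<in>I. Z i \<omega>) \<in> borel_measurable M" using L2leD(1)[OF Z] by auto
  ultimately have "L2le (\<lambda>\<omega>. \<Sum>i\<in>I. Z i \<omega>) (sqrt (real N) * c)" using c by (intro L2leI) auto
  from L2le_cmult[OF this, of "1 / real N"]
  have "L2le (\<lambda>\<omega>. 1 / real N * (\<Sum>i\<in>I. Z i \<omega>)) (\<bar>1 / real N\<bar> * (sqrt (real N) * c))" .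
  moreover have "\<bar>1 / real N\<bar> * (sqrt (real N) * c) = c / sqrt (real N)"
  proof -
    have "0 < sqrt (real N)" using I(3) by simp
    then have "1 / real N * (sqrt (real N) * c) = c / sqrt (real N)"
      using real_sqrt_mult_self[of "real N"] I(3) by (simp add: field_simps)
    then show ?thesis by simp
  qed
  ultimately show ?thesis by (simp add: Z_def)
qed

end

section \<open>The multilevel Picard scheme as a random field\<close>

lemma (in semilinear) measurable_f:
  assumes [measurable]: "s \<in> borel_measurable N" "X \<in> borel_measurable N" "Z \<in> borel_measurable N"
  shows "(\<lambda>q. f (s q) (X q) (Z q)) \<in> borel_measurable N"
proof -
  have "(\<lambda>(t, x, v). f t x v) \<in> borel_measurable (borel \<Otimes>\<^sub>M (borel \<Otimes>\<^sub>M borel))"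
    using borel_measurable_continuous_onI[OF f_cont] by (simp add: borel_prod)
  from measurable_compose[OF _ this, of "\<lambda>q. (s q, X q, Z q)" N] show ?thesis by simp
qed

lemma (in semilinear) measurable_g [measurable]: "g \<in> borel_measurable borel"
  by (rule borel_measurable_continuous_onI[OF g_cont])

text \<open>The noise behind the approximation with index \<theta>: its recursion only reaches
  strict extensions of \<theta>, so \<open>U \<theta>\<close> and \<open>W \<theta>\<close> stay
  independent of it. \<open>family\<close> adds these two.\<close>

definition offspring :: "int list \<Rightarrow> (int list + int list) set" where
  "offspring \<theta> = {k. \<exists>\<eta>. \<eta> \<noteq> [] \<and> (k = Inl (\<theta> @ \<eta>) \<or> k = Inr (\<theta> @ \<eta>))}"

definition family :: "int list \<Rightarrow> (int list + int list) set" where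
  "family \<theta> = {k. \<exists>\<eta>. k = Inl (\<theta> @ \<eta>) \<or> k = Inr (\<theta> @ \<eta>)}"

lemma family_eq: "family \<theta> = {Inl \<theta>, Inr \<theta>} \<union> offspring \<theta>"
  unfolding family_def offspring_def by force

lemma offspring_not_self: "offspring \<theta> \<inter> {Inl \<theta>, Inr \<theta>} = {}"
  unfolding offspring_def by auto

text \<open>Two different tuples of equal length have no common extension.\<close>

lemma family_disjoint: "length \<theta> = length \<theta>' \<Longrightarrow> \<theta> \<noteq> \<theta>' \<Longrightarrow> family \<theta> \<inter> family \<theta>' = {}"
  unfolding family_def by auto

lemma family_child: "\<eta> \<noteq> [] \<Longrightarrow> family (\<theta> @ \<eta>) \<subseteq> offspring \<theta>"
  unfolding family_def offspring_def by auto

lemma snoc2_in_Theta [simp]: "\<theta> @ [a, b] \<in> Theta"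
  by (simp add: Theta_def)

text \<open>For a fixed \<open>M\<close> the scheme is written in the time to maturity \<tau> and
  with natural numbers as levels: at l = 0 the factor \<open>of_bool\<close> removes the term whose
  index \<open>l - 1\<close> would be truncated.\<close>

locale mlp = bm_noise P d T U W + semilinear d m T L f g
  for P :: "'w measure" and d m T U W L f g +
  fixes M :: nat and V :: "int list \<Rightarrow> nat \<Rightarrow> real \<Rightarrow> (nat \<Rightarrow> real) \<Rightarrow> 'w \<Rightarrow> real"
  assumes M: "1 \<le> M"
    and V_0: "\<And>\<theta> \<tau> x \<omega>. \<theta> \<in> Theta \<Longrightarrow> \<omega> \<in> space P \<Longrightarrow> V \<theta> 0 \<tau> x \<omega> = 0"
    and V_clip: "\<And>\<theta> n \<tau> x \<omega>. V \<theta> n (clip T \<tau>) x \<omega> = V \<theta> n \<tau> x \<omega>"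
    and V_rec: "\<And>\<theta> n \<tau> x \<omega>. \<lbrakk>1 \<le> n; \<theta> \<in> Theta; \<omega> \<in> space P; 0 \<le> \<tau>; \<tau> \<le> T\<rbrakk> \<Longrightarrow>
      V \<theta> n \<tau> x \<omega> = 1 / real M ^ n * (\<Sum>i=1..M ^ n. g (x + W (\<theta> @ [0, int i]) \<tau> \<omega>))
        + (\<Sum>l<n. 1 / real M ^ (n - l) * (\<Sum>i=1..M ^ (n - l). \<tau> * (
            f (T - (1 - U (\<theta> @ [int l, int i]) \<omega>) * \<tau>)
              (x + W (\<theta> @ [int l, int i]) (U (\<theta> @ [int l, int i]) \<omega> * \<tau>) \<omega>)
              (V (\<theta> @ [int l, int i]) l ((1 - U (\<theta> @ [int l, int i]) \<omega>) * \<tau>)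
                (x + W (\<theta> @ [int l, int i]) (U (\<theta> @ [int l, int i]) \<omega> * \<tau>) \<omega>) \<omega>)
          - of_bool (l \<ge> 1) *
            f (T - (1 - U (\<theta> @ [int l, int i]) \<omega>) * \<tau>)
              (x + W (\<theta> @ [int l, int i]) (U (\<theta> @ [int l, int i]) \<omega> * \<tau>) \<omega>)
              (V (\<theta> @ [- int l, int i]) (l - 1) ((1 - U (\<theta> @ [int l, int i]) \<omega>) * \<tau>)
                (x + W (\<theta> @ [int l, int i]) (U (\<theta> @ [int l, int i]) \<omega> * \<tau>) \<omega>) \<omega>))))"
begin

definition f_at :: "int list \<Rightarrow> int list \<Rightarrow> nat \<Rightarrow> real \<Rightarrow> (nat \<Rightarrow> real) \<Rightarrow> 'w \<Rightarrow> real" where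
  "f_at \<eta> \<eta>' l \<tau> x \<omega> = f (T - (1 - U \<eta> \<omega>) * \<tau>) (x + W \<eta> (U \<eta> \<omega> * \<tau>) \<omega>)
     (V \<eta>' l ((1 - U \<eta> \<omega>) * \<tau>) (x + W \<eta> (U \<eta> \<omega> * \<tau>) \<omega>) \<omega>)"

definition summand :: "int list \<Rightarrow> nat \<Rightarrow> nat \<Rightarrow> real \<Rightarrow> (nat \<Rightarrow> real) \<Rightarrow> 'w \<Rightarrow> real" where
  "summand \<theta> l i \<tau> x \<omega> = \<tau> * (f_at (\<theta> @ [int l, int i]) (\<theta> @ [int l, int i]) l \<tau> x \<omega>
     - of_bool (l \<ge> 1) * f_at (\<theta> @ [int l, int i]) (\<theta> @ [- int l, int i]) (l - 1) \<tau> x \<omega>)"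

lemma V_rec':
  "\<lbrakk>1 \<le> n; \<theta> \<in> Theta; \<omega> \<in> space P; 0 \<le> \<tau>; \<tau> \<le> T\<rbrakk> \<Longrightarrow>
     V \<theta> n \<tau> x \<omega> = 1 / real M ^ n * (\<Sum>i=1..M ^ n. g (x + W (\<theta> @ [0, int i]) \<tau> \<omega>))
        + (\<Sum>l<n. 1 / real M ^ (n - l) * (\<Sum>i=1..M ^ (n - l). summand \<theta> l i \<tau> x \<omega>))"
  unfolding summand_def f_at_def by (rule V_rec)

lemma times_in_range:
  assumes "0 \<le> \<tau>" "\<tau> \<le> T" "0 \<le> u" "u \<le> 1"
  shows "0 \<le> u * \<tau>" "u * \<tau> \<le> T" "0 \<le> (1 - u) * \<tau>" "(1 - u) * \<tau> \<le> T"
  using assms mult_right_mono[of u 1 \<tau>] mult_right_mono[of "1 - u" 1 \<tau>] by auto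

lemma U_bounds: "\<eta> \<in> Theta \<Longrightarrow> \<omega> \<in> space P \<Longrightarrow> 0 \<le> U \<eta> \<omega> \<and> U \<eta> \<omega> \<le> 1"
  using U_range[of \<eta> \<omega>] by auto

lemma W_comp:
  assumes "\<eta> \<in> Theta" "Inr \<eta> \<in> S" "s \<in> borel_measurable N" "w \<in> measurable N (alg S)"
  shows "(\<lambda>q. W \<eta> (clip T (s q)) (w q)) \<in> borel_measurable N"
  using measurable_compose[of "\<lambda>q. (s q, w q)" N "borel \<Otimes>\<^sub>M alg S", OF _ measurable_alg_W_joint[OF assms(2,1)]] assms
  by simp

text \<open>Measurability jointly in time, space and noise is required because the recursion
  evaluates \<open>V\<close> at random times and positions.\<close>

definition V_measurable :: "int list \<Rightarrow> nat \<Rightarrow> bool" where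
  "V_measurable \<theta> n \<longleftrightarrow> (\<lambda>p. V \<theta> n (fst p) (fst (snd p)) (snd (snd p))) \<in> borel_measurable (borel \<Otimes>\<^sub>M (borel \<Otimes>\<^sub>M alg (offspring \<theta>)))"

lemma V_comp:
  assumes "V_measurable \<theta> n" "offspring \<theta> \<subseteq> S" "s \<in> borel_measurable N" "X \<in> borel_measurable N" "w \<in> measurable N (alg S)"
  shows "(\<lambda>q. V \<theta> n (s q) (X q) (w q)) \<in> borel_measurable N"
proof -
  have "w \<in> measurable N (alg (offspring \<theta>))"
    using measurable_compose[OF assms(5) measurable_id_alg[OF assms(2)]] by simp
  then show ?thesis
    using measurable_compose[of "\<lambda>q. (s q, X q, w q)" N _, OF _ assms(1)[unfolded V_measurable_def]] assms by simp
qed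

lemma f_at_comp:
  assumes \<eta>: "\<eta> \<in> Theta" and S: "{Inl \<eta>, Inr \<eta>} \<union> offspring \<eta>' \<subseteq> S" and V: "V_measurable \<eta>' l"
    and [measurable]: "s \<in> borel_measurable N" "X \<in> borel_measurable N" and w: "w \<in> measurable N (alg S)"
  shows "(\<lambda>q. f_at \<eta> \<eta>' l (clip T (s q)) (X q) (w q)) \<in> borel_measurable N"
proof -
  have Um [measurable]: "(\<lambda>q. U \<eta> (w q)) \<in> borel_measurable N"
    using measurable_compose[OF w measurable_alg_U] S by auto
  have [measurable]: "(\<lambda>q. X q + W \<eta> (clip T (U \<eta> (w q) * clip T (s q))) (w q)) \<in> borel_measurable N"
    by (rule measurable_fun_plus[OF _ W_comp[OF \<eta> _ _ w]]) (use S in auto)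
  have [measurable]: "(\<lambda>q. V \<eta>' l ((1 - U \<eta> (w q)) * clip T (s q)) (X q + W \<eta> (clip T (U \<eta> (w q) * clip T (s q))) (w q)) (w q)) \<in> borel_measurable N"
    by (rule V_comp[OF V _ _ _ w]) (use S in auto)
  have "(\<lambda>q. f (T - (1 - U \<eta> (w q)) * clip T (s q)) (X q + W \<eta> (clip T (U \<eta> (w q) * clip T (s q))) (w q))
     (V \<eta>' l ((1 - U \<eta> (w q)) * clip T (s q)) (X q + W \<eta> (clip T (U \<eta> (w q) * clip T (s q))) (w q)) (w q))) \<in> borel_measurable N"
    by (rule measurable_f) measurable
  moreover have "clip T (U \<eta> (w q) * clip T (s q)) = U \<eta> (w q) * clip T (s q)" if "q \<in> space N" for q
  proof -
    have "w q \<in> space P" using measurable_space[OF w that] by simp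
    then show ?thesis
      using times_in_range[of "clip T (s q)" "U \<eta> (w q)"] U_bounds[OF \<eta>] clip_range T by simp
  qed
  ultimately show ?thesis
    unfolding f_at_def by (simp cong: measurable_cong)
qed

lemma V_meas: "V_measurable \<theta> n" if "\<theta> \<in> Theta"
  using that
proof (induction n arbitrary: \<theta> rule: less_induct)
  case (less n)
  let ?N = "borel \<Otimes>\<^sub>M (borel \<Otimes>\<^sub>M alg (offspring \<theta>)) :: (real \<times> (nat \<Rightarrow> real) \<times> 'w) measure"
  show ?case
  proof (cases "n = 0")
    case True
    have "(\<lambda>p. V \<theta> n (fst p) (fst (snd p)) (snd (snd p))) \<in> borel_measurable ?N \<longleftrightarrow> (\<lambda>p. 0::real) \<in> borel_measurable ?N"
      by (rule measurable_cong) (auto simp: True V_0 less.prems space_pair_measure)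
    then show ?thesis unfolding V_measurable_def by simp
  next
    case False
    have w: "(\<lambda>p. snd (snd p)) \<in> measurable ?N (alg (offspring \<theta>))" by measurable
    have sub: "family (\<theta> @ [a, b]) \<subseteq> offspring \<theta>" for a b by (rule family_child) simp
    have o: "{Inl (\<theta> @ [a, b]), Inr (\<theta> @ [a, b])} \<union> offspring (\<theta> @ [c, e]) \<subseteq> offspring \<theta>" for a b c e
      using sub[of a b] sub[of c e] unfolding family_eq by blast
    have [measurable]: "(\<lambda>p. summand \<theta> l i (clip T (fst p)) (fst (snd p)) (snd (snd p))) \<in> borel_measurable ?N" if "l < n" for l i
    proof -
      have "V_measurable \<eta> l" "V_measurable \<eta> (l - 1)" if "\<eta> \<in> Theta" for \<eta>
        using less.IH[of l \<eta>] less.IH[of "l - 1" \<eta>] \<open>l < n\<close> that by auto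
      then have Vm: "V_measurable (\<theta> @ [a, b]) l" "V_measurable (\<theta> @ [a, b]) (l - 1)" for a b
        by simp_all
      have [measurable]: "(\<lambda>p. f_at (\<theta> @ [int l, int i]) (\<theta> @ [int l, int i]) l (clip T (fst p)) (fst (snd p)) (snd (snd p))) \<in> borel_measurable ?N"
        "(\<lambda>p. f_at (\<theta> @ [int l, int i]) (\<theta> @ [- int l, int i]) (l - 1) (clip T (fst p)) (fst (snd p)) (snd (snd p))) \<in> borel_measurable ?N"
        by (rule f_at_comp[OF snoc2_in_Theta o Vm(1) _ _ w] f_at_comp[OF snoc2_in_Theta o Vm(2) _ _ w]; measurable)+
      show ?thesis unfolding summand_def by measurable
    qed
    have [measurable]: "(\<lambda>p. g (fst (snd p) + W (\<theta> @ [0, int i]) (clip T (fst p)) (snd (snd p)))) \<in> borel_measurable ?N" for i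
    proof -
      have "Inr (\<theta> @ [0, int i]) \<in> offspring \<theta>" using sub[of 0 "int i"] by (auto simp: family_eq)
      then have [measurable]: "(\<lambda>p. W (\<theta> @ [0, int i]) (clip T (fst p)) (snd (snd p))) \<in> borel_measurable ?N"
        by (intro W_comp[OF _ _ _ w]) auto
      show ?thesis by measurable
    qed
    have "(\<lambda>p. V \<theta> n (fst p) (fst (snd p)) (snd (snd p))) \<in> borel_measurable ?N \<longleftrightarrow>
      (\<lambda>p. 1 / real M ^ n * (\<Sum>i=1..M ^ n. g (fst (snd p) + W (\<theta> @ [0, int i]) (clip T (fst p)) (snd (snd p))))
        + (\<Sum>l<n. 1 / real M ^ (n - l) * (\<Sum>i=1..M ^ (n - l). summand \<theta> l i (clip T (fst p)) (fst (snd p)) (snd (snd p))))) \<in> borel_measurable ?N"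
    proof (rule measurable_cong)
      fix p assume "p \<in> space ?N"
      then have "snd (snd p) \<in> space P" by (auto simp: space_pair_measure)
      then show "V \<theta> n (fst p) (fst (snd p)) (snd (snd p)) =
         1 / real M ^ n * (\<Sum>i=1..M ^ n. g (fst (snd p) + W (\<theta> @ [0, int i]) (clip T (fst p)) (snd (snd p))))
        + (\<Sum>l<n. 1 / real M ^ (n - l) * (\<Sum>i=1..M ^ (n - l). summand \<theta> l i (clip T (fst p)) (fst (snd p)) (snd (snd p))))"
        unfolding V_clip[symmetric, of \<theta> n "fst p"]
        using False less.prems clip_range[of T "fst p"] T by (intro V_rec') auto
    qed
    then show ?thesis unfolding V_measurable_def by (rule iffD2) measurable
  qed
qed

lemma offspring_sources: "\<theta> \<in> Theta \<Longrightarrow> offspring \<theta> \<subseteq> sources"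
  by (auto simp: offspring_def sources_def Theta_def)

lemma family_sources: "\<theta> \<in> Theta \<Longrightarrow> family \<theta> \<subseteq> sources"
  by (auto simp: family_def sources_def Theta_def)

lemma V_alg: "\<theta> \<in> Theta \<Longrightarrow> V \<theta> n \<tau> x \<in> borel_measurable (alg (offspring \<theta>))"
  using V_comp[OF V_meas, of \<theta> "offspring \<theta>" "\<lambda>_. \<tau>" "alg (offspring \<theta>)" "\<lambda>_. x" "\<lambda>\<omega>. \<omega>" n]
    measurable_id_alg[OF order_refl] by simp

lemma V_random: "\<theta> \<in> Theta \<Longrightarrow> V \<theta> n \<tau> x \<in> borel_measurable P"
  using measurable_alg_P[OF offspring_sources V_alg] by blast

lemma f_at_alg:
  assumes "\<eta> \<in> Theta" "\<eta>' \<in> Theta" "{Inl \<eta>, Inr \<eta>} \<union> offspring \<eta>' \<subseteq> S" "0 \<le> \<tau>" "\<tau> \<le> T"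
  shows "f_at \<eta> \<eta>' l \<tau> x \<in> borel_measurable (alg S)"
  using f_at_comp[OF assms(1,3) V_meas[OF assms(2)], of "\<lambda>_. \<tau>" "alg S" "\<lambda>_. x" "\<lambda>\<omega>. \<omega>" l]
    measurable_id_alg[OF order_refl] assms by simp

lemma summand_alg:
  assumes "0 \<le> \<tau>" "\<tau> \<le> T"
  shows "summand \<theta> l i \<tau> x \<in> borel_measurable (alg (family (\<theta> @ [int l, int i]) \<union> family (\<theta> @ [- int l, int i])))"
proof -
  let ?S = "family (\<theta> @ [int l, int i]) \<union> family (\<theta> @ [- int l, int i])"
  have [measurable]: "f_at (\<theta> @ [int l, int i]) (\<theta> @ [int l, int i]) l \<tau> x \<in> borel_measurable (alg ?S)"
    "f_at (\<theta> @ [int l, int i]) (\<theta> @ [- int l, int i]) (l - 1) \<tau> x \<in> borel_measurable (alg ?S)"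
    by (rule f_at_alg; use assms in \<open>auto simp: family_eq\<close>)+
  show ?thesis unfolding summand_def[abs_def] by measurable
qed

text \<open>The correction term of a level uses the index (-l, i), so a block consists of two
  families, which coincide at l = 0. Different pairs (l, i) give different tuples of equal length,
  whatever the signs.\<close>

lemma disjoint_blocks:
  "disjoint_family_on (\<lambda>(l, i). family (\<theta> @ [int l, int i]) \<union> family (\<theta> @ [- int l, int i])) J"
proof -
  have D: "family (\<theta> @ [a, int i]) \<inter> family (\<theta> @ [b, int j]) = {}"
    if "(l, i) \<noteq> (k, j)" "a = int l \<or> a = - int l" "b = int k \<or> b = - int k" for l i k j a b
    using that by (intro family_disjoint) auto
  show ?thesis
    unfolding disjoint_family_on_def
  proof (intro ballI impI)
    fix p q :: "nat \<times> nat" assume "p \<noteq> q"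
    moreover obtain l i k j where pq: "p = (l, i)" "q = (k, j)" by (cases p, cases q)
    ultimately have ne: "(l, i) \<noteq> (k, j)" by simp
    show "(case p of (l, i) \<Rightarrow> family (\<theta> @ [int l, int i]) \<union> family (\<theta> @ [- int l, int i])) \<inter>
      (case q of (l, i) \<Rightarrow> family (\<theta> @ [int l, int i]) \<union> family (\<theta> @ [- int l, int i])) = {}"
      using D[OF ne, of "int l" "int k"] D[OF ne, of "int l" "- int k"]
        D[OF ne, of "- int l" "int k"] D[OF ne, of "- int l" "- int k"]
      by (simp add: pq Int_Un_distrib Int_Un_distrib2)
  qed
qed

end

section \<open>Equality in law of the approximations\<close>

lemma distr_eqI_nn_integral:
  assumes [measurable]: "X \<in> measurable M1 N" "X' \<in> measurable M2 N"
    and eq: "\<And>H. H \<in> borel_measurable N \<Longrightarrow> (\<integral>\<^sup>+\<omega>. H (X \<omega>) \<partial>M1) = (\<integral>\<^sup>+\<omega>. H (X' \<omega>) \<partial>M2)"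
  shows "distr M1 N X = distr M2 N X'"
proof (rule measure_eqI)
  fix A assume "A \<in> sets (distr M1 N X)"
  then have A [measurable]: "A \<in> sets N" by simp
  have "emeasure (distr M1 N X) A = (\<integral>\<^sup>+y. indicator A y \<partial>distr M1 N X)" by simp
  also have "\<dots> = (\<integral>\<^sup>+\<omega>. indicator A (X \<omega>) \<partial>M1)" by (rule nn_integral_distr) measurable
  also have "\<dots> = (\<integral>\<^sup>+\<omega>. indicator A (X' \<omega>) \<partial>M2)" by (rule eq) measurable
  also have "\<dots> = (\<integral>\<^sup>+y. indicator A y \<partial>distr M2 N X')" by (rule nn_integral_distr[symmetric]) measurable
  also have "\<dots> = emeasure (distr M2 N X') A" by simp
  finally show "emeasure (distr M1 N X) A = emeasure (distr M2 N X') A" .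
qed simp

context bm_noise
begin

lemma measurable_alg_pair_P:
  assumes "R \<subseteq> sources" "G \<in> measurable (N \<Otimes>\<^sub>M alg R) K"
  shows "G \<in> measurable (N \<Otimes>\<^sub>M P) K"
proof -
  have "(\<lambda>p. (fst p, snd p)) \<in> measurable (N \<Otimes>\<^sub>M P) (N \<Otimes>\<^sub>M alg R)"
    by (rule measurable_Pair[OF measurable_fst measurable_compose[OF measurable_snd measurable_id_P[OF assms(1)]]])
  from measurable_compose[OF this assms(2)] show ?thesis by simp
qed

lemma measurable_nn_integral_alg:
  assumes "R \<subseteq> sources" "G \<in> borel_measurable (N \<Otimes>\<^sub>M alg R)"
  shows "(\<lambda>a. \<integral>\<^sup>+\<omega>. G (a, \<omega>) \<partial>P) \<in> borel_measurable N"
  by (rule borel_measurable_nn_integral_fst[OF measurable_alg_pair_P[OF assms]])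

lemma UW_alg:
  assumes \<eta>: "\<eta> \<in> Theta" and \<tau>: "0 \<le> \<tau>" "\<tau> \<le> T"
  shows "(\<lambda>\<omega>. (U \<eta> \<omega>, x + W \<eta> (U \<eta> \<omega> * \<tau>) \<omega>)) \<in> measurable (alg {Inl \<eta>, Inr \<eta>}) (borel \<Otimes>\<^sub>M borel)"
proof -
  let ?S = "{Inl \<eta>, Inr \<eta>}"
  have [measurable]: "U \<eta> \<in> borel_measurable (alg ?S)" by (rule measurable_alg_U) simp
  have [measurable]: "(\<lambda>\<omega>. W \<eta> (clip T (U \<eta> \<omega> * \<tau>)) \<omega>) \<in> borel_measurable (alg ?S)"
    using measurable_compose[of "\<lambda>\<omega>. (U \<eta> \<omega> * \<tau>, \<omega>)" "alg ?S" "borel \<Otimes>\<^sub>M alg ?S", OF _ measurable_alg_W_joint[OF _ \<eta>]]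
      measurable_id_alg[OF order_refl] by simp
  have cl: "clip T (U \<eta> \<omega> * \<tau>) = U \<eta> \<omega> * \<tau>" if "\<omega> \<in> space P" for \<omega>
    using U_range[OF \<eta> that] \<tau> mult_right_mono[of "U \<eta> \<omega>" 1 \<tau>] by simp
  have "(\<lambda>\<omega>. (U \<eta> \<omega>, x + W \<eta> (U \<eta> \<omega> * \<tau>) \<omega>)) \<in> measurable (alg ?S) (borel \<Otimes>\<^sub>M borel) \<longleftrightarrow>
    (\<lambda>\<omega>. (U \<eta> \<omega>, x + W \<eta> (clip T (U \<eta> \<omega> * \<tau>)) \<omega>)) \<in> measurable (alg ?S) (borel \<Otimes>\<^sub>M borel)"
    by (rule measurable_cong) (simp add: cl)
  then show ?thesis by (rule iffD2) measurable
qed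

lemma self_sources: "\<eta> \<in> Theta \<Longrightarrow> {Inl \<eta>, Inr \<eta>} \<subseteq> sources"
  by (auto simp: sources_def)

lemma distr_UW:
  assumes \<eta>: "\<eta> \<in> Theta" and \<tau>: "0 \<le> \<tau>" "\<tau> \<le> T"
  shows "distr P (borel \<Otimes>\<^sub>M borel) (\<lambda>\<omega>. (U \<eta> \<omega>, x + W \<eta> (U \<eta> \<omega> * \<tau>) \<omega>))
    = distr (noise d) (borel \<Otimes>\<^sub>M borel) (\<lambda>p. (fst p, heat_shift x (fst p * \<tau>) (snd p)))"
proof (rule distr_eqI_nn_integral)
  show "(\<lambda>\<omega>. (U \<eta> \<omega>, x + W \<eta> (U \<eta> \<omega> * \<tau>) \<omega>)) \<in> measurable P (borel \<Otimes>\<^sub>M borel)"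
    by (rule measurable_alg_P[OF self_sources[OF \<eta>] UW_alg[OF assms]])
qed (use nn_integral_UW[OF assms] in auto)

text \<open>One step of the scheme: time fraction and position are drawn first, and everything
  driven by the remaining sources \<open>R\<close> is integrated with them frozen.\<close>

lemma freeze_level:
  assumes \<eta>: "\<eta> \<in> Theta" and R: "R \<subseteq> sources" "R \<inter> {Inl \<eta>, Inr \<eta>} = {}" and \<tau>: "0 \<le> \<tau>" "\<tau> \<le> T"
    and G: "G \<in> borel_measurable ((borel \<Otimes>\<^sub>M borel) \<Otimes>\<^sub>M alg R)"
  shows "(\<integral>\<^sup>+\<omega>. G ((U \<eta> \<omega>, x + W \<eta> (U \<eta> \<omega> * \<tau>) \<omega>), \<omega>) \<partial>P)
    = (\<integral>\<^sup>+p. (\<integral>\<^sup>+\<omega>. G ((fst p, heat_shift x (fst p * \<tau>) (snd p)), \<omega>) \<partial>P) \<partial>noise d)"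
proof -
  let ?X = "\<lambda>\<omega>. (U \<eta> \<omega>, x + W \<eta> (U \<eta> \<omega> * \<tau>) \<omega>)"
  have [measurable]: "(\<lambda>a. \<integral>\<^sup>+\<omega>. G (a, \<omega>) \<partial>P) \<in> borel_measurable (borel \<Otimes>\<^sub>M borel)"
    by (rule measurable_nn_integral_alg[OF R(1) G])
  have "(\<integral>\<^sup>+\<omega>. G (?X \<omega>, \<omega>) \<partial>P) = (\<integral>\<^sup>+a. (\<integral>\<^sup>+\<omega>. G (a, \<omega>) \<partial>P) \<partial>distr P (borel \<Otimes>\<^sub>M borel) ?X)"
    by (rule nn_integral_freeze[OF self_sources[OF \<eta>] R(1) _ UW_alg[OF \<eta> \<tau>] G]) (use R(2) in auto)
  also have "\<dots> = (\<integral>\<^sup>+p. (\<integral>\<^sup>+\<omega>. G ((fst p, heat_shift x (fst p * \<tau>) (snd p)), \<omega>) \<partial>P) \<partial>noise d)"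
    unfolding distr_UW[OF \<eta> \<tau>] by (rule nn_integral_distr) measurable
  finally show ?thesis .
qed

text \<open>At level 0 the terminal sample and the source sample use the same Brownian path, so the
  law of their sum requires the joint law at the random time and at the final time.\<close>

lemma UW2_law:
  assumes \<theta>: "\<theta> \<in> Theta" "\<theta>' \<in> Theta" and \<tau>: "0 \<le> \<tau>" "\<tau> \<le> T"
    and H [measurable]: "H \<in> borel_measurable (borel \<Otimes>\<^sub>M (borel \<Otimes>\<^sub>M borel))"
  shows "(\<integral>\<^sup>+\<omega>. H (U \<theta> \<omega>, x + W \<theta> (U \<theta> \<omega> * \<tau>) \<omega>, x + W \<theta> \<tau> \<omega>) \<partial>P)
    = (\<integral>\<^sup>+\<omega>. H (U \<theta>' \<omega>, x + W \<theta>' (U \<theta>' \<omega> * \<tau>) \<omega>, x + W \<theta>' \<tau> \<omega>) \<partial>P)"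
proof -
  \<comment> \<open>A common value of both sides that mentions no index; \<tau> = 0 is separated
    because both times then coincide.\<close>
  define K where "K u = (if \<tau> = 0 then H (u, x, x) else
     (\<integral>\<^sup>+z. (\<integral>\<^sup>+z'. H (u, heat_shift x (u * \<tau>) z, heat_shift (heat_shift x (u * \<tau>) z) (\<tau> - u * \<tau>) z') \<partial>gauss d) \<partial>gauss d))" for u
  have "(\<integral>\<^sup>+\<omega>. H (U \<theta> \<omega>, x + W \<theta> (U \<theta> \<omega> * \<tau>) \<omega>, x + W \<theta> \<tau> \<omega>) \<partial>P) = (\<integral>\<^sup>+u. K u \<partial>unif)" if \<theta>: "\<theta> \<in> Theta" for \<theta>
  proof -
    let ?S = "{Inr \<theta>} :: (int list + int list) set"
    define H' where "H' p = H (fst p, x + W \<theta> (clip T (fst p * \<tau>)) (snd p), x + W \<theta> \<tau> (snd p))" for p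
    have [measurable]: "(\<lambda>p. W \<theta> (clip T (fst p * \<tau>)) (snd p)) \<in> borel_measurable (borel \<Otimes>\<^sub>M alg ?S)"
      using measurable_compose[of "\<lambda>p. (fst p * \<tau>, snd p)" "borel \<Otimes>\<^sub>M alg ?S" "borel \<Otimes>\<^sub>M alg ?S", OF _ measurable_alg_W_joint[OF _ \<theta>]]
      by simp
    have [measurable]: "W \<theta> \<tau> \<in> borel_measurable (alg ?S)" by (rule measurable_alg_W) (use \<tau> in auto)
    have H' [measurable]: "H' \<in> borel_measurable (borel \<Otimes>\<^sub>M alg ?S)" unfolding H'_def by measurable
    have clipu: "clip T (u * \<tau>) = u * \<tau>" if "0 \<le> u" "u \<le> 1" for u
      using that \<tau> mult_right_mono[of u 1 \<tau>] by simp
    have "(\<integral>\<^sup>+\<omega>. H (U \<theta> \<omega>, x + W \<theta> (U \<theta> \<omega> * \<tau>) \<omega>, x + W \<theta> \<tau> \<omega>) \<partial>P) = (\<integral>\<^sup>+\<omega>. H' (U \<theta> \<omega>, \<omega>) \<partial>P)"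
      using U_range[OF \<theta>] clipu by (intro nn_integral_cong) (auto simp: H'_def)
    also have "\<dots> = (\<integral>\<^sup>+u. (\<integral>\<^sup>+\<omega>. H' (u, \<omega>) \<partial>P) \<partial>distr P borel (U \<theta>))"
      by (rule nn_integral_freeze[OF sources_pair[OF \<theta>] _ measurable_alg_U H']) auto
    also have "\<dots> = (\<integral>\<^sup>+u. (\<integral>\<^sup>+\<omega>. H' (u, \<omega>) \<partial>P) \<partial>unif)"
      by (rule nn_integral_U[OF \<theta> measurable_nn_integral_alg[OF sources_pair(2)[OF \<theta>] H']])
    also have "\<dots> = (\<integral>\<^sup>+u. K u \<partial>unif)"
    proof (rule nn_integral_cong_AE)
      \<comment> \<open>The end points of the unit interval form a null set; strictly between them
        the two times are positive and distinct, as \<open>nn_integral_W2\<close> demands.\<close>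
      have "AE u in lborel. u \<noteq> (0::real)" "AE u in lborel. u \<noteq> (1::real)" by (rule AE_lborel_singleton)+
      then have "AE u in unif. u \<in> {0<..<1}"
        by (intro AE_uniform_measureI) auto
      then show "AE u in unif. (\<integral>\<^sup>+\<omega>. H' (u, \<omega>) \<partial>P) = K u"
      proof eventually_elim
        case (elim u)
        show ?case
        proof (cases "\<tau> = 0")
          case True
          have "(\<integral>\<^sup>+\<omega>. H' (u, \<omega>) \<partial>P) = (\<integral>\<^sup>+\<omega>. H (u, x, x) \<partial>P)"
            using W_zero[OF \<theta>] T by (intro nn_integral_cong_AE) (auto simp: H'_def True elim!: eventually_mono)
          then show ?thesis using True emeasure_space_1 by (simp add: K_def)
        next
          case False
          then have "0 < u * \<tau>" "u * \<tau> < \<tau>" using elim \<tau> by auto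
          then show ?thesis
            using nn_integral_W2[OF \<theta>, of "u * \<tau>" \<tau> "\<lambda>q. H (u, q)" x] elim \<tau> False clipu[of u]
            by (simp add: H'_def K_def)
        qed
      qed
    qed
    finally show ?thesis .
  qed
  then show ?thesis using \<theta> by simp
qed

end

context mlp
begin

lemma V_pair_law:
  assumes "\<eta> \<in> Theta" "\<eta>' \<in> Theta" "offspring \<eta> \<inter> offspring \<eta>' = {}"
  shows "distr P (borel \<Otimes>\<^sub>M borel) (\<lambda>\<omega>. (V \<eta> l s z \<omega>, V \<eta>' k s z \<omega>)) = distr P borel (V \<eta> l s z) \<Otimes>\<^sub>M distr P borel (V \<eta>' k s z)"
  by (rule distr_freeze[OF offspring_sources offspring_sources _ V_alg V_alg]) (use assms in auto)

text \<open>The law does not depend on the index tuple; this is no statement of stochastic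
  independence.\<close>

definition law_indep :: "nat \<Rightarrow> bool" where
  "law_indep n \<longleftrightarrow> (\<forall>\<theta>\<in>Theta. \<forall>\<theta>'\<in>Theta. \<forall>\<tau>\<in>{0..T}. \<forall>x. distr P borel (V \<theta> n \<tau> x) = distr P borel (V \<theta>' n \<tau> x))"

text \<open>Expresses a summand through the laws of the two approximations alone. Their joint law is
  a product because the indices (l, i) and (-l, i) have disjoint offspring for l \<ge> 1.\<close>

lemma nn_integral_summand:
  assumes \<tau>: "0 \<le> \<tau>" "\<tau> \<le> T" and l: "1 \<le> l" and H [measurable]: "H \<in> borel_measurable borel"
  shows "(\<integral>\<^sup>+\<omega>. H (summand \<theta> l i \<tau> x \<omega>) \<partial>P) =
    (\<integral>\<^sup>+p. (\<integral>\<^sup>+q. H (\<tau> * (f (T - (1 - fst p) * \<tau>) (heat_shift x (fst p * \<tau>) (snd p)) (fst q)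
        - f (T - (1 - fst p) * \<tau>) (heat_shift x (fst p * \<tau>) (snd p)) (snd q)))
      \<partial>(distr P borel (V (\<theta> @ [int l, int i]) l ((1 - fst p) * \<tau>) (heat_shift x (fst p * \<tau>) (snd p)))
        \<Otimes>\<^sub>M distr P borel (V (\<theta> @ [- int l, int i]) (l - 1) ((1 - fst p) * \<tau>) (heat_shift x (fst p * \<tau>) (snd p)))))
      \<partial>noise d)"
proof -
  let ?\<eta> = "\<theta> @ [int l, int i]" and ?\<eta>' = "\<theta> @ [- int l, int i]"
  let ?R = "offspring ?\<eta> \<union> offspring ?\<eta>'"
  have "family ?\<eta> \<inter> family ?\<eta>' = {}" using l by (intro family_disjoint) auto
  then have disj: "offspring ?\<eta> \<inter> offspring ?\<eta>' = {}" "?R \<inter> {Inl ?\<eta>, Inr ?\<eta>} = {}"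
    using offspring_not_self[of ?\<eta>] unfolding family_eq by blast+
  have R: "?R \<subseteq> sources" using offspring_sources by simp
  define G where "G q = H (\<tau> * (f (T - (1 - fst (fst q)) * \<tau>) (snd (fst q)) (V ?\<eta> l ((1 - fst (fst q)) * \<tau>) (snd (fst q)) (snd q))
     - f (T - (1 - fst (fst q)) * \<tau>) (snd (fst q)) (V ?\<eta>' (l - 1) ((1 - fst (fst q)) * \<tau>) (snd (fst q)) (snd q))))"
    for q :: "(real \<times> (nat \<Rightarrow> real)) \<times> 'w"
  let ?N = "(borel \<Otimes>\<^sub>M borel) \<Otimes>\<^sub>M alg ?R"
  have w: "snd \<in> measurable ?N (alg ?R)" by measurable
  have [measurable]: "(\<lambda>q. V ?\<eta> l ((1 - fst (fst q)) * \<tau>) (snd (fst q)) (snd q)) \<in> borel_measurable ?N"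
    "(\<lambda>q. V ?\<eta>' (l - 1) ((1 - fst (fst q)) * \<tau>) (snd (fst q)) (snd q)) \<in> borel_measurable ?N"
    by (rule V_comp[OF V_meas _ _ _ w]; simp)+
  have [measurable]: "(\<lambda>q. f (T - (1 - fst (fst q)) * \<tau>) (snd (fst q)) (V ?\<eta> l ((1 - fst (fst q)) * \<tau>) (snd (fst q)) (snd q))) \<in> borel_measurable ?N"
    "(\<lambda>q. f (T - (1 - fst (fst q)) * \<tau>) (snd (fst q)) (V ?\<eta>' (l - 1) ((1 - fst (fst q)) * \<tau>) (snd (fst q)) (snd q))) \<in> borel_measurable ?N"
    by (rule measurable_f; measurable)+
  have G: "G \<in> borel_measurable ?N" unfolding G_def by measurable
  have "(\<integral>\<^sup>+\<omega>. H (summand \<theta> l i \<tau> x \<omega>) \<partial>P) = (\<integral>\<^sup>+\<omega>. G ((U ?\<eta> \<omega>, x + W ?\<eta> (U ?\<eta> \<omega> * \<tau>) \<omega>), \<omega>) \<partial>P)"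
    using l by (simp add: G_def summand_def f_at_def)
  also have "\<dots> = (\<integral>\<^sup>+p. (\<integral>\<^sup>+\<omega>. G ((fst p, heat_shift x (fst p * \<tau>) (snd p)), \<omega>) \<partial>P) \<partial>noise d)"
    by (rule freeze_level[OF snoc2_in_Theta R disj(2) \<tau> G])
  also have "\<dots> = (\<integral>\<^sup>+p. (\<integral>\<^sup>+q. H (\<tau> * (f (T - (1 - fst p) * \<tau>) (heat_shift x (fst p * \<tau>) (snd p)) (fst q)
        - f (T - (1 - fst p) * \<tau>) (heat_shift x (fst p * \<tau>) (snd p)) (snd q)))
      \<partial>(distr P borel (V ?\<eta> l ((1 - fst p) * \<tau>) (heat_shift x (fst p * \<tau>) (snd p)))
        \<Otimes>\<^sub>M distr P borel (V ?\<eta>' (l - 1) ((1 - fst p) * \<tau>) (heat_shift x (fst p * \<tau>) (snd p)))))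
      \<partial>noise d)"
  proof (rule nn_integral_cong)
    fix p :: "real \<times> (nat \<Rightarrow> real)"
    define s where "s = (1 - fst p) * \<tau>"
    define z where "z = heat_shift x (fst p * \<tau>) (snd p)"
    have [measurable]: "V ?\<eta> l s z \<in> borel_measurable P" "V ?\<eta>' (l - 1) s z \<in> borel_measurable P"
      by (rule V_random; simp)+
    have [measurable]: "(\<lambda>q. f (T - s) z (fst q)) \<in> borel_measurable (borel \<Otimes>\<^sub>M borel)"
      "(\<lambda>q. f (T - s) z (snd q)) \<in> borel_measurable (borel \<Otimes>\<^sub>M borel)"
      by (rule measurable_f; measurable)+
    have "(\<integral>\<^sup>+\<omega>. G ((fst p, z), \<omega>) \<partial>P)
      = (\<integral>\<^sup>+\<omega>. (\<lambda>q. H (\<tau> * (f (T - s) z (fst q) - f (T - s) z (snd q)))) (V ?\<eta> l s z \<omega>, V ?\<eta>' (l - 1) s z \<omega>) \<partial>P)"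
      by (simp add: G_def s_def)
    also have "\<dots> = (\<integral>\<^sup>+q. H (\<tau> * (f (T - s) z (fst q) - f (T - s) z (snd q))) \<partial>distr P (borel \<Otimes>\<^sub>M borel) (\<lambda>\<omega>. (V ?\<eta> l s z \<omega>, V ?\<eta>' (l - 1) s z \<omega>)))"
      by (rule nn_integral_distr[symmetric]) measurable
    finally show "(\<integral>\<^sup>+\<omega>. G ((fst p, heat_shift x (fst p * \<tau>) (snd p)), \<omega>) \<partial>P) =
       (\<integral>\<^sup>+q. H (\<tau> * (f (T - (1 - fst p) * \<tau>) (heat_shift x (fst p * \<tau>) (snd p)) (fst q)
        - f (T - (1 - fst p) * \<tau>) (heat_shift x (fst p * \<tau>) (snd p)) (snd q)))
      \<partial>(distr P borel (V ?\<eta> l ((1 - fst p) * \<tau>) (heat_shift x (fst p * \<tau>) (snd p)))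
        \<Otimes>\<^sub>M distr P borel (V ?\<eta>' (l - 1) ((1 - fst p) * \<tau>) (heat_shift x (fst p * \<tau>) (snd p)))))"
      unfolding V_pair_law[OF snoc2_in_Theta snoc2_in_Theta disj(1)] s_def z_def .
  qed
  finally show ?thesis .
qed

lemma law_indepD:
  assumes "law_indep n" "\<theta> \<in> Theta" "\<theta>' \<in> Theta" "0 \<le> \<tau>" "\<tau> \<le> T"
  shows "distr P borel (V \<theta> n \<tau> x) = distr P borel (V \<theta>' n \<tau> x)"
  using assms(1)[unfolded law_indep_def, THEN bspec, OF assms(2), THEN bspec, OF assms(3), THEN bspec, of \<tau>] assms(4,5)
  by (simp only: atLeastAtMost_iff simp_thms)

text \<open>Strong induction: an approximation is a sum of independent blocks, and the law of each
  block is determined by the noise and by the laws of lower levels.\<close>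

lemma law_indep: "law_indep n"
proof (induction n rule: less_induct)
  case (less n)
  show ?case
    unfolding law_indep_def
  proof (intro ballI allI)
    fix \<theta> \<theta>' \<tau> x assume \<theta>: "\<theta> \<in> Theta" "\<theta>' \<in> Theta" and "\<tau> \<in> {0..T}"
    then have \<tau>: "0 \<le> \<tau>" "\<tau> \<le> T" by auto
    show "distr P borel (V \<theta> n \<tau> x) = distr P borel (V \<theta>' n \<tau> x)"
    proof (cases "n = 0")
      case True
      then show ?thesis using V_0 \<theta> by (intro distr_cong) auto
    next
      case False
      define I where "I = (SIGMA l:{..<n}. {1..M ^ (n - l)})"
      \<comment> \<open>The terminal samples are attached to the blocks of level 0, with which they
        share sources; only then are the blocks independent.\<close>
      define X where "X \<theta> k \<omega> = (if fst k = 0 then 1 / real M ^ n * g (x + W (\<theta> @ [0, int (snd k)]) \<tau> \<omega>) else 0)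
         + 1 / real M ^ (n - fst k) * summand \<theta> (fst k) (snd k) \<tau> x \<omega>" for \<theta> k \<omega>
      define B where "B \<theta> = (\<lambda>(l, i). family (\<theta> @ [int l, int i]) \<union> family (\<theta> @ [- int l, int i]))" for \<theta>
      have V_sum: "V \<theta> n \<tau> x \<omega> = (\<Sum>k\<in>I. X \<theta> k \<omega>)" if "\<theta> \<in> Theta" "\<omega> \<in> space P" for \<theta> \<omega>
      proof -
        have "(\<Sum>k\<in>I. X \<theta> k \<omega>) = (\<Sum>l<n. \<Sum>i=1..M ^ (n - l). X \<theta> (l, i) \<omega>)"
          unfolding I_def by (subst sum.Sigma) auto
        also have "\<dots> = (\<Sum>l<n. (if l = 0 then (\<Sum>i=1..M ^ n. 1 / real M ^ n * g (x + W (\<theta> @ [0, int i]) \<tau> \<omega>)) else 0)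
           + 1 / real M ^ (n - l) * (\<Sum>i=1..M ^ (n - l). summand \<theta> l i \<tau> x \<omega>))"
          by (intro sum.cong refl) (auto simp: X_def sum.distrib sum_distrib_left)
        also have "\<dots> = V \<theta> n \<tau> x \<omega>"
          using False that \<tau> by (simp add: V_rec' sum.distrib sum_distrib_left)
        finally show ?thesis by simp
      qed
      have X_alg: "X \<theta> k \<in> borel_measurable (alg (B \<theta> k))" for \<theta> k
      proof -
        obtain l i where k: "k = (l, i)" by (cases k)
        have [measurable]: "summand \<theta> l i \<tau> x \<in> borel_measurable (alg (B \<theta> k))"
          using summand_alg[OF \<tau>] by (simp add: B_def k)
        have [measurable]: "(\<lambda>\<omega>. if l = 0 then 1 / real M ^ n * g (x + W (\<theta> @ [0, int i]) \<tau> \<omega>) else 0) \<in> borel_measurable (alg (B \<theta> k))"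
        proof (cases "l = 0")
          case True
          then have "W (\<theta> @ [0, int i]) \<tau> \<in> borel_measurable (alg (B \<theta> k))"
            by (intro measurable_alg_W \<tau>) (auto simp: B_def k family_eq)
          then show ?thesis using True by simp
        qed simp
        have fs: "fst k = l" "snd k = i" by (simp_all add: k)
        show ?thesis unfolding X_def[abs_def] fs by measurable
      qed
      have B_src: "B \<theta> k \<subseteq> sources" for \<theta> k
        using family_sources by (auto simp: B_def split: prod.split)
      have X_P: "X \<theta> k \<in> borel_measurable P" for \<theta> k by (rule measurable_alg_P[OF B_src X_alg])
      have X_ind: "indep_vars (\<lambda>_. borel) (X \<theta>) I" for \<theta>
      proof (rule indep_vars_alg[OF B_src _ X_alg])
        show "disjoint_family_on (B \<theta>) I" unfolding B_def by (rule disjoint_blocks)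
      qed
      have X_law: "distr P borel (X \<theta> k) = distr P borel (X \<theta>' k)" if k: "k \<in> I" for k
      proof (rule distr_eqI_nn_integral[OF X_P X_P])
        fix H :: "real \<Rightarrow> ennreal" assume H [measurable]: "H \<in> borel_measurable borel"
        obtain l i where li: "k = (l, i)" "l < n" using k by (auto simp: I_def)
        let ?c = "1 / real M ^ (n - l)"
        show "(\<integral>\<^sup>+\<omega>. H (X \<theta> k \<omega>) \<partial>P) = (\<integral>\<^sup>+\<omega>. H (X \<theta>' k \<omega>) \<partial>P)"
        proof (cases "l = 0")
          case True
          define H' where "H' q = H (1 / real M ^ n * g (snd (snd q)) + ?c * (\<tau> * f (T - (1 - fst q) * \<tau>) (fst (snd q)) 0))"
            for q :: "real \<times> (nat \<Rightarrow> real) \<times> (nat \<Rightarrow> real)"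
          have [measurable]: "(\<lambda>q. f (T - (1 - fst q) * \<tau>) (fst (snd q)) 0) \<in> borel_measurable (borel \<Otimes>\<^sub>M (borel \<Otimes>\<^sub>M (borel :: (nat \<Rightarrow> real) measure)))"
            by (rule measurable_f) measurable
          have H': "H' \<in> borel_measurable (borel \<Otimes>\<^sub>M (borel \<Otimes>\<^sub>M borel))" unfolding H'_def by measurable
          have "(\<integral>\<^sup>+\<omega>. H (X \<theta> k \<omega>) \<partial>P) = (\<integral>\<^sup>+\<omega>. H' (U (\<theta> @ [0, int i]) \<omega>, x + W (\<theta> @ [0, int i]) (U (\<theta> @ [0, int i]) \<omega> * \<tau>) \<omega>, x + W (\<theta> @ [0, int i]) \<tau> \<omega>) \<partial>P)" for \<theta>
            by (intro nn_integral_cong) (simp add: X_def H'_def li True summand_def f_at_def V_0)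
          then show ?thesis using UW2_law[OF snoc2_in_Theta snoc2_in_Theta \<tau> H'] by simp
        next
          case False
          then have l: "1 \<le> l" by simp
          have Hc: "(\<lambda>v. H (?c * v)) \<in> borel_measurable borel" by measurable
          have "(\<integral>\<^sup>+\<omega>. H (X \<theta> k \<omega>) \<partial>P) = (\<integral>\<^sup>+\<omega>. H (?c * summand \<theta> l i \<tau> x \<omega>) \<partial>P)" for \<theta>
            using False by (simp add: X_def li)
          moreover have "(\<integral>\<^sup>+\<omega>. H (?c * summand \<theta> l i \<tau> x \<omega>) \<partial>P) = (\<integral>\<^sup>+\<omega>. H (?c * summand \<theta>' l i \<tau> x \<omega>) \<partial>P)"
            unfolding nn_integral_summand[OF \<tau> l Hc]
          proof (rule nn_integral_cong_AE)
            show "AE p in noise d. (\<integral>\<^sup>+q. H (?c * (\<tau> * (f (T - (1 - fst p) * \<tau>) (heat_shift x (fst p * \<tau>) (snd p)) (fst q)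
                - f (T - (1 - fst p) * \<tau>) (heat_shift x (fst p * \<tau>) (snd p)) (snd q))))
              \<partial>(distr P borel (V (\<theta> @ [int l, int i]) l ((1 - fst p) * \<tau>) (heat_shift x (fst p * \<tau>) (snd p)))
                \<Otimes>\<^sub>M distr P borel (V (\<theta> @ [- int l, int i]) (l - 1) ((1 - fst p) * \<tau>) (heat_shift x (fst p * \<tau>) (snd p)))))
              = (\<integral>\<^sup>+q. H (?c * (\<tau> * (f (T - (1 - fst p) * \<tau>) (heat_shift x (fst p * \<tau>) (snd p)) (fst q)
                - f (T - (1 - fst p) * \<tau>) (heat_shift x (fst p * \<tau>) (snd p)) (snd q))))
              \<partial>(distr P borel (V (\<theta>' @ [int l, int i]) l ((1 - fst p) * \<tau>) (heat_shift x (fst p * \<tau>) (snd p)))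
                \<Otimes>\<^sub>M distr P borel (V (\<theta>' @ [- int l, int i]) (l - 1) ((1 - fst p) * \<tau>) (heat_shift x (fst p * \<tau>) (snd p)))))"
              using AE_noise
            proof eventually_elim
              case (elim p)
              then have s: "0 \<le> (1 - fst p) * \<tau>" "(1 - fst p) * \<tau> \<le> T" using times_in_range[OF \<tau>, of "fst p"] by auto
              have il: "law_indep l" "law_indep (l - 1)" using less.IH li(2) l by auto
              show ?case
                by (simp only: law_indepD[OF il(1) snoc2_in_Theta[of \<theta> "int l" "int i"] snoc2_in_Theta[of \<theta>' "int l" "int i"] s]
                  law_indepD[OF il(2) snoc2_in_Theta[of \<theta> "- int l" "int i"] snoc2_in_Theta[of \<theta>' "- int l" "int i"] s])
            qed
          qed
          ultimately show ?thesis by simp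
        qed
      qed
      have "I \<noteq> {}"
      proof -
        have "(0, 1) \<in> I" using False M by (simp add: I_def)
        then show ?thesis by auto
      qed
      then have joint: "distr P (PiM I (\<lambda>_. borel)) (\<lambda>\<omega>. \<lambda>k\<in>I. X \<theta> k \<omega>) = PiM I (\<lambda>k. distr P borel (X \<theta> k))" for \<theta>
        using indep_vars_iff_distr_eq_PiM'[where I = I and M' = "\<lambda>_. borel" and X = "X \<theta>"] X_P X_ind by auto
      have V_distr: "distr P borel (V \<theta> n \<tau> x) = distr (PiM I (\<lambda>k. distr P borel (X \<theta> k))) borel (\<lambda>v. \<Sum>k\<in>I. v k)"
        if "\<theta> \<in> Theta" for \<theta>
      proof -
        have r: "(\<lambda>\<omega>. \<lambda>k\<in>I. X \<theta> k \<omega>) \<in> measurable P (PiM I (\<lambda>_. borel))"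
          by (intro measurable_restrict X_P)
        have s: "(\<lambda>v. \<Sum>k\<in>I. v k) \<in> borel_measurable (PiM I (\<lambda>_. borel :: real measure))" by measurable
        have "distr P borel (V \<theta> n \<tau> x) = distr P borel ((\<lambda>v. \<Sum>k\<in>I. v k) \<circ> (\<lambda>\<omega>. \<lambda>k\<in>I. X \<theta> k \<omega>))"
          using V_sum[OF that] by (intro distr_cong) auto
        also have "\<dots> = distr (distr P (PiM I (\<lambda>_. borel)) (\<lambda>\<omega>. \<lambda>k\<in>I. X \<theta> k \<omega>)) borel (\<lambda>v. \<Sum>k\<in>I. v k)"
          by (rule distr_distr[symmetric, OF s r])
        finally show ?thesis unfolding joint .
      qed
      have "PiM I (\<lambda>k. distr P borel (X \<theta> k)) = PiM I (\<lambda>k. distr P borel (X \<theta>' k))"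
        by (intro PiM_cong refl X_law)
      then show ?thesis using V_distr \<theta> by simp
    qed
  qed
qed

end

section \<open>The error of the multilevel Picard scheme\<close>

locale mlp_error = mlp P d m T U W L f g M V
  for P :: "'w measure" and d m T U W L f g M V +
  fixes y :: "real \<Rightarrow> (nat \<Rightarrow> real) \<Rightarrow> real" and a A :: real
  assumes a: "0 \<le> a" "2 * a * T < 1" and A: "0 < A"
    and gA: "\<And>x. \<bar>g x\<bar> \<le> sqrt (A * gauss_weight d a 0 x)"
    and fA: "\<And>t x. 0 \<le> t \<Longrightarrow> t \<le> T \<Longrightarrow> \<bar>f t x 0\<bar> \<le> sqrt (A * gauss_weight d a 0 x)"
    and y_growth: "growth d T m y"
    and y_fix: "\<And>t x. 0 \<le> t \<Longrightarrow> t \<le> T \<Longrightarrow> y t x = picard y t x"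
    and y_bound: "\<And>t x. 0 \<le> t \<Longrightarrow> t \<le> T \<Longrightarrow>
       \<bar>y t x\<bar> \<le> (1 + (T - t)) * exp (L * (T - t)) * sqrt (A * gauss_weight d a (T - t) x)"
begin

definition v :: "real \<Rightarrow> (nat \<Rightarrow> real) \<Rightarrow> real" where "v \<tau> x = y (T - \<tau>) x"

definition \<Phi> :: "real \<Rightarrow> (nat \<Rightarrow> real) \<Rightarrow> real" where "\<Phi> \<tau> x = A * gauss_weight d a \<tau> x"

definition C where "C = (1 + T) * exp (L * T)"

lemma weight_range: "\<tau> \<le> T \<Longrightarrow> 2 * a * \<tau> < 1"
  using mult_left_mono[of \<tau> T "2 * a"] a by linarith

lemma \<Phi>_nonneg: "\<tau> \<le> T \<Longrightarrow> 0 \<le> \<Phi> \<tau> x"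
  unfolding \<Phi>_def using gauss_weight_nonneg[OF weight_range] A by simp

lemma measurable_\<Phi> [measurable (raw)]:
  assumes [measurable]: "s \<in> borel_measurable N" "X \<in> borel_measurable N"
  shows "(\<lambda>q. \<Phi> (s q) (X q)) \<in> borel_measurable N"
  unfolding \<Phi>_def by measurable

lemma measurable_v [measurable (raw)]:
  assumes [measurable]: "s \<in> borel_measurable N" "X \<in> borel_measurable N"
  shows "(\<lambda>q. v (s q) (X q)) \<in> borel_measurable N"
  unfolding v_def by (rule measurable_pair_comp[OF growth_cont[OF y_growth]]) measurable

lemma C_nonneg: "0 \<le> C" using T by (simp add: C_def)

lemma abs_v_le:
  assumes "0 \<le> \<tau>" "\<tau> \<le> T" shows "\<bar>v \<tau> x\<bar> \<le> C * sqrt (\<Phi> \<tau> x)"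
proof -
  have "\<bar>v \<tau> x\<bar> \<le> (1 + \<tau>) * exp (L * \<tau>) * sqrt (\<Phi> \<tau> x)"
    using y_bound[of "T - \<tau>" x] assms by (simp add: v_def \<Phi>_def)
  also have "\<dots> \<le> C * sqrt (\<Phi> \<tau> x)"
    unfolding C_def using assms L T \<Phi>_nonneg[of \<tau> x]
    by (intro mult_right_mono mult_mono) (auto intro: mult_left_mono)
  finally show ?thesis .
qed

lemma sqrt_\<Phi>_mono: "0 \<le> s \<Longrightarrow> s \<le> \<tau> \<Longrightarrow> \<tau> \<le> T \<Longrightarrow> sqrt (\<Phi> s x) \<le> sqrt (\<Phi> \<tau> x)"
  unfolding \<Phi>_def using gauss_weight_mono[of a s \<tau> d x] weight_range[of \<tau>] a A by simp

text \<open>The square of \<open>g\<close> is bounded by \<Phi> at time 0, and averaging over the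
  Gaussian step yields \<Phi> at time \<tau>.\<close>

lemma terminal_L2le:
  assumes \<theta>: "\<theta> \<in> Theta" and \<tau>: "0 \<le> \<tau>" "\<tau> \<le> T"
  shows "L2le (\<lambda>\<omega>. g (x + W \<theta> \<tau> \<omega>)) (sqrt (\<Phi> \<tau> x))"
  unfolding L2le_def
proof (intro conjI)
  have "W \<theta> \<tau> \<in> borel_measurable P"
    by (rule measurable_alg_P[OF self_sources[OF \<theta>] measurable_alg_W]) (use \<tau> in auto)
  then show "(\<lambda>\<omega>. g (x + W \<theta> \<tau> \<omega>)) \<in> borel_measurable P" by measurable
  show "0 \<le> sqrt (\<Phi> \<tau> x)" using \<Phi>_nonneg \<tau> by simp
  have "(\<integral>\<^sup>+\<omega>. ennreal ((g (x + W \<theta> \<tau> \<omega>))\<^sup>2) \<partial>P) = (\<integral>\<^sup>+z. ennreal ((g (heat_shift x \<tau> z))\<^sup>2) \<partial>gauss d)"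
    by (rule nn_integral_W[OF \<theta> \<tau>, of "\<lambda>x. ennreal ((g x)\<^sup>2)"]) measurable
  also have "\<dots> \<le> (\<integral>\<^sup>+z. ennreal A * ennreal (gauss_weight d a 0 (heat_shift x \<tau> z)) \<partial>gauss d)"
  proof (rule nn_integral_mono)
    fix z
    have pos: "0 \<le> A * gauss_weight d a 0 (heat_shift x \<tau> z)" using \<Phi>_nonneg[of 0] T by (simp add: \<Phi>_def)
    have "(g (heat_shift x \<tau> z))\<^sup>2 \<le> (sqrt (A * gauss_weight d a 0 (heat_shift x \<tau> z)))\<^sup>2"
      by (rule abs_le_square_iff[THEN iffD1]) (use gA pos in auto)
    then show "ennreal ((g (heat_shift x \<tau> z))\<^sup>2) \<le> ennreal A * ennreal (gauss_weight d a 0 (heat_shift x \<tau> z))"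
      using pos A gauss_weight_nonneg[of a 0 d] by (simp add: ennreal_mult[symmetric] ennreal_leI)
  qed
  also have "\<dots> = ennreal A * ennreal (gauss_weight d a \<tau> x)"
    using nn_integral_gauss_weight[of a 0 \<tau> d x] weight_range[of \<tau>] a \<tau> by (simp add: nn_integral_cmult)
  also have "\<dots> = ennreal ((sqrt (\<Phi> \<tau> x))\<^sup>2)"
    using \<Phi>_nonneg[of \<tau> x] \<tau> A gauss_weight_nonneg[OF weight_range, of \<tau> d x] by (simp add: \<Phi>_def ennreal_mult)
  finally show "(\<integral>\<^sup>+\<omega>. ennreal ((g (x + W \<theta> \<tau> \<omega>))\<^sup>2) \<partial>P) \<le> ennreal ((sqrt (\<Phi> \<tau> x))\<^sup>2)" .
qed

text \<open>The semigroup property of the weights \<open>\<Phi>\<close> makes the bound at the frozen point reproduce itself.\<close>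

lemma level_L2le:
  assumes \<eta>: "\<eta> \<in> Theta" and R: "R \<subseteq> sources" "R \<inter> {Inl \<eta>, Inr \<eta>} = {}" and \<tau>: "0 \<le> \<tau>" "\<tau> \<le> T"
    and G: "G \<in> borel_measurable ((borel \<Otimes>\<^sub>M borel) \<Otimes>\<^sub>M alg R)"
    and e [measurable]: "e \<in> borel_measurable borel" and b: "0 \<le> b" and c: "0 \<le> c"
    and ec: "(\<integral>\<^sup>+u. ennreal ((\<tau> * e u)\<^sup>2) \<partial>unif) \<le> ennreal (c\<^sup>2)"
    and GL: "\<And>u z. 0 \<le> u \<Longrightarrow> u \<le> 1 \<Longrightarrow> L2le (\<lambda>\<omega>. G ((u, z), \<omega>)) (b * e u * sqrt (\<Phi> ((1 - u) * \<tau>) z))"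
  shows "L2le (\<lambda>\<omega>. \<tau> * G ((U \<eta> \<omega>, x + W \<eta> (U \<eta> \<omega> * \<tau>) \<omega>), \<omega>)) (b * c * sqrt (\<Phi> \<tau> x))"
  unfolding L2le_def
proof (intro conjI)
  let ?X = "\<lambda>\<omega>. (U \<eta> \<omega>, x + W \<eta> (U \<eta> \<omega> * \<tau>) \<omega>)"
  have X: "?X \<in> measurable P (borel \<Otimes>\<^sub>M borel)"
    by (rule measurable_alg_P[OF self_sources[OF \<eta>] UW_alg[OF \<eta> \<tau>]])
  have "(\<lambda>\<omega>. (?X \<omega>, \<omega>)) \<in> measurable P ((borel \<Otimes>\<^sub>M borel) \<Otimes>\<^sub>M P)"
    using X by (rule measurable_Pair) simp
  from measurable_compose[OF this measurable_alg_pair_P[OF R(1) G]]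
  show "(\<lambda>\<omega>. \<tau> * G (?X \<omega>, \<omega>)) \<in> borel_measurable P" by measurable
  show "0 \<le> b * c * sqrt (\<Phi> \<tau> x)" using b c \<Phi>_nonneg[OF \<tau>(2), of x] by simp
  have G2: "(\<lambda>q. ennreal ((\<tau> * G q)\<^sup>2)) \<in> borel_measurable ((borel \<Otimes>\<^sub>M borel) \<Otimes>\<^sub>M alg R)" using G by measurable
  have "(\<integral>\<^sup>+\<omega>. ennreal ((\<tau> * G (?X \<omega>, \<omega>))\<^sup>2) \<partial>P)
    = (\<integral>\<^sup>+p. (\<integral>\<^sup>+\<omega>. ennreal ((\<tau> * G ((fst p, heat_shift x (fst p * \<tau>) (snd p)), \<omega>))\<^sup>2) \<partial>P) \<partial>noise d)"
    by (rule freeze_level[OF \<eta> R \<tau> G2])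
  also have "\<dots> \<le> (\<integral>\<^sup>+p. ennreal (b\<^sup>2 * (\<tau> * e (fst p))\<^sup>2) * ennreal (\<Phi> ((1 - fst p) * \<tau>) (heat_shift x (fst p * \<tau>) (snd p))) \<partial>noise d)"
  proof (rule nn_integral_mono_AE)
    show "AE p in noise d. (\<integral>\<^sup>+\<omega>. ennreal ((\<tau> * G ((fst p, heat_shift x (fst p * \<tau>) (snd p)), \<omega>))\<^sup>2) \<partial>P)
      \<le> ennreal (b\<^sup>2 * (\<tau> * e (fst p))\<^sup>2) * ennreal (\<Phi> ((1 - fst p) * \<tau>) (heat_shift x (fst p * \<tau>) (snd p)))"
      using AE_noise
    proof eventually_elim
      case (elim p)
      then have u: "0 \<le> fst p" "fst p \<le> 1" by auto
      let ?z = "heat_shift x (fst p * \<tau>) (snd p)"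
      let ?p = "\<Phi> ((1 - fst p) * \<tau>) ?z"
      have pp: "0 \<le> ?p" by (rule \<Phi>_nonneg[OF times_in_range(4)[OF \<tau> u]])
      have "L2le (\<lambda>\<omega>. \<tau> * G ((fst p, ?z), \<omega>)) (\<bar>\<tau>\<bar> * (b * e (fst p) * sqrt ?p))"
        by (rule L2le_cmult[OF GL[OF u]])
      then have "(\<integral>\<^sup>+\<omega>. ennreal ((\<tau> * G ((fst p, ?z), \<omega>))\<^sup>2) \<partial>P) \<le> ennreal ((\<bar>\<tau>\<bar> * (b * e (fst p) * sqrt ?p))\<^sup>2)"
        by (simp add: L2le_def)
      also have "(\<bar>\<tau>\<bar> * (b * e (fst p) * sqrt ?p))\<^sup>2 = b\<^sup>2 * (\<tau> * e (fst p))\<^sup>2 * ?p"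
        using pp by (simp add: power_mult_distrib)
      finally show ?case using pp by (simp add: ennreal_mult)
    qed
  qed
  also have "\<dots> = (\<integral>\<^sup>+u. (\<integral>\<^sup>+z. ennreal (b\<^sup>2 * (\<tau> * e u)\<^sup>2) * ennreal (\<Phi> ((1 - u) * \<tau>) (heat_shift x (u * \<tau>) z)) \<partial>gauss d) \<partial>unif)"
    by (subst nn_integral_noise_iterated) (simp, measurable)
  also have "\<dots> = (\<integral>\<^sup>+u. ennreal (b\<^sup>2 * (\<tau> * e u)\<^sup>2) * ennreal (\<Phi> \<tau> x) \<partial>unif)"
  proof (rule nn_integral_cong_AE)
    show "AE u in unif. (\<integral>\<^sup>+z. ennreal (b\<^sup>2 * (\<tau> * e u)\<^sup>2) * ennreal (\<Phi> ((1 - u) * \<tau>) (heat_shift x (u * \<tau>) z)) \<partial>gauss d)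
       = ennreal (b\<^sup>2 * (\<tau> * e u)\<^sup>2) * ennreal (\<Phi> \<tau> x)"
      using AE_unif
    proof eventually_elim
      case (elim u)
      note r = times_in_range[OF \<tau>, of u]
      have st: "(1 - u) * \<tau> + u * \<tau> = \<tau>" by (simp add: algebra_simps)
      have gw: "(\<integral>\<^sup>+z. ennreal (gauss_weight d a ((1 - u) * \<tau>) (heat_shift x (u * \<tau>) z)) \<partial>gauss d) = ennreal (gauss_weight d a \<tau> x)"
        using nn_integral_gauss_weight[of a "(1 - u) * \<tau>" "u * \<tau>" d x] r elim a weight_range[OF \<tau>(2)] by (simp add: st)
      have "(\<integral>\<^sup>+z. ennreal (\<Phi> ((1 - u) * \<tau>) (heat_shift x (u * \<tau>) z)) \<partial>gauss d)
        = (\<integral>\<^sup>+z. ennreal A * ennreal (gauss_weight d a ((1 - u) * \<tau>) (heat_shift x (u * \<tau>) z)) \<partial>gauss d)"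
        using A by (simp add: \<Phi>_def ennreal_mult')
      also have "\<dots> = ennreal A * ennreal (gauss_weight d a \<tau> x)"
        by (subst nn_integral_cmult) (simp_all add: gw)
      also have "\<dots> = ennreal (\<Phi> \<tau> x)" using A by (simp add: \<Phi>_def ennreal_mult')
      finally show ?case by (subst nn_integral_cmult) auto
    qed
  qed
  also have "\<dots> = ennreal (b\<^sup>2 * \<Phi> \<tau> x) * (\<integral>\<^sup>+u. ennreal ((\<tau> * e u)\<^sup>2) \<partial>unif)"
    using \<Phi>_nonneg[OF \<tau>(2), of x] by (subst nn_integral_cmult[symmetric]) (auto simp: ennreal_mult[symmetric] mult_ac)
  also have "\<dots> \<le> ennreal (b\<^sup>2 * \<Phi> \<tau> x) * ennreal (c\<^sup>2)" by (rule mult_left_mono[OF ec]) simp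
  also have "\<dots> = ennreal ((b * c * sqrt (\<Phi> \<tau> x))\<^sup>2)"
    using \<Phi>_nonneg[OF \<tau>(2), of x] by (simp add: ennreal_mult[symmetric] power_mult_distrib mult_ac)
  finally show "(\<integral>\<^sup>+\<omega>. ennreal ((\<tau> * G (?X \<omega>, \<omega>))\<^sup>2) \<partial>P) \<le> ennreal ((b * c * sqrt (\<Phi> \<tau> x))\<^sup>2)" .
qed

lemma unif_square_const:
  assumes "0 \<le> \<tau>" "\<tau> \<le> T" shows "(\<integral>\<^sup>+u. ennreal ((\<tau> * 1)\<^sup>2) \<partial>unif) \<le> ennreal (T\<^sup>2)"
  using assms unif.emeasure_space_1 by (simp add: ennreal_leI power_mono)

text \<open>At \<tau> = T the time weight exp (growth_rate \<tau> / 2) equals exp (M/2), which the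
  linear bound on the sample numbers will turn into a geometric factor.\<close>

definition growth_rate where "growth_rate = real M / T"

text \<open>With rate k = M/T the integral equals \<tau>/k (exp (k \<tau>) - 1), at most T^2/M exp
  (k \<tau>). Its square root is T/\<surd>M times the weight itself.\<close>

lemma unif_square_exp:
  assumes \<tau>: "0 \<le> \<tau>" "\<tau> \<le> T"
  shows "(\<integral>\<^sup>+u. ennreal ((\<tau> * exp (growth_rate * ((1 - u) * \<tau>) / 2))\<^sup>2) \<partial>unif)
    \<le> ennreal ((T / sqrt (real M) * exp (growth_rate * \<tau> / 2))\<^sup>2)"
proof -
  let ?k = growth_rate
  have k: "0 < ?k" using T M by (simp add: growth_rate_def)
  have sq: "(exp (r / 2))\<^sup>2 = exp r" for r :: real
    by (simp add: power2_eq_square flip: exp_add)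
  have "(\<integral>\<^sup>+u. ennreal ((\<tau> * exp (?k * ((1 - u) * \<tau>) / 2))\<^sup>2) \<partial>unif)
    = (\<integral>\<^sup>+u. ennreal (\<tau> / ?k) * ennreal (\<tau> * ?k * exp (?k * ((1 - u) * \<tau>))) \<partial>unif)"
    using \<tau> k by (intro nn_integral_cong)
      (simp add: ennreal_mult[symmetric] power_mult_distrib sq, simp add: power2_eq_square)
  also have "\<dots> = ennreal (\<tau> / ?k) * ennreal (exp (?k * \<tau>) - 1)"
    using k \<tau> by (subst nn_integral_cmult) (auto simp: unif_exp_integral)
  also have "\<dots> = ennreal (\<tau> / ?k * (exp (?k * \<tau>) - 1))"
    using k \<tau> by (intro ennreal_mult[symmetric]) auto
  also have "\<dots> \<le> ennreal (T / ?k * exp (?k * \<tau>))"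
    using k \<tau> T by (intro ennreal_leI mult_mono divide_right_mono) auto
  also have "T / ?k * exp (?k * \<tau>) = (T / sqrt (real M) * exp (?k * \<tau> / 2))\<^sup>2"
    unfolding power_mult_distrib sq using T M by (simp add: growth_rate_def power_divide power2_eq_square)
  finally show ?thesis .
qed

section \<open>Errors of a single level\<close>

definition f_exact :: "int list \<Rightarrow> real \<Rightarrow> (nat \<Rightarrow> real) \<Rightarrow> 'w \<Rightarrow> real" where
  "f_exact \<eta> \<tau> x \<omega> = f (T - (1 - U \<eta> \<omega>) * \<tau>) (x + W \<eta> (U \<eta> \<omega> * \<tau>) \<omega>)
     (v ((1 - U \<eta> \<omega>) * \<tau>) (x + W \<eta> (U \<eta> \<omega> * \<tau>) \<omega>))"

definition level_error :: "int list \<Rightarrow> int list \<Rightarrow> nat \<Rightarrow> real \<Rightarrow> (nat \<Rightarrow> real) \<Rightarrow> 'w \<Rightarrow> real" where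
  "level_error \<eta> \<eta>' l \<tau> x \<omega> = \<tau> * (f_at \<eta> \<eta>' l \<tau> x \<omega> - f_exact \<eta> \<tau> x \<omega>)"

definition frozen_error :: "int list \<Rightarrow> nat \<Rightarrow> real \<Rightarrow> (real \<times> (nat \<Rightarrow> real)) \<times> 'w \<Rightarrow> real" where
  "frozen_error \<eta>' l \<tau> q = f (T - (1 - fst (fst q)) * \<tau>) (snd (fst q)) (V \<eta>' l ((1 - fst (fst q)) * \<tau>) (snd (fst q)) (snd q))
     - f (T - (1 - fst (fst q)) * \<tau>) (snd (fst q)) (v ((1 - fst (fst q)) * \<tau>) (snd (fst q)))"

lemma level_error_eq:
  "level_error \<eta> \<eta>' l \<tau> x \<omega> = \<tau> * frozen_error \<eta>' l \<tau> ((U \<eta> \<omega>, x + W \<eta> (U \<eta> \<omega> * \<tau>) \<omega>), \<omega>)"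
  by (simp add: level_error_def frozen_error_def f_at_def f_exact_def)

lemma measurable_frozen_error:
  assumes "\<eta>' \<in> Theta"
  shows "frozen_error \<eta>' l \<tau> \<in> borel_measurable ((borel \<Otimes>\<^sub>M borel) \<Otimes>\<^sub>M alg (offspring \<eta>'))"
proof -
  let ?N = "(borel \<Otimes>\<^sub>M borel) \<Otimes>\<^sub>M alg (offspring \<eta>') :: ((real \<times> (nat \<Rightarrow> real)) \<times> 'w) measure"
  have w: "snd \<in> measurable ?N (alg (offspring \<eta>'))" by measurable
  have [measurable]: "(\<lambda>q. V \<eta>' l ((1 - fst (fst q)) * \<tau>) (snd (fst q)) (snd q)) \<in> borel_measurable ?N"
    by (rule V_comp[OF V_meas[OF assms] _ _ _ w]) (simp, measurable)
  have [measurable]: "(\<lambda>q. f (T - (1 - fst (fst q)) * \<tau>) (snd (fst q)) (V \<eta>' l ((1 - fst (fst q)) * \<tau>) (snd (fst q)) (snd q))) \<in> borel_measurable ?N"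
    "(\<lambda>q. f (T - (1 - fst (fst q)) * \<tau>) (snd (fst q)) (v ((1 - fst (fst q)) * \<tau>) (snd (fst q)))) \<in> borel_measurable ?N"
    by (rule measurable_f; measurable)+
  show ?thesis unfolding frozen_error_def[abs_def] by measurable
qed

lemma offspring_fresh: "length \<eta> = length \<eta>' \<Longrightarrow> offspring \<eta>' \<inter> {Inl \<eta>, Inr \<eta>} = {}"
  unfolding offspring_def by auto

definition error_at :: "nat \<Rightarrow> real \<Rightarrow> bool" where
  "error_at l \<beta> \<longleftrightarrow> (\<forall>\<theta>\<in>Theta. \<forall>\<tau>\<in>{0..T}. \<forall>x.
     L2le (\<lambda>\<omega>. V \<theta> l \<tau> x \<omega> - v \<tau> x) (\<beta> * exp (growth_rate * \<tau> / 2) * sqrt (\<Phi> \<tau> x)))"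

text \<open>At a frozen point the error of \<open>V\<close> is multiplied by the Lipschitz constant;
  integration over time fraction and position returns the same weight at \<tau> and \<open>x\<close>
  with the additional factor T/\<surd>M.\<close>

lemma level_error_L2le:
  assumes err: "error_at l \<beta>" and \<beta>: "0 \<le> \<beta>" and \<eta>: "\<eta> \<in> Theta" "\<eta>' \<in> Theta" "length \<eta> = length \<eta>'"
    and \<tau>: "0 \<le> \<tau>" "\<tau> \<le> T"
  shows "L2le (level_error \<eta> \<eta>' l \<tau> x) (L * \<beta> * (T / sqrt (real M) * exp (growth_rate * \<tau> / 2)) * sqrt (\<Phi> \<tau> x))"
  unfolding level_error_eq[abs_def]
proof (rule level_L2le[OF \<eta>(1) offspring_sources[OF \<eta>(2)] offspring_fresh[OF \<eta>(3)] \<tau> measurable_frozen_error[OF \<eta>(2)]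
      _ _ _ unif_square_exp[OF \<tau>]])
  fix u :: real and z assume u: "0 \<le> u" "u \<le> 1"
  define s where "s = (1 - u) * \<tau>"
  have s: "0 \<le> s" "s \<le> T" unfolding s_def by (rule times_in_range(3,4)[OF \<tau> u])+
  have L2: "L2le (\<lambda>\<omega>. V \<eta>' l s z \<omega> - v s z) (\<beta> * exp (growth_rate * s / 2) * sqrt (\<Phi> s z))"
    using err \<eta>(2) s unfolding error_at_def by auto
  have "L2le (\<lambda>\<omega>. frozen_error \<eta>' l \<tau> ((u, z), \<omega>)) (\<bar>L\<bar> * (\<beta> * exp (growth_rate * s / 2) * sqrt (\<Phi> s z)))"
  proof (rule L2le_dominated[OF L2le_cmult[OF L2, of L]])
    have [measurable]: "V \<eta>' l s z \<in> borel_measurable P" by (rule V_random[OF \<eta>(2)])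
    have [measurable]: "(\<lambda>\<omega>. f (T - s) z (V \<eta>' l s z \<omega>)) \<in> borel_measurable P" by (rule measurable_f) measurable
    show "(\<lambda>\<omega>. frozen_error \<eta>' l \<tau> ((u, z), \<omega>)) \<in> borel_measurable P"
      unfolding frozen_error_def fst_conv snd_conv s_def[symmetric] by measurable
    show "\<bar>frozen_error \<eta>' l \<tau> ((u, z), \<omega>)\<bar> \<le> \<bar>L * (V \<eta>' l s z \<omega> - v s z)\<bar>" for \<omega>
      unfolding frozen_error_def fst_conv snd_conv s_def[symmetric] abs_mult
      using f_lip[of "T - s" z "V \<eta>' l s z \<omega>" "v s z"] s L by simp
  qed
  then show "L2le (\<lambda>\<omega>. frozen_error \<eta>' l \<tau> ((u, z), \<omega>)) (L * \<beta> * exp (growth_rate * ((1 - u) * \<tau>) / 2) * sqrt (\<Phi> ((1 - u) * \<tau>) z))"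
    using L by (simp add: s_def mult.assoc)
qed (use L \<beta> T in auto)

text \<open>The index [0] is an arbitrary representative; \<open>level_error_mean\<close> shows that
  the mean is the same for all admissible indices.\<close>

definition level_mean :: "nat \<Rightarrow> real \<Rightarrow> (nat \<Rightarrow> real) \<Rightarrow> real" where
  "level_mean l \<tau> x = expectation (level_error [0] [0] l \<tau> x)"

lemma V_law:
  assumes "\<theta> \<in> Theta" "\<theta>' \<in> Theta"
  shows "distr P borel (V \<theta> n \<tau> x) = distr P borel (V \<theta>' n \<tau> x)"
proof -
  have "V \<theta> n \<tau> x = V \<theta> n (clip T \<tau>) x" for \<theta> using V_clip by presburger
  then show ?thesis using law_indepD[OF law_indep assms, of "clip T \<tau>"] clip_range T by simp
qed

text \<open>By freezing, the mean depends on \<open>V\<close> only through its law, which is the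
  same for all indices. This is what makes the expectations cancel between a level and the
  correction term of the next one.\<close>

lemma level_error_mean:
  assumes err: "error_at l \<beta>" "0 \<le> \<beta>" and \<eta>: "\<eta> \<in> Theta" "\<eta>' \<in> Theta" "length \<eta> = length \<eta>'"
    and \<tau>: "0 \<le> \<tau>" "\<tau> \<le> T"
  shows "expectation (level_error \<eta> \<eta>' l \<tau> x) = level_mean l \<tau> x"
proof -
  have z: "[0] \<in> Theta" by (simp add: Theta_def)
  have mean: "expectation (level_error \<eta> \<eta>' l \<tau> x)
    = (\<integral>b. expectation (\<lambda>\<omega>. \<tau> * frozen_error \<eta>' l \<tau> (b, \<omega>)) \<partial>distr (noise d) (borel \<Otimes>\<^sub>M borel) (\<lambda>p. (fst p, heat_shift x (fst p * \<tau>) (snd p))))"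
    if \<eta>: "\<eta> \<in> Theta" "\<eta>' \<in> Theta" "length \<eta> = length \<eta>'" for \<eta> \<eta>'
    unfolding distr_UW[OF \<eta>(1) \<tau>, symmetric] level_error_eq
  proof (rule integral_freeze(2)[where H = "\<lambda>q. \<tau> * frozen_error \<eta>' l \<tau> q", OF self_sources[OF \<eta>(1)] offspring_sources[OF \<eta>(2)] _ UW_alg[OF \<eta>(1) \<tau>]])
    show "{Inl \<eta>, Inr \<eta>} \<inter> offspring \<eta>' = {}" using offspring_fresh[OF \<eta>(3)] by blast
    show "(\<lambda>q. \<tau> * frozen_error \<eta>' l \<tau> q) \<in> borel_measurable ((borel \<Otimes>\<^sub>M borel) \<Otimes>\<^sub>M alg (offspring \<eta>'))"
      using measurable_frozen_error[OF \<eta>(2)] by measurable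
    show "integrable P (\<lambda>\<omega>. \<tau> * frozen_error \<eta>' l \<tau> ((U \<eta> \<omega>, x + W \<eta> (U \<eta> \<omega> * \<tau>) \<omega>), \<omega>))"
      using L2leD(5)[OF level_error_L2le[OF err \<eta> \<tau>, of x]] unfolding level_error_eq[abs_def] .
  qed
  have inner: "expectation (\<lambda>\<omega>. \<tau> * frozen_error \<eta>' l \<tau> (b, \<omega>)) = expectation (\<lambda>\<omega>. \<tau> * frozen_error [0] l \<tau> (b, \<omega>))"
    for b :: "real \<times> (nat \<Rightarrow> real)"
  proof -
    let ?s = "(1 - fst b) * \<tau>"
    define h where "h r = \<tau> * (f (T - ?s) (snd b) r - f (T - ?s) (snd b) (v ?s (snd b)))" for r
    have [measurable]: "(\<lambda>r. f (T - ?s) (snd b) r) \<in> borel_measurable borel" by (rule measurable_f) measurable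
    have h: "h \<in> borel_measurable borel" unfolding h_def by measurable
    have "expectation (\<lambda>\<omega>. \<tau> * frozen_error \<zeta> l \<tau> (b, \<omega>)) = (\<integral>r. h r \<partial>distr P borel (V \<zeta> l ?s (snd b)))" if "\<zeta> \<in> Theta" for \<zeta>
      by (subst integral_distr[OF V_random[OF that] h]) (simp add: h_def frozen_error_def)
    then show ?thesis using V_law[OF \<eta>(2) z] \<eta>(2) z by simp
  qed
  show ?thesis unfolding level_mean_def mean[OF \<eta>] mean[OF z z refl] inner ..
qed

lemma level_mean_le:
  assumes "error_at l \<beta>" "0 \<le> \<beta>" "0 \<le> \<tau>" "\<tau> \<le> T"
  shows "\<bar>level_mean l \<tau> x\<bar> \<le> L * \<beta> * (T / sqrt (real M) * exp (growth_rate * \<tau> / 2)) * sqrt (\<Phi> \<tau> x)"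
proof -
  have z: "[0] \<in> Theta" by (simp add: Theta_def)
  show ?thesis unfolding level_mean_def
    by (rule abs_expectation_le_L2[OF level_error_L2le[OF assms(1,2) z z refl assms(3,4)]])
qed

text \<open>The case of \<open>level_L2le\<close> without further randomness: no sources remain
  after freezing, and the time factor is 1.\<close>

lemma deterministic_L2le:
  assumes \<eta>: "\<eta> \<in> Theta" and \<tau>: "0 \<le> \<tau>" "\<tau> \<le> T" and b: "0 \<le> b"
    and h: "(\<lambda>q. h (fst q) (snd q)) \<in> borel_measurable (borel \<Otimes>\<^sub>M borel)"
    and le: "\<And>u z. 0 \<le> u \<Longrightarrow> u \<le> 1 \<Longrightarrow> \<bar>h u z\<bar> \<le> b * sqrt (\<Phi> ((1 - u) * \<tau>) z)"
  shows "L2le (\<lambda>\<omega>. \<tau> * h (U \<eta> \<omega>) (x + W \<eta> (U \<eta> \<omega> * \<tau>) \<omega>)) (b * T * sqrt (\<Phi> \<tau> x))"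
proof -
  have "L2le (\<lambda>\<omega>. \<tau> * (\<lambda>q. h (fst (fst q)) (snd (fst q))) ((U \<eta> \<omega>, x + W \<eta> (U \<eta> \<omega> * \<tau>) \<omega>), \<omega>)) (b * T * sqrt (\<Phi> \<tau> x))"
  proof (rule level_L2le[where R = "{}" and e = "\<lambda>_. 1", OF \<eta> _ _ \<tau> _ _ b _ unif_square_const[OF \<tau>]])
    show "(\<lambda>q. h (fst (fst q)) (snd (fst q))) \<in> borel_measurable ((borel \<Otimes>\<^sub>M borel) \<Otimes>\<^sub>M alg {})"
      by (rule measurable_compose[OF measurable_fst h])
    show "L2le (\<lambda>\<omega>. h (fst (fst ((u, z), \<omega>))) (snd (fst ((u, z), \<omega>)))) (b * 1 * sqrt (\<Phi> ((1 - u) * \<tau>) z))"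
      if "0 \<le> u" "u \<le> 1" for u z
      using L2le_mono[OF L2le_const le[OF that]] by simp
  qed (use T in auto)
  then show ?thesis by simp
qed

lemma f_zero_L2le:
  assumes \<eta>: "\<eta> \<in> Theta" and \<tau>: "0 \<le> \<tau>" "\<tau> \<le> T"
  shows "L2le (\<lambda>\<omega>. \<tau> * f (T - (1 - U \<eta> \<omega>) * \<tau>) (x + W \<eta> (U \<eta> \<omega> * \<tau>) \<omega>) 0) (T * sqrt (\<Phi> \<tau> x))"
proof -
  have "L2le (\<lambda>\<omega>. \<tau> * f (T - (1 - U \<eta> \<omega>) * \<tau>) (x + W \<eta> (U \<eta> \<omega> * \<tau>) \<omega>) 0) (1 * T * sqrt (\<Phi> \<tau> x))"
  proof (rule deterministic_L2le[where h = "\<lambda>u z. f (T - (1 - u) * \<tau>) z 0", OF \<eta> \<tau>])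
    show "(\<lambda>q. f (T - (1 - fst q) * \<tau>) (snd q) 0) \<in> borel_measurable (borel \<Otimes>\<^sub>M borel)"
      by (rule measurable_f) measurable
    fix u :: real and z assume u: "0 \<le> u" "u \<le> 1"
    note s = times_in_range[OF \<tau> u]
    have "\<bar>f (T - (1 - u) * \<tau>) z 0\<bar> \<le> sqrt (\<Phi> 0 z)" using fA[of "T - (1 - u) * \<tau>" z] s by (simp add: \<Phi>_def)
    also have "\<dots> \<le> sqrt (\<Phi> ((1 - u) * \<tau>) z)" using s by (intro sqrt_\<Phi>_mono) auto
    finally show "\<bar>f (T - (1 - u) * \<tau>) z 0\<bar> \<le> 1 * sqrt (\<Phi> ((1 - u) * \<tau>) z)" by simp
  qed simp
  then show ?thesis by simp
qed

lemma f_exact_L2le: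
  assumes \<eta>: "\<eta> \<in> Theta" and \<tau>: "0 \<le> \<tau>" "\<tau> \<le> T"
  shows "L2le (\<lambda>\<omega>. \<tau> * f_exact \<eta> \<tau> x \<omega>) ((1 + L * C) * T * sqrt (\<Phi> \<tau> x))"
  unfolding f_exact_def
proof (rule deterministic_L2le[where h = "\<lambda>u z. f (T - (1 - u) * \<tau>) z (v ((1 - u) * \<tau>) z)", OF \<eta> \<tau>])
  show "0 \<le> 1 + L * C" using L C_nonneg by simp
  show "(\<lambda>q. f (T - (1 - fst q) * \<tau>) (snd q) (v ((1 - fst q) * \<tau>) (snd q))) \<in> borel_measurable (borel \<Otimes>\<^sub>M borel)"
    by (rule measurable_f) measurable
  fix u :: real and z assume u: "0 \<le> u" "u \<le> 1"
  define s where "s = (1 - u) * \<tau>"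
  have s: "0 \<le> s" "s \<le> T" unfolding s_def by (rule times_in_range(3,4)[OF \<tau> u])+
  have "\<bar>f (T - s) z (v s z)\<bar> \<le> \<bar>f (T - s) z 0\<bar> + L * \<bar>v s z - 0\<bar>"
    using f_lip[of "T - s" z "v s z" 0] s by simp
  also have "\<dots> \<le> sqrt (\<Phi> s z) + L * (C * sqrt (\<Phi> s z))"
  proof (rule add_mono)
    have "\<bar>f (T - s) z 0\<bar> \<le> sqrt (\<Phi> 0 z)" using fA[of "T - s" z] s by (simp add: \<Phi>_def)
    also have "\<dots> \<le> sqrt (\<Phi> s z)" using s by (intro sqrt_\<Phi>_mono) auto
    finally show "\<bar>f (T - s) z 0\<bar> \<le> sqrt (\<Phi> s z)" .
    show "L * \<bar>v s z - 0\<bar> \<le> L * (C * sqrt (\<Phi> s z))" using abs_v_le[OF s] L by (simp add: mult_left_mono)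
  qed
  finally show "\<bar>f (T - (1 - u) * \<tau>) z (v ((1 - u) * \<tau>) z)\<bar> \<le> (1 + L * C) * sqrt (\<Phi> ((1 - u) * \<tau>) z)"
    by (simp add: s_def algebra_simps)
qed

text \<open>The fixed-point equation rewritten on the probability space \<open>P\<close>. The two
  means may use different indices because each depends on a marginal law only.\<close>

lemma v_eq_means:
  assumes \<theta>: "\<theta> \<in> Theta" "\<eta> \<in> Theta" and \<tau>: "0 \<le> \<tau>" "\<tau> \<le> T"
  shows "v \<tau> x = expectation (\<lambda>\<omega>. g (x + W \<theta> \<tau> \<omega>)) + expectation (\<lambda>\<omega>. \<tau> * f_exact \<eta> \<tau> x \<omega>)"
proof -
  have Wm [measurable]: "W \<theta> \<tau> \<in> borel_measurable P"
    by (rule measurable_alg_P[OF self_sources[OF \<theta>(1)] measurable_alg_W]) (use \<tau> in auto)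
  have dW: "distr P borel (\<lambda>\<omega>. x + W \<theta> \<tau> \<omega>) = distr (gauss d) borel (heat_shift x \<tau>)"
    by (rule distr_eqI_nn_integral) (measurable, rule nn_integral_W[OF \<theta>(1) \<tau>])
  have gi: "integrable (gauss d) (\<lambda>z. g (heat_shift x \<tau> z))"
    and ge: "(\<integral>z. g (heat_shift x \<tau> z) \<partial>gauss d) = expectation (\<lambda>\<omega>. g (x + W \<theta> \<tau> \<omega>))"
  proof -
    have "integrable (distr P borel (\<lambda>\<omega>. x + W \<theta> \<tau> \<omega>)) g"
      using L2leD(5)[OF terminal_L2le[OF \<theta>(1) \<tau>, of x]] by (subst integrable_distr_eq) auto
    then show "integrable (gauss d) (\<lambda>z. g (heat_shift x \<tau> z))"
      unfolding dW by (subst (asm) integrable_distr_eq) auto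
    have "(\<integral>z. g (heat_shift x \<tau> z) \<partial>gauss d) = (\<integral>b. g b \<partial>distr P borel (\<lambda>\<omega>. x + W \<theta> \<tau> \<omega>))"
      unfolding dW by (subst integral_distr) auto
    also have "\<dots> = expectation (\<lambda>\<omega>. g (x + W \<theta> \<tau> \<omega>))" by (subst integral_distr) auto
    finally show "(\<integral>z. g (heat_shift x \<tau> z) \<partial>gauss d) = expectation (\<lambda>\<omega>. g (x + W \<theta> \<tau> \<omega>))" .
  qed
  have gn: "integrable (noise d) (\<lambda>p. g (heat_shift x \<tau> (snd p)))"
    "(\<integral>p. g (heat_shift x \<tau> (snd p)) \<partial>noise d) = expectation (\<lambda>\<omega>. g (x + W \<theta> \<tau> \<omega>))"
    using integrable_noise_mult[of "\<lambda>_. 1" d, OF _ gi] integral_noise_mult[of "\<lambda>_. 1" d, OF _ gi] ge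
    by (simp_all add: unif.prob_space)
  define h where "h q = \<tau> * f (T - (1 - fst q) * \<tau>) (snd q) (v ((1 - fst q) * \<tau>) (snd q))" for q
  have [measurable]: "h \<in> borel_measurable (borel \<Otimes>\<^sub>M borel)"
  proof -
    have [measurable]: "(\<lambda>q. f (T - (1 - fst q) * \<tau>) (snd q) (v ((1 - fst q) * \<tau>) (snd q))) \<in> borel_measurable (borel \<Otimes>\<^sub>M borel)"
      by (rule measurable_f) measurable
    show ?thesis unfolding h_def[abs_def] by measurable
  qed
  let ?X = "\<lambda>\<omega>. (U \<eta> \<omega>, x + W \<eta> (U \<eta> \<omega> * \<tau>) \<omega>)"
  have Xm: "?X \<in> measurable P (borel \<Otimes>\<^sub>M borel)"
    by (rule measurable_alg_P[OF self_sources[OF \<theta>(2)] UW_alg[OF \<theta>(2) \<tau>]])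
  have hX: "(\<lambda>\<omega>. \<tau> * f_exact \<eta> \<tau> x \<omega>) = (\<lambda>\<omega>. h (?X \<omega>))" by (simp add: h_def f_exact_def)
  have hs: "(\<lambda>p. (fst p, heat_shift x (fst p * \<tau>) (snd p))) \<in> measurable (noise d) (borel \<Otimes>\<^sub>M borel)" by measurable
  have hn: "integrable (noise d) (\<lambda>p. h (fst p, heat_shift x (fst p * \<tau>) (snd p)))"
    "(\<integral>p. h (fst p, heat_shift x (fst p * \<tau>) (snd p)) \<partial>noise d) = expectation (\<lambda>\<omega>. \<tau> * f_exact \<eta> \<tau> x \<omega>)"
  proof -
    have "integrable (distr P (borel \<Otimes>\<^sub>M borel) ?X) h"
      using L2leD(5)[OF f_exact_L2le[OF \<theta>(2) \<tau>, of x]] unfolding hX by (subst integrable_distr_eq[OF Xm]) auto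
    then show "integrable (noise d) (\<lambda>p. h (fst p, heat_shift x (fst p * \<tau>) (snd p)))"
      unfolding distr_UW[OF \<theta>(2) \<tau>] by (subst (asm) integrable_distr_eq[OF hs]) auto
    have "(\<integral>p. h (fst p, heat_shift x (fst p * \<tau>) (snd p)) \<partial>noise d) = (\<integral>b. h b \<partial>distr P (borel \<Otimes>\<^sub>M borel) ?X)"
      unfolding distr_UW[OF \<theta>(2) \<tau>] by (subst integral_distr[OF hs]) auto
    also have "\<dots> = expectation (\<lambda>\<omega>. \<tau> * f_exact \<eta> \<tau> x \<omega>)" unfolding hX by (subst integral_distr[OF Xm]) auto
    finally show "(\<integral>p. h (fst p, heat_shift x (fst p * \<tau>) (snd p)) \<partial>noise d) = expectation (\<lambda>\<omega>. \<tau> * f_exact \<eta> \<tau> x \<omega>)" .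
  qed
  have "v \<tau> x = feynman_kac d T (\<lambda>t x. f t x (y t x)) g (T - \<tau>) x"
    using y_fix[of "T - \<tau>" x] \<tau> by (simp add: v_def picard_def)
  also have "\<dots> = (\<integral>p. g (heat_shift x \<tau> (snd p)) + h (fst p, heat_shift x (fst p * \<tau>) (snd p)) \<partial>noise d)"
  proof -
    have e: "T - \<tau> + u * \<tau> = T - (1 - u) * \<tau>" for u by (simp add: algebra_simps)
    show ?thesis unfolding feynman_kac_def fk_sample_def h_def v_def by (simp add: e)
  qed
  finally show ?thesis using Bochner_Integration.integral_add[OF gn(1) hn(1)] gn(2) hn(2) by simp
qed

end

section \<open>Solution of the error recursion\<close>

context mlp_error
begin

text \<open>For l \<ge> 1 a difference of consecutive level means; level 0 has nothing to subtract
  and carries the mean of the exact source in addition. The sum over the levels telescopes.\<close>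

definition summand_mean :: "nat \<Rightarrow> real \<Rightarrow> (nat \<Rightarrow> real) \<Rightarrow> real" where
  "summand_mean l \<tau> x = (if l = 0 then level_mean 0 \<tau> x + expectation (\<lambda>\<omega>. \<tau> * f_exact [0] \<tau> x \<omega>)
     else level_mean l \<tau> x - level_mean (l - 1) \<tau> x)"

definition summand_bound :: "(nat \<Rightarrow> real) \<Rightarrow> nat \<Rightarrow> real \<Rightarrow> (nat \<Rightarrow> real) \<Rightarrow> real" where
  "summand_bound \<beta> l \<tau> x = (if l = 0 then T * sqrt (\<Phi> \<tau> x)
     else L * (\<beta> l + \<beta> (l - 1)) * (T / sqrt (real M) * exp (growth_rate * \<tau> / 2)) * sqrt (\<Phi> \<tau> x))"

lemma summand_eq_errors:
  assumes "1 \<le> l"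
  shows "summand \<theta> l i \<tau> x \<omega> = level_error (\<theta> @ [int l, int i]) (\<theta> @ [int l, int i]) l \<tau> x \<omega>
    + (-1) * level_error (\<theta> @ [int l, int i]) (\<theta> @ [- int l, int i]) (l - 1) \<tau> x \<omega>"
  using assms by (simp add: summand_def level_error_def algebra_simps)

lemma summand_L2le:
  assumes err: "\<And>k. k \<le> l \<Longrightarrow> error_at k (\<beta> k)" and \<beta>: "\<And>k. 0 \<le> \<beta> k" and \<tau>: "0 \<le> \<tau>" "\<tau> \<le> T"
  shows "L2le (summand \<theta> l i \<tau> x) (summand_bound \<beta> l \<tau> x)"
    and "expectation (summand \<theta> l i \<tau> x) = summand_mean l \<tau> x"
proof -
  let ?\<eta> = "\<theta> @ [int l, int i]" and ?\<eta>' = "\<theta> @ [- int l, int i]"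
  show "L2le (summand \<theta> l i \<tau> x) (summand_bound \<beta> l \<tau> x)"
  proof (cases "l = 0")
    case True
    have "L2le (summand \<theta> l i \<tau> x) (T * sqrt (\<Phi> \<tau> x)) \<longleftrightarrow>
      L2le (\<lambda>\<omega>. \<tau> * f (T - (1 - U ?\<eta> \<omega>) * \<tau>) (x + W ?\<eta> (U ?\<eta> \<omega> * \<tau>) \<omega>) 0) (T * sqrt (\<Phi> \<tau> x))"
      by (rule L2le_cong) (simp add: True summand_def f_at_def V_0)
    then show ?thesis using f_zero_L2le[OF snoc2_in_Theta \<tau>] by (simp add: summand_bound_def True)
  next
    case False
    then have l: "1 \<le> l" by simp
    have "L2le (\<lambda>\<omega>. level_error ?\<eta> ?\<eta> l \<tau> x \<omega> + (-1) * level_error ?\<eta> ?\<eta>' (l - 1) \<tau> x \<omega>)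
      (L * \<beta> l * (T / sqrt (real M) * exp (growth_rate * \<tau> / 2)) * sqrt (\<Phi> \<tau> x)
        + \<bar>- 1\<bar> * (L * \<beta> (l - 1) * (T / sqrt (real M) * exp (growth_rate * \<tau> / 2)) * sqrt (\<Phi> \<tau> x)))"
      by (intro L2le_add L2le_cmult level_error_L2le err \<beta> \<tau>) simp_all
    then show ?thesis
      unfolding summand_eq_errors[OF l, abs_def] summand_bound_def using False by (simp add: algebra_simps add_divide_distrib)
  qed
  show "expectation (summand \<theta> l i \<tau> x) = summand_mean l \<tau> x"
  proof (cases "l = 0")
    case True
    have z: "[0] \<in> Theta" by (simp add: Theta_def)
    have int: "integrable P (level_error ?\<eta> ?\<eta> 0 \<tau> x)" "integrable P (\<lambda>\<omega>. \<tau> * f_exact ?\<eta> \<tau> x \<omega>)"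
      using L2leD(5)[OF level_error_L2le[OF err \<beta> snoc2_in_Theta snoc2_in_Theta refl \<tau>]] L2leD(5)[OF f_exact_L2le[OF snoc2_in_Theta \<tau>]] by auto
    have "expectation (summand \<theta> l i \<tau> x) = expectation (\<lambda>\<omega>. level_error ?\<eta> ?\<eta> 0 \<tau> x \<omega> + \<tau> * f_exact ?\<eta> \<tau> x \<omega>)"
      by (rule Bochner_Integration.integral_cong) (simp_all add: True summand_def level_error_def algebra_simps)
    also have "\<dots> = level_mean 0 \<tau> x + expectation (\<lambda>\<omega>. \<tau> * f_exact ?\<eta> \<tau> x \<omega>)"
      using int level_error_mean[OF err \<beta> snoc2_in_Theta snoc2_in_Theta refl \<tau>] by simp
    also have "expectation (\<lambda>\<omega>. \<tau> * f_exact ?\<eta> \<tau> x \<omega>) = expectation (\<lambda>\<omega>. \<tau> * f_exact [0] \<tau> x \<omega>)"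
      using v_eq_means[OF z snoc2_in_Theta[of \<theta> "int l" "int i"] \<tau>, of x] v_eq_means[OF z z \<tau>, of x] by linarith
    finally show ?thesis by (simp add: summand_mean_def True)
  next
    case False
    then have l: "1 \<le> l" by simp
    have 1: "integrable P (level_error ?\<eta> ?\<eta> l \<tau> x)" "expectation (level_error ?\<eta> ?\<eta> l \<tau> x) = level_mean l \<tau> x"
      by (rule L2leD(5)[OF level_error_L2le[OF err \<beta> snoc2_in_Theta snoc2_in_Theta refl \<tau>]], simp,
        rule level_error_mean[OF err \<beta> snoc2_in_Theta snoc2_in_Theta refl \<tau>], simp)
    have 2: "integrable P (level_error ?\<eta> ?\<eta>' (l - 1) \<tau> x)" "expectation (level_error ?\<eta> ?\<eta>' (l - 1) \<tau> x) = level_mean (l - 1) \<tau> x"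
      by (rule L2leD(5)[OF level_error_L2le[OF err \<beta> snoc2_in_Theta snoc2_in_Theta _ \<tau>]], simp, simp,
        rule level_error_mean[OF err \<beta> snoc2_in_Theta snoc2_in_Theta _ \<tau>], simp, simp)
    show ?thesis
      unfolding summand_eq_errors[OF l, abs_def] using 1 2 False by (simp add: summand_mean_def)
  qed
qed

lemma sum_summand_mean: "1 \<le> n \<Longrightarrow>
  (\<Sum>l<n. summand_mean l \<tau> x) = level_mean (n - 1) \<tau> x + expectation (\<lambda>\<omega>. \<tau> * f_exact [0] \<tau> x \<omega>)"
  by (induction n rule: nat_induct_at_least) (auto simp: summand_mean_def)

text \<open>Fluctuation and bias: centred Monte Carlo averages of the terminal samples and of each
  level, plus the mean error of level \<open>n - 1\<close>, the only bias that survives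
  telescoping.\<close>

lemma V_error_decomposition:
  assumes err: "\<And>k. k < n \<Longrightarrow> error_at k (\<beta> k)" and \<beta>: "\<And>k. 0 \<le> \<beta> k"
    and n: "1 \<le> n" and \<theta>: "\<theta> \<in> Theta" and \<tau>: "0 \<le> \<tau>" "\<tau> \<le> T"
  shows "L2le (\<lambda>\<omega>. V \<theta> n \<tau> x \<omega> - v \<tau> x)
    (sqrt (\<Phi> \<tau> x) / sqrt (real (M ^ n)) + (\<Sum>l<n. summand_bound \<beta> l \<tau> x / sqrt (real (M ^ (n - l))))
      + L * \<beta> (n - 1) * (T / sqrt (real M) * exp (growth_rate * \<tau> / 2)) * sqrt (\<Phi> \<tau> x))"
proof -
  have z: "[0] \<in> Theta" by (simp add: Theta_def)
  have pow: "1 \<le> M ^ k" for k using M by simp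
  define G where "G i \<omega> = g (x + W (\<theta> @ [0, int i]) \<tau> \<omega>)" for i \<omega>
  define Ig where "Ig = expectation (\<lambda>\<omega>. g (x + W [0] \<tau> \<omega>))"
  have G_L2: "L2le (G i) (sqrt (\<Phi> \<tau> x))" for i
    unfolding G_def[abs_def] by (rule terminal_L2le[OF snoc2_in_Theta \<tau>])
  have G_mean: "expectation (G i) = Ig" for i
    using v_eq_means[OF snoc2_in_Theta[of \<theta> 0 "int i"] z \<tau>, of x] v_eq_means[OF z z \<tau>, of x]
    unfolding G_def[abs_def] Ig_def by simp
  have G_ind: "indep_vars (\<lambda>_. borel) G J" for J
  proof (rule indep_vars_alg[where S = "\<lambda>i. {Inr (\<theta> @ [0, int i])}"])
    show "G i \<in> borel_measurable (alg {Inr (\<theta> @ [0, int i])})" for i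
    proof -
      have "W (\<theta> @ [0, int i]) \<tau> \<in> borel_measurable (alg {Inr (\<theta> @ [0, int i])})"
        by (rule measurable_alg_W) (use \<tau> in auto)
      then show ?thesis unfolding G_def[abs_def] by measurable
    qed
  qed (auto simp: sources_def disjoint_family_on_def)
  have A1: "L2le (\<lambda>\<omega>. 1 / real (M ^ n) * (\<Sum>i=1..M ^ n. G i \<omega> - Ig)) (sqrt (\<Phi> \<tau> x) / sqrt (real (M ^ n)))"
    using L2le_indep_mean[OF _ _ pow G_ind G_L2, of "{1..M ^ n}" n] by (simp add: G_mean)
  have S_L2: "L2le (summand \<theta> l i \<tau> x) (summand_bound \<beta> l \<tau> x)"
    and S_mean: "expectation (summand \<theta> l i \<tau> x) = summand_mean l \<tau> x" if "l < n" for l i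
    using that by (auto intro!: summand_L2le err \<beta> \<tau>)
  have S_ind: "indep_vars (\<lambda>_. borel) (\<lambda>i. summand \<theta> l i \<tau> x) J" for l J
  proof (rule indep_vars_alg[OF _ _ summand_alg[OF \<tau>]])
    show "family (\<theta> @ [int l, int i]) \<union> family (\<theta> @ [- int l, int i]) \<subseteq> sources" for i
      using family_sources[OF snoc2_in_Theta] by simp
    show "disjoint_family_on (\<lambda>i. family (\<theta> @ [int l, int i]) \<union> family (\<theta> @ [- int l, int i])) J"
      using disjoint_blocks[of \<theta> UNIV] unfolding disjoint_family_on_def by fastforce
  qed
  define D where "D l \<omega> = 1 / real (M ^ (n - l)) * (\<Sum>i=1..M ^ (n - l). summand \<theta> l i \<tau> x \<omega> - summand_mean l \<tau> x)" for l \<omega>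
  have A2: "L2le (D l) (summand_bound \<beta> l \<tau> x / sqrt (real (M ^ (n - l))))" if "l < n" for l
    unfolding D_def[abs_def]
    using L2le_indep_mean[OF _ _ pow S_ind S_L2[OF that], of "{1..M ^ (n - l)}" "n - l"] by (simp add: S_mean[OF that])
  have A3: "L2le (\<lambda>_. level_mean (n - 1) \<tau> x) (L * \<beta> (n - 1) * (T / sqrt (real M) * exp (growth_rate * \<tau> / 2)) * sqrt (\<Phi> \<tau> x))"
    by (rule L2le_mono[OF L2le_const level_mean_le[OF err \<beta> \<tau>]]) (use n in simp)
  have "L2le (\<lambda>\<omega>. 1 / real (M ^ n) * (\<Sum>i=1..M ^ n. G i \<omega> - Ig) + (\<Sum>l<n. D l \<omega>) + level_mean (n - 1) \<tau> x)
    (sqrt (\<Phi> \<tau> x) / sqrt (real (M ^ n)) + (\<Sum>l<n. summand_bound \<beta> l \<tau> x / sqrt (real (M ^ (n - l))))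
      + L * \<beta> (n - 1) * (T / sqrt (real M) * exp (growth_rate * \<tau> / 2)) * sqrt (\<Phi> \<tau> x))"
    by (intro L2le_add A1 A3 L2le_sum A2) auto
  \<comment> \<open>The recursion minus the fixed-point equation: the means of all summands add up
    to the exact source mean plus the mean error of the last level.\<close>
  moreover have "V \<theta> n \<tau> x \<omega> - v \<tau> x = 1 / real (M ^ n) * (\<Sum>i=1..M ^ n. G i \<omega> - Ig) + (\<Sum>l<n. D l \<omega>) + level_mean (n - 1) \<tau> x"
    if "\<omega> \<in> space P" for \<omega>
  proof -
    have M0: "real M \<noteq> 0" using M by simp
    have "(\<Sum>l<n. D l \<omega>) = (\<Sum>l<n. 1 / real M ^ (n - l) * (\<Sum>i=1..M ^ (n - l). summand \<theta> l i \<tau> x \<omega>)) - (\<Sum>l<n. summand_mean l \<tau> x)"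
      unfolding D_def sum_subtractf[symmetric] using M0 by (intro sum.cong refl) (simp add: sum_subtractf right_diff_distrib diff_divide_distrib)
    moreover have "1 / real (M ^ n) * (\<Sum>i=1..M ^ n. G i \<omega> - Ig) = 1 / real M ^ n * (\<Sum>i=1..M ^ n. G i \<omega>) - Ig"
      using M0 by (simp add: sum_subtractf diff_divide_distrib)
    ultimately show ?thesis
      using V_rec'[OF n \<theta> that \<tau>, of x] v_eq_means[OF z z \<tau>, of x] sum_summand_mean[OF n, of \<tau> x]
      by (simp add: G_def Ig_def)
  qed
  ultimately show ?thesis by (subst L2le_cong)
qed

text \<open>The constant \<open>C\<close> bounds the exact solution, which is the error at n = 0
  since the scheme starts from 0.\<close>

definition error_rate :: "nat \<Rightarrow> real" where
  "error_rate n = C * ((1 + 2 * L * T) / sqrt (real M)) ^ n"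

lemma error_rate_nonneg: "0 \<le> error_rate n"
  using C_nonneg L T by (simp add: error_rate_def)

text \<open>A Gronwall argument with the geometric ansatz built in. Every level error occurs twice,
  once in its own level and once in the next one or in the bias, which is why 2 L T enters the
  ratio.\<close>

lemma geometric_error_sum:
  assumes "1 \<le> n" and \<tau>: "0 \<le> \<tau>" "\<tau> \<le> T"
  shows "sqrt (\<Phi> \<tau> x) / sqrt (real (M ^ n)) + (\<Sum>l<n. summand_bound error_rate l \<tau> x / sqrt (real (M ^ (n - l))))
      + L * error_rate (n - 1) * (T / sqrt (real M) * exp (growth_rate * \<tau> / 2)) * sqrt (\<Phi> \<tau> x)
    \<le> error_rate n * exp (growth_rate * \<tau> / 2) * sqrt (\<Phi> \<tau> x)"
proof -
  define r where "r = sqrt (real M)"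
  define q where "q = 1 + 2 * L * T"
  define E where "E = exp (growth_rate * \<tau> / 2)"
  \<comment> \<open>In this unit the claim becomes an inequality between powers of
    \<open>q\<close>.\<close>
  define S where "S = E * C * sqrt (\<Phi> \<tau> x) / r ^ n"
  have r: "1 \<le> r" "0 < r" using M by (auto simp: r_def)
  have q: "1 \<le> q" using L T by (simp add: q_def)
  have E: "1 \<le> E" using \<tau> T M by (simp add: E_def growth_rate_def)
  have \<Phi>0: "0 \<le> \<Phi> \<tau> x" by (rule \<Phi>_nonneg[OF \<tau>(2)])
  have S0: "0 \<le> S" unfolding S_def using E C_nonneg r \<Phi>0 by simp
  have rM: "sqrt (real (M ^ k)) = r ^ k" for k by (simp add: r_def real_sqrt_power)
  have er: "error_rate k = C * q ^ k / r ^ k" for k by (simp add: error_rate_def q_def r_def power_divide)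
  have term_le: "summand_bound error_rate l \<tau> x / r ^ (n - l) \<le> L * T * S * (q ^ l + q ^ (l - 1))" if "1 \<le> l" "l < n" for l
  proof -
    obtain k where k: "l = Suc k" using \<open>1 \<le> l\<close> by (cases l) auto
    have rn: "r ^ n = r ^ (n - l) * r ^ k * r" using that k by (simp add: power_add[symmetric] flip: power_Suc2)
    have "summand_bound error_rate l \<tau> x / r ^ (n - l) = L * T * S * (q ^ l / r + q ^ k)"
      unfolding S_def rn summand_bound_def er E_def[symmetric] r_def[symmetric] k using r
      by (simp add: field_simps)
    also have "\<dots> \<le> L * T * S * (q ^ l + q ^ k)"
      using L T S0 q r by (intro mult_left_mono add_mono) (auto simp: divide_le_eq intro: mult_le_cancel_left1[THEN iffD2])
    finally show ?thesis by (simp add: k)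
  qed
  \<comment> \<open>The bias term is part of the invariant: adding level \<open>k\<close> and moving
    the bias from q^(k-1) to q^k costs 2 L T S q^k, which is S (q^(k+1) - q^k).\<close>
  have partial: "(\<Sum>l<k. summand_bound error_rate l \<tau> x / r ^ (n - l)) + L * T * S * q ^ (k - 1)
      \<le> T * sqrt (\<Phi> \<tau> x) / r ^ n + S * (q ^ k - 1)" if "1 \<le> k" "k \<le> n" for k
    using that
  proof (induction k rule: nat_induct_at_least)
    case base
    have "L * T * S \<le> S * (q - 1)" using L T S0 by (simp add: q_def)
    then show ?case by (simp add: summand_bound_def)
  next
    case (Suc k)
    have "L * T * S * (q ^ k + q ^ (k - 1)) + L * T * S * (q ^ k - q ^ (k - 1)) = S * (q ^ Suc k - q ^ k)"
      by (simp add: q_def algebra_simps)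
    then show ?case using Suc.IH Suc.prems Suc.hyps term_le[of k] by (simp add: algebra_simps)
  qed
  have last: "L * error_rate (n - 1) * (T / r * E) * sqrt (\<Phi> \<tau> x) = L * T * S * q ^ (n - 1)"
  proof -
    obtain k where k: "n = Suc k" using assms by (cases n) auto
    show ?thesis unfolding S_def er k using r by (simp add: field_simps)
  qed
  \<comment> \<open>\<open>C\<close> contains the factor 1 + T, which pays for the terminal
    fluctuation and for level 0, whose bound is T times \<surd>\<Phi>.\<close>
  have "(1 + T) * 1 \<le> C * E" unfolding C_def using T L E by (intro mult_mono) auto
  then have "(1 + T) * sqrt (\<Phi> \<tau> x) / r ^ n \<le> S"
    unfolding S_def using \<Phi>0 r mult_right_mono[of "1 + T" "C * E" "sqrt (\<Phi> \<tau> x)"]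
    by (intro divide_right_mono) (auto simp: mult_ac)
  then have "sqrt (\<Phi> \<tau> x) / r ^ n + (\<Sum>l<n. summand_bound error_rate l \<tau> x / r ^ (n - l)) + L * T * S * q ^ (n - 1) \<le> S * q ^ n"
    using partial[OF assms(1) order_refl] by (simp add: algebra_simps add_divide_distrib)
  also have "S * q ^ n = error_rate n * E * sqrt (\<Phi> \<tau> x)" unfolding S_def er by simp
  finally show ?thesis unfolding rM last[symmetric] E_def[symmetric] r_def[symmetric] .
qed

text \<open>The strong induction closes because the sum estimate returns exactly the rate assumed
  for the lower levels.\<close>

lemma V_error: "error_at n (error_rate n)"
proof (induction n rule: less_induct)
  case (less n)
  show ?case
    unfolding error_at_def
  proof (intro ballI allI)
    fix \<theta> \<tau> x assume \<theta>: "\<theta> \<in> Theta" and "\<tau> \<in> {0..T}"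
    then have \<tau>: "0 \<le> \<tau>" "\<tau> \<le> T" by auto
    show "L2le (\<lambda>\<omega>. V \<theta> n \<tau> x \<omega> - v \<tau> x) (error_rate n * exp (growth_rate * \<tau> / 2) * sqrt (\<Phi> \<tau> x))"
    proof (cases "n = 0")
      case True
      have "\<bar>- v \<tau> x\<bar> \<le> C * 1 * sqrt (\<Phi> \<tau> x)" using abs_v_le[OF \<tau>] by simp
      also have "\<dots> \<le> C * exp (growth_rate * \<tau> / 2) * sqrt (\<Phi> \<tau> x)"
        using C_nonneg \<tau> T \<Phi>_nonneg[OF \<tau>(2)] by (intro mult_right_mono mult_left_mono) (auto simp: growth_rate_def)
      finally have "L2le (\<lambda>_. - v \<tau> x) (error_rate n * exp (growth_rate * \<tau> / 2) * sqrt (\<Phi> \<tau> x))"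
        using L2le_mono[OF L2le_const] True by (simp add: error_rate_def)
      then show ?thesis by (subst L2le_cong[of _ "\<lambda>_. - v \<tau> x"]) (simp add: True V_0 \<theta>)
    next
      case False
      then have n: "1 \<le> n" by simp
      show ?thesis
        by (rule L2le_mono[OF V_error_decomposition[OF less.IH error_rate_nonneg n \<theta> \<tau>] geometric_error_sum[OF n \<tau>]])
    qed
  qed
qed

lemma mlp_L2_error:
  assumes "\<theta> \<in> Theta"
  shows "L2le (\<lambda>\<omega>. V \<theta> n T x \<omega> - y 0 x)
    ((1 + T) * exp (L * T) * sqrt (A * gauss_weight d a T x) * ((1 + 2 * L * T) / sqrt (real M)) ^ n * exp (real M / 2))"
proof -
  have "T \<in> {0..T}" using T by simp
  then have "L2le (\<lambda>\<omega>. V \<theta> n T x \<omega> - v T x) (error_rate n * exp (growth_rate * T / 2) * sqrt (\<Phi> T x))"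
    using V_error[of n] assms unfolding error_at_def by blast
  moreover have "growth_rate * T = real M" using T by (simp add: growth_rate_def)
  ultimately show ?thesis by (simp add: v_def error_rate_def C_def \<Phi>_def mult_ac)
qed

end

section \<open>Viscosity solutions as fixed points\<close>

lemma heat_subsolution_cong:
  assumes "\<And>t x. 0 < t \<Longrightarrow> t < T \<Longrightarrow> x \<in> Rd d \<Longrightarrow> h t x = h' t x"
    and "\<And>t x. 0 < t \<Longrightarrow> t < T \<Longrightarrow> x \<in> Rd d \<Longrightarrow> u t x = u' t x"
  shows "heat_subsolution T d h u \<longleftrightarrow> heat_subsolution T d h' u'"
  unfolding heat_subsolution_def using assms by (intro iff_allI ball_cong refl) auto

lemma continuous_on_clip_proj:
  assumes "0 \<le> T" "continuous_on ({0..T} \<times> Rd d) (\<lambda>(t, x). u t x)"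
  shows "continuous_on UNIV (\<lambda>(t, x). u (clip T t) (proj d x))"
proof -
  have "continuous_on UNIV ((\<lambda>(t, x). u t x) \<circ> (\<lambda>q. (clip T (fst q), proj d (snd q))))"
  proof (rule continuous_on_compose)
    show "continuous_on UNIV (\<lambda>q::real \<times> (nat \<Rightarrow> real). (clip T (fst q), proj d (snd q)))"
      by (intro continuous_intros)
    show "continuous_on (range (\<lambda>q::real \<times> (nat \<Rightarrow> real). (clip T (fst q), proj d (snd q)))) (\<lambda>(t, x). u t x)"
      by (rule continuous_on_subset[OF assms(2)]) (use clip_range assms(1) in auto)
  qed
  then show ?thesis by (simp add: comp_def case_prod_beta)
qed

lemma norm_Rd_proj [simp]: "norm_Rd d (proj d x) = norm_Rd d x"
  by (rule L2_set_cong) (auto simp: proj_nth)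

locale heat_problem =
  fixes d :: nat and T L p :: real
    and f :: "real \<Rightarrow> (nat \<Rightarrow> real) \<Rightarrow> real \<Rightarrow> real" and g :: "(nat \<Rightarrow> real) \<Rightarrow> real"
  assumes T_pos: "0 < T" and L_nonneg: "0 \<le> L" and p: "0 \<le> p"
    and f_continuous: "continuous_on ({0..T} \<times> Rd d \<times> UNIV) (\<lambda>(t, x, v). f t x v)"
    and g_continuous: "continuous_on (Rd d) g"
    and fg_growth: "\<And>t x. t \<in> {0..T} \<Longrightarrow> x \<in> Rd d \<Longrightarrow> max \<bar>f t x 0\<bar> \<bar>g x\<bar> \<le> L * max 1 (norm_Rd d x powr p)"
    and f_lipschitz: "\<And>t x v w. t \<in> {0..T} \<Longrightarrow> x \<in> Rd d \<Longrightarrow> \<bar>f t x v - f t x w\<bar> \<le> L * \<bar>v - w\<bar>"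
begin

definition f' :: "real \<Rightarrow> (nat \<Rightarrow> real) \<Rightarrow> real \<Rightarrow> real" where "f' t x v = f (clip T t) (proj d x) v"

definition g' :: "(nat \<Rightarrow> real) \<Rightarrow> real" where "g' x = g (proj d x)"

text \<open>The exponent \<open>2 * m\<close> is at least \<open>p\<close>; the successor makes
  \<open>m\<close> positive, as the translation back to powers of the norm requires.\<close>

definition m :: nat where "m = Suc (nat \<lceil>p\<rceil>)"

lemma m: "1 \<le> m" "p \<le> real (2 * m)"
proof -
  show "1 \<le> m" by (simp add: m_def)
  have "real (nat \<lceil>p\<rceil>) \<le> real (2 * m)" unfolding m_def by simp
  then show "p \<le> real (2 * m)" using real_nat_ceiling_ge[of p] by linarith
qed

lemma clip_in: "clip T t \<in> {0..T}"
  using clip_range T_pos by auto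

lemma fg_bounds: "\<bar>f' t x 0\<bar> \<le> L * max 1 (norm_Rd d x powr p)" "\<bar>g' x\<bar> \<le> L * max 1 (norm_Rd d x powr p)"
  using fg_growth[OF clip_in[of t] proj_in_Rd[of d x]] by (auto simp: f'_def g'_def)

lemma growth_from_norm_bound:
  assumes c: "continuous_on UNIV (\<lambda>(t, x). u t x)" and q: "0 \<le> q" "q \<le> real (2 * n)" and B: "0 \<le> B"
    and b: "\<And>t x. 0 \<le> t \<Longrightarrow> t \<le> T \<Longrightarrow> \<bar>u t x\<bar> \<le> B * (1 + norm_Rd d x powr q)"
  shows "growth d T n u"
  unfolding growth_def
proof (intro conjI exI ballI allI)
  fix t x assume "t \<in> {0..T}"
  then have "\<bar>u t x\<bar> \<le> B * (1 + norm_Rd d x powr q)" using b by auto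
  also have "\<dots> \<le> B * (poly_weight d n x + (1 + real d ^ n) * poly_weight d n x)"
    using B by (intro mult_left_mono add_mono poly_weight_ge_1 norm_powr_le_poly_weight q)
  finally show "\<bar>u t x\<bar> \<le> (B * (2 + real d ^ n)) * poly_weight d n x" by (simp add: algebra_simps)
qed (rule c)

lemma max_powr_le: "L * max 1 (norm_Rd d x powr p) \<le> L * (1 + norm_Rd d x powr p)"
  using L_nonneg by (intro mult_left_mono) auto

lemma f'_continuous: "continuous_on UNIV (\<lambda>(t, x, v). f' t x v)"
proof -
  have "continuous_on UNIV ((\<lambda>(t, x, v). f t x v) \<circ> (\<lambda>q. (clip T (fst q), proj d (fst (snd q)), snd (snd q))))"
  proof (rule continuous_on_compose)
    show "continuous_on UNIV (\<lambda>q::real \<times> (nat \<Rightarrow> real) \<times> real. (clip T (fst q), proj d (fst (snd q)), snd (snd q)))"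
      by (intro continuous_intros)
    show "continuous_on (range (\<lambda>q::real \<times> (nat \<Rightarrow> real) \<times> real. (clip T (fst q), proj d (fst (snd q)), snd (snd q)))) (\<lambda>(t, x, v). f t x v)"
      by (rule continuous_on_subset[OF f_continuous]) (use clip_range T_pos in auto)
  qed
  then show ?thesis by (simp add: comp_def case_prod_beta f'_def)
qed

lemma g'_continuous: "continuous_on UNIV g'"
proof -
  have "continuous_on UNIV (g \<circ> proj d)"
    by (rule continuous_on_compose) (auto intro!: continuous_intros continuous_on_subset[OF g_continuous])
  then show ?thesis by (simp add: comp_def g'_def[abs_def])
qed

sublocale semilinear d m T L f' g'
proof
  show "continuous_on UNIV (\<lambda>(t, x, v). f' t x v)" by (rule f'_continuous)
  show "\<bar>f' t x v - f' t x w\<bar> \<le> L * \<bar>v - w\<bar>" if "0 \<le> t" "t \<le> T" for t x v w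
    unfolding f'_def by (rule f_lipschitz[OF clip_in proj_in_Rd])
  show "growth d T m (\<lambda>t x. f' t x 0)"
  proof (rule growth_from_norm_bound[OF _ p m(2) L_nonneg])
    have "continuous_on UNIV ((\<lambda>(t, x, v). f' t x v) \<circ> (\<lambda>q. (fst q, snd q, 0)))"
      by (rule continuous_on_compose) (auto intro!: continuous_intros continuous_on_subset[OF f'_continuous])
    then show "continuous_on UNIV (\<lambda>(t, x). f' t x 0)" by (simp add: comp_def case_prod_beta)
    show "\<bar>f' t x 0\<bar> \<le> L * (1 + norm_Rd d x powr p)" for t x using fg_bounds(1) max_powr_le order_trans by blast
  qed
  show "growth d T m (\<lambda>_. g')"
  proof (rule growth_from_norm_bound[OF _ p m(2) L_nonneg])
    have "continuous_on UNIV (g' \<circ> (snd :: real \<times> (nat \<Rightarrow> real) \<Rightarrow> _))"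
      by (rule continuous_on_compose) (auto intro!: continuous_intros continuous_on_subset[OF g'_continuous])
    then show "continuous_on UNIV (\<lambda>(t::real, x). g' x)" by (simp add: comp_def case_prod_beta)
    show "\<bar>g' x\<bar> \<le> L * (1 + norm_Rd d x powr p)" for x using fg_bounds(2) max_powr_le order_trans by blast
  qed
qed (use T_pos L_nonneg in \<open>auto simp: f'_def g'_def\<close>)

text \<open>With the source frozen along it, the fixed point is a linear Feynman--Kac formula and
  hence a subsolution; the supersolution half is the same statement for the negated data.\<close>

lemma fixpoint_is_solution:
  assumes y: "growth d T m y" "\<And>t x. y t (proj d x) = y t x" and fixp: "\<And>t x. 0 \<le> t \<Longrightarrow> t \<le> T \<Longrightarrow> y t x = picard y t x"
  shows "semilinear_heat_solution T d f g y"
  unfolding semilinear_heat_solution_def viscosity_solution_def viscosity_subsolution_iff viscosity_supersolution_iff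
proof (intro conjI ballI)
  define h where "h t x = f' t x (y t x)" for t x
  have h: "growth d T m h" "\<And>t x. h t (proj d x) = h t x"
    unfolding h_def by (rule growth_comp[OF y(1) order_refl], simp add: f_proj y(2))
  have fk: "y t x = feynman_kac d T h g' t x" if "0 \<le> t" "t \<le> T" for t x
    using fixp[OF that, of x] by (simp add: picard_def h_def[abs_def])
  have hf: "h t x = f t x (y t x)" if "0 < t" "t < T" "x \<in> Rd d" for t x
    using that by (simp add: h_def f'_def proj_ident)
  show cont: "continuous_on ({0..T} \<times> Rd d) (\<lambda>(t, x). y t x)" "continuous_on ({0<..<T} \<times> Rd d) (\<lambda>(t, x). y t x)"
    by (rule continuous_on_subset[OF growth_cont[OF y(1)]], simp)+
  show "poly_growing T d y"
    unfolding poly_growing_def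
  proof (intro exI conjI)
    obtain C where C: "0 \<le> C" "\<forall>t\<in>{0..T}. \<forall>x. \<bar>y t x\<bar> \<le> C * poly_weight d m x" by (rule growthE[OF y(1)])
    show "bdd_above ((\<lambda>(t, x). \<bar>y t x\<bar> / (1 + norm_Rd d x powr real (2 * m))) ` ({0..T} \<times> Rd d))"
    proof (rule bdd_aboveI2[where M = "C * (1 + real d)"])
      fix q assume "q \<in> {0..T} \<times> Rd d"
      then obtain t x where q: "q = (t, x)" "t \<in> {0..T}" by (cases q) auto
      have pos: "0 < 1 + norm_Rd d x powr real (2 * m)" by (rule add_pos_nonneg) auto
      have "\<bar>y t x\<bar> \<le> C * poly_weight d m x" using C(2) q by auto
      also have "\<dots> \<le> C * ((1 + real d) * (1 + norm_Rd d x powr real (2 * m)))"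
        by (rule mult_left_mono[OF poly_weight_le_norm_powr[OF m(1)] C(1)])
      finally show "(case q of (t, x) \<Rightarrow> \<bar>y t x\<bar> / (1 + norm_Rd d x powr real (2 * m))) \<le> C * (1 + real d)"
        using pos by (simp add: q pos_divide_le_eq mult.assoc)
    qed
  qed simp
  show "y T x = g x" if "x \<in> Rd d" for x
    using fk[of T x] fk_terminal[OF g'_continuous] T_pos that by (simp add: g'_def proj_ident)
  have "heat_subsolution T d h (feynman_kac d T h g')"
    by (rule heat_subsolution_fk[OF T_pos h(1) g_growth h(2) g_proj])
  then show "heat_subsolution T d (\<lambda>t x. f t x (y t x)) y"
    using fk hf by (subst heat_subsolution_cong[of T d _ h y "feynman_kac d T h g'"]) auto
  have "heat_subsolution T d (\<lambda>t x. - h t x) (feynman_kac d T (\<lambda>t x. - h t x) (\<lambda>x. - g' x))"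
    by (rule heat_subsolution_fk[OF T_pos growth_uminus[OF h(1)] growth_uminus[OF g_growth]]) (simp_all add: h(2) g_proj)
  then show "heat_subsolution T d (\<lambda>t x. - f t x (y t x)) (\<lambda>t x. - y t x)"
    using fk hf by (subst heat_subsolution_cong[of T d _ "\<lambda>t x. - h t x" _ "feynman_kac d T (\<lambda>t x. - h t x) (\<lambda>x. - g' x)"]) (auto simp: fk_uminus)
qed

text \<open>Freezing the source along \<open>u\<close> reduces the claim to two comparisons with a
  linear Feynman--Kac formula, one for \<open>u\<close> and one for its negative.\<close>

lemma solution_is_fixpoint:
  assumes sol: "semilinear_heat_solution T d f g u"
  obtains n where "m \<le> n" "growth d T n (\<lambda>t x. u (clip T t) (proj d x))"
    "\<forall>t\<in>{0..T}. \<forall>x. u (clip T t) (proj d x) = picard (\<lambda>t x. u (clip T t) (proj d x)) t x"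
proof -
  define w where "w t x = u (clip T t) (proj d x)" for t x
  note S = sol[unfolded semilinear_heat_solution_def viscosity_solution_def viscosity_subsolution_iff viscosity_supersolution_iff]
  have w_cont: "continuous_on UNIV (\<lambda>(t, x). w t x)"
    unfolding w_def using continuous_on_clip_proj[of T d u] S T_pos by auto
  obtain q where q: "0 \<le> q" and "bdd_above ((\<lambda>(t, x). \<bar>u t x\<bar> / (1 + norm_Rd d x powr q)) ` ({0..T} \<times> Rd d))"
    using S unfolding poly_growing_def by blast
  then obtain B where B: "\<bar>u t x\<bar> / (1 + norm_Rd d x powr q) \<le> B" if "t \<in> {0..T}" "x \<in> Rd d" for t x
    by (force simp: bdd_above_def)
  \<comment> \<open>The growth of \<open>u\<close> may exceed that of the data, so the degree is
    chosen anew.\<close>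
  define n where "n = max m (nat \<lceil>q\<rceil>)"
  have n: "m \<le> n" "q \<le> real (2 * n)"
  proof -
    show "m \<le> n" by (simp add: n_def)
    have "nat \<lceil>q\<rceil> \<le> n" by (simp add: n_def)
    then have "real (nat \<lceil>q\<rceil>) \<le> real n" by (rule of_nat_mono)
    then show "q \<le> real (2 * n)" using real_nat_ceiling_ge[of q] by simp
  qed
  have w_growth: "growth d T n w"
  proof (rule growth_from_norm_bound[OF w_cont q n(2), of "\<bar>B\<bar>"])
    fix t x
    have pos: "0 < 1 + norm_Rd d x powr q" by (rule add_pos_nonneg) auto
    have "\<bar>w t x\<bar> \<le> B * (1 + norm_Rd d x powr q)"
      using B[OF clip_in[of t] proj_in_Rd[of d x]] pos by (simp add: w_def pos_divide_le_eq)
    also have "\<dots> \<le> \<bar>B\<bar> * (1 + norm_Rd d x powr q)" using pos by (intro mult_right_mono) auto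
    finally show "\<bar>w t x\<bar> \<le> \<bar>B\<bar> * (1 + norm_Rd d x powr q)" .
  qed simp
  define h where "h t x = f' t x (w t x)" for t x
  have h: "growth d T n h" "\<And>t x. h t (proj d x) = h t x"
    unfolding h_def by (rule growth_comp[OF w_growth n(1)], simp add: f_proj w_def)
  have gn: "growth d T n (\<lambda>_. g')" by (rule growth_mono[OF g_growth n(1)])
  have hf: "h t x = f t x (u t x)" "w t x = u t x" if "0 < t" "t < T" "x \<in> Rd d" for t x
    using that by (simp_all add: h_def w_def f'_def proj_ident)
  have wT: "w T x = g' x" for x using S T_pos by (simp add: w_def g'_def)
  have "heat_subsolution T d (\<lambda>t x. f t x (u t x)) u" "heat_subsolution T d (\<lambda>t x. - f t x (u t x)) (\<lambda>t x. - u t x)"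
    using S by auto
  moreover have "heat_subsolution T d h w \<longleftrightarrow> heat_subsolution T d (\<lambda>t x. f t x (u t x)) u"
    "heat_subsolution T d (\<lambda>t x. - h t x) (\<lambda>t x. - w t x) \<longleftrightarrow> heat_subsolution T d (\<lambda>t x. - f t x (u t x)) (\<lambda>t x. - u t x)"
    by (rule heat_subsolution_cong; simp add: hf)+
  ultimately have sub: "heat_subsolution T d h w" "heat_subsolution T d (\<lambda>t x. - h t x) (\<lambda>t x. - w t x)"
    by simp_all
  have eq0: "w t x = feynman_kac d T h g' t x" if t: "0 < t" "t \<le> T" and x: "x \<in> Rd d" for t x
  proof (rule antisym)
    show "w t x \<le> feynman_kac d T h g' t x"
      by (rule heat_comparison[OF T_pos h(1) gn w_growth h(2) g_proj sub(1) _ t x]) (simp add: wT)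
    have "- w t x \<le> feynman_kac d T (\<lambda>t x. - h t x) (\<lambda>x. - g' x) t x"
      by (rule heat_comparison[OF T_pos growth_uminus[OF h(1)] growth_uminus[OF gn] growth_uminus[OF w_growth] _ _ sub(2) _ t x])
        (simp_all add: wT h(2) g_proj)
    then show "feynman_kac d T h g' t x \<le> w t x" by (simp add: fk_uminus)
  qed
  \<comment> \<open>The comparison excludes time 0, where the two sides agree by continuity.\<close>
  have eq: "w t x = feynman_kac d T h g' t x" if t: "t \<in> {0..T}" and x: "x \<in> Rd d" for t x
  proof -
    have cl: "closure {0<..T} = {0..T}" using T_pos by (simp add: closure_greaterThanAtMost)
    have "continuous_on {0..T} (\<lambda>t. feynman_kac d T h g' t x)"
    proof -
      have "continuous_on {0..T} ((\<lambda>(t, x). feynman_kac d T h g' t x) \<circ> (\<lambda>t. (t, x)))"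
        by (rule continuous_on_compose)
          (auto intro!: continuous_intros continuous_on_subset[OF continuous_on_fk[OF T_pos h(1) gn h(2) g_proj]])
      then show ?thesis by (simp add: comp_def)
    qed
    moreover have "continuous_on {0..T} (\<lambda>t. w t x)"
      by (rule continuous_on_pair_comp[OF w_cont]) (auto intro!: continuous_intros)
    ultimately have "continuous_on (closure {0<..T}) (\<lambda>t. w t x - feynman_kac d T h g' t x)"
      unfolding cl by (intro continuous_intros)
    from continuous_constant_on_closure[OF this, of 0 t] show ?thesis
      using eq0[OF _ _ x] t by (simp add: cl)
  qed
  have "w t x = picard w t x" if "t \<in> {0..T}" for t x
  proof -
    have "w t x = w t (proj d x)" by (simp add: w_def)
    also have "\<dots> = feynman_kac d T h g' t (proj d x)" by (rule eq[OF that]) simp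
    also have "\<dots> = feynman_kac d T h g' t x" by (rule fk_proj[where h = h and g = g' and d = d, OF h(2) g_proj])
    finally show ?thesis by (simp add: picard_def h_def[abs_def])
  qed
  then show ?thesis using that[OF n(1)] w_growth unfolding w_def[abs_def] by blast
qed

lemma solution_unique:
  assumes y: "growth d T m y" and fixp: "\<And>t x. 0 \<le> t \<Longrightarrow> t \<le> T \<Longrightarrow> y t x = picard y t x"
    and sol: "semilinear_heat_solution T d f g u" and t: "t \<in> {0..T}" and x: "x \<in> Rd d"
  shows "u t x = y t x"
proof -
  obtain n where n: "m \<le> n" "growth d T n (\<lambda>t x. u (clip T t) (proj d x))"
    "\<forall>t\<in>{0..T}. \<forall>x. u (clip T t) (proj d x) = picard (\<lambda>t x. u (clip T t) (proj d x)) t x"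
    by (rule solution_is_fixpoint[OF sol])
  have "u (clip T t) (proj d x) = y t x"
    using fixpoint_unique[OF n(2) growth_mono[OF y n(1)] n(1)] n(3) fixp t by simp
  then show ?thesis using t x by (simp add: proj_ident)
qed

text \<open>From y \<le> exp y with y = |x|^2/D follows |x|^2 \<le> D exp (|x|^2/D). The power p/2
  of this trades the polynomial bound for the square root of a Gaussian weight with a = p/D.\<close>

lemma abs_le_sqrt_gauss_weight:
  assumes D: "1 \<le> D"
  shows "L * max 1 (norm_Rd d x powr p) \<le> sqrt ((max L 1)\<^sup>2 * D powr p * gauss_weight d (p / D) 0 x)"
proof -
  define N where "N = (norm_Rd d x)\<^sup>2"
  have N: "N = (\<Sum>i<d. (x i)\<^sup>2)" "0 \<le> N" by (simp_all add: N_def L2_set_def sum_nonneg)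
  define E where "E = D * exp (N / D)"
  have NE: "N \<le> E"
  proof -
    have "N / D \<le> exp (N / D)" using exp_ge_add_one_self[of "N / D"] by linarith
    then show ?thesis using D by (simp add: E_def field_simps)
  qed
  have E1: "1 \<le> E" unfolding E_def using D N(2) mult_mono[of 1 D 1 "exp (N / D)"] by simp
  have "norm_Rd d x powr p = N powr (p / 2)"
    using L2_set_nonneg[of x "{..<d}"] by (cases "norm_Rd d x = 0") (simp_all add: N_def powr_powr flip: powr_numeral)
  also have "\<dots> \<le> E powr (p / 2)" using N(2) NE p by (intro powr_mono2) auto
  finally have "max 1 (norm_Rd d x powr p) \<le> E powr (p / 2)" using E1 p by (simp add: ge_one_powr_ge_zero)
  then have "L * max 1 (norm_Rd d x powr p) \<le> max L 1 * E powr (p / 2)"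
    using L_nonneg by (intro mult_mono) auto
  also have "\<dots> = sqrt ((max L 1)\<^sup>2 * D powr p * gauss_weight d (p / D) 0 x)"
  proof (rule real_sqrt_unique[symmetric])
    have "(E powr (p / 2))\<^sup>2 = E powr p" by (simp add: power2_eq_square flip: powr_add)
    also have "\<dots> = D powr p * exp (N / D) powr p" using D by (simp add: E_def powr_mult)
    also have "exp (N / D) powr p = exp (p / D * N)" by (simp add: powr_def)
    finally show "(max L 1 * E powr (p / 2))\<^sup>2 = (max L 1)\<^sup>2 * D powr p * gauss_weight d (p / D) 0 x"
      by (simp add: power_mult_distrib gauss_weight_def N(1))
  qed (auto simp: max_def)
  finally show ?thesis .
qed

lemma solution_exists:
  assumes D: "1 \<le> D" "2 * (p / D) * T < 1"
  obtains y where "growth d T m y" "\<forall>t x. y t (proj d x) = y t x" "\<forall>t\<in>{0..T}. \<forall>x. y t x = picard y t x"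
    "\<forall>t\<in>{0..T}. \<forall>x. \<bar>y t x\<bar> \<le> (1 + (T - t)) * exp (L * (T - t))
       * sqrt ((max L 1)\<^sup>2 * D powr p * gauss_weight d (p / D) (T - t) x)"
proof -
  let ?A = "(max L 1)\<^sup>2 * D powr p" and ?a = "p / D"
  have A: "0 < ?A" using D by auto
  have a: "0 \<le> ?a" using p D by simp
  have gA: "\<bar>g' x\<bar> \<le> sqrt (?A * gauss_weight d ?a 0 x)" for x
    using order_trans[OF fg_bounds(2) abs_le_sqrt_gauss_weight[OF D(1)]] .
  have fA: "\<bar>f' t x 0\<bar> \<le> sqrt (?A * gauss_weight d ?a 0 x)" for t x
    using order_trans[OF fg_bounds(1) abs_le_sqrt_gauss_weight[OF D(1)]] .
  define B where "B t x = (1 + (T - t)) * exp (L * (T - t)) * sqrt (?A * gauss_weight d ?a (T - t) x)" for t x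
  \<comment> \<open>Beyond [0,T] the Gaussian bound may be negative or lose its meaning, while
    \<open>fixpoint_exists\<close> asks for a bound that is nonnegative everywhere.\<close>
  define V where "V t x = (if 0 \<le> t \<and> t \<le> T then B t x else 0)" for t x
  have B0: "0 \<le> B t x" if "0 \<le> t" "t \<le> T" for t x
  proof -
    have "2 * ?a * (T - t) \<le> 2 * ?a * T" using a that by (intro mult_left_mono) auto
    then have "0 \<le> gauss_weight d ?a (T - t) x" using D(2) by (intro gauss_weight_nonneg) linarith
    then show ?thesis unfolding B_def using that A by (intro mult_nonneg_nonneg) auto
  qed
  have V0: "0 \<le> V t x" for t x using B0 by (simp add: V_def)
  have V1: "\<bar>picard u t x\<bar> \<le> V t x"
    if u: "growth d T m u" "\<And>t x. 0 \<le> t \<Longrightarrow> t \<le> T \<Longrightarrow> \<bar>u t x\<bar> \<le> V t x" and t: "0 \<le> t" "t \<le> T" for u t x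
    using picard_gauss_bound[OF a D(2) A gA fA u(1) _ t, of x] u(2) t by (simp add: V_def B_def)
  obtain y where y: "growth d T m y" "\<forall>t x. y t (proj d x) = y t x" "\<forall>t\<in>{0..T}. \<forall>x. y t x = picard y t x"
    "\<forall>t\<in>{0..T}. \<forall>x. \<bar>y t x\<bar> \<le> V t x"
    by (rule fixpoint_exists[OF V0 V1])
  have "\<forall>t\<in>{0..T}. \<forall>x. \<bar>y t x\<bar> \<le> B t x" using y(4) by (auto simp: V_def)
  then show ?thesis using that[OF y(1-3)] unfolding B_def by blast
qed

end

locale mlp_problem = heat_problem d T L p f g + bm_noise P d T U W
  for P :: "'w measure" and d T L p f g U W +
  fixes M :: nat and Y :: "int list \<Rightarrow> int \<Rightarrow> real \<Rightarrow> (nat \<Rightarrow> real) \<Rightarrow> 'w \<Rightarrow> real"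
  assumes M_pos: "1 \<le> M"
    and Y_init: "\<And>\<theta> t x \<omega>. \<lbrakk>\<theta> \<in> Theta; t \<in> {0..T}; x \<in> Rd d; \<omega> \<in> space P\<rbrakk> \<Longrightarrow> Y \<theta> 0 t x \<omega> = 0"
    and Y_rec: "\<And>n \<theta> t x \<omega>. \<lbrakk>n \<ge> 1; \<theta> \<in> Theta; t \<in> {0..T}; x \<in> Rd d; \<omega> \<in> space P\<rbrakk> \<Longrightarrow>
          Y \<theta> (int n) (T - t) x \<omega> =
            1 / real M ^ n * (\<Sum>i=1..M ^ n. g (x + W (\<theta> @ [0, int i]) t \<omega>))
            + (\<Sum>l<n. t / real M ^ (n - l) * (\<Sum>i=1..M ^ (n - l).
                let \<eta> = \<theta> @ [int l, int i];
                    \<eta>' = \<theta> @ [- int l, int i];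
                    s = T - t + U \<eta> \<omega> * t;
                    z = x + W \<eta> (U \<eta> \<omega> * t) \<omega>
                in f s z (Y \<eta> (int l) s z \<omega>)
                   - of_bool (l \<ge> 1) * f s z (Y \<eta>' (int l - 1) s z \<omega>)))"
begin

text \<open>Passage to the time to maturity, with the values outside [0,T] and R^d inherited by
  clamping, as the total scheme of \<open>mlp\<close> expects.\<close>

definition V :: "int list \<Rightarrow> nat \<Rightarrow> real \<Rightarrow> (nat \<Rightarrow> real) \<Rightarrow> 'w \<Rightarrow> real" where
  "V \<theta> n \<tau> x \<omega> = Y \<theta> (int n) (T - clip T \<tau>) (proj d x) \<omega>"

lemma proj_plus_W:
  assumes "\<eta> \<in> Theta" "0 \<le> t" "t \<le> T" "\<omega> \<in> space P"
  shows "proj d x + W \<eta> t \<omega> = proj d (x + W \<eta> t \<omega>)"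
proof
  fix i
  have "W \<eta> t \<omega> \<in> Rd d" using W_Rd assms by auto
  then show "(proj d x + W \<eta> t \<omega>) i = proj d (x + W \<eta> t \<omega>) i" by (simp add: proj_def mem_Rd_iff)
qed

sublocale mlp P d m T U W L f' g' M V
proof
  show "V \<theta> 0 \<tau> x \<omega> = 0" if "\<theta> \<in> Theta" "\<omega> \<in> space P" for \<theta> \<tau> x \<omega>
    using Y_init[OF that(1) _ proj_in_Rd that(2)] clip_in[of \<tau>] by (simp add: V_def)
  show "V \<theta> n (clip T \<tau>) x \<omega> = V \<theta> n \<tau> x \<omega>" for \<theta> n \<tau> x \<omega>
    using clip_in[of \<tau>] by (simp add: V_def)
  fix \<theta> and n :: nat and \<tau> x \<omega> assume n: "1 \<le> n" and \<theta>: "\<theta> \<in> Theta" and \<omega>: "\<omega> \<in> space P" and \<tau>: "0 \<le> \<tau>" "\<tau> \<le> T"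
  have \<tau>': "\<tau> \<in> {0..T}" using \<tau> by simp
  have G: "g (proj d x + W (\<theta> @ [0, int i]) \<tau> \<omega>) = g' (x + W (\<theta> @ [0, int i]) \<tau> \<omega>)" for i
    by (simp add: proj_plus_W[OF snoc2_in_Theta \<tau> \<omega>] g'_def)
  have F: "f (T - \<tau> + U \<eta> \<omega> * \<tau>) (proj d x + W \<eta> (U \<eta> \<omega> * \<tau>) \<omega>) (Y \<eta>' (int k) (T - \<tau> + U \<eta> \<omega> * \<tau>) (proj d x + W \<eta> (U \<eta> \<omega> * \<tau>) \<omega>) \<omega>)
    = f' (T - (1 - U \<eta> \<omega>) * \<tau>) (x + W \<eta> (U \<eta> \<omega> * \<tau>) \<omega>) (V \<eta>' k ((1 - U \<eta> \<omega>) * \<tau>) (x + W \<eta> (U \<eta> \<omega> * \<tau>) \<omega>) \<omega>)"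
    if "\<eta> \<in> Theta" for \<eta> \<eta>' k
  proof -
    have u: "0 \<le> U \<eta> \<omega>" "U \<eta> \<omega> \<le> 1" using U_range[OF that \<omega>] by auto
    have ut: "0 \<le> U \<eta> \<omega> * \<tau>" "U \<eta> \<omega> * \<tau> \<le> \<tau>" using u \<tau> mult_right_mono[of "U \<eta> \<omega>" 1 \<tau>] by auto
    have e: "T - \<tau> + U \<eta> \<omega> * \<tau> = T - (1 - U \<eta> \<omega>) * \<tau>" by (simp add: algebra_simps)
    have r: "0 \<le> (1 - U \<eta> \<omega>) * \<tau>" "(1 - U \<eta> \<omega>) * \<tau> \<le> T" using ut \<tau> unfolding left_diff_distrib by linarith+
    have z: "proj d x + W \<eta> (U \<eta> \<omega> * \<tau>) \<omega> = proj d (x + W \<eta> (U \<eta> \<omega> * \<tau>) \<omega>)"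
      by (rule proj_plus_W[OF that _ _ \<omega>]) (use ut \<tau> in auto)
    show ?thesis unfolding e z f'_def V_def using r by simp
  qed
  have F': "(let \<eta> = \<theta> @ [int l, int i]; \<eta>' = \<theta> @ [- int l, int i]; s = T - \<tau> + U \<eta> \<omega> * \<tau>; z = proj d x + W \<eta> (U \<eta> \<omega> * \<tau>) \<omega>
      in f s z (Y \<eta> (int l) s z \<omega>) - of_bool (l \<ge> 1) * f s z (Y \<eta>' (int l - 1) s z \<omega>))
    = f' (T - (1 - U (\<theta> @ [int l, int i]) \<omega>) * \<tau>) (x + W (\<theta> @ [int l, int i]) (U (\<theta> @ [int l, int i]) \<omega> * \<tau>) \<omega>)
        (V (\<theta> @ [int l, int i]) l ((1 - U (\<theta> @ [int l, int i]) \<omega>) * \<tau>) (x + W (\<theta> @ [int l, int i]) (U (\<theta> @ [int l, int i]) \<omega> * \<tau>) \<omega>) \<omega>)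
      - of_bool (l \<ge> 1) * f' (T - (1 - U (\<theta> @ [int l, int i]) \<omega>) * \<tau>) (x + W (\<theta> @ [int l, int i]) (U (\<theta> @ [int l, int i]) \<omega> * \<tau>) \<omega>)
        (V (\<theta> @ [- int l, int i]) (l - 1) ((1 - U (\<theta> @ [int l, int i]) \<omega>) * \<tau>) (x + W (\<theta> @ [int l, int i]) (U (\<theta> @ [int l, int i]) \<omega> * \<tau>) \<omega>) \<omega>)" for l i
  proof (cases "l = 0")
    case True
    then show ?thesis using F[OF snoc2_in_Theta, of \<theta> "int l" "int i" "\<theta> @ [int l, int i]" l] by (simp add: Let_def)
  next
    case False
    then have "int l - 1 = int (l - 1)" by (simp add: of_nat_diff)
    then show ?thesis unfolding Let_def by (simp only: F[OF snoc2_in_Theta])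
  qed
  have "V \<theta> n \<tau> x \<omega> = Y \<theta> (int n) (T - \<tau>) (proj d x) \<omega>" using \<tau> by (simp add: V_def)
  also have "\<dots> = 1 / real M ^ n * (\<Sum>i=1..M ^ n. g' (x + W (\<theta> @ [0, int i]) \<tau> \<omega>))
     + (\<Sum>l<n. 1 / real M ^ (n - l) * (\<Sum>i=1..M ^ (n - l). \<tau> * (
         f' (T - (1 - U (\<theta> @ [int l, int i]) \<omega>) * \<tau>) (x + W (\<theta> @ [int l, int i]) (U (\<theta> @ [int l, int i]) \<omega> * \<tau>) \<omega>)
        (V (\<theta> @ [int l, int i]) l ((1 - U (\<theta> @ [int l, int i]) \<omega>) * \<tau>) (x + W (\<theta> @ [int l, int i]) (U (\<theta> @ [int l, int i]) \<omega> * \<tau>) \<omega>) \<omega>)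
      - of_bool (l \<ge> 1) * f' (T - (1 - U (\<theta> @ [int l, int i]) \<omega>) * \<tau>) (x + W (\<theta> @ [int l, int i]) (U (\<theta> @ [int l, int i]) \<omega> * \<tau>) \<omega>)
        (V (\<theta> @ [- int l, int i]) (l - 1) ((1 - U (\<theta> @ [int l, int i]) \<omega>) * \<tau>) (x + W (\<theta> @ [int l, int i]) (U (\<theta> @ [int l, int i]) \<omega> * \<tau>) \<omega>) \<omega>))))"
    unfolding Y_rec[OF n \<theta> \<tau>' proj_in_Rd \<omega>] F' G sum_distrib_left[of \<tau>, symmetric] by simp
  finally show "V \<theta> n \<tau> x \<omega> = \<dots>" .
qed (rule M_pos)

lemma Y_L2_error:
  assumes D: "1 \<le> D" "2 * (p / D) * T < 1"
    and y: "growth d T m y" "\<forall>t\<in>{0..T}. \<forall>x. y t x = picard y t x"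
      "\<forall>t\<in>{0..T}. \<forall>x. \<bar>y t x\<bar> \<le> (1 + (T - t)) * exp (L * (T - t))
       * sqrt ((max L 1)\<^sup>2 * D powr p * gauss_weight d (p / D) (T - t) x)"
    and \<theta>: "\<theta> \<in> Theta" and x: "x \<in> Rd d"
  shows "L2le (\<lambda>\<omega>. Y \<theta> (int n) 0 x \<omega> - y 0 x)
    ((1 + T) * exp (L * T) * sqrt ((max L 1)\<^sup>2 * D powr p * gauss_weight d (p / D) T x)
      * ((1 + 2 * L * T) / sqrt (real M)) ^ n * exp (real M / 2))"
proof -
  interpret E: mlp_error P d m T U W L f' g' M V y "p / D" "(max L 1)\<^sup>2 * D powr p"
  proof
    show "\<bar>g' x\<bar> \<le> sqrt ((max L 1)\<^sup>2 * D powr p * gauss_weight d (p / D) 0 x)" for x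
      using order_trans[OF fg_bounds(2) abs_le_sqrt_gauss_weight[OF D(1)]] .
    show "\<bar>f' t x 0\<bar> \<le> sqrt ((max L 1)\<^sup>2 * D powr p * gauss_weight d (p / D) 0 x)" for t x
      using order_trans[OF fg_bounds(1) abs_le_sqrt_gauss_weight[OF D(1)]] .
    show "0 < (max L 1)\<^sup>2 * D powr p" using D by auto
  qed (use p D y in auto)
  have "V \<theta> n T x = Y \<theta> (int n) 0 x" using T_pos x by (simp add: V_def[abs_def] proj_ident)
  then show ?thesis using E.mlp_L2_error[OF \<theta>, of n x] by simp
qed

end

section \<open>The computational cost\<close>

lemma cost_sum_bound: "1 \<le> n \<Longrightarrow> (\<Sum>l<n. 2 + (if l = 0 then 0 else 6 * 5 ^ (l - 1))) + 1 \<le> (5::nat) ^ n"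
proof (induction n rule: nat_induct_at_least)
  case (Suc n)
  then obtain k where "n = Suc k" by (cases n) auto
  then show ?case using Suc.IH by simp
qed simp

text \<open>Inserting d (5 M)^l for the lower costs and d + 1 \<le> 2 d leaves the factor 5^l +
  5^(l-1) + 2, that is 6 times 5^(l-1) plus 2, for a level l \<ge> 1. With the terminal samples the
  factors sum to at most 5^n.\<close>

lemma cost_bound:
  fixes c :: "int \<Rightarrow> nat"
  assumes d: "1 \<le> d" and init: "c (-1) = 0" "c 0 = 0"
    and rec: "\<And>n::nat. 1 \<le> n \<Longrightarrow> c (int n) \<le> M ^ n * d + (\<Sum>l<n. M ^ (n - l) * (c (int l) + c (int l - 1) + d + 1))"
    and M: "1 \<le> M"
  shows "c (int n) \<le> d * (5 * M) ^ n"
proof (induction n rule: less_induct)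
  case (less n)
  show ?case
  proof (cases "n = 0")
    case True then show ?thesis using init by simp
  next
    case False
    then have n: "1 \<le> n" by simp
    have summand: "M ^ (n - l) * (c (int l) + c (int l - 1) + d + 1)
        \<le> d * M ^ n * (2 + (if l = 0 then 0 else 6 * 5 ^ (l - 1)))" if "l < n" for l
    proof (cases "l = 0")
      case True
      have "M ^ n * (d + 1) \<le> M ^ n * (2 * d)" using d by (intro mult_left_mono) auto
      then show ?thesis using init True by (simp add: mult_ac)
    next
      case False
      then obtain k where k: "l = Suc k" by (cases l) auto
      have il: "int l - 1 = int k" by (simp add: k)
      have "c (int l) + c (int l - 1) + d + 1 \<le> d * (5 * M) ^ l + d * (5 * M) ^ k + 2 * d"
        unfolding il using less.IH[of l] less.IH[of k] \<open>l < n\<close> d k by simp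
      also have "\<dots> \<le> d * (5 ^ l * M ^ l) + d * (5 ^ k * M ^ l) + (2 * d) * M ^ l"
        using M k by (intro add_mono mult_left_mono) (auto simp: power_mult_distrib)
      also have "\<dots> = d * M ^ l * (2 + 6 * 5 ^ k)" by (simp add: k algebra_simps)
      finally have "M ^ (n - l) * (c (int l) + c (int l - 1) + d + 1) \<le> M ^ (n - l) * (d * M ^ l * (2 + 6 * 5 ^ k))"
        by (rule mult_left_mono) simp
      also have "\<dots> = d * M ^ n * (2 + 6 * 5 ^ k)"
      proof -
        have "M ^ n = M ^ (n - l) * M ^ l" using that by (simp flip: power_add)
        then show ?thesis by (simp only: mult_ac)
      qed
      finally show ?thesis by (simp add: k)
    qed
    have "c (int n) \<le> M ^ n * d + (\<Sum>l<n. d * M ^ n * (2 + (if l = 0 then 0 else 6 * 5 ^ (l - 1))))"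
      using summand by (intro order_trans[OF rec[OF n]] add_left_mono sum_mono) auto
    also have "\<dots> = d * M ^ n * ((\<Sum>l<n. 2 + (if l = 0 then 0 else 6 * 5 ^ (l - 1))) + 1)"
    proof -
      have "M ^ n * d + d * M ^ n * S = d * M ^ n * (S + 1)" for S by (simp add: algebra_simps)
      then show ?thesis unfolding sum_distrib_left[symmetric] .
    qed
    also have "\<dots> \<le> d * M ^ n * 5 ^ n" by (rule mult_left_mono[OF cost_sum_bound[OF n]]) simp
    finally show ?thesis by (simp add: power_mult_distrib mult_ac)
  qed
qed

text \<open>With s = \<kappa> (n + 1), the linear factor costs at most 4 exp (s/4), and 2^n is
  covered by the remaining exp (-3 s/4) because 2 \<le> exp (3/4).\<close>

lemma exp_dominates:
  fixes \<kappa> :: real assumes "1 \<le> \<kappa>"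
  shows "\<kappa> * real (n + 1) * 2 ^ n * exp (- \<kappa> * real n) \<le> 4 * exp \<kappa>"
proof -
  define s where "s = \<kappa> * real (n + 1)"
  have "(1 + 3/4 + (3/4)\<^sup>2 / 2 :: real) \<le> exp (3/4)" by (rule exp_lower_Taylor_quadratic) simp
  then have e: "(2::real) \<le> exp (3/4)" by (simp add: power2_eq_square)
  have "s / 4 \<le> exp (s / 4)" using exp_ge_add_one_self[of "s / 4"] by linarith
  then have "s * 2 ^ n * exp (- s) \<le> 4 * exp (s / 4) * 2 ^ n * exp (- s)" by (intro mult_right_mono) auto
  also have "\<dots> = 4 * 2 ^ n * exp (- (3/4 * s))" by (simp add: mult_ac flip: exp_add)
  also have "\<dots> \<le> 4 * 2 ^ n * exp (- (real n * (3/4)))"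
  proof -
    have "1 * real n \<le> \<kappa> * real (n + 1)" using assms by (intro mult_mono) auto
    then show ?thesis by (simp add: s_def)
  qed
  also have "\<dots> = 4 * (2 / exp (3/4)) ^ n"
    unfolding exp_minus exp_of_nat_mult by (simp add: power_divide inverse_eq_divide)
  also have "\<dots> \<le> 4" using e by (simp add: power_le_one)
  finally have "s * 2 ^ n * exp (- s) * exp \<kappa> \<le> 4 * exp \<kappa>" by (rule mult_right_mono) simp
  moreover have e2: "exp (- s) * exp \<kappa> = exp (- \<kappa> * real n)" by (simp add: s_def algebra_simps flip: exp_add)
  ultimately show ?thesis unfolding mult.assoc e2 by (simp only: s_def mult.assoc)
qed

text \<open>If the error bound of index \<open>n\<close> still exceeds \<open>\<epsilon>\<close>, its power \<open>2 (1 + \<delta>)\<close> compensates the cost of index \<open>n + 1\<close>.\<close>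

lemma cost_of_next:
  fixes \<kappa> \<BB> L T E \<epsilon> \<delta> m m' :: real and n :: nat
  assumes \<kappa>: "1 \<le> \<kappa>" and \<BB>: "1 \<le> \<BB>" and LT: "0 \<le> L * T" and E: "0 < E" and \<epsilon>: "0 < \<epsilon>" and \<delta>: "0 < \<delta>"
    and m: "1 \<le> m" "0 \<le> m'" "m' \<le> \<BB> * m" "m' \<le> \<kappa> * real (n + 1)"
    and large: "\<epsilon> < E / 14 * ((1 + 2 * L * T) * exp (\<kappa> / 2) / sqrt m) ^ n"
  shows "(5 * m') ^ (n + 1) \<le> (E / \<epsilon>) powr (2 * (1 + \<delta>)) * exp \<kappa>
    * ((5 * \<BB> * exp (2 * \<kappa>) * (1 + (2 * L * T)\<^sup>2)) powr (1 + \<delta>) / m powr \<delta>) ^ n"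
proof -
  define q where "q = 1 + 2 * L * T"
  define Q where "Q = q\<^sup>2 * exp \<kappa>"
  define w where "w = 1 + (2 * L * T)\<^sup>2"
  have q: "1 \<le> q" using LT by (simp add: q_def mult.assoc)
  have w: "1 \<le> w" by (simp add: w_def)
  \<comment> \<open>Trades (1 + 2 L T)^2 for the factor 1 + (2 L T)^2 of the claim at the price of a
    factor 2 per step, later absorbed by exp (-\<kappa> n).\<close>
  have qw: "q\<^sup>2 \<le> 2 * w"
    using zero_le_power2[of "1 - 2 * L * T"] by (simp add: q_def w_def power2_eq_square algebra_simps)
  have Q: "0 < Q" using q by (simp add: Q_def)
  \<comment> \<open>The hypothesis \<open>large\<close> raised to the power 2 (1 + \<delta>): a
    factor above 1 by which the cost may be multiplied.\<close>
  have "(1::real) < (E / \<epsilon> / 14 * (sqrt (Q / m)) ^ n) powr (2 * (1 + \<delta>))"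
  proof -
    have "sqrt (Q / m) = q * exp (\<kappa> / 2) / sqrt m"
    proof (rule real_sqrt_unique)
      have "(exp (\<kappa> / 2))\<^sup>2 = exp \<kappa>" by (simp add: power2_eq_square flip: exp_add)
      then show "(q * exp (\<kappa> / 2) / sqrt m)\<^sup>2 = Q / m" using m by (simp add: power_mult_distrib power_divide Q_def)
    qed (use q m in auto)
    then have sq: "sqrt (Q / m) = (1 + 2 * L * T) * exp (\<kappa> / 2) / sqrt m" by (simp only: q_def)
    have "1 < (E / 14 * (sqrt (Q / m)) ^ n) / \<epsilon>" using large unfolding sq less_divide_eq_1_pos[OF \<epsilon>] .
    then have "1 < E / \<epsilon> / 14 * (sqrt (Q / m)) ^ n" by (simp add: mult_ac)
    then show ?thesis using \<delta> powr_less_mono2[of "2 * (1 + \<delta>)" 1 "E / \<epsilon> / 14 * (sqrt (Q / m)) ^ n"] by simp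
  qed
  also have "\<dots> = (E / \<epsilon>) powr (2 * (1 + \<delta>)) * (1 / 14) powr (2 * (1 + \<delta>)) * ((Q / m) powr (1 + \<delta>)) ^ n"
  proof -
    have "((sqrt (Q / m)) ^ n) powr (2 * (1 + \<delta>)) = ((Q / m) powr (1 + \<delta>)) ^ n"
      using Q m by (simp add: powr_realpow[symmetric] powr_half_sqrt[symmetric] powr_powr algebra_simps)
    then show ?thesis using E \<epsilon> Q m by (simp add: powr_mult powr_divide)
  qed
  finally have one: "1 \<le> (E / \<epsilon>) powr (2 * (1 + \<delta>)) * (1 / 14) powr (2 * (1 + \<delta>)) * ((Q / m) powr (1 + \<delta>)) ^ n" by simp
  \<comment> \<open>The factor 1/196 covers the 5 of the cost and the 4 of
    \<open>exp_dominates\<close>, since 20 \<le> 196.\<close>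
  have c14: "(1 / 14) powr (2 * (1 + \<delta>)) \<le> (1 / 196 :: real)"
  proof -
    have "(1 / 14) powr (2 * (1 + \<delta>)) \<le> (1 / 14 :: real) powr 2" using \<delta> by (intro powr_mono') auto
    then show ?thesis by (simp add: power2_eq_square)
  qed
  define R where "R = (5 * \<BB> * exp (2 * \<kappa>) * w) powr (1 + \<delta>) / m powr \<delta>"
  \<comment> \<open>One factor of the cost against one factor of the error. The power 1 + \<delta>
    leaves m^(-\<delta>), and the exponent 2 \<kappa> in place of \<kappa> leaves exp (-\<kappa>) to
    spare.\<close>
  have ratio: "5 * \<BB> * m * (Q / m) powr (1 + \<delta>) \<le> 2 * exp (- \<kappa>) * R"
  proof -
    have x1: "exp \<kappa> powr (1 + \<delta>) = exp (\<kappa> * (1 + \<delta>))" by (simp add: powr_def mult.commute)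
    have x2: "exp (2 * \<kappa>) powr (1 + \<delta>) = exp (2 * \<kappa> * (1 + \<delta>))" by (simp add: powr_def mult.commute)
    have x3: "(5 * \<BB> * exp (2 * \<kappa>) * w) powr (1 + \<delta>) = (5 * \<BB> * w) powr (1 + \<delta>) * exp (2 * \<kappa> * (1 + \<delta>))"
    proof -
      have eq: "5 * \<BB> * exp (2 * \<kappa>) * w = 5 * \<BB> * w * exp (2 * \<kappa>)" by simp
      show ?thesis unfolding eq x2[symmetric] using \<BB> w by (simp add: powr_mult)
    qed
    have x4: "exp (2 * \<kappa> * (1 + \<delta>) - \<kappa>) = exp (2 * \<kappa> * (1 + \<delta>)) * exp (- \<kappa>)"
      by (simp only: exp_diff exp_minus divide_inverse)
    have "Q powr (1 + \<delta>) \<le> (2 * w * exp \<kappa>) powr (1 + \<delta>)"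
      using qw Q \<delta> by (intro powr_mono2) (auto simp: Q_def)
    also have "\<dots> = 2 * 2 powr \<delta> * w powr (1 + \<delta>) * exp \<kappa> powr (1 + \<delta>)"
      using w by (simp add: powr_mult powr_add)
    also have "\<dots> \<le> 2 * (5 * \<BB>) powr \<delta> * w powr (1 + \<delta>) * exp \<kappa> powr (1 + \<delta>)"
      using \<BB> \<delta> by (intro mult_right_mono mult_left_mono powr_mono2) auto
    finally have "5 * \<BB> * Q powr (1 + \<delta>) \<le> 5 * \<BB> * (2 * (5 * \<BB>) powr \<delta> * w powr (1 + \<delta>) * exp \<kappa> powr (1 + \<delta>))"
      using \<BB> by (intro mult_left_mono) auto
    also have "\<dots> = 2 * (5 * \<BB> * w) powr (1 + \<delta>) * exp (\<kappa> * (1 + \<delta>))"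
      unfolding x1 using \<BB> w by (simp add: powr_mult powr_add mult_ac)
    also have "\<dots> \<le> 2 * (5 * \<BB> * w) powr (1 + \<delta>) * exp (2 * \<kappa> * (1 + \<delta>) - \<kappa>)"
      using \<kappa> \<delta> by (intro mult_left_mono) (auto simp: algebra_simps)
    also have "\<dots> = 2 * exp (- \<kappa>) * (5 * \<BB> * exp (2 * \<kappa>) * w) powr (1 + \<delta>)"
      unfolding x3 x4 by (simp only: mult_ac)
    finally have le: "5 * \<BB> * Q powr (1 + \<delta>) \<le> 2 * exp (- \<kappa>) * (5 * \<BB> * exp (2 * \<kappa>) * w) powr (1 + \<delta>)" .
    have "5 * \<BB> * m * (Q / m) powr (1 + \<delta>) = 5 * \<BB> * Q powr (1 + \<delta>) / m powr \<delta>"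
      using m Q by (simp add: powr_divide powr_add)
    also have "\<dots> \<le> 2 * exp (- \<kappa>) * (5 * \<BB> * exp (2 * \<kappa>) * w) powr (1 + \<delta>) / m powr \<delta>"
      by (rule divide_right_mono[OF le]) simp
    finally show ?thesis by (simp add: R_def)
  qed
  have R0: "0 \<le> R" by (simp add: R_def)
  have Eb: "0 \<le> (E / \<epsilon>) powr (2 * (1 + \<delta>))" by simp
  \<comment> \<open>One factor is bounded by the linear growth; the ratio bound carries the other
    \<open>n\<close> back to the sample number of the previous index.\<close>
  have "(5 * m') ^ (n + 1) = (5 * m') * (5 * m') ^ n" by simp
  also have "\<dots> \<le> (5 * (\<kappa> * real (n + 1))) * (5 * \<BB> * m) ^ n"
  proof (rule mult_mono)
    show "(5 * m') ^ n \<le> (5 * \<BB> * m) ^ n" using m by (intro power_mono) auto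
    show "5 * m' \<le> 5 * (\<kappa> * real (n + 1))" using m(4) by linarith
  qed (use m \<kappa> in auto)
  also have "\<dots> \<le> (5 * (\<kappa> * real (n + 1))) * (5 * \<BB> * m) ^ n *
     ((E / \<epsilon>) powr (2 * (1 + \<delta>)) * (1 / 14) powr (2 * (1 + \<delta>)) * ((Q / m) powr (1 + \<delta>)) ^ n)"
  proof -
    have "0 \<le> (5 * (\<kappa> * real (n + 1))) * (5 * \<BB> * m) ^ n" using \<kappa> \<BB> m by simp
    from mult_left_mono[OF one this] show ?thesis by simp
  qed
  also have "\<dots> = (E / \<epsilon>) powr (2 * (1 + \<delta>)) * ((1 / 14) powr (2 * (1 + \<delta>)) * (5 * (\<kappa> * real (n + 1))) * (5 * \<BB> * m * (Q / m) powr (1 + \<delta>)) ^ n)"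
    unfolding power_mult_distrib[of "5 * \<BB> * m"] by (simp only: mult_ac)
  also have "\<dots> \<le> (E / \<epsilon>) powr (2 * (1 + \<delta>)) * (1 / 196 * (5 * (\<kappa> * real (n + 1))) * (2 * exp (- \<kappa>) * R) ^ n)"
  proof (rule mult_left_mono[OF _ Eb], rule mult_mono)
    show "(1 / 14) powr (2 * (1 + \<delta>)) * (5 * (\<kappa> * real (n + 1))) \<le> 1 / 196 * (5 * (\<kappa> * real (n + 1)))"
      by (rule mult_right_mono[OF c14]) (use \<kappa> in simp)
    show "(5 * \<BB> * m * (Q / m) powr (1 + \<delta>)) ^ n \<le> (2 * exp (- \<kappa>) * R) ^ n"
      by (rule power_mono[OF ratio]) (use \<BB> m in simp)
  qed (use \<kappa> \<BB> m in simp_all)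
  also have "\<dots> = (E / \<epsilon>) powr (2 * (1 + \<delta>)) * (5 / 196 * (\<kappa> * real (n + 1) * 2 ^ n * exp (- \<kappa> * real n)) * R ^ n)"
  proof -
    have "exp (- \<kappa> * real n) = exp (- \<kappa>) ^ n" by (metis exp_of_nat_mult mult.commute)
    then show ?thesis unfolding power_mult_distrib by simp
  qed
  also have "\<dots> \<le> (E / \<epsilon>) powr (2 * (1 + \<delta>)) * (exp \<kappa> * R ^ n)"
  proof (intro mult_left_mono[OF _ Eb] mult_right_mono)
    show "5 / 196 * (\<kappa> * real (n + 1) * 2 ^ n * exp (- \<kappa> * real n)) \<le> exp \<kappa>"
      using exp_dominates[OF \<kappa>, of n] exp_gt_zero[of \<kappa>] by linarith
  qed (use R0 in simp)
  finally show ?thesis by (simp add: R_def w_def mult.assoc)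
qed

text \<open>As the sample numbers tend to infinity, the base is eventually at most 1. The sequence
  is therefore bounded and its supremum is a real number.\<close>

lemma SUP_power_finite:
  fixes M :: "nat \<Rightarrow> nat" and R \<delta> :: real
  assumes M: "filterlim (\<lambda>n. real (M n)) at_top sequentially" and R: "0 \<le> R" and \<delta>: "0 < \<delta>"
  obtains \<sigma> where "(SUP n\<in>{1..}. ereal ((R / real (M n) powr \<delta>) ^ n)) = ereal \<sigma>"
    "\<forall>n\<ge>1. (R / real (M n) powr \<delta>) ^ n \<le> \<sigma>"
proof -
  let ?s = "\<lambda>n. (R / real (M n) powr \<delta>) ^ n"
  have s0: "0 \<le> ?s n" for n using R by simp
  have "eventually (\<lambda>n. (R + 1) powr (1 / \<delta>) \<le> real (M n)) sequentially"
    using M by (simp add: filterlim_at_top)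
  then have "eventually (\<lambda>n. R + 1 \<le> real (M n) powr \<delta>) sequentially"
  proof eventually_elim
    case (elim n)
    have "((R + 1) powr (1 / \<delta>)) powr \<delta> \<le> real (M n) powr \<delta>" using elim \<delta> by (intro powr_mono2) auto
    then show ?case using R \<delta> by (simp add: powr_powr)
  qed
  then have "eventually (\<lambda>n. norm (?s n) \<le> 1) sequentially"
  proof eventually_elim
    case (elim n)
    then have "0 \<le> R / real (M n) powr \<delta>" "R / real (M n) powr \<delta> \<le> 1" using R by (auto simp: divide_le_eq)
    then show ?case using power_le_one[of "R / real (M n) powr \<delta>" n] by simp
  qed
  then have "Bseq ?s" by (rule BfunI)
  then obtain B where B: "norm (?s n) \<le> B" for n by (auto simp: Bseq_def)
  let ?S = "SUP n\<in>{1..}. ereal (?s n)"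
  have le: "ereal (?s n) \<le> ?S" if "1 \<le> n" for n using that by (intro SUP_upper) auto
  have "?S \<le> ereal B"
  proof (rule SUP_least)
    fix n show "ereal (?s n) \<le> ereal B" using B[of n] by simp
  qed
  moreover have "0 \<le> ?S" using le[of 1] s0[of 1] order_trans[of 0 "ereal (?s 1)" ?S] by (simp add: zero_ereal_def)
  ultimately obtain \<sigma> where \<sigma>: "?S = ereal \<sigma>" by (cases ?S) auto
  moreover have "\<forall>n\<ge>1. ?s n \<le> \<sigma>" using le unfolding \<sigma> by simp
  ultimately show ?thesis using that by blast
qed

lemma geometric_sqrt_tendsto_0:
  fixes M :: "nat \<Rightarrow> nat" and c :: real
  assumes M: "filterlim (\<lambda>n. real (M n)) at_top sequentially" and c: "0 \<le> c"
  shows "(\<lambda>n. (c / sqrt (real (M n))) ^ n) \<longlonglongrightarrow> 0"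
proof (rule Lim_null_comparison)
  have "filterlim (\<lambda>n. sqrt (real (M n))) at_top sequentially" by (rule filterlim_compose[OF sqrt_at_top M])
  then have "eventually (\<lambda>n. 2 * c + 1 \<le> sqrt (real (M n))) sequentially" by (simp add: filterlim_at_top)
  then show "eventually (\<lambda>n. norm ((c / sqrt (real (M n))) ^ n) \<le> (1/2) ^ n) sequentially"
  proof eventually_elim
    case (elim n)
    then have "0 \<le> c / sqrt (real (M n))" "c / sqrt (real (M n)) \<le> 1 / 2" using c by (auto simp: divide_le_eq)
    then show ?case using power_mono[of "c / sqrt (real (M n))" "1/2" n] by simp
  qed
  show "(\<lambda>n. (1/2::real) ^ n) \<longlonglongrightarrow> 0" by (rule LIMSEQ_realpow_zero) auto
qed

text \<open>The factor \<open>7/8\<close> is the slack \<open>14/16\<close> that pays for the constants in \<open>cost_of_next\<close>.\<close>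

lemma initial_weight_bound:
  fixes T p m\<^sub>0 L :: real and d :: nat
  assumes T: "0 < T" and p: "0 \<le> p" and m: "1 \<le> m\<^sub>0" "p \<le> m\<^sub>0" and d: "1 \<le> d"
    and x: "norm_Rd d x \<le> m\<^sub>0"
  defines "D \<equiv> 8 * real d * (1 + T) * m\<^sub>0\<^sup>2"
  shows "1 \<le> D" and "2 * (p / D) * T < 1"
    and "7 / 8 * sqrt ((max L 1)\<^sup>2 * D powr p * gauss_weight d (p / D) T x)
      \<le> 4 powr p * max L 1 * (1 + T) powr (p / 2) * m\<^sub>0 powr p * real d powr (p / 2)"
proof -
  have m2: "1 \<le> m\<^sub>0\<^sup>2" "p \<le> m\<^sub>0\<^sup>2"
  proof -
    show "1 \<le> m\<^sub>0\<^sup>2" using m by (simp add: one_le_power)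
    have "m\<^sub>0 * 1 \<le> m\<^sub>0 * m\<^sub>0" using m by (intro mult_left_mono) auto
    then show "p \<le> m\<^sub>0\<^sup>2" using m unfolding power2_eq_square by linarith
  qed
  have "1 * 1 * 1 * 1 \<le> 8 * real d * (1 + T) * m\<^sub>0\<^sup>2" using T d m2 by (intro mult_mono) auto
  then show D1: "1 \<le> D" by (simp add: D_def)
  \<comment> \<open>\<open>D\<close> is so large that 2 a T \<le> 1/(4 d) for a = p/D, which bounds
    the normalising factor of the weight uniformly in the dimension, and that |x|^2/D \<le>
    1/8.\<close>
  define h where "h = 2 * (p / D) * T"
  have h0: "0 \<le> h" using p D1 T by (simp add: h_def)
  have h4: "h \<le> 1 / (4 * real d)"
  proof -
    have "p * T \<le> m\<^sub>0\<^sup>2 * (1 + T)" using p m2 T by (intro mult_mono) auto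
    then have "8 * real d * (p * T) \<le> 8 * real d * (m\<^sub>0\<^sup>2 * (1 + T))" by (intro mult_left_mono) auto
    then have "p * T * (8 * real d) \<le> D" unfolding D_def by (simp only: mult_ac)
    then show ?thesis using D1 d by (simp add: h_def field_simps)
  qed
  have h14: "h \<le> 1 / 4"
  proof -
    have "1 / (4 * real d) \<le> 1 / 4" using d by (simp add: field_simps)
    then show ?thesis using h4 by linarith
  qed
  show "2 * (p / D) * T < 1" using h14 by (simp add: h_def)
  have gw: "gauss_weight d (p / D) T x \<le> 64 / 49 * exp (p / 6)"
  proof -
    have "1 - real d * h \<le> (1 - h) ^ d"
      using Bernoulli_inequality[of "- h" d] h14 by simp
    moreover have "real d * h \<le> 1 / 4" using mult_left_mono[OF h4, of "real d"] d by simp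
    \<comment> \<open>Bernoulli's inequality gives 3/4, which exceeds (49/64)^2; and 64/49 = (8/7)^2
      is the loss that the factor 7/8 of the claim allows.\<close>
    ultimately have b: "(49 / 64)\<^sup>2 \<le> (1 - h) ^ d" by (simp add: power2_eq_square)
    have "49 / 64 \<le> sqrt ((1 - h) ^ d)" by (rule real_le_rsqrt[OF b])
    moreover have "0 < (1 - h) ^ d" using h14 by simp
    ultimately have "1 / sqrt ((1 - h) ^ d) \<le> 1 / (49 / 64)" by (intro divide_left_mono) auto
    then have f1: "(1 / sqrt (1 - h)) ^ d \<le> 64 / 49" by (simp add: power_one_over real_sqrt_power)
    have s: "(\<Sum>i<d. (x i)\<^sup>2) \<le> m\<^sub>0\<^sup>2"
    proof -
      have "(norm_Rd d x)\<^sup>2 \<le> m\<^sub>0\<^sup>2" using x by (intro power_mono) auto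
      then show ?thesis by (simp add: L2_set_def sum_nonneg)
    qed
    have "8 * m\<^sub>0\<^sup>2 \<le> D"
    proof -
      have "1 * 1 \<le> real d * (1 + T)" using d T by (intro mult_mono) auto
      then have "8 * m\<^sub>0\<^sup>2 * 1 \<le> 8 * m\<^sub>0\<^sup>2 * (real d * (1 + T))" by (intro mult_left_mono) auto
      then show ?thesis unfolding D_def mult_1_right by (simp only: mult_ac)
    qed
    then have "(\<Sum>i<d. (x i)\<^sup>2) / D \<le> 1 / 8" using s D1 by (simp add: divide_le_eq)
    then have "p * ((\<Sum>i<d. (x i)\<^sup>2) / D) \<le> p * (1 / 8)" by (rule mult_left_mono[OF _ p])
    then have ps: "p / D * (\<Sum>i<d. (x i)\<^sup>2) \<le> p / 8" by simp
    have "p / D * (\<Sum>i<d. (x i)\<^sup>2) / (1 - h) \<le> (p / 8) / (3 / 4)"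
      using h14 ps p by (intro frac_le) auto
    then have f2: "exp (p / D * (\<Sum>i<d. (x i)\<^sup>2) / (1 - h)) \<le> exp (p / 6)" by simp
    show ?thesis
      unfolding gauss_weight_def h_def[symmetric] using f1 f2 h14 by (intro mult_mono) auto
  qed
  \<comment> \<open>The power 8^p stems from \<open>D powr p\<close>; together with exp (p/6) it
    stays below the square of 4^p.\<close>
  have e16: "exp (p / 6) * 8 powr p \<le> 16 powr p"
  proof -
    have "1 / 6 \<le> ln (2::real)" using ln2_ge_two_thirds by simp
    then have "p * (1 / 6) \<le> p * ln 2" by (rule mult_left_mono[OF _ p])
    then have "exp (p / 6) \<le> 2 powr p" by (simp add: powr_def)
    then have "exp (p / 6) * 8 powr p \<le> 2 powr p * 8 powr p" by (rule mult_right_mono) simp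
    also have "\<dots> = 16 powr p" by (simp flip: powr_mult)
    finally show ?thesis .
  qed
  let ?B = "4 powr p * max L 1 * (1 + T) powr (p / 2) * m\<^sub>0 powr p * real d powr (p / 2)"
  have sqr: "(z powr (p / 2))\<^sup>2 = z powr p" for z :: real by (simp add: power2_eq_square flip: powr_add)
  have B2: "?B\<^sup>2 = 16 powr p * (max L 1)\<^sup>2 * (1 + T) powr p * (m\<^sub>0\<^sup>2) powr p * real d powr p"
  proof -
    have "(4 powr p)\<^sup>2 = (16::real) powr p" by (simp add: power2_eq_square flip: powr_mult)
    moreover have "(m\<^sub>0 powr p)\<^sup>2 = (m\<^sub>0\<^sup>2) powr p" using m by (simp add: power2_eq_square powr_mult)
    ultimately show ?thesis by (simp add: power_mult_distrib sqr)
  qed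
  have Dp: "D powr p = 8 powr p * real d powr p * (1 + T) powr p * (m\<^sub>0\<^sup>2) powr p"
    unfolding D_def using T m by (simp add: powr_mult)
  have "(max L 1)\<^sup>2 * D powr p * gauss_weight d (p / D) T x \<le> (max L 1)\<^sup>2 * D powr p * (64 / 49 * exp (p / 6))"
    using gw by (intro mult_left_mono) auto
  also have "\<dots> = 64 / 49 * ((max L 1)\<^sup>2 * real d powr p * (1 + T) powr p * (m\<^sub>0\<^sup>2) powr p) * (exp (p / 6) * 8 powr p)"
    unfolding Dp by (simp add: mult_ac)
  also have "\<dots> \<le> 64 / 49 * ((max L 1)\<^sup>2 * real d powr p * (1 + T) powr p * (m\<^sub>0\<^sup>2) powr p) * 16 powr p"
    using T by (intro mult_left_mono[OF e16]) auto
  also have "\<dots> = (8 / 7 * ?B)\<^sup>2"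
    unfolding power_mult_distrib[of "8 / 7"] B2 by (simp add: power2_eq_square mult_ac)
  finally have "sqrt ((max L 1)\<^sup>2 * D powr p * gauss_weight d (p / D) T x) \<le> 8 / 7 * ?B"
    using T by (intro real_le_lsqrt) auto
  then show "7 / 8 * sqrt ((max L 1)\<^sup>2 * D powr p * gauss_weight d (p / D) T x) \<le> ?B" by simp
qed

lemma (in prob_space) L2_norm_rv_le:
  assumes "L2le X c" shows "L2_norm_rv M X \<le> ereal c"
proof -
  note D = L2leD[OF assms]
  have "sqrt (expectation (\<lambda>\<omega>. (X \<omega>)\<^sup>2)) \<le> c" using D(2,4) by (intro real_le_lsqrt) auto
  then show ?thesis using D by (simp add: L2_norm_rv_def)
qed

text \<open>The solution is fixed before the scheme is, so that one \<open>y\<close> serves all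
  sample numbers and all iteration depths.\<close>

lemma (in heat_problem) solution_with_error:
  fixes m\<^sub>0 :: real
  assumes d: "1 \<le> d" and m\<^sub>0: "1 \<le> m\<^sub>0" "p \<le> m\<^sub>0"
  obtains y where "semilinear_heat_solution T d f g y"
    "\<forall>u. semilinear_heat_solution T d f g u \<longrightarrow> (\<forall>t\<in>{0..T}. \<forall>x\<in>Rd d. u t x = y t x)"
    "\<forall>(P :: 'w measure) U W M Y \<theta> n x. mlp_problem P d T L p f g U W M Y \<longrightarrow> \<theta> \<in> Theta \<longrightarrow> x \<in> Rd d \<longrightarrow> norm_Rd d x \<le> m\<^sub>0 \<longrightarrow>
       L2_norm_rv P (\<lambda>\<omega>. Y \<theta> (int n) 0 x \<omega> - y 0 x) \<le>
       ereal (4 powr (p + 2) * max L 1 * (1 + T) powr (p / 2 + 1) * exp (L * T) * m\<^sub>0 powr p * real d powr (p / 2) / 14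
         * (((1 + 2 * L * T) / sqrt (real M)) ^ n * exp (real M / 2)))"
proof -
  define D where "D = 8 * real d * (1 + T) * m\<^sub>0\<^sup>2"
  note weight = initial_weight_bound[OF T_pos p m\<^sub>0 d, folded D_def]
  have D: "1 \<le> D" "2 * (p / D) * T < 1"
    using weight(1,2)[of "\<lambda>_. 0"] m\<^sub>0 by (auto simp: L2_set_def)
  obtain y where y: "growth d T m y" "\<forall>t x. y t (proj d x) = y t x" "\<forall>t\<in>{0..T}. \<forall>x. y t x = picard y t x"
    "\<forall>t\<in>{0..T}. \<forall>x. \<bar>y t x\<bar> \<le> (1 + (T - t)) * exp (L * (T - t))
       * sqrt ((max L 1)\<^sup>2 * D powr p * gauss_weight d (p / D) (T - t) x)"
    by (rule solution_exists[OF D])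
  have sol: "semilinear_heat_solution T d f g y" by (rule fixpoint_is_solution) (use y in auto)
  have uniq: "\<forall>u. semilinear_heat_solution T d f g u \<longrightarrow> (\<forall>t\<in>{0..T}. \<forall>x\<in>Rd d. u t x = y t x)"
    using solution_unique[OF y(1)] y(3) by auto
  have err: "L2_norm_rv P (\<lambda>\<omega>. Y \<theta> (int n) 0 x \<omega> - y 0 x) \<le>
       ereal (4 powr (p + 2) * max L 1 * (1 + T) powr (p / 2 + 1) * exp (L * T) * m\<^sub>0 powr p * real d powr (p / 2) / 14
         * (((1 + 2 * L * T) / sqrt (real M)) ^ n * exp (real M / 2)))"
    if "mlp_problem P d T L p f g U W M Y" and \<theta>: "\<theta> \<in> Theta" and x: "x \<in> Rd d" "norm_Rd d x \<le> m\<^sub>0"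
    for P :: "'w measure" and U W M Y \<theta> n x
  proof -
    interpret Q: mlp_problem P d T L p f g U W M Y by (rule that(1))
    let ?s = "sqrt ((max L 1)\<^sup>2 * D powr p * gauss_weight d (p / D) T x)"
    let ?r = "((1 + 2 * L * T) / sqrt (real M)) ^ n * exp (real M / 2)"
    let ?B = "4 powr p * max L 1 * (1 + T) powr (p / 2) * m\<^sub>0 powr p * real d powr (p / 2)"
    \<comment> \<open>The ratio 16/14 is 8/7; its 16 is the surplus of \<open>4 powr (p + 2)\<close>
      over \<open>4 powr p\<close>.\<close>
    have "?s \<le> 16 / 14 * ?B" using weight(3)[OF x(2), of L] by simp
    then have "(1 + T) * exp (L * T) * ?s \<le> (1 + T) * exp (L * T) * (16 / 14 * ?B)"
      using T_pos by (intro mult_left_mono) auto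
    also have "\<dots> = 4 powr (p + 2) * max L 1 * (1 + T) powr (p / 2 + 1) * exp (L * T) * m\<^sub>0 powr p * real d powr (p / 2) / 14"
      using T_pos by (simp add: powr_add)
    finally have le: "(1 + T) * exp (L * T) * ?s * ?r \<le> 4 powr (p + 2) * max L 1 * (1 + T) powr (p / 2 + 1) * exp (L * T) * m\<^sub>0 powr p * real d powr (p / 2) / 14 * ?r"
      using L_nonneg T_pos by (intro mult_right_mono) auto
    have "Q.L2le (\<lambda>\<omega>. Y \<theta> (int n) 0 x \<omega> - y 0 x) ((1 + T) * exp (L * T) * ?s * ?r)"
      using Q.Y_L2_error[OF D y(1,3,4) \<theta> x(1), of n] by (simp add: mult.assoc)
    from Q.L2_norm_rv_le[OF Q.L2le_mono[OF this le]] show ?thesis .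
  qed
  show ?thesis by (rule that[OF sol uniq]) (use err in blast)
qed


theorem theorem3p17:
  fixes T K L p \<BB> \<kappa> :: real
    and M :: "nat \<Rightarrow> nat"
    and \<xi> :: "nat \<Rightarrow> nat \<Rightarrow> real"
    and f :: "nat \<Rightarrow> real \<Rightarrow> (nat \<Rightarrow> real) \<Rightarrow> real \<Rightarrow> real"
    and g :: "nat \<Rightarrow> (nat \<Rightarrow> real) \<Rightarrow> real"
    and P :: "'w measure"
    and U :: "int list \<Rightarrow> 'w \<Rightarrow> real"
    and W :: "nat \<Rightarrow> int list \<Rightarrow> real \<Rightarrow> 'w \<Rightarrow> nat \<Rightarrow> real"
    and Y :: "nat \<Rightarrow> int list \<Rightarrow> int \<Rightarrow> nat \<Rightarrow> real \<Rightarrow> (nat \<Rightarrow> real) \<Rightarrow> 'w \<Rightarrow> real"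
    and Cost :: "nat \<Rightarrow> int \<Rightarrow> nat \<Rightarrow> nat"
  assumes "T > 0" and "K \<ge> 0" and "L \<ge> 0" and "p \<ge> 0" and "\<BB> \<ge> 0" and "\<kappa> \<ge> 0"
    and M_pos: "\<And>j. j \<ge> 1 \<Longrightarrow> M j \<ge> 1"
    and M_liminf: "liminf (\<lambda>j. ereal (real (M j))) = \<infinity>"
    and M_ratio: "(SUP j\<in>{1..}. ereal (real (M (j + 1)) / real (M j))) \<le> ereal \<BB>"
    and M_linear: "(SUP j\<in>{1..}. ereal (real (M j) / real j)) \<le> ereal \<kappa>"
    and xi_space: "\<And>d. d \<ge> 1 \<Longrightarrow> \<xi> d \<in> Rd d"
    and xi_bound: "(SUP d\<in>{1..}. ereal (norm_Rd d (\<xi> d))) \<le> ereal K"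
    and f_cont: "\<And>d. d \<ge> 1 \<Longrightarrow>
          continuous_on ({0..T} \<times> Rd d \<times> UNIV) (\<lambda>(t, x, v). f d t x v)"
    and g_cont: "\<And>d. d \<ge> 1 \<Longrightarrow> continuous_on (Rd d) (g d)"
    and fg_growth: "\<And>d t x. \<lbrakk>d \<ge> 1; t \<in> {0..T}; x \<in> Rd d\<rbrakk> \<Longrightarrow>
          max \<bar>f d t x 0\<bar> \<bar>g d x\<bar> \<le> L * max 1 (norm_Rd d x powr p)"
    and f_lip: "\<And>d t x v w. \<lbrakk>d \<ge> 1; t \<in> {0..T}; x \<in> Rd d\<rbrakk> \<Longrightarrow>
          \<bar>f d t x v - f d t x w\<bar> \<le> L * \<bar>v - w\<bar>"
    and P: "prob_space P"
    and U_range: "\<And>\<theta> \<omega>. \<lbrakk>\<theta> \<in> Theta; \<omega> \<in> space P\<rbrakk> \<Longrightarrow> U \<theta> \<omega> \<in> {0..1}"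
    and U_indep: "prob_space.indep_vars P (\<lambda>_. borel) U Theta"
    and U_uniform: "\<And>\<theta>. \<theta> \<in> Theta \<Longrightarrow> distr P lborel (U \<theta>) = uniform_measure lborel {0..1}"
    and W_BM: "\<And>d \<theta>. \<lbrakk>d \<ge> 1; \<theta> \<in> Theta\<rbrakk> \<Longrightarrow> standard_BM P T d (W d \<theta>)"
    and W_indep: "\<And>d. d \<ge> 1 \<Longrightarrow>
          prob_space.indep_vars P (\<lambda>_. \<Pi>\<^sub>M t\<in>{0..T}. borel)
            (\<lambda>\<theta> \<omega>. \<lambda>t\<in>{0..T}. W d \<theta> t \<omega>) Theta"
    and UW_indep: "\<And>d. d \<ge> 1 \<Longrightarrow>
          indep_pair P
            (\<Pi>\<^sub>M \<theta>\<in>Theta. borel) (\<lambda>\<omega>. \<lambda>\<theta>\<in>Theta. U \<theta> \<omega>)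
            (\<Pi>\<^sub>M \<theta>\<in>Theta. \<Pi>\<^sub>M t\<in>{0..T}. borel) (\<lambda>\<omega>. \<lambda>\<theta>\<in>Theta. \<lambda>t\<in>{0..T}. W d \<theta> t \<omega>)"
    and Y_init: "\<And>d j \<theta> t x \<omega>.
          \<lbrakk>d \<ge> 1; j \<ge> 1; \<theta> \<in> Theta; t \<in> {0..T}; x \<in> Rd d; \<omega> \<in> space P\<rbrakk> \<Longrightarrow>
          Y d \<theta> (-1) j t x \<omega> = 0 \<and> Y d \<theta> 0 j t x \<omega> = 0"
    and Y_rec: "\<And>d n j \<theta> t x \<omega>.
          \<lbrakk>d \<ge> 1; n \<ge> 1; j \<ge> 1; \<theta> \<in> Theta; t \<in> {0..T}; x \<in> Rd d; \<omega> \<in> space P\<rbrakk> \<Longrightarrow>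
          Y d \<theta> (int n) j (T - t) x \<omega> =
            1 / real (M j) ^ n * (\<Sum>i=1..M j ^ n. g d (x + W d (\<theta> @ [0, int i]) t \<omega>))
            + (\<Sum>l<n. t / real (M j) ^ (n - l) * (\<Sum>i=1..M j ^ (n - l).
                let \<eta> = \<theta> @ [int l, int i];
                    \<eta>' = \<theta> @ [- int l, int i];
                    s = T - t + U \<eta> \<omega> * t;
                    z = x + W d \<eta> (U \<eta> \<omega> * t) \<omega>
                in f d s z (Y d \<eta> (int l) j s z \<omega>)
                   - of_bool (l \<ge> 1) * f d s z (Y d \<eta>' (int l - 1) j s z \<omega>)))"
    and Cost_init: "\<And>d j. \<lbrakk>d \<ge> 1; j \<ge> 1\<rbrakk> \<Longrightarrow> Cost d (-1) j = 0 \<and> Cost d 0 j = 0"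
    and Cost_rec: "\<And>d n j. \<lbrakk>d \<ge> 1; n \<ge> 1; j \<ge> 1\<rbrakk> \<Longrightarrow>
          Cost d (int n) j \<le> M j ^ n * d
            + (\<Sum>l<n. M j ^ (n - l) * (Cost d (int l) j + Cost d (int l - 1) j + d + 1))"
  shows "\<exists>y :: nat \<Rightarrow> real \<Rightarrow> (nat \<Rightarrow> real) \<Rightarrow> real.
    (\<forall>d\<ge>1. semilinear_heat_solution T d (f d) (g d) (y d) \<and>
       (\<forall>u. semilinear_heat_solution T d (f d) (g d) u \<longrightarrow>
          (\<forall>t\<in>{0..T}. \<forall>x\<in>Rd d. u t x = y d t x))) \<and>
    (\<exists>N :: nat \<Rightarrow> real \<Rightarrow> nat.
       (\<forall>d\<ge>1. \<forall>\<epsilon>\<in>{0<..1}. N d \<epsilon> \<ge> 1) \<and>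
       (\<forall>d\<ge>1. \<forall>\<epsilon>\<in>{0<..1}. \<forall>\<delta>>0.
          (SUP n\<in>{N d \<epsilon>..}. L2_norm_rv P (\<lambda>\<omega>. Y d [0] (int n) n 0 (\<xi> d) \<omega> - y d 0 (\<xi> d)))
            \<le> ereal \<epsilon> \<and>
          (let bound =
             ereal ((4 powr (p + 2) * max L 1 * (1 + T) powr (p / 2 + 1) * exp (L * T)
                       * max K (max p 1) powr p) powr (2 * (1 + \<delta>)) * exp \<kappa>)
             * (1 + (SUP n\<in>{1..}. ereal (((5 * \<BB> * exp (2 * \<kappa>) * (1 + (2 * L * T)\<^sup>2)) powr (1 + \<delta>)
                                        / real (M n) powr \<delta>) ^ n)))
             * ereal (real d powr (1 + p * (1 + \<delta>)) * \<epsilon> powr (- (2 * (1 + \<delta>))))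
           in ereal (real (Cost d (int (N d \<epsilon>)) (N d \<epsilon>))) \<le> bound \<and> bound < \<infinity>)))"
  proof -
  define q where "q = 1 + 2 * L * T"
  \<comment> \<open>Bounds the starting points and the exponent at once, as
    \<open>initial_weight_bound\<close> requires.\<close>
  define m\<^sub>0 where "m\<^sub>0 = max K (max p 1)"
  define B where "B = 4 powr (p + 2) * max L 1 * (1 + T) powr (p / 2 + 1) * exp (L * T) * m\<^sub>0 powr p"
  define E where "E d = B * real d powr (p / 2)" for d :: nat
  \<comment> \<open>The linear bound on the sample numbers turns exp (M n / 2) into at most the n-th
    power of exp (\<kappa>/2), so the whole bound is an n-th power whose base tends to 0.\<close>
  define e where "e d n = E d / 14 * (q * exp (\<kappa> / 2) / sqrt (real (M n))) ^ n" for d n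
  have q: "1 \<le> q" using \<open>L \<ge> 0\<close> \<open>T > 0\<close> by (simp add: q_def)
  have m\<^sub>0: "1 \<le> m\<^sub>0" "p \<le> m\<^sub>0" "K \<le> m\<^sub>0" by (auto simp: m\<^sub>0_def)
  have B: "16 \<le> B"
  proof -
    have "(4::real) powr 2 \<le> 4 powr (p + 2)" using \<open>p \<ge> 0\<close> by (intro powr_mono) auto
    then have "16 * 1 * 1 * 1 * 1 \<le> B"
      unfolding B_def using \<open>p \<ge> 0\<close> \<open>T > 0\<close> \<open>L \<ge> 0\<close> m\<^sub>0 by (intro mult_mono ge_one_powr_ge_zero) auto
    then show ?thesis by simp
  qed
  have E: "16 \<le> E d" if "1 \<le> d" for d
    using mult_mono[of 16 B 1 "real d powr (p / 2)"] B that \<open>p \<ge> 0\<close> by (simp add: E_def ge_one_powr_ge_zero)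
  have M_le: "real (M j) \<le> \<kappa> * real j" if "1 \<le> j" for j
  proof -
    have "ereal (real (M j) / real j) \<le> ereal \<kappa>"
      by (rule order_trans[OF SUP_upper M_linear]) (use that in auto)
    then show ?thesis using that by (simp add: divide_le_eq)
  qed
  have M_next: "real (M (j + 1)) \<le> \<BB> * real (M j)" if "1 \<le> j" for j
  proof -
    have "ereal (real (M (j + 1)) / real (M j)) \<le> ereal \<BB>"
      by (rule order_trans[OF SUP_upper M_ratio]) (use that in auto)
    then show ?thesis using M_pos[OF that] by (simp add: divide_le_eq)
  qed
  \<comment> \<open>The case j = 1 of the linear bound, as M 1 \<ge> 1.\<close>
  have \<kappa>: "1 \<le> \<kappa>" using M_le[of 1] M_pos[of 1] by simp
  have M_top: "filterlim (\<lambda>n. real (M n)) at_top sequentially"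
  proof -
    have "((\<lambda>j. ereal (real (M j))) \<longlongrightarrow> \<infinity>) sequentially"
      using M_liminf by (simp add: Liminf_PInfty)
    then have "eventually (\<lambda>j. r < real (M j)) sequentially" for r by (simp add: tendsto_PInfty)
    then show ?thesis by (auto simp: filterlim_at_top intro: eventually_mono less_imp_le)
  qed
  \<comment> \<open>Otherwise the sample numbers could not increase from index 1 on, in
    contradiction to their divergence.\<close>
  have \<BB>: "1 \<le> \<BB>"
  proof (rule ccontr)
    assume "\<not> 1 \<le> \<BB>"
    then have dec: "M (j + 1) \<le> M j" if "1 \<le> j" for j
      using M_next[OF that] mult_right_mono[of \<BB> 1 "real (M j)"] by simp
    have "M j \<le> M 1" if "1 \<le> j" for j
      using that by (induction j rule: nat_induct_at_least) (use dec order_trans in auto)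
    moreover have "eventually (\<lambda>j. real (M 1) + 1 \<le> real (M j)) sequentially"
      using M_top by (simp add: filterlim_at_top)
    then obtain k where "\<forall>j\<ge>k. real (M 1) + 1 \<le> real (M j)" by (auto simp: eventually_sequentially)
    then have "real (M 1) + 1 \<le> real (M (max 1 k))" by simp
    ultimately show False by (metis add_le_same_cancel1 max.cobounded1 not_one_le_zero of_nat_1 of_nat_add of_nat_le_iff order_trans)
  qed
  have heat: "heat_problem d T L p (f d) (g d)" if "1 \<le> d" for d
    by unfold_locales (use assms(1-4) f_cont g_cont fg_growth f_lip that in auto)
  have mlp: "mlp_problem P d T L p (f d) (g d) U (W d) (M j) (\<lambda>\<theta> n. Y d \<theta> n j)" if "1 \<le> d" "1 \<le> j" for d j
  proof -
    interpret heat_problem d T L p "f d" "g d" by (rule heat[OF that(1)])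
    interpret prob_space P by (rule P)
    interpret bm_noise P d T U "W d"
      by unfold_locales (use U_range U_indep U_uniform W_BM W_indep UW_indep that \<open>T > 0\<close> in auto)
    show ?thesis
    proof
      show "1 \<le> M j" by (rule M_pos[OF that(2)])
      show "Y d \<theta> 0 j t x \<omega> = 0" if "\<theta> \<in> Theta" "t \<in> {0..T}" "x \<in> Rd d" "\<omega> \<in> space P" for \<theta> t x \<omega>
        using Y_init[OF \<open>1 \<le> d\<close> \<open>1 \<le> j\<close> that] by simp
    qed (rule Y_rec[OF that(1) _ that(2)])
  qed
  have xi: "norm_Rd d (\<xi> d) \<le> m\<^sub>0" if "1 \<le> d" for d
  proof -
    have "ereal (norm_Rd d (\<xi> d)) \<le> ereal K" by (rule order_trans[OF SUP_upper xi_bound]) (use that in auto)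
    then show ?thesis using m\<^sub>0(3) by simp
  qed
  have "\<forall>d. \<exists>y. 1 \<le> d \<longrightarrow> semilinear_heat_solution T d (f d) (g d) y \<and>
      (\<forall>u. semilinear_heat_solution T d (f d) (g d) u \<longrightarrow> (\<forall>t\<in>{0..T}. \<forall>x\<in>Rd d. u t x = y t x)) \<and>
      (\<forall>n\<ge>1. L2_norm_rv P (\<lambda>\<omega>. Y d [0] (int n) n 0 (\<xi> d) \<omega> - y 0 (\<xi> d)) \<le> ereal (e d n))"
  proof (intro allI)
    fix d :: nat
    show "\<exists>y. 1 \<le> d \<longrightarrow> semilinear_heat_solution T d (f d) (g d) y \<and>
      (\<forall>u. semilinear_heat_solution T d (f d) (g d) u \<longrightarrow> (\<forall>t\<in>{0..T}. \<forall>x\<in>Rd d. u t x = y t x)) \<and>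
      (\<forall>n\<ge>1. L2_norm_rv P (\<lambda>\<omega>. Y d [0] (int n) n 0 (\<xi> d) \<omega> - y 0 (\<xi> d)) \<le> ereal (e d n))"
    proof (cases "1 \<le> d")
      case True
      obtain y where sol: "semilinear_heat_solution T d (f d) (g d) y"
        "\<forall>u. semilinear_heat_solution T d (f d) (g d) u \<longrightarrow> (\<forall>t\<in>{0..T}. \<forall>x\<in>Rd d. u t x = y t x)"
        and err: "\<forall>(P :: 'w measure) U W M Y \<theta> n x. mlp_problem P d T L p (f d) (g d) U W M Y \<longrightarrow> \<theta> \<in> Theta \<longrightarrow> x \<in> Rd d \<longrightarrow> norm_Rd d x \<le> m\<^sub>0 \<longrightarrow>
          L2_norm_rv P (\<lambda>\<omega>. Y \<theta> (int n) 0 x \<omega> - y 0 x) \<le>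
          ereal (4 powr (p + 2) * max L 1 * (1 + T) powr (p / 2 + 1) * exp (L * T) * m\<^sub>0 powr p * real d powr (p / 2) / 14
         * (((1 + 2 * L * T) / sqrt (real M)) ^ n * exp (real M / 2)))"
        by (rule heat_problem.solution_with_error[OF heat[OF True] True m\<^sub>0(1,2)])
      have "L2_norm_rv P (\<lambda>\<omega>. Y d [0] (int n) n 0 (\<xi> d) \<omega> - y 0 (\<xi> d)) \<le> ereal (e d n)" if n: "1 \<le> n" for n
      proof -
        have z: "[0] \<in> Theta" by (simp add: Theta_def)
        have "L2_norm_rv P (\<lambda>\<omega>. Y d [0] (int n) n 0 (\<xi> d) \<omega> - y 0 (\<xi> d))
          \<le> ereal (E d / 14 * ((q / sqrt (real (M n))) ^ n * exp (real (M n) / 2)))"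
          using err[rule_format, OF mlp[OF True n] z xi_space[OF True] xi[OF True], of n]
          by (simp only: E_def B_def q_def)
        also have "E d / 14 * ((q / sqrt (real (M n))) ^ n * exp (real (M n) / 2)) \<le> e d n"
        proof -
          have "exp (real (M n) / 2) \<le> exp (\<kappa> / 2) ^ n"
            using M_le[OF n] by (simp add: exp_of_nat_mult[symmetric] mult.commute)
          then have "(q / sqrt (real (M n))) ^ n * exp (real (M n) / 2) \<le> (q / sqrt (real (M n))) ^ n * exp (\<kappa> / 2) ^ n"
            using q by (intro mult_left_mono) auto
          also have "\<dots> = (q * exp (\<kappa> / 2) / sqrt (real (M n))) ^ n"
            by (simp add: power_mult_distrib power_divide)
          finally show ?thesis unfolding e_def using E[OF True] by (intro mult_left_mono) auto
        qed
        finally show ?thesis by simp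
      qed
      then show ?thesis using sol by blast
    qed simp
  qed
  then obtain y where y: "\<forall>d\<ge>1. semilinear_heat_solution T d (f d) (g d) (y d) \<and>
      (\<forall>u. semilinear_heat_solution T d (f d) (g d) u \<longrightarrow> (\<forall>t\<in>{0..T}. \<forall>x\<in>Rd d. u t x = y d t x)) \<and>
      (\<forall>n\<ge>1. L2_norm_rv P (\<lambda>\<omega>. Y d [0] (int n) n 0 (\<xi> d) \<omega> - y d 0 (\<xi> d)) \<le> ereal (e d n))"
    by metis
  \<comment> \<open>All later indices are included because the error bound need not be monotone in
    \<open>n\<close>.\<close>
  define good where "good d \<epsilon> k \<longleftrightarrow> 1 \<le> k \<and> (\<forall>n\<ge>k. e d n \<le> \<epsilon>)" for d k :: nat and \<epsilon>
  define N where "N d \<epsilon> = (LEAST k. good d \<epsilon> k)" for d \<epsilon>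
  have "\<exists>k. good d \<epsilon> k" if "0 < \<epsilon>" for d \<epsilon>
  proof -
    have "0 \<le> q * exp (\<kappa> / 2)" using q by simp
    then have "(\<lambda>n. e d n) \<longlonglongrightarrow> E d / 14 * 0"
      unfolding e_def by (intro tendsto_mult_left geometric_sqrt_tendsto_0[OF M_top])
    then have "eventually (\<lambda>n. e d n < \<epsilon>) sequentially"
      by (rule order_tendstoD(2)) (use that in simp)
    then obtain k where "\<forall>n\<ge>k. e d n < \<epsilon>" by (auto simp: eventually_sequentially)
    then have "good d \<epsilon> (max 1 k)" by (auto simp: good_def intro: less_imp_le)
    then show ?thesis ..
  qed
  then have N: "good d \<epsilon> (N d \<epsilon>)" if "0 < \<epsilon>" for d \<epsilon>
    unfolding N_def using that by (metis LeastI_ex)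
  have error: "(SUP n\<in>{N d \<epsilon>..}. L2_norm_rv P (\<lambda>\<omega>. Y d [0] (int n) n 0 (\<xi> d) \<omega> - y d 0 (\<xi> d))) \<le> ereal \<epsilon>"
    if "1 \<le> d" "0 < \<epsilon>" for d \<epsilon>
  proof (rule SUP_least)
    fix n assume "n \<in> {N d \<epsilon>..}"
    then have n: "1 \<le> n" "e d n \<le> \<epsilon>" using N[OF that(2), of d] by (auto simp: good_def)
    have "L2_norm_rv P (\<lambda>\<omega>. Y d [0] (int n) n 0 (\<xi> d) \<omega> - y d 0 (\<xi> d)) \<le> ereal (e d n)"
      using y that(1) n(1) by blast
    also have "\<dots> \<le> ereal \<epsilon>" using n(2) by simp
    finally show "L2_norm_rv P (\<lambda>\<omega>. Y d [0] (int n) n 0 (\<xi> d) \<omega> - y d 0 (\<xi> d)) \<le> ereal \<epsilon>" .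
  qed
  have cost: "let bound =
             ereal ((4 powr (p + 2) * max L 1 * (1 + T) powr (p / 2 + 1) * exp (L * T)
                       * max K (max p 1) powr p) powr (2 * (1 + \<delta>)) * exp \<kappa>)
             * (1 + (SUP n\<in>{1..}. ereal (((5 * \<BB> * exp (2 * \<kappa>) * (1 + (2 * L * T)\<^sup>2)) powr (1 + \<delta>)
                                        / real (M n) powr \<delta>) ^ n)))
             * ereal (real d powr (1 + p * (1 + \<delta>)) * \<epsilon> powr (- (2 * (1 + \<delta>))))
           in ereal (real (Cost d (int (N d \<epsilon>)) (N d \<epsilon>))) \<le> bound \<and> bound < \<infinity>"
    if d: "1 \<le> d" and \<epsilon>: "0 < \<epsilon>" "\<epsilon> \<le> 1" and \<delta>: "0 < \<delta>" for d \<epsilon> \<delta>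
  proof -
    let ?R = "(5 * \<BB> * exp (2 * \<kappa>) * (1 + (2 * L * T)\<^sup>2)) powr (1 + \<delta>)"
    obtain \<sigma> where \<sigma>: "(SUP n\<in>{1..}. ereal ((?R / real (M n) powr \<delta>) ^ n)) = ereal \<sigma>"
      "\<forall>n\<ge>1. (?R / real (M n) powr \<delta>) ^ n \<le> \<sigma>"
      by (rule SUP_power_finite[OF M_top powr_ge_zero \<delta>])
    have \<sigma>0: "0 \<le> \<sigma>" using \<sigma>(2)[rule_format, of 1] order_trans[of 0 "?R / real (M 1) powr \<delta>" \<sigma>] by simp
    define G where "G = (E d / \<epsilon>) powr (2 * (1 + \<delta>))"
    have G: "5 \<le> G"
    proof -
      have "16 \<le> E d / \<epsilon>" using E[OF d] \<epsilon> frac_le[of "E d" "E d" \<epsilon> 1] by simp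
      then have "16 powr (1::real) \<le> (E d / \<epsilon>) powr (2 * (1 + \<delta>))"
        using \<delta> by (intro order_trans[OF powr_mono[of 1 "2 * (1 + \<delta>)" "16::real"] powr_mono2]) auto
      then show ?thesis by (simp add: G_def)
    qed
    let ?N = "N d \<epsilon>"
    have "real (5 * M ?N) ^ ?N \<le> G * exp \<kappa> * (1 + \<sigma>)"
    \<comment> \<open>Without a previous index the cost is estimated directly, with
      \<open>5 \<le> G\<close>.\<close>
    proof (cases "?N = 1")
      case True
      have "real (5 * M ?N) ^ ?N \<le> 5 * \<kappa>" using M_le[of 1] True by simp
      also have "\<dots> \<le> G * exp \<kappa> * 1"
      proof -
        have "\<kappa> \<le> exp \<kappa>" using exp_ge_add_one_self[of \<kappa>] by linarith
        then have "5 * \<kappa> \<le> G * exp \<kappa>" using G \<kappa> by (intro mult_mono) auto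
        then show ?thesis by simp
      qed
      also have "\<dots> \<le> G * exp \<kappa> * (1 + \<sigma>)" using \<sigma>0 G by (intro mult_left_mono) auto
      finally show ?thesis .
    next
      case False
      have good: "good d \<epsilon> ?N" by (rule N[OF \<epsilon>(1)])
      define n where "n = ?N - 1"
      have n: "1 \<le> n" "?N = n + 1" using False good by (auto simp: n_def good_def)
      \<comment> \<open>The condition fails at \<open>n\<close> but holds at \<open>n + 1\<close>,
        so the index with too large an error bound is \<open>n\<close> itself.\<close>
      have "\<not> good d \<epsilon> n" using not_less_Least[of n "good d \<epsilon>"] n(2) by (simp add: N_def)
      then obtain k where k: "n \<le> k" "\<epsilon> < e d k" using n(1) by (auto simp: good_def not_le)
      have "\<not> ?N \<le> k" using good k(2) unfolding good_def by (meson not_le)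
      then have "k = n" using k(1) n(2) by linarith
      then have large: "\<epsilon> < E d / 14 * ((1 + 2 * L * T) * exp (\<kappa> / 2) / sqrt (real (M n))) ^ n"
        using k(2) by (simp add: e_def q_def)
      have "(5 * real (M (n + 1))) ^ (n + 1) \<le> (E d / \<epsilon>) powr (2 * (1 + \<delta>)) * exp \<kappa> * (?R / real (M n) powr \<delta>) ^ n"
        by (rule cost_of_next[OF \<kappa> \<BB> _ _ \<epsilon>(1) \<delta> _ _ M_next[OF n(1)] _ large])
          (use \<open>L \<ge> 0\<close> \<open>T > 0\<close> E[OF d] M_pos[OF n(1)] M_le[of "n + 1"] in auto)
      also have "\<dots> \<le> G * exp \<kappa> * (1 + \<sigma>)"
        unfolding G_def[symmetric] using \<sigma>(2)[rule_format, OF n(1)] G by (intro mult_left_mono) auto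
      finally show ?thesis by (simp add: n(2))
    qed
    moreover have "real (Cost d (int ?N) ?N) \<le> real d * real (5 * M ?N) ^ ?N"
    proof -
      have N1: "1 \<le> ?N" using N[OF \<epsilon>(1), of d] by (simp add: good_def)
      have "Cost d (int ?N) ?N \<le> d * (5 * M ?N) ^ ?N"
        by (rule cost_bound[where c = "\<lambda>n. Cost d n ?N"])
          (use d Cost_init[OF d N1] Cost_rec[OF d _ N1] M_pos[OF N1] in auto)
      then have "real (Cost d (int ?N) ?N) \<le> real (d * (5 * M ?N) ^ ?N)" by (rule of_nat_mono)
      then show ?thesis by simp
    qed
    ultimately have "real (Cost d (int ?N) ?N) \<le> real d * (G * exp \<kappa> * (1 + \<sigma>))"
      by (meson mult_left_mono of_nat_0_le_iff order_trans)
    also have "\<dots> = B powr (2 * (1 + \<delta>)) * exp \<kappa> * (1 + \<sigma>) * (real d powr (1 + p * (1 + \<delta>)) * \<epsilon> powr (- (2 * (1 + \<delta>))))"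
    proof -
      \<comment> \<open>The dimension enters the error bound through d^(p/2), whose power 2 (1 +
        \<delta>) is d^(p (1 + \<delta>)); one more factor \<open>d\<close> comes from
        \<open>cost_bound\<close>.\<close>
      have "G = B powr (2 * (1 + \<delta>)) * real d powr (p * (1 + \<delta>)) * \<epsilon> powr (- (2 * (1 + \<delta>)))"
      proof -
        have "(B * real d powr (p / 2) / \<epsilon>) powr a = B powr a * real d powr (p / 2 * a) * \<epsilon> powr (- a)" for a
          using B \<epsilon> by (simp add: powr_divide powr_mult powr_powr powr_minus_divide)
        moreover have "p / 2 * (2 * (1 + \<delta>)) = p * (1 + \<delta>)" by simp
        ultimately show ?thesis unfolding G_def E_def by metis
      qed
      moreover have "real d * real d powr (p * (1 + \<delta>)) = real d powr (1 + p * (1 + \<delta>))"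
        using d by (simp add: powr_add)
      ultimately show ?thesis by (simp add: mult_ac)
    qed
    finally show ?thesis
      unfolding \<sigma>(1) Let_def B_def m\<^sub>0_def by (simp add: one_ereal_def)
  qed
  show ?thesis
  proof (intro exI conjI)
    show "\<forall>d\<ge>1. semilinear_heat_solution T d (f d) (g d) (y d) \<and>
       (\<forall>u. semilinear_heat_solution T d (f d) (g d) u \<longrightarrow> (\<forall>t\<in>{0..T}. \<forall>x\<in>Rd d. u t x = y d t x))"
      using y by blast
    show "\<forall>d\<ge>1. \<forall>\<epsilon>\<in>{0<..1}. N d \<epsilon> \<ge> 1" using N by (auto simp: good_def)
  qed (use error cost in auto)
qed

end
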